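(* Let $\Omega$ be a bounded and simply connected Lipschitz domain in $\mathbb{R}^d$. For $\delta>0$ let $\Omega_\delta=\{x\in\mathbb{R}^d\setminus\Omega:\ \mathrm{dist}(x,\Omega)<\delta\}$ and $\hat\Omega=\Omega\cup\Omega_\delta$. There exist a constant $\epsilon>0$ depending on $\Omega$, and constants $C_1,C_2$ independent of $\delta$ and $\beta$, such that the following hold. (i) For any $\delta\in(0,\epsilon)$ and any $\beta\in[0,d+p)$, $$\|u\|_{\mathcal{T}^\beta_\delta(\Omega_\delta)}\le C_1|d+p-\beta|^{-1/p}\|u\|_{\mathcal{S}^\beta_\delta(\hat\Omega)}\qquad\text{for all }u\in\mathcal{S}^\beta_\delta(\hat\Omega).$$ (ii) For any $\delta\in(0,\epsilon)$ and any $\beta\in[0,d+p)$ with $\beta\neq d$, there exists an extension operator $E:\mathcal{T}^\beta_\delta(\Omega_\delta)\to\mathcal{S}^\beta_\delta(\hat\Omega)$ such that $$\|Eu\|_{\mathcal{S}^\beta_\delta(\hat\Omega)}\le C_2|d-\beta|^{-1/p}\left(\|u\|_{\mathcal{T}^\beta_\delta(\Omega_\delta)}+|d+p-\beta|^{-1/p}\|u\|_{L^p(\Omega_\delta)}\right)\qquad\text{for all }u\in\mathcal{T}^\beta_\delta(\Omega_\delta).$$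
   Context: Here $d$ is a positive integer and $1<p<\infty$. An extension operator is a linear map $E$ with $(Eu)|_{\Omega_\delta}=u$ (a.e.) for all $u$. For $\delta>0$ and $\beta\in[0,d+p)$ the kernel is $\gamma^{\beta}_\delta(r)=\frac{C_{d,p,\beta}}{\delta^{d+p-\beta}}\,r^{-\beta}\,1_{\{r<\delta\}}$ with $C_{d,p,\beta}=(d+p-\beta)/s_{d-1}$, where $s_{d-1}$ is the surface area of the unit sphere in $\mathbb{R}^d$. For a domain $U\subset\mathbb{R}^d$, $|u|^p_{\mathcal{S}^{\beta}_\delta(U)}=\int_U\int_U\gamma^\beta_\delta(|y-x|)\,|u(y)-u(x)|^p\,dy\,dx$ and $\|u\|_{\mathcal{S}^\beta_\delta(U)}=(\|u\|_{L^p(U)}^p+|u|^p_{\mathcal{S}^\beta_\delta(U)})^{1/p}$; the space $\mathcal{S}^\beta_\delta(U)$ is the completion, with respect to this norm, of the functions in $C^1(\overline U)$ with finite norm. For measurable $V\subset\mathbb{R}^d$, $\mathcal{T}^\beta_\delta(V)$ is the space of $u\in L^p(V)$ with finite norm $\|u\|_{\mathcal{T}^\beta_\delta(V)}=\left(\frac1\delta\|u\|^p_{L^p(V)}+|u|^p_{\mathcal{T}^\beta_\delta(V)}\right)^{1/p}$, where $$|u|^p_{\mathcal{T}^\beta_\delta(V)}=\delta^{\beta-2}\int_V\int_V\frac{|u(y)-u(x)|^p}{(|y-x|\vee\delta)^{d+p-2}(|y-x|\wedge\delta)^\beta}\,dy\,dx,$$ with $a\vee b=\max(a,b)$, $a\wedge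 b=\min(a,b)$. *)

theory Defs
  imports "HOL-Analysis.Analysis"
begin

text \<open>The dimension d is \<open>DIM('a)\<close>. Functions on a set \<open>U\<close> are represented by total
  functions \<open>'a \<Rightarrow> real\<close> whose values outside \<open>U\<close> are irrelevant. The \<open>_pow\<close> constants are the
  p-th powers of norms and seminorms, with values in the extended nonnegative reals; the norms are
  real numbers and are meaningful only for functions of finite norm, which is part of membership
  in the function spaces.\<close>

section \<open>Domains\<close>

text \<open>Near each boundary point the domain is, in the direction of a unit vector \<open>e\<close>, the region
  above the graph of a Lipschitz function \<open>g\<close> on the hyperplane orthogonal to \<open>e\<close>.\<close>

definition lipschitz_domain :: "'a::euclidean_space set \<Rightarrow> bool" where
  "lipschitz_domain \<Omega> \<longleftrightarrow> open \<Omega> \<and> connected \<Omega> \<and> \<Omega> \<noteq> {} \<and>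
     (\<forall>z\<in>frontier \<Omega>. \<exists>r>0. \<exists>e L. \<exists>g::'a \<Rightarrow> real. norm e = 1 \<and> L-lipschitz_on {y. e \<bullet> y = 0} g \<and>
        \<Omega> \<inter> ball z r = {x \<in> ball z r. e \<bullet> x > g (x - (e \<bullet> x) *\<^sub>R e)})"

definition collar :: "real \<Rightarrow> 'a::euclidean_space set \<Rightarrow> 'a set" where
  "collar \<delta> \<Omega> = {x. x \<notin> \<Omega> \<and> infdist x \<Omega> < \<delta>}"

section \<open>The space \<open>L\<^sup>p\<close>\<close>

definition Lp_pow :: "real \<Rightarrow> 'a::euclidean_space set \<Rightarrow> ('a \<Rightarrow> real) \<Rightarrow> ennreal" where
  "Lp_pow p U u = (\<integral>\<^sup>+x. ennreal (\<bar>u x\<bar> powr p) \<partial>lebesgue_on U)"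

definition Lp_norm :: "real \<Rightarrow> 'a::euclidean_space set \<Rightarrow> ('a \<Rightarrow> real) \<Rightarrow> real" where
  "Lp_norm p U u = enn2real (Lp_pow p U u) powr (1 / p)"

definition Lp_space :: "real \<Rightarrow> 'a::euclidean_space set \<Rightarrow> ('a \<Rightarrow> real) set" where
  "Lp_space p U = {u \<in> borel_measurable (lebesgue_on U). Lp_pow p U u < \<infinity>}"

section \<open>The space S\<close>

text \<open>The surface area of the unit sphere is d times the volume of the unit ball
  (which gives 2 for \<open>d = 1\<close>).\<close>

definition sphere_area :: "nat \<Rightarrow> real" where
  "sphere_area d = real d * unit_ball_vol (real d)"

definition nl_kernel :: "nat \<Rightarrow> real \<Rightarrow> real \<Rightarrow> real \<Rightarrow> real \<Rightarrow> real" where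
  "nl_kernel d p \<beta> \<delta> r =
     ((real d + p - \<beta>) / sphere_area d) / \<delta> powr (real d + p - \<beta>) * r powr (- \<beta>) * indicator {..<\<delta>} r"

definition S_semi_pow :: "real \<Rightarrow> real \<Rightarrow> real \<Rightarrow> 'a::euclidean_space set \<Rightarrow> ('a \<Rightarrow> real) \<Rightarrow> ennreal"
  where
  "S_semi_pow p \<beta> \<delta> U u =
     (\<integral>\<^sup>+x. (\<integral>\<^sup>+y. ennreal (nl_kernel DIM('a) p \<beta> \<delta> (norm (y - x)) * \<bar>u y - u x\<bar> powr p)
        \<partial>lebesgue_on U) \<partial>lebesgue_on U)"

definition S_pow :: "real \<Rightarrow> real \<Rightarrow> real \<Rightarrow> 'a::euclidean_space set \<Rightarrow> ('a \<Rightarrow> real) \<Rightarrow> ennreal" where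
  "S_pow p \<beta> \<delta> U u = Lp_pow p U u + S_semi_pow p \<beta> \<delta> U u"

definition S_norm :: "real \<Rightarrow> real \<Rightarrow> real \<Rightarrow> 'a::euclidean_space set \<Rightarrow> ('a \<Rightarrow> real) \<Rightarrow> real" where
  "S_norm p \<beta> \<delta> U u = enn2real (S_pow p \<beta> \<delta> U u) powr (1 / p)"

definition C1_closure :: "'a::euclidean_space set \<Rightarrow> ('a \<Rightarrow> real) set" where
  "C1_closure U = {f. continuous_on (closure U) f \<and>
     (\<exists>D::'a \<Rightarrow> 'a. continuous_on (closure U) D \<and> (\<forall>x\<in>U. GDERIV f x :> D x))}"

text \<open>The norm dominates the \<open>L\<^sup>p\<close> norm, and by Fatou's lemma the functions in \<open>L\<^sup>p\<close> of finite
  norm form a complete space. The completion of the functions in \<open>C1_closure U\<close> of finite norm is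
  therefore realised as their closure in that space, and the norm of the completion is given by
  the same integrals.\<close>

definition S_space :: "real \<Rightarrow> real \<Rightarrow> real \<Rightarrow> 'a::euclidean_space set \<Rightarrow> ('a \<Rightarrow> real) set" where
  "S_space p \<beta> \<delta> U = {u \<in> borel_measurable (lebesgue_on U). S_pow p \<beta> \<delta> U u < \<infinity> \<and>
     (\<exists>\<phi>::nat \<Rightarrow> 'a \<Rightarrow> real. (\<forall>n. \<phi> n \<in> C1_closure U \<and> S_pow p \<beta> \<delta> U (\<phi> n) < \<infinity>) \<and>
        (\<lambda>n. S_pow p \<beta> \<delta> U (\<lambda>x. \<phi> n x - u x)) \<longlonglongrightarrow> 0)}"

section \<open>The trace space T\<close>

definition T_semi_pow :: "real \<Rightarrow> real \<Rightarrow> real \<Rightarrow> 'a::euclidean_space set \<Rightarrow> ('a \<Rightarrow> real) \<Rightarrow> ennreal"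
  where
  "T_semi_pow p \<beta> \<delta> V u = ennreal (\<delta> powr (\<beta> - 2)) *
     (\<integral>\<^sup>+x. (\<integral>\<^sup>+y. ennreal (\<bar>u y - u x\<bar> powr p /
          (max (norm (y - x)) \<delta> powr (real DIM('a) + p - 2) * min (norm (y - x)) \<delta> powr \<beta>))
        \<partial>lebesgue_on V) \<partial>lebesgue_on V)"

definition T_pow :: "real \<Rightarrow> real \<Rightarrow> real \<Rightarrow> 'a::euclidean_space set \<Rightarrow> ('a \<Rightarrow> real) \<Rightarrow> ennreal" where
  "T_pow p \<beta> \<delta> V u = ennreal (1 / \<delta>) * Lp_pow p V u + T_semi_pow p \<beta> \<delta> V u"

definition T_norm :: "real \<Rightarrow> real \<Rightarrow> real \<Rightarrow> 'a::euclidean_space set \<Rightarrow> ('a \<Rightarrow> real) \<Rightarrow> real" where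
  "T_norm p \<beta> \<delta> V u = enn2real (T_pow p \<beta> \<delta> V u) powr (1 / p)"

definition T_space :: "real \<Rightarrow> real \<Rightarrow> real \<Rightarrow> 'a::euclidean_space set \<Rightarrow> ('a \<Rightarrow> real) set" where
  "T_space p \<beta> \<delta> V = {u \<in> Lp_space p V. T_pow p \<beta> \<delta> V u < \<infinity>}"

section \<open>Extension operators\<close>

text \<open>Elements of the spaces are functions up to equality almost everywhere, so the operator must
  respect this equality, and linearity is required almost everywhere.\<close>

definition extension_operator ::
  "'a::euclidean_space set \<Rightarrow> 'a set \<Rightarrow> ('a \<Rightarrow> real) set \<Rightarrow> ('a \<Rightarrow> real) set \<Rightarrow>
   (('a \<Rightarrow> real) \<Rightarrow> ('a \<Rightarrow> real)) \<Rightarrow> bool" where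
  "extension_operator V U X Y E \<longleftrightarrow>
     (\<forall>u\<in>X. E u \<in> Y) \<and>
     (\<forall>u\<in>X. \<forall>v\<in>X. (AE x in lebesgue_on V. u x = v x) \<longrightarrow> (AE x in lebesgue_on U. E u x = E v x)) \<and>
     (\<forall>u\<in>X. \<forall>v\<in>X. \<forall>a b. AE x in lebesgue_on U. E (\<lambda>y. a * u y + b * v y) x = a * E u x + b * E v x) \<and>
     (\<forall>u\<in>X. AE x in lebesgue_on V. E u x = u x)"

end

theory Submission
  imports Defs
begin

text \<open>For the trace estimate, start two chains of points at \<open>x\<close> and \<open>y\<close> in the collar, with steps of
  length about \<open>\<delta> / 2\<close> in almost the same inward direction. They can be made to meet after about
  \<open>\<bar>x - y\<bar> / \<delta>\<close> steps, so \<open>u(y) - u(x)\<close> is a sum of differences over pairs of points at distance less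
  than \<open>\<delta>\<close>. Averaging over the steps and applying Hoelder's inequality with weights that are powers of
  the index of the step bounds the long-range part of the trace seminorm by the energy of the close
  pairs; at short range the two kernels differ by the factor \<open>d + p - \<beta>\<close> only.

  The extension at a point of \<open>\<Omega>\<close> is an average of \<open>u\<close> over the part of the collar whose distance is
  comparable to the depth of the point. By Jensen's inequality every double integral for the
  extension is at most the integral of \<open>\<bar>u(a) - u(b)\<bar>\<^sup>p\<close> against a kernel in \<open>a\<close> and \<open>b\<close>, which is bounded by
  the kernel of the trace seminorm.

  The extension lies in the space \<open>S\<close> because, on a set that fills a fixed proportion of every small
  ball around its points, averaging against a bump function approximates every function of finite
  norm by continuously differentiable ones.\<close>

section \<open>Powers, integrals and averages\<close>

text \<open>Uniformity in \<beta> shapes the argument. For pairs closer than \<delta> the kernel of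
  S is at least a multiple of (d + p - \<beta>) * \<delta>^(-d-p), whatever \<beta> is, and beyond
  \<delta> the trace kernel is free of \<beta>; so the chains need only control a \<beta>-free
  energy of close pairs. Over the collar, which fills about \<delta> * \<rho>^(d-1) of a ball of
  radius \<rho>, the long-range kernel \<rho>^(-(d-1)-(p-1)) leaves just \<rho>^(p-1) to spare.
  Unweighted Hoelder over about \<rho> / \<delta> links spends all of it and leaves a logarithm
  unbounded as \<delta> tends to 0; the weights turn the estimate into a discrete Hardy inequality.
  A plain average over the collar would create a second logarithm, since a collar point is used from
  all depths above a fraction of its distance to \<Omega>; weighting by that distance removes it.
  Finally the factor d + p - \<beta> in the kernel cancels the integral of the near-diagonal power,
  which is of order 1 / (d + p - \<beta>). The extension is thus bounded uniformly in \<beta>, and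
  the factor involving d - \<beta> enters through \<bar>d - \<beta>\<bar> \<le> d + p.\<close>

abbreviation nn_integral_lborel :: "('a::euclidean_space \<Rightarrow> ennreal) \<Rightarrow> ennreal" (binder "\<integral>\<^sup>+" 10) where
  "nn_integral_lborel f \<equiv> integral\<^sup>N lborel f"

section \<open>Convexity: the inequalities of Jensen and Hoelder\<close>

lemma powr_abs_add_le:
  fixes a b :: real
  assumes "p \<ge> 0"
  shows "\<bar>a + b\<bar> powr p \<le> 2 powr p * (\<bar>a\<bar> powr p + \<bar>b\<bar> powr p)"
proof -
  have "\<bar>a + b\<bar> powr p \<le> (2 * max \<bar>a\<bar> \<bar>b\<bar>) powr p"
    using assms by (intro powr_mono2) auto
  also have "\<dots> = 2 powr p * max \<bar>a\<bar> \<bar>b\<bar> powr p"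
    by (simp add: powr_mult)
  also have "\<dots> \<le> 2 powr p * (\<bar>a\<bar> powr p + \<bar>b\<bar> powr p)"
    by (intro mult_left_mono) (auto simp: max_def)
  finally show ?thesis .
qed

text \<open>The graph of the p-th power lies above its tangent at \<open>A\<close>. The inequality
  is linear in \<open>f\<close> and in \<open>f powr p\<close>, so it can be integrated against a
  kernel as it stands.\<close>

lemma powr_tangent_le:
  fixes A f p :: real
  assumes "p > 1" "A \<ge> 0" "f \<ge> 0"
  shows "p * A powr (p - 1) * f \<le> f powr p + (p - 1) * A powr p"
proof -
  define q where "q = p / (p - 1)"
  have q: "q > 1" "1 / p + 1 / q = 1" "(p - 1) * q = p"
    using assms by (auto simp: q_def field_simps)
  have "f * A powr (p - 1) \<le> f powr p / p + (A powr (p - 1)) powr q / q"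
    using assms q by (intro Youngs_inequality) auto
  also have "(A powr (p - 1)) powr q = A powr p"
    using q by (simp add: powr_powr)
  finally have "p * (f * A powr (p - 1)) \<le> p * (f powr p / p + A powr p / q)"
    using assms by (intro mult_left_mono) auto
  also have "\<dots> = f powr p + (p - 1) * A powr p"
    using assms by (simp add: q_def field_simps)
  finally show ?thesis by (simp add: mult_ac)
qed

text \<open>Jensen's inequality for a kernel of mass at most \<open>G\<close>, by integrating the
  tangent inequality. \<open>A\<close> is any real number below the integral of
  \<open>k * f\<close>, so that this integral may be infinite and no division in
  \<open>ennreal\<close> occurs.\<close>

lemma powr_le_nn_integral:
  fixes k :: "'b \<Rightarrow> ennreal" and f :: "'b \<Rightarrow> real"
  assumes p: "p > 1" and [measurable]: "k \<in> borel_measurable M" "f \<in> borel_measurable M"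
    and f0: "\<And>x. x \<in> space M \<Longrightarrow> 0 \<le> f x" and G: "(\<integral>\<^sup>+x. k x \<partial>M) \<le> ennreal G" "G > 0"
    and A: "A \<ge> 0" "ennreal A \<le> (\<integral>\<^sup>+x. k x * ennreal (f x) \<partial>M)"
  shows "ennreal (A powr p) \<le> ennreal (G powr (p - 1)) * (\<integral>\<^sup>+x. k x * ennreal (f x powr p) \<partial>M)"
proof (cases "(\<integral>\<^sup>+x. k x * ennreal (f x powr p) \<partial>M) = \<infinity>")
  case True
  then show ?thesis
    using G by (simp add: ennreal_mult_top)
next
  case False
  then obtain J where J: "J \<ge> 0" "(\<integral>\<^sup>+x. k x * ennreal (f x powr p) \<partial>M) = ennreal J"
    by (cases "\<integral>\<^sup>+x. k x * ennreal (f x powr p) \<partial>M") auto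
  \<comment> \<open>\<open>A / G\<close> is the mean value when equality holds; tangency there gives
    the sharp constant \<open>G powr (p - 1)\<close>.\<close>
  define B where "B = A / G"
  have B: "B \<ge> 0" using A G by (simp add: B_def)
  have "ennreal (p * B powr (p - 1)) * ennreal A
      \<le> ennreal (p * B powr (p - 1)) * (\<integral>\<^sup>+x. k x * ennreal (f x) \<partial>M)"
    using A by (intro mult_left_mono) auto
  also have "\<dots> = (\<integral>\<^sup>+x. k x * ennreal (p * B powr (p - 1) * f x) \<partial>M)"
    using p by (subst nn_integral_cmult[symmetric])
      (auto simp: ennreal_mult f0 mult_ac intro!: nn_integral_cong)
  also have "\<dots> \<le> (\<integral>\<^sup>+x. k x * ennreal (f x powr p) + k x * ennreal ((p - 1) * B powr p) \<partial>M)"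
    using p B by (intro nn_integral_mono)
      (auto simp: distrib_left[symmetric] ennreal_plus[symmetric] simp del: ennreal_plus
        intro!: mult_left_mono ennreal_leI powr_tangent_le f0)
  also have "\<dots> = ennreal J + (\<integral>\<^sup>+x. k x \<partial>M) * ennreal ((p - 1) * B powr p)"
    by (subst nn_integral_add) (auto simp: J nn_integral_multc)
  also have "\<dots> \<le> ennreal J + ennreal G * ennreal ((p - 1) * B powr p)"
    using G by (intro add_left_mono mult_right_mono) auto
  also have "\<dots> = ennreal (J + G * ((p - 1) * B powr p))"
    using J G p by (simp add: ennreal_mult)
  finally have "ennreal (p * B powr (p - 1) * A) \<le> ennreal (J + G * ((p - 1) * B powr p))"
    using p A by (subst (asm) ennreal_mult[symmetric]) auto
  then have "p * B powr (p - 1) * A \<le> J + G * ((p - 1) * B powr p)"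
    using J G p by (subst (asm) ennreal_le_iff) auto
  moreover have "B powr (p - 1) * A = G * B powr p"
    using G A p by (cases "A = 0") (auto simp: B_def powr_diff powr_divide field_simps)
  then have "p * B powr (p - 1) * A = p * (G * B powr p)"
    by (simp only: mult.assoc)
  moreover have "G * ((p - 1) * B powr p) = p * (G * B powr p) - G * B powr p"
    by (simp add: algebra_simps)
  ultimately have "G * B powr p \<le> J"
    by linarith
  moreover have "A powr p = G powr (p - 1) * (G * B powr p)"
    using G A p by (auto simp: B_def powr_diff powr_divide field_simps)
  ultimately have "A powr p \<le> G powr (p - 1) * J"
    by (simp add: mult_left_mono)
  then show ?thesis
    using J by (simp add: ennreal_leI ennreal_mult[symmetric])
qed

text \<open>\<open>powr_le_nn_integral\<close> for the counting measure on \<open>J\<close>, with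
  masses \<open>\<mu> j\<close> and values \<open>a j / \<mu> j\<close>. The freedom in
  \<open>\<mu>\<close> is what chains of unbounded length exploit later.\<close>

lemma powr_sum_le_weighted:
  fixes a \<mu> :: "'b \<Rightarrow> real"
  assumes "finite J" and p: "p > 1" and a: "\<And>j. j \<in> J \<Longrightarrow> 0 \<le> a j" and \<mu>: "\<And>j. j \<in> J \<Longrightarrow> 0 < \<mu> j"
  shows "(\<Sum>j\<in>J. a j) powr p \<le> (\<Sum>j\<in>J. \<mu> j) powr (p - 1) * (\<Sum>j\<in>J. \<mu> j powr (1 - p) * a j powr p)"
proof (cases "J = {}")
  case False
  have pos: "(\<Sum>j\<in>J. \<mu> j) > 0"
    using False assms by (intro sum_pos) auto
  have 1: "(\<Sum>j\<in>J. \<mu> j * (a j / \<mu> j)) = (\<Sum>j\<in>J. a j)"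
    by (rule sum.cong) (use \<mu> in \<open>force+\<close>)
  have 2: "\<mu> j * (a j / \<mu> j) powr p = \<mu> j powr (1 - p) * a j powr p" if "j \<in> J" for j
    using \<mu>[OF that] a[OF that] by (simp add: powr_divide powr_diff)
  have "ennreal ((\<Sum>j\<in>J. a j) powr p) \<le> ennreal ((\<Sum>j\<in>J. \<mu> j) powr (p - 1)) *
      (\<integral>\<^sup>+j. ennreal (\<mu> j) * ennreal ((a j / \<mu> j) powr p) \<partial>count_space J)"
  proof (rule powr_le_nn_integral)
    show "ennreal (\<Sum>j\<in>J. a j) \<le> (\<integral>\<^sup>+j. ennreal (\<mu> j) * ennreal (a j / \<mu> j) \<partial>count_space J)"
      using assms a less_imp_le[OF \<mu>] 1
      by (simp add: nn_integral_count_space_finite ennreal_mult[symmetric] sum_nonneg)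
    show "(\<integral>\<^sup>+j. ennreal (\<mu> j) \<partial>count_space J) \<le> ennreal (\<Sum>j\<in>J. \<mu> j)"
      using assms less_imp_le[OF \<mu>] by (simp add: nn_integral_count_space_finite)
  qed (use assms pos less_imp_le[OF \<mu>] in \<open>auto intro: sum_nonneg divide_nonneg_nonneg\<close>)
  also have "(\<integral>\<^sup>+j. ennreal (\<mu> j) * ennreal ((a j / \<mu> j) powr p) \<partial>count_space J)
      = ennreal (\<Sum>j\<in>J. \<mu> j powr (1 - p) * a j powr p)"
    using assms a less_imp_le[OF \<mu>] 2
    by (simp add: nn_integral_count_space_finite ennreal_mult[symmetric])
  finally show ?thesis
    using assms by (subst (asm) ennreal_mult[symmetric]) (auto simp: sum_nonneg)
qed simp

section \<open>Integrals of powers of the distance\<close>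

lemma nn_integral_powr_atLeast:
  fixes \<alpha> \<tau> :: real
  assumes "\<alpha> > 0" "\<tau> > 0"
  shows "(\<integral>\<^sup>+\<sigma>. ennreal (\<sigma> powr (- \<alpha> - 1)) * indicator {\<tau>..} \<sigma>) = ennreal (\<tau> powr (- \<alpha>) / \<alpha>)"
proof -
  have "((\<lambda>x. x powr (- \<alpha> - 1)) has_integral (\<tau> powr (- \<alpha>) / \<alpha>)) {\<tau>..}"
    using has_integral_powr_to_inf[of "- \<alpha> - 1" \<tau>] assms by simp
  then show ?thesis
    by (intro nn_integral_has_integral_lebesgue') auto
qed

lemma nn_integral_powr_atMost:
  fixes \<alpha> R :: real
  assumes "\<alpha> > 0" "R \<ge> 0"
  shows "(\<integral>\<^sup>+\<sigma>. ennreal (\<sigma> powr (\<alpha> - 1)) * indicator {0..R} \<sigma>) = ennreal (R powr \<alpha> / \<alpha>)"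
proof -
  have "((\<lambda>x. x powr (\<alpha> - 1)) has_integral (R powr \<alpha> / \<alpha>)) {0..R}"
    using has_integral_powr_from_0[of "\<alpha> - 1" R] assms by simp
  then show ?thesis
    by (intro nn_integral_has_integral_lebesgue') auto
qed

text \<open>Replaces a power of the distance \<open>r\<close> by an integral over radii \<sigma>
  between \<open>r\<close> and \<open>2 * r\<close>. After Fubini the condition r \<le> \<sigma>
  describes a ball, so a volume bound suffices to integrate powers of either sign.\<close>

lemma powr_le_integral_dyadic:
  fixes q r :: real
  assumes "r > 0"
  shows "ennreal (r powr q) \<le> ennreal (2 powr (\<bar>q\<bar> + 1)) *
     (\<integral>\<^sup>+\<sigma>. ennreal (\<sigma> powr (q - 1)) * indicator {r..2 * r} \<sigma>)"
proof -
  define m where "m = r powr (q - 1) * 2 powr (- \<bar>q\<bar> - 1)"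
  have m: "m \<le> \<sigma> powr (q - 1)" if \<sigma>: "\<sigma> \<in> {r..2 * r}" for \<sigma>
  proof (cases "q \<ge> 1")
    case True
    have "m \<le> r powr (q - 1) * 1"
      unfolding m_def using powr_mono[of "- \<bar>q\<bar> - 1" 0 2] by (intro mult_left_mono) auto
    also have "\<dots> \<le> \<sigma> powr (q - 1)"
      using \<sigma> assms True by (simp add: powr_mono2)
    finally show ?thesis .
  next
    case False
    have "m \<le> r powr (q - 1) * 2 powr (q - 1)"
      unfolding m_def by (intro mult_left_mono powr_mono) auto
    also have "\<dots> = (2 * r) powr (q - 1)"
      using assms by (simp add: powr_mult)
    also have "\<dots> \<le> \<sigma> powr (q - 1)"
      using \<sigma> assms False by (intro powr_mono2') auto
    finally show ?thesis .
  qed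
  have "r powr q = 2 powr (\<bar>q\<bar> + 1) * (m * r)"
    using assms by (simp add: m_def powr_diff powr_minus powr_add field_simps)
  then have "ennreal (r powr q) = ennreal (2 powr (\<bar>q\<bar> + 1)) * (ennreal m * ennreal r)"
    using assms by (simp add: m_def ennreal_mult[symmetric])
  also have "ennreal m * ennreal r = (\<integral>\<^sup>+\<sigma>. ennreal m * indicator {r..2 * r} \<sigma>)"
    using assms by (simp add: nn_integral_cmult)
  also have "\<dots> \<le> (\<integral>\<^sup>+\<sigma>. ennreal (\<sigma> powr (q - 1)) * indicator {r..2 * r} \<sigma>)"
    by (intro nn_integral_mono) (auto simp: indicator_def intro: ennreal_leI m)
  finally show ?thesis
    by (simp add: mult_left_mono)
qed

text \<open>Replaces polar coordinates: only an upper bound on the measure of balls is needed.\<close>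

lemma nn_integral_dist_powr_le:
  fixes x :: "'a::euclidean_space"
  assumes [measurable]: "V \<in> sets borel" "S \<in> sets borel" "T \<in> sets borel"
    and S: "S \<subseteq> {0<..}" and ST: "\<And>r \<sigma>. r \<in> S \<Longrightarrow> r \<le> \<sigma> \<Longrightarrow> \<sigma> \<le> 2 * r \<Longrightarrow> \<sigma> \<in> T"
    and T: "T \<subseteq> {0..}" and c: "c \<ge> 0"
    and growth: "\<And>\<sigma>. \<sigma> \<in> T \<Longrightarrow> \<sigma> > 0 \<Longrightarrow> emeasure lborel (V \<inter> cball x \<sigma>) \<le> ennreal (c * \<sigma> powr s)"
  shows "(\<integral>\<^sup>+y. ennreal (dist x y powr q) * indicator V y * indicator S (dist x y)) \<le>
    ennreal (2 powr (\<bar>q\<bar> + 1) * c) * (\<integral>\<^sup>+\<sigma>. ennreal (\<sigma> powr (q + s - 1)) * indicator T \<sigma>)"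
proof -
  let ?C = "ennreal (2 powr (\<bar>q\<bar> + 1))"
  have [measurable]: "Measurable.pred (lborel \<Otimes>\<^sub>M lborel) (\<lambda>w::'a \<times> real. fst w \<in> cball x (snd w))"
    by (simp add: mem_cball)
  have cball_meas: "indicator (cball x \<sigma>) y = (indicator {dist x y..} \<sigma> :: ennreal)" for y \<sigma>
    by (auto simp: indicator_def)
  have "(\<integral>\<^sup>+y. ennreal (dist x y powr q) * indicator V y * indicator S (dist x y))
    \<le> (\<integral>\<^sup>+y. (\<integral>\<^sup>+\<sigma>. ?C * (ennreal (\<sigma> powr (q - 1)) * indicator T \<sigma> * indicator V y * indicator (cball x \<sigma>) y)))"
  proof (intro nn_integral_mono)
    fix y :: 'a
    show "ennreal (dist x y powr q) * indicator V y * indicator S (dist x y)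
       \<le> (\<integral>\<^sup>+\<sigma>. ?C * (ennreal (\<sigma> powr (q - 1)) * indicator T \<sigma> * indicator V y * indicator (cball x \<sigma>) y))"
    proof (cases "y \<in> V \<and> dist x y \<in> S")
      case True
      then have pos: "dist x y > 0" using S by auto
      have "ennreal (dist x y powr q) \<le> ?C * (\<integral>\<^sup>+\<sigma>. ennreal (\<sigma> powr (q - 1)) * indicator {dist x y..2 * dist x y} \<sigma>)"
        by (rule powr_le_integral_dyadic[OF pos])
      also have "\<dots> \<le> ?C * (\<integral>\<^sup>+\<sigma>. (ennreal (\<sigma> powr (q - 1)) * indicator T \<sigma> * indicator V y * indicator (cball x \<sigma>) y))"
        using True ST by (intro mult_left_mono nn_integral_mono) (auto simp: indicator_def)
      also have "\<dots> = (\<integral>\<^sup>+\<sigma>. ?C * (ennreal (\<sigma> powr (q - 1)) * indicator T \<sigma> * indicator V y * indicator (cball x \<sigma>) y))"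
        by (rule nn_integral_cmult[symmetric]) (simp add: cball_meas)
      finally show ?thesis
        using True by simp
    qed auto
  qed
  \<comment> \<open>Exchanging the integrals turns \<open>dist x y \<le> \<sigma>\<close> into the
    ball around \<open>x\<close>, whose intersection with \<open>V\<close> is what
    \<open>growth\<close> measures.\<close>
  also have "\<dots> = (\<integral>\<^sup>+\<sigma>. (\<integral>\<^sup>+y. ?C * (ennreal (\<sigma> powr (q - 1)) * indicator T \<sigma> * indicator V y * indicator (cball x \<sigma>) y)))"
    by (rule lborel_pair.Fubini') (measurable, simp add: case_prod_beta mem_cball indicator_def, measurable)
  also have "\<dots> = (\<integral>\<^sup>+\<sigma>. ?C * (ennreal (\<sigma> powr (q - 1)) * indicator T \<sigma> * emeasure lborel (V \<inter> cball x \<sigma>)))"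
  proof (rule nn_integral_cong)
    fix \<sigma> :: real
    have "(\<integral>\<^sup>+y. ?C * (ennreal (\<sigma> powr (q - 1)) * indicator T \<sigma> * indicator V y * indicator (cball x \<sigma>) y))
      = (\<integral>\<^sup>+y. (?C * (ennreal (\<sigma> powr (q - 1)) * indicator T \<sigma>)) * indicator (V \<inter> cball x \<sigma>) y)"
      by (intro nn_integral_cong) (simp add: indicator_inter_arith mult_ac)
    then show "(\<integral>\<^sup>+y. ?C * (ennreal (\<sigma> powr (q - 1)) * indicator T \<sigma> * indicator V y * indicator (cball x \<sigma>) y))
      = ?C * (ennreal (\<sigma> powr (q - 1)) * indicator T \<sigma> * emeasure lborel (V \<inter> cball x \<sigma>))"
      by (simp only:) (subst nn_integral_cmult_indicator, auto simp: mult.assoc)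
  qed
  also have "\<dots> \<le> (\<integral>\<^sup>+\<sigma>. ?C * (ennreal (\<sigma> powr (q - 1)) * indicator T \<sigma> * ennreal (c * \<sigma> powr s)))"
  proof (rule nn_integral_mono)
    fix \<sigma> :: real
    have "ennreal (\<sigma> powr (q - 1)) * indicator T \<sigma> * emeasure lborel (V \<inter> cball x \<sigma>)
       \<le> ennreal (\<sigma> powr (q - 1)) * indicator T \<sigma> * ennreal (c * \<sigma> powr s)"
      using T by (cases "\<sigma> \<in> T"; cases "\<sigma> = 0") (force intro!: mult_left_mono growth)+
    then show "?C * (ennreal (\<sigma> powr (q - 1)) * indicator T \<sigma> * emeasure lborel (V \<inter> cball x \<sigma>))
       \<le> ?C * (ennreal (\<sigma> powr (q - 1)) * indicator T \<sigma> * ennreal (c * \<sigma> powr s))"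
      by (rule mult_left_mono) auto
  qed
  also have "\<dots> = (\<integral>\<^sup>+\<sigma>. ennreal (2 powr (\<bar>q\<bar> + 1) * c) * (ennreal (\<sigma> powr (q + s - 1)) * indicator T \<sigma>))"
    using c T by (intro nn_integral_cong)
      (auto simp: indicator_def ennreal_mult[symmetric] powr_add[symmetric] mult_ac algebra_simps)
  also have "\<dots> = ennreal (2 powr (\<bar>q\<bar> + 1) * c) * (\<integral>\<^sup>+\<sigma>. ennreal (\<sigma> powr (q + s - 1)) * indicator T \<sigma>)"
    by (rule nn_integral_cmult) auto
  finally show ?thesis .
qed

text \<open>The exponent \<open>s\<close> is the dimension seen by \<open>V\<close>: it is d for the
  whole space and d - 1 for the collar. Growth is asked from \<tau> on only, because a collar of
  width \<delta> looks (d-1)-dimensional at scales above \<delta>.\<close>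

lemma nn_integral_dist_powr_tail_le:
  fixes x :: "'a::euclidean_space"
  assumes [measurable]: "V \<in> sets borel" and "\<alpha> > 0" "\<tau> > 0" "c \<ge> 0"
    and growth: "\<And>\<sigma>. \<sigma> \<ge> \<tau> \<Longrightarrow> emeasure lborel (V \<inter> cball x \<sigma>) \<le> ennreal (c * \<sigma> powr s)"
  shows "(\<integral>\<^sup>+y. ennreal (dist x y powr (- s - \<alpha>)) * indicator V y * indicator {\<tau>..} (dist x y)) \<le>
    ennreal (2 powr (\<bar>s + \<alpha>\<bar> + 1) * c * (\<tau> powr (- \<alpha>) / \<alpha>))"
proof -
  have "(\<integral>\<^sup>+y. ennreal (dist x y powr (- s - \<alpha>)) * indicator V y * indicator {\<tau>..} (dist x y)) \<le>
     ennreal (2 powr (\<bar>- s - \<alpha>\<bar> + 1) * c) * (\<integral>\<^sup>+\<sigma>. ennreal (\<sigma> powr (- s - \<alpha> + s - 1)) * indicator {\<tau>..} \<sigma>)"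
    using assms by (intro nn_integral_dist_powr_le) auto
  also have "\<bar>- s - \<alpha>\<bar> = \<bar>s + \<alpha>\<bar>"
    by linarith
  also have "- s - \<alpha> + s - 1 = - \<alpha> - 1"
    by simp
  also note nn_integral_powr_atLeast[OF \<open>\<alpha> > 0\<close> \<open>\<tau> > 0\<close>]
  finally show ?thesis
    using assms by (simp add: ennreal_mult[symmetric])
qed

lemma nn_integral_dist_powr_ball_le:
  fixes x :: "'a::euclidean_space"
  assumes [measurable]: "V \<in> sets borel" and "\<alpha> > 0" "R > 0" "c \<ge> 0"
    and growth: "\<And>\<sigma>. \<sigma> > 0 \<Longrightarrow> \<sigma> \<le> 2 * R \<Longrightarrow> emeasure lborel (V \<inter> cball x \<sigma>) \<le> ennreal (c * \<sigma> powr s)"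
  shows "(\<integral>\<^sup>+y. ennreal (dist x y powr (\<alpha> - s)) * indicator V y * indicator {0<..R} (dist x y)) \<le>
    ennreal (2 powr (\<bar>\<alpha> - s\<bar> + 1) * c * ((2 * R) powr \<alpha> / \<alpha>))"
proof -
  have "(\<integral>\<^sup>+y. ennreal (dist x y powr (\<alpha> - s)) * indicator V y * indicator {0<..R} (dist x y)) \<le>
     ennreal (2 powr (\<bar>\<alpha> - s\<bar> + 1) * c) * (\<integral>\<^sup>+\<sigma>. ennreal (\<sigma> powr (\<alpha> - s + s - 1)) * indicator {0..2 * R} \<sigma>)"
    using assms by (intro nn_integral_dist_powr_le) auto
  also have "\<dots> = ennreal (2 powr (\<bar>\<alpha> - s\<bar> + 1) * c) * ennreal ((2 * R) powr \<alpha> / \<alpha>)"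
    using nn_integral_powr_atMost[of \<alpha> "2 * R"] assms by simp
  finally show ?thesis
    using assms by (simp add: ennreal_mult[symmetric])
qed

section \<open>Weighted averages\<close>

definition wavg :: "('a::euclidean_space \<Rightarrow> real) \<Rightarrow> ('a \<Rightarrow> real) \<Rightarrow> real" where
  "wavg k u = (\<integral>a. u a * k a \<partial>lborel) / (\<integral>a. k a \<partial>lborel)"

definition averaging :: "('a::euclidean_space \<Rightarrow> real) \<Rightarrow> ('a \<Rightarrow> real) \<Rightarrow> bool" where
  "averaging k u \<longleftrightarrow> u \<in> borel_measurable borel \<and> (\<forall>a. k a \<ge> 0) \<and> integrable lborel k \<and>
     integral\<^sup>L lborel k > 0 \<and> integrable lborel (\<lambda>a. u a * k a)"

lemma averagingD:
  assumes "averaging k u"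
  shows "u \<in> borel_measurable borel" "k \<in> borel_measurable borel" "\<And>a. 0 \<le> k a"
    "integrable lborel k" "0 < integral\<^sup>L lborel k" "integrable lborel (\<lambda>a. u a * k a)"
proof -
  show i: "integrable lborel k"
    using assms unfolding averaging_def by blast
  show "k \<in> borel_measurable borel"
    using borel_measurable_integrable[OF i] by simp
qed (use assms in \<open>simp_all add: averaging_def\<close>)

lemma wavg_minus_eq:
  assumes "averaging k u"
  shows "wavg k u - c = (\<integral>a. (u a - c) * k a \<partial>lborel) / integral\<^sup>L lborel k"
proof -
  have "(\<integral>a. (u a - c) * k a \<partial>lborel) = (\<integral>a. u a * k a - c * k a \<partial>lborel)"
    by (simp add: left_diff_distrib)
  also have "\<dots> = (\<integral>a. u a * k a \<partial>lborel) - c * integral\<^sup>L lborel k"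
    using averagingD(4,6)[OF assms] by simp
  finally show ?thesis
    using averagingD(5)[OF assms] by (simp add: wavg_def diff_divide_distrib)
qed

lemma wavg_minus_powr_le:
  assumes k: "averaging k u" and p: "p > 1"
  shows "ennreal (\<bar>wavg k u - c\<bar> powr p) \<le>
    (\<integral>\<^sup>+a. ennreal (k a / integral\<^sup>L lborel k) * ennreal (\<bar>u a - c\<bar> powr p))"
proof -
  define K where "K = integral\<^sup>L lborel k"
  note [measurable] = averagingD(1,2)[OF k]
  note k0 = averagingD(3)[OF k] and ik = averagingD(4)[OF k] and iu = averagingD(6)[OF k]
  have K: "K > 0" using averagingD(5)[OF k] by (simp add: K_def)
  have iuc: "integrable lborel (\<lambda>a. (u a - c) * k a)"
    using ik iu by (simp add: left_diff_distrib)
  have "\<bar>wavg k u - c\<bar> = \<bar>\<integral>a. (u a - c) * k a \<partial>lborel\<bar> / K"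
    using K by (simp add: wavg_minus_eq[OF k] K_def)
  also have "\<dots> \<le> (\<integral>a. \<bar>(u a - c) * k a\<bar> \<partial>lborel) / K"
    using K by (intro divide_right_mono integral_abs_bound) auto
  also have "\<dots> = (\<integral>a. k a / K * \<bar>u a - c\<bar> \<partial>lborel)"
    using k0 by (subst integral_divide_zero[symmetric]) (simp add: abs_mult mult_ac)
  finally have "ennreal \<bar>wavg k u - c\<bar> \<le> ennreal (\<integral>a. k a / K * \<bar>u a - c\<bar> \<partial>lborel)"
    by (rule ennreal_leI)
  also have "\<dots> = (\<integral>\<^sup>+a. ennreal (k a / K * \<bar>u a - c\<bar>))"
  proof (rule nn_integral_eq_integral[symmetric])
    show "integrable lborel (\<lambda>a. k a / K * \<bar>u a - c\<bar>)"
      using integrable_divide[OF integrable_abs[OF iuc], of K] k0 by (simp add: abs_mult mult_ac)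
  qed (use k0 K in auto)
  also have "\<dots> = (\<integral>\<^sup>+a. ennreal (k a / K) * ennreal \<bar>u a - c\<bar>)"
    using k0 K by (auto intro!: nn_integral_cong simp: ennreal_mult[symmetric])
  finally have 1: "ennreal \<bar>wavg k u - c\<bar> \<le> (\<integral>\<^sup>+a. ennreal (k a / K) * ennreal \<bar>u a - c\<bar>)" .
  have 2: "(\<integral>\<^sup>+a. ennreal (k a / K)) \<le> ennreal 1"
    using ik k0 K by (subst nn_integral_eq_integral) (auto simp: K_def[symmetric])
  show ?thesis
    using powr_le_nn_integral[OF p _ _ _ 2 _ _ 1] by (simp add: K_def)
qed

lemma wavg_diff_powr_le:
  assumes k: "averaging k u" and l: "averaging l u" and p: "p > 1"
  shows "ennreal (\<bar>wavg k u - wavg l u\<bar> powr p) \<le>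
    (\<integral>\<^sup>+a. (\<integral>\<^sup>+b. ennreal (k a / integral\<^sup>L lborel k) * ennreal (l b / integral\<^sup>L lborel l) *
       ennreal (\<bar>u a - u b\<bar> powr p)))"
proof -
  note [measurable] = averagingD(1,2)[OF k] averagingD(2)[OF l]
  have "ennreal (\<bar>wavg k u - wavg l u\<bar> powr p) \<le> (\<integral>\<^sup>+a. ennreal (k a / integral\<^sup>L lborel k) * ennreal (\<bar>u a - wavg l u\<bar> powr p))"
    by (rule wavg_minus_powr_le[OF k p])
  also have "\<dots> \<le> (\<integral>\<^sup>+a. ennreal (k a / integral\<^sup>L lborel k) * (\<integral>\<^sup>+b. ennreal (l b / integral\<^sup>L lborel l) *
       ennreal (\<bar>u a - u b\<bar> powr p)))"
    by (intro nn_integral_mono mult_left_mono)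
      (use wavg_minus_powr_le[OF l p] in \<open>auto simp: abs_minus_commute\<close>)
  finally show ?thesis
    by (simp add: nn_integral_cmult mult.assoc)
qed

text \<open>With c = \<open>wavg l u\<close> the integral of \<open>(u - c) * l\<close> vanishes, so
  \<open>wavg k u - c\<close> is the integral of \<open>(u - c) * (k - l)\<close> divided by the
  mass of \<open>k\<close>. Hence only the unnormalised kernels have to be close, and the change of
  the normalising constants never enters. A second use of Jensen's inequality replaces
  \<open>c\<close> by \<open>u b\<close>. The gain over \<open>wavg_diff_powr_le\<close> is the
  factor \<open>e powr p\<close>.\<close>

lemma wavg_diff_lipschitz_powr_le:
  assumes k: "averaging k u" and l: "averaging l u" and p: "p > 1"
    and g[measurable]: "g \<in> borel_measurable borel" and g0: "\<And>a. g a \<ge> 0"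
    and G: "(\<integral>\<^sup>+a. ennreal (g a)) \<le> ennreal G" "G > 0" and e: "e \<ge> 0"
    and kl: "\<And>a. \<bar>k a - l a\<bar> \<le> integral\<^sup>L lborel k * e * g a"
    and lg: "\<And>a. l a \<le> integral\<^sup>L lborel l * g a"
  shows "ennreal (\<bar>wavg k u - wavg l u\<bar> powr p) \<le> ennreal (e powr p * G powr (p - 1)) *
    (\<integral>\<^sup>+a. (\<integral>\<^sup>+b. ennreal (g a) * ennreal (g b) * ennreal (\<bar>u a - u b\<bar> powr p)))"
proof (cases "e = 0")
  case True
  then have "k = l" using kl by auto
  then show ?thesis using p by simp
next
  case False
  with e have e: "e > 0" by simp
  define K L c where "K = integral\<^sup>L lborel k" and "L = integral\<^sup>L lborel l" and "c = wavg l u"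
  note [measurable] = averagingD(1,2)[OF k] averagingD(2)[OF l]
  note ik = averagingD(4)[OF k] averagingD(4)[OF l] and iu = averagingD(6)[OF k] averagingD(6)[OF l]
  have K: "K > 0" "L > 0" using averagingD(5)[OF k] averagingD(5)[OF l] by (auto simp: K_def L_def)
  have i1: "integrable lborel (\<lambda>a. (u a - c) * k a)" "integrable lborel (\<lambda>a. (u a - c) * l a)"
    using ik iu by (simp_all add: left_diff_distrib)
  have i2: "integrable lborel (\<lambda>a. (u a - c) * (k a - l a))"
    using i1 by (simp add: right_diff_distrib)
  have "(\<integral>a. (u a - c) * l a \<partial>lborel) = 0"
    using wavg_minus_eq[OF l, of c] K by (simp add: c_def L_def)
  then have eq: "wavg k u - c = (\<integral>a. (u a - c) * (k a - l a) \<partial>lborel) / K"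
    using i1 by (simp add: wavg_minus_eq[OF k] K_def right_diff_distrib)
  have "\<bar>wavg k u - c\<bar> \<le> (\<integral>a. \<bar>(u a - c) * (k a - l a)\<bar> \<partial>lborel) / K"
    unfolding eq using K by (auto simp: abs_divide intro!: divide_right_mono)
  also have "\<dots> = (\<integral>a. \<bar>(u a - c) * (k a - l a)\<bar> / K \<partial>lborel)"
    by simp
  finally have "ennreal (\<bar>wavg k u - c\<bar>) \<le> ennreal (\<integral>a. \<bar>(u a - c) * (k a - l a)\<bar> / K \<partial>lborel)"
    by (rule ennreal_leI)
  also have "\<dots> = (\<integral>\<^sup>+a. ennreal (\<bar>(u a - c) * (k a - l a)\<bar> / K))"
    using K i2 by (intro nn_integral_eq_integral[symmetric]) auto
  also have "\<dots> \<le> (\<integral>\<^sup>+a. ennreal (e * g a) * ennreal \<bar>u a - c\<bar>)"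
  proof (intro nn_integral_mono)
    fix a
    have "\<bar>(u a - c) * (k a - l a)\<bar> / K \<le> \<bar>u a - c\<bar> * (K * e * g a) / K"
      unfolding abs_mult using kl[of a] K by (intro divide_right_mono mult_left_mono) (auto simp: K_def)
    then show "ennreal (\<bar>(u a - c) * (k a - l a)\<bar> / K) \<le> ennreal (e * g a) * ennreal \<bar>u a - c\<bar>"
      using K e g0 by (auto simp: ennreal_mult[symmetric] mult_ac intro!: ennreal_leI)
  qed
  finally have 1: "ennreal \<bar>wavg k u - c\<bar> \<le> (\<integral>\<^sup>+a. ennreal (e * g a) * ennreal \<bar>u a - c\<bar>)" .
  have 2: "(\<integral>\<^sup>+a. ennreal (e * g a)) \<le> ennreal (e * G)"
    using G e g0 by (simp add: ennreal_mult nn_integral_cmult mult_left_mono)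
  have "ennreal (\<bar>wavg k u - c\<bar> powr p) \<le> ennreal ((e * G) powr (p - 1)) *
      (\<integral>\<^sup>+a. ennreal (e * g a) * ennreal (\<bar>u a - c\<bar> powr p))"
    using powr_le_nn_integral[OF p _ _ _ 2 _ _ 1] e G by simp
  also have "\<dots> = ennreal ((e * G) powr (p - 1)) * (ennreal e *
      (\<integral>\<^sup>+a. ennreal (g a) * ennreal (\<bar>u a - c\<bar> powr p)))"
    using e g0 by (subst nn_integral_cmult[symmetric]) (auto simp: ennreal_mult mult.assoc)
  also have "\<dots> = ennreal (e powr p * G powr (p - 1)) *
      (\<integral>\<^sup>+a. ennreal (g a) * ennreal (\<bar>u a - c\<bar> powr p))"
    using e G by (simp add: mult.assoc[symmetric] ennreal_mult[symmetric] powr_mult powr_diff)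
  also have "\<dots> \<le> ennreal (e powr p * G powr (p - 1)) *
      (\<integral>\<^sup>+a. ennreal (g a) * (\<integral>\<^sup>+b. ennreal (g b) * ennreal (\<bar>u a - u b\<bar> powr p)))"
  proof (intro mult_left_mono nn_integral_mono)
    fix a
    have "ennreal (\<bar>u a - c\<bar> powr p) \<le> (\<integral>\<^sup>+b. ennreal (l b / L) * ennreal (\<bar>u a - u b\<bar> powr p))"
      using wavg_minus_powr_le[OF l p, of "u a"] by (simp add: c_def L_def abs_minus_commute)
    also have "\<dots> \<le> (\<integral>\<^sup>+b. ennreal (g b) * ennreal (\<bar>u a - u b\<bar> powr p))"
      using K lg by (intro nn_integral_mono mult_right_mono ennreal_leI) (auto simp: L_def field_simps)
    finally show "ennreal (\<bar>u a - c\<bar> powr p) \<le> (\<integral>\<^sup>+b. ennreal (g b) * ennreal (\<bar>u a - u b\<bar> powr p))" .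
  qed auto
  finally show ?thesis
    by (simp add: nn_integral_cmult mult.assoc c_def)
qed

section \<open>Continuity of translations in L^p\<close>

lemma nn_integral_lborel_shift:
  fixes z :: "'a::euclidean_space"
  assumes [measurable]: "f \<in> borel_measurable borel"
  shows "(\<integral>\<^sup>+x. f (x + z)) = (\<integral>\<^sup>+x. f x)"
proof -
  have "(\<integral>\<^sup>+x. f x) = (\<integral>\<^sup>+x. f x \<partial>distr lborel borel ((+) z))"
    by (simp add: lborel_distr_plus)
  also have "\<dots> = (\<integral>\<^sup>+x. f (z + x))"
    by (rule nn_integral_distr) auto
  finally show ?thesis by (simp add: add.commute)
qed

lemma nn_integral_lebesgue_on:
  fixes f :: "'a::euclidean_space \<Rightarrow> ennreal"
  assumes "U \<in> sets lebesgue"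
  shows "(\<integral>\<^sup>+x. f x \<partial>lebesgue_on U) = (\<integral>\<^sup>+x. f x * indicator U x)"
  using assms by (subst nn_integral_restrict_space) (auto simp: nn_integral_completion)

text \<open>Points that a short shift carries out of \<open>W\<close> lie in a thin layer of points
  of \<open>W\<close> close to its complement. These layers decrease to the empty set because
  \<open>W\<close> is open.\<close>

lemma eventually_open_shift_small:
  fixes W :: "'a::euclidean_space set"
  assumes "open W" "emeasure lborel W < \<infinity>" "(e::real) > 0"
  shows "\<forall>\<^sub>F z in nhds 0. emeasure lborel {x \<in> W. x + z \<notin> W} \<le> ennreal e"
proof -
  define A where "A n = {x \<in> W. infdist x (- W) < 1 / real (Suc n)}" for n
  have [measurable]: "W \<in> sets borel" using assms by auto
  have [measurable]: "(\<lambda>x. infdist x (- W)) \<in> borel_measurable borel"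
    by (intro borel_measurable_continuous_onI continuous_intros)
  have A_meas[measurable]: "A n \<in> sets borel" for n
    unfolding A_def by measurable
  \<comment> \<open>\<open>infdist\<close> to the empty set is 0, which would make every layer equal
    to \<open>W\<close>; finite measure excludes that case.\<close>
  have ne: "- W \<noteq> {}"
  proof
    assume "- W = {}"
    then have "W = UNIV" by auto
    then show False using assms by simp
  qed
  have "(\<lambda>n. emeasure lborel (A n)) \<longlonglongrightarrow> emeasure lborel (\<Inter>n. A n)"
  proof (rule Lim_emeasure_decseq)
    show "decseq A"
      by (auto simp: A_def decseq_def frac_le elim!: less_le_trans intro!: divide_left_mono)
    fix n
    have "emeasure lborel (A n) \<le> emeasure lborel W"
      by (intro emeasure_mono) (auto simp: A_def)
    with assms show "emeasure lborel (A n) \<noteq> \<infinity>" by (auto simp: top_unique)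
  qed auto
  moreover have "(\<Inter>n. A n) = {}"
  proof (rule ccontr)
    assume "(\<Inter>n. A n) \<noteq> {}"
    then obtain x where x: "\<And>n. x \<in> A n" by auto
    then have "x \<in> W" by (auto simp: A_def)
    then have "infdist x (- W) > 0"
      using assms ne by (metis ComplD closed_Compl in_closed_iff_infdist_zero infdist_nonneg less_le)
    then obtain n where "1 / real (Suc n) < infdist x (- W)"
      using reals_Archimedean by (metis inverse_eq_divide)
    then show False using x[of n] by (auto simp: A_def)
  qed
  ultimately have "(\<lambda>n. emeasure lborel (A n)) \<longlonglongrightarrow> 0" by simp
  then have "\<forall>\<^sub>F n in sequentially. emeasure lborel (A n) < ennreal e"
    using assms by (intro order_tendstoD) auto
  then obtain n where n: "emeasure lborel (A n) < ennreal e"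
    by (auto simp: eventually_sequentially)
  have "\<forall>\<^sub>F z in nhds (0::'a). norm z < 1 / real (Suc n)"
    by (auto simp: eventually_nhds_metric dist_norm intro!: exI[of _ "1 / real (Suc n)"])
  then show ?thesis
  proof eventually_elim
    fix z :: 'a assume z: "norm z < 1 / real (Suc n)"
    have "{x \<in> W. x + z \<notin> W} \<subseteq> A n"
    proof
      fix x assume "x \<in> {x \<in> W. x + z \<notin> W}"
      then have "infdist x (- W) \<le> dist x (x + z)" "x \<in> W"
        by (auto intro: infdist_le)
      then show "x \<in> A n" using z by (auto simp: A_def dist_norm)
    qed
    then have "emeasure lborel {x \<in> W. x + z \<notin> W} \<le> emeasure lborel (A n)"
      by (intro emeasure_mono) auto
    then show "emeasure lborel {x \<in> W. x + z \<notin> W} \<le> ennreal e" using n by auto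
  qed
qed

text \<open>Induction on integrable functions. For an indicator, outer regularity gives an open
  superset of almost the same measure, to which the preceding lemma applies; limits are handled by
  dominated convergence and invariance under shifts.\<close>

lemma eventually_L1_shift_small:
  fixes f :: "'a::euclidean_space \<Rightarrow> real"
  assumes "integrable lborel f"
  shows "\<forall>e>0. \<forall>\<^sub>F z in nhds 0. (\<integral>\<^sup>+x. ennreal \<bar>f (x + z) - f x\<bar>) \<le> ennreal e"
  using assms
proof (induction rule: integrable_induct)
  case (base A c)
  have [measurable]: "A \<in> sets borel" using base by auto
  show ?case
  proof (intro allI impI)
    fix e :: real assume e: "e > 0"
    define d where "d = e / (4 * (\<bar>c\<bar> + 1))"
    have d: "d > 0" using e by (simp add: d_def add_nonneg_pos)
    obtain W where W: "open W" "A \<subseteq> W" "emeasure lborel (W - A) < ennreal d"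
      using outer_regular_lborel[of A d] d by auto
    have [measurable]: "W \<in> sets borel" using W by auto
    have "emeasure lborel W = emeasure lborel A + emeasure lborel (W - A)"
      using W by (subst plus_emeasure) (auto simp: Un_absorb1)
    also have "\<dots> < \<infinity>"
      using W base by (auto simp: less_top[symmetric])
    finally have Ofin: "emeasure lborel W < \<infinity>" .
    have ev: "\<forall>\<^sub>F z in nhds 0. emeasure lborel {x \<in> W. x + z \<notin> W} \<le> ennreal d"
      using W Ofin d by (intro eventually_open_shift_small) auto
    \<comment> \<open>The indicator of \<open>A\<close> can change under the shift by leaving or by
      entering, so the estimate is needed for \<open>z\<close> and for \<open>- z\<close>.\<close>
    have "filterlim uminus (nhds (0::'a)) (nhds 0)"
      using tendsto_minus[OF filterlim_ident[of "nhds (0::'a)"]] by simp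
    from eventually_compose_filterlim[OF ev this]
    have ev': "\<forall>\<^sub>F z in nhds 0. emeasure lborel {x \<in> W. x + - z \<notin> W} \<le> ennreal d" .
    show "\<forall>\<^sub>F z in nhds 0. (\<integral>\<^sup>+x. ennreal \<bar>indicator A (x + z) *\<^sub>R c - indicator A x *\<^sub>R c\<bar>) \<le> ennreal e"
      using ev ev'
    proof eventually_elim
      fix z assume z: "emeasure lborel {x \<in> W. x + z \<notin> W} \<le> ennreal d" "emeasure lborel {x \<in> W. x + - z \<notin> W} \<le> ennreal d"
      have meas[measurable]: "{x \<in> W. x + z \<notin> W} \<in> sets borel" "{x \<in> W. x + - z \<notin> W} \<in> sets borel"
        by measurable
      have "(\<integral>\<^sup>+x. ennreal \<bar>indicator A (x + z) *\<^sub>R c - indicator A x *\<^sub>R c\<bar>)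
        \<le> (\<integral>\<^sup>+x. ennreal \<bar>c\<bar> * (indicator {x \<in> W. x + z \<notin> W} x + indicator {x \<in> W. x + - z \<notin> W} (x + z) +
              (indicator (W - A) x + indicator (W - A) (x + z))))"
        using W by (intro nn_integral_mono) (auto simp: indicator_def add_nonneg_nonneg distrib_left)
      also have "\<dots> = ennreal \<bar>c\<bar> * ((\<integral>\<^sup>+x. indicator {x \<in> W. x + z \<notin> W} x) + (\<integral>\<^sup>+x. indicator {x \<in> W. x + - z \<notin> W} (x + z)) +
              ((\<integral>\<^sup>+x. indicator (W - A) x) + (\<integral>\<^sup>+x. indicator (W - A) (x + z))))"
        by (subst nn_integral_cmult) (measurable, subst nn_integral_add[symmetric], measurable)+
      also have "\<dots> = ennreal \<bar>c\<bar> * (emeasure lborel {x \<in> W. x + z \<notin> W} + emeasure lborel {x \<in> W. x + - z \<notin> W} + (emeasure lborel (W - A) + emeasure lborel (W - A)))"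
        by (simp add: nn_integral_lborel_shift)
      also have "\<dots> \<le> ennreal \<bar>c\<bar> * (ennreal d + ennreal d + (ennreal d + ennreal d))"
        using z W by (intro mult_left_mono add_mono) auto
      also have "\<dots> = ennreal (\<bar>c\<bar> * (4 * d))"
        using d by (simp add: ennreal_mult[symmetric] ennreal_plus[symmetric] del: ennreal_plus)
      also have "\<dots> \<le> ennreal e"
        using e by (intro ennreal_leI) (simp add: d_def field_simps)
      finally show "(\<integral>\<^sup>+x. ennreal \<bar>indicator A (x + z) *\<^sub>R c - indicator A x *\<^sub>R c\<bar>) \<le> ennreal e" .
    qed
  qed
next
  case (add f g)
  have [measurable]: "f \<in> borel_measurable borel" "g \<in> borel_measurable borel"
    using add borel_measurable_integrable by force+
  show ?case
  proof (intro allI impI)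
    fix e :: real assume e: "e > 0"
    then have "\<forall>\<^sub>F z in nhds 0. (\<integral>\<^sup>+x. ennreal \<bar>f (x + z) - f x\<bar>) \<le> ennreal (e / 2)"
      "\<forall>\<^sub>F z in nhds 0. (\<integral>\<^sup>+x. ennreal \<bar>g (x + z) - g x\<bar>) \<le> ennreal (e / 2)"
      using add.IH half_gt_zero by blast+
    then show "\<forall>\<^sub>F z in nhds 0. (\<integral>\<^sup>+x. ennreal \<bar>f (x + z) + g (x + z) - (f x + g x)\<bar>) \<le> ennreal e"
    proof eventually_elim
      fix z assume z: "(\<integral>\<^sup>+x. ennreal \<bar>f (x + z) - f x\<bar>) \<le> ennreal (e / 2)"
       "(\<integral>\<^sup>+x. ennreal \<bar>g (x + z) - g x\<bar>) \<le> ennreal (e / 2)"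
      have "(\<integral>\<^sup>+x. ennreal \<bar>f (x + z) + g (x + z) - (f x + g x)\<bar>) \<le>
         (\<integral>\<^sup>+x. ennreal \<bar>f (x + z) - f x\<bar> + ennreal \<bar>g (x + z) - g x\<bar>)"
        by (intro nn_integral_mono) (auto simp: ennreal_plus[symmetric] simp del: ennreal_plus intro!: ennreal_leI)
      also have "\<dots> = (\<integral>\<^sup>+x. ennreal \<bar>f (x + z) - f x\<bar>) + (\<integral>\<^sup>+x. ennreal \<bar>g (x + z) - g x\<bar>)"
        by (rule nn_integral_add) auto
      also have "\<dots> \<le> ennreal (e / 2) + ennreal (e / 2)"
        using z by (intro add_mono) auto
      also have "\<dots> = ennreal e" using e by (simp add: ennreal_plus[symmetric] del: ennreal_plus)
      finally show "(\<integral>\<^sup>+x. ennreal \<bar>f (x + z) + g (x + z) - (f x + g x)\<bar>) \<le> ennreal e" .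
    qed
  qed
next
  case (lim f s)
  have [measurable]: "f \<in> borel_measurable borel" "\<And>i. s i \<in> borel_measurable borel"
    using lim borel_measurable_integrable by force+
  show ?case
  proof (intro allI impI)
    fix e :: real assume e: "e > 0"
    \<comment> \<open>Majorant for \<open>s i - f\<close>, since the approximants satisfy \<bar>s
      i\<bar> \<le> 2 * \<bar>f\<bar>.\<close>
    have fin: "(\<integral>\<^sup>+x. ennreal (3 * \<bar>f x\<bar>)) < \<infinity>"
      using lim.hyps(4) by (simp add: integrable_iff_bounded ennreal_mult nn_integral_cmult ennreal_mult_less_top)
    have "(\<lambda>i. \<integral>\<^sup>+x. ennreal \<bar>s i x - f x\<bar>) \<longlonglongrightarrow> (\<integral>\<^sup>+(x::'a). 0)"
    proof (rule nn_integral_dominated_convergence[where w="\<lambda>x. ennreal (3 * \<bar>f x\<bar>)"])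
      show "AE x in lborel. ennreal \<bar>s i x - f x\<bar> \<le> ennreal (3 * \<bar>f x\<bar>)" for i
      proof (intro AE_I2 ennreal_leI)
        fix x
        have "\<bar>s i x\<bar> \<le> 2 * \<bar>f x\<bar>" using lim.hyps(3)[of x i] by simp
        then show "\<bar>s i x - f x\<bar> \<le> 3 * \<bar>f x\<bar>" by linarith
      qed
      show "AE x in lborel. (\<lambda>i. ennreal \<bar>s i x - f x\<bar>) \<longlonglongrightarrow> 0"
      proof (intro AE_I2)
        fix x
        have "(\<lambda>i. \<bar>s i x - f x\<bar>) \<longlonglongrightarrow> 0"
          using lim.hyps(2)[of x] by (simp add: LIM_zero tendsto_rabs_zero)
        then show "(\<lambda>i. ennreal \<bar>s i x - f x\<bar>) \<longlonglongrightarrow> 0"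
          using tendsto_ennrealI by force
      qed
    qed (use fin in auto)
    then have "\<forall>\<^sub>F i in sequentially. (\<integral>\<^sup>+x. ennreal \<bar>s i x - f x\<bar>) < ennreal (e / 3)"
      using e by (intro order_tendstoD) auto
    then obtain i where i: "(\<integral>\<^sup>+x. ennreal \<bar>s i x - f x\<bar>) < ennreal (e / 3)"
      by (auto simp: eventually_sequentially)
    have "\<forall>\<^sub>F z in nhds 0. (\<integral>\<^sup>+x. ennreal \<bar>s i (x + z) - s i x\<bar>) \<le> ennreal (e / 3)"
      using lim.IH[of i] e by simp
    then show "\<forall>\<^sub>F z in nhds 0. (\<integral>\<^sup>+x. ennreal \<bar>f (x + z) - f x\<bar>) \<le> ennreal e"
    proof eventually_elim
      fix z assume z: "(\<integral>\<^sup>+x. ennreal \<bar>s i (x + z) - s i x\<bar>) \<le> ennreal (e / 3)"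
      have "(\<integral>\<^sup>+x. ennreal \<bar>f (x + z) - f x\<bar>) \<le>
         (\<integral>\<^sup>+x. ennreal \<bar>s i (x + z) - s i x\<bar> + (ennreal \<bar>s i (x + z) - f (x + z)\<bar> + ennreal \<bar>s i x - f x\<bar>))"
        by (intro nn_integral_mono) (auto simp: ennreal_plus[symmetric] simp del: ennreal_plus intro!: ennreal_leI)
      also have "\<dots> = (\<integral>\<^sup>+x. ennreal \<bar>s i (x + z) - s i x\<bar>) +
          ((\<integral>\<^sup>+x. ennreal \<bar>s i (x + z) - f (x + z)\<bar>) + (\<integral>\<^sup>+x. ennreal \<bar>s i x - f x\<bar>))"
        by (simp add: nn_integral_add)
      also have "(\<integral>\<^sup>+x. ennreal \<bar>s i (x + z) - f (x + z)\<bar>) = (\<integral>\<^sup>+x. ennreal \<bar>s i x - f x\<bar>)"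
        by (rule nn_integral_lborel_shift) auto
      also have "(\<integral>\<^sup>+x. ennreal \<bar>s i (x + z) - s i x\<bar>) +
          ((\<integral>\<^sup>+x. ennreal \<bar>s i x - f x\<bar>) + (\<integral>\<^sup>+x. ennreal \<bar>s i x - f x\<bar>)) \<le> ennreal (e / 3) + (ennreal (e / 3) + ennreal (e / 3))"
        using z i by (intro add_mono) auto
      also have "\<dots> = ennreal e" using e by (simp add: ennreal_plus[symmetric] del: ennreal_plus)
      finally show "(\<integral>\<^sup>+x. ennreal \<bar>f (x + z) - f x\<bar>) \<le> ennreal e" .
    qed
  qed
qed

lemma powr_superadditive:
  fixes a b p :: real
  assumes "p \<ge> 1" "a \<ge> 0" "b \<ge> 0"
  shows "a powr p + b powr p \<le> (a + b) powr p"
proof (cases "a + b = 0")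
  case True
  then have "a = 0" "b = 0" using assms by auto
  then show ?thesis by simp
next
  case False
  then have s: "a + b > 0" using assms by auto
  have le: "t powr p \<le> t" if "0 \<le> t" "t \<le> 1" for t :: real
    using powr_mono'[of 1 p t] that assms by simp
  have "(a / (a + b)) powr p + (b / (a + b)) powr p \<le> a / (a + b) + b / (a + b)"
    using assms s by (intro add_mono le) auto
  also have "\<dots> = 1" using s by (simp add: add_divide_distrib[symmetric])
  finally show ?thesis
    using s assms by (simp add: powr_divide add_divide_distrib[symmetric])
qed

text \<open>The signed power \<open>sgn a * \<bar>a\<bar> powr p\<close> sends functions in L^p to
  integrable ones and keeps the sign, so differences can be recovered from it. This reduces
  continuity of translations in L^p to the case of L^1.\<close>

lemma abs_diff_powr_le_signed:
  fixes a b p :: real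
  assumes "p \<ge> 1"
  shows "\<bar>a - b\<bar> powr p \<le> 2 powr p * \<bar>sgn a * \<bar>a\<bar> powr p - sgn b * \<bar>b\<bar> powr p\<bar>"
proof -
  have two: "1 \<le> 2 powr p" using assms by (simp add: ge_one_powr_ge_zero)
  have same: "\<bar>a - b\<bar> powr p \<le> 2 powr p * \<bar>a powr p - b powr p\<bar>" if "0 \<le> a" "0 \<le> b" for a b :: real
  proof -
    have "\<bar>a - b\<bar> powr p \<le> \<bar>a powr p - b powr p\<bar>"
      using powr_superadditive[OF assms, of "a - b" b] powr_superadditive[OF assms, of "b - a" a] that
      by (cases "a \<ge> b") auto
    also have "\<dots> \<le> 2 powr p * \<bar>a powr p - b powr p\<bar>"
      using mult_right_mono[OF two, of "\<bar>a powr p - b powr p\<bar>"] by simp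
    finally show ?thesis .
  qed
  have opp: "\<bar>a + b\<bar> powr p \<le> 2 powr p * (a powr p + b powr p)" if "0 \<le> a" "0 \<le> b" for a b :: real
    using powr_abs_add_le[of p a b] that assms by simp
  consider "0 \<le> a \<and> 0 \<le> b" | "a < 0 \<and> b < 0" | "a < 0 \<and> 0 \<le> b" | "0 \<le> a \<and> b < 0"
    by linarith
  then show ?thesis
  proof cases
    case 1
    then show ?thesis using same[of a b] by (auto simp: sgn_if)
  next
    case 2
    then show ?thesis using same[of "-a" "-b"] by (auto simp: abs_minus_commute)
  next
    case 3
    then have "sgn a * \<bar>a\<bar> powr p - sgn b * \<bar>b\<bar> powr p = - ((- a) powr p + b powr p)"
      by (auto simp: sgn_if)
    then have "\<bar>sgn a * \<bar>a\<bar> powr p - sgn b * \<bar>b\<bar> powr p\<bar> = (- a) powr p + b powr p"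
      by (simp only: abs_minus_cancel) simp
    then show ?thesis using opp[of "-a" b] 3 by (simp add: abs_minus_commute)
  next
    case 4
    then have "\<bar>sgn a * \<bar>a\<bar> powr p - sgn b * \<bar>b\<bar> powr p\<bar> = \<bar>a powr p + (- b) powr p\<bar>"
      by (auto simp: sgn_if)
    then have eq: "\<bar>sgn a * \<bar>a\<bar> powr p - sgn b * \<bar>b\<bar> powr p\<bar> = a powr p + (- b) powr p"
      by simp
    show ?thesis unfolding eq using opp[of a "-b"] 4 by simp
  qed
qed

lemma eventually_Lp_shift_small:
  fixes u :: "'a::euclidean_space \<Rightarrow> real"
  assumes [measurable]: "u \<in> borel_measurable borel" and p: "p \<ge> 1"
    and fin: "(\<integral>\<^sup>+x. ennreal (\<bar>u x\<bar> powr p)) < \<infinity>" and e: "e > 0"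
  shows "\<forall>\<^sub>F z in nhds 0. (\<integral>\<^sup>+x. ennreal (\<bar>u (x + z) - u x\<bar> powr p)) \<le> ennreal e"
proof -
  define f where "f x = sgn (u x) * \<bar>u x\<bar> powr p" for x
  have [measurable]: "f \<in> borel_measurable borel"
    unfolding f_def by measurable
  have "norm (f x) = \<bar>u x\<bar> powr p" for x
    by (auto simp: f_def abs_mult sgn_if)
  then have "integrable lborel f"
    using fin by (simp add: integrable_iff_bounded)
  from eventually_L1_shift_small[OF this, rule_format, of "e / 2 powr p"] e
  have "\<forall>\<^sub>F z in nhds 0. (\<integral>\<^sup>+x. ennreal \<bar>f (x + z) - f x\<bar>) \<le> ennreal (e / 2 powr p)"
    by simp
  then show ?thesis
  proof eventually_elim
    fix z assume z: "(\<integral>\<^sup>+x. ennreal \<bar>f (x + z) - f x\<bar>) \<le> ennreal (e / 2 powr p)"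
    have "(\<integral>\<^sup>+x. ennreal (\<bar>u (x + z) - u x\<bar> powr p)) \<le> (\<integral>\<^sup>+x. ennreal (2 powr p) * ennreal \<bar>f (x + z) - f x\<bar>)"
      unfolding f_def using abs_diff_powr_le_signed[OF p]
      by (intro nn_integral_mono) (auto simp: ennreal_mult[symmetric] intro!: ennreal_leI)
    also have "\<dots> = ennreal (2 powr p) * (\<integral>\<^sup>+x. ennreal \<bar>f (x + z) - f x\<bar>)"
      by (rule nn_integral_cmult) auto
    also have "\<dots> \<le> ennreal (2 powr p) * ennreal (e / 2 powr p)"
      using z by (intro mult_left_mono) auto
    also have "\<dots> = ennreal e"
      using e by (simp add: ennreal_mult[symmetric])
    finally show "(\<integral>\<^sup>+x. ennreal (\<bar>u (x + z) - u x\<bar> powr p)) \<le> ennreal e" .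
  qed
qed

section \<open>Approximation by continuously differentiable functions\<close>

lemma GDERIV_quadratic_bound:
  fixes f :: "'a::real_inner \<Rightarrow> real"
  assumes "\<And>w. norm w \<le> 1 \<Longrightarrow> \<bar>f (x + w) - f x - w \<bullet> D\<bar> \<le> C * (norm w)\<^sup>2"
  shows "GDERIV f x :> D"
  unfolding gderiv_def has_derivative_at
proof
  show "bounded_linear (\<lambda>w. w \<bullet> D)"
    by (rule bounded_linear_inner_left)
  have "((\<lambda>w::'a. C * norm w) \<longlongrightarrow> C * norm (0::'a)) (at 0)"
    by (intro tendsto_intros tendsto_ident_at)
  then have lim: "((\<lambda>w::'a. C * norm w) \<longlongrightarrow> 0) (at 0)" by simp
  show "(\<lambda>w. norm (f (x + w) - f x - w \<bullet> D) / norm w) \<midarrow>0\<rightarrow> 0"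
  proof (rule real_tendsto_sandwich[OF _ _ tendsto_const lim])
    have "\<forall>\<^sub>F w in at (0::'a). norm w < 1"
      by (auto simp: eventually_at intro!: exI[of _ 1])
    then show "\<forall>\<^sub>F w in at 0. norm (f (x + w) - f x - w \<bullet> D) / norm w \<le> C * norm w"
    proof eventually_elim
      fix w :: 'a assume "norm w < 1"
      then have "\<bar>f (x + w) - f x - w \<bullet> D\<bar> \<le> C * (norm w)\<^sup>2"
        using assms[of w] by simp
      then show "norm (f (x + w) - f x - w \<bullet> D) / norm w \<le> C * norm w"
        by (cases "w = 0") (auto simp: field_simps power2_eq_square)
    qed
  qed auto
qed

text \<open>The square of a truncated paraboloid is continuously differentiable with explicit
  Lipschitz and Taylor constants, and one derivative is all that \<open>C1_closure\<close> asks for.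
  It is of size \<open>h ^ 4\<close> rather than normalised, since \<open>wavg\<close> divides by
  the mass.\<close>

definition bump :: "real \<Rightarrow> 'a::euclidean_space \<Rightarrow> real" where
  "bump h v = (max 0 (h\<^sup>2 - (norm v)\<^sup>2))\<^sup>2"

lemma bump_measurable[measurable]: "bump h \<in> borel_measurable borel"
  unfolding bump_def by measurable

lemma bump_nonneg: "0 \<le> bump h v"
  by (simp add: bump_def)

lemma bump_le: "bump h v \<le> h ^ 4"
proof -
  have "bump h v \<le> (h\<^sup>2)\<^sup>2"
    unfolding bump_def by (intro power_mono) auto
  then show ?thesis by (simp add: power_mult[symmetric])
qed

lemma bump_eq_0: "0 \<le> h \<Longrightarrow> h \<le> norm v \<Longrightarrow> bump h v = 0"
  by (simp add: bump_def power_mono)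

lemma bump_ge_half:
  assumes "norm v \<le> h / 2"
  shows "9 / 16 * h ^ 4 \<le> bump h v"
proof -
  have "(norm v)\<^sup>2 \<le> (h / 2)\<^sup>2"
    using assms by (intro power_mono) auto
  then have "3 / 4 * h\<^sup>2 \<le> h\<^sup>2 - (norm v)\<^sup>2"
    by (simp add: power_divide)
  then have "3 / 4 * h\<^sup>2 \<le> max 0 (h\<^sup>2 - (norm v)\<^sup>2)"
    by linarith
  then have "(3 / 4 * h\<^sup>2)\<^sup>2 \<le> bump h v"
    unfolding bump_def by (intro power_mono) auto
  then show ?thesis
    by (simp add: power_mult_distrib power2_eq_square power4_eq_xxxx mult.assoc)
qed

lemma bump_lipschitz:
  fixes v w :: "'a::euclidean_space"
  assumes h: "0 \<le> h"
  shows "\<bar>bump h v - bump h w\<bar> \<le> 4 * h ^ 3 * norm (v - w)"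
proof -
  \<comment> \<open>Truncating the norm at \<open>h\<close> makes the bump a polynomial in
    \<open>n\<close>, without a case distinction, and truncation does not increase
    distances.\<close>
  define n where "n v = min (norm v) h" for v :: 'a
  have n: "0 \<le> n v" "n v \<le> h" for v using h by (auto simp: n_def)
  have m: "max 0 (h\<^sup>2 - (norm v)\<^sup>2) = h\<^sup>2 - (n v)\<^sup>2" for v :: 'a
    using h by (auto simp: n_def min_def power_mono max_def)
  have le: "0 \<le> h\<^sup>2 - (n v)\<^sup>2" "h\<^sup>2 - (n v)\<^sup>2 \<le> h\<^sup>2" for v
    using n by (auto simp: power_mono)
  have "\<bar>bump h v - bump h w\<bar> = \<bar>(n w - n v) * (n w + n v) * ((h\<^sup>2 - (n v)\<^sup>2) + (h\<^sup>2 - (n w)\<^sup>2))\<bar>"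
    unfolding bump_def m by (simp add: power2_eq_square algebra_simps)
  also have "\<dots> = \<bar>n w - n v\<bar> * (n w + n v) * ((h\<^sup>2 - (n v)\<^sup>2) + (h\<^sup>2 - (n w)\<^sup>2))"
    unfolding abs_mult using n le[of v] le[of w] by simp
  also have "\<dots> \<le> norm (v - w) * (h + h) * (h\<^sup>2 + h\<^sup>2)"
  proof (intro mult_mono add_mono n le mult_nonneg_nonneg add_nonneg_nonneg)
    show "\<bar>n w - n v\<bar> \<le> norm (v - w)"
      using norm_triangle_ineq3[of v w] by (auto simp: n_def)
  qed (auto simp: h)
  also have "\<dots> = norm (v - w) * (2 * h) * (2 * h\<^sup>2)" by simp
  also have "\<dots> = 4 * h ^ 3 * norm (v - w)"
    by (simp add: power3_eq_cube power2_eq_square)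
  finally show ?thesis .
qed

lemma bump_taylor:
  fixes v w :: "'a::euclidean_space"
  assumes "norm v \<le> R" "norm w \<le> 1"
  shows "\<bar>bump h (v + w) - bump h v - w \<bullet> ((- 4 * max 0 (h\<^sup>2 - (norm v)\<^sup>2)) *\<^sub>R v)\<bar>
    \<le> ((2 * R + 1)\<^sup>2 + 2 * h\<^sup>2) * (norm w)\<^sup>2"
proof -
  define m where "m = h\<^sup>2 - (norm v)\<^sup>2"
  define t where "t = - 2 * (v \<bullet> w) - (norm w)\<^sup>2"
  have R: "0 \<le> R" using assms norm_ge_zero[of v] by linarith
  have m2: "h\<^sup>2 - (norm (v + w))\<^sup>2 = m + t"
    by (simp add: m_def t_def power2_norm_eq_inner algebra_simps inner_commute)
  \<comment> \<open>The squared positive part has derivative \<open>2 * max 0 m\<close>, and its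
    Taylor remainder is at most the square of the increment on either side of the kink.\<close>
  have sq: "\<bar>(max 0 (m + t))\<^sup>2 - (max 0 m)\<^sup>2 - 2 * max 0 m * t\<bar> \<le> t\<^sup>2"
  proof -
    consider "m \<ge> 0 \<and> m + t \<ge> 0" | "m \<ge> 0 \<and> m + t < 0" | "m < 0 \<and> m + t \<ge> 0" | "m < 0 \<and> m + t < 0"
      by linarith
    then show ?thesis
    proof cases
      case 1
      then show ?thesis by (simp add: power2_eq_square algebra_simps max_def)
    next
      case 2
      have "0 \<le> (m + t)\<^sup>2" "0 \<le> m * (- m - 2 * t)"
        using 2 by auto
      then show ?thesis using 2 by (auto simp: max_def power2_eq_square algebra_simps abs_if)
    next
      case 3
      have "(m + t)\<^sup>2 \<le> t\<^sup>2" using 3 by (intro power_mono) auto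
      then show ?thesis using 3 by (auto simp: max_def)
    next
      case 4
      then show ?thesis by (auto simp: max_def)
    qed
  qed
  have "\<bar>t\<bar> \<le> 2 * \<bar>v \<bullet> w\<bar> + (norm w)\<^sup>2"
    unfolding t_def by (simp add: abs_if)
  also have "\<dots> \<le> 2 * (R * norm w) + norm w * 1"
    using Cauchy_Schwarz_ineq2[of v w] mult_right_mono[OF assms(1), of "norm w"] mult_left_mono[OF assms(2), of "norm w"]
    by (intro add_mono) (auto simp: power2_eq_square)
  finally have t: "\<bar>t\<bar> \<le> (2 * R + 1) * norm w"
    by (simp add: algebra_simps)
  have t2: "t\<^sup>2 \<le> (2 * R + 1)\<^sup>2 * (norm w)\<^sup>2"
    using power_mono[OF t, of 2] by (simp add: power_mult_distrib)
  have m0: "0 \<le> max 0 m" "max 0 m \<le> h\<^sup>2" by (auto simp: m_def)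
  have "bump h (v + w) - bump h v - w \<bullet> ((- 4 * max 0 m) *\<^sub>R v)
    = ((max 0 (m + t))\<^sup>2 - (max 0 m)\<^sup>2 - 2 * max 0 m * t) - 2 * max 0 m * (norm w)\<^sup>2"
    unfolding bump_def m2 m_def[symmetric] by (simp add: t_def inner_commute algebra_simps)
  then have "\<bar>bump h (v + w) - bump h v - w \<bullet> ((- 4 * max 0 m) *\<^sub>R v)\<bar> \<le> t\<^sup>2 + 2 * max 0 m * (norm w)\<^sup>2"
    using sq m0 by (smt (verit) mult_nonneg_nonneg zero_le_power2)
  also have "\<dots> \<le> (2 * R + 1)\<^sup>2 * (norm w)\<^sup>2 + 2 * h\<^sup>2 * (norm w)\<^sup>2"
    using t2 m0 by (intro add_mono mult_right_mono) auto
  finally show ?thesis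
    by (simp add: m_def algebra_simps)
qed

definition bump_grad :: "real \<Rightarrow> 'a::euclidean_space \<Rightarrow> 'a" where
  "bump_grad h v = (- 4 * max 0 (h\<^sup>2 - (norm v)\<^sup>2)) *\<^sub>R v"

lemma bump_grad_measurable[measurable]: "bump_grad h \<in> borel_measurable borel"
  unfolding bump_grad_def by measurable

lemma norm_bump_grad_le:
  assumes "0 \<le> h"
  shows "norm (bump_grad h v) \<le> 4 * h ^ 3"
proof (cases "norm v \<le> h")
  case True
  have "max 0 (h\<^sup>2 - (norm v)\<^sup>2) * norm v \<le> h\<^sup>2 * h"
    using True assms by (intro mult_mono) auto
  then show ?thesis
    by (simp add: bump_grad_def abs_mult power3_eq_cube power2_eq_square mult_ac)
next
  case False
  then have "(norm v)\<^sup>2 \<ge> h\<^sup>2" using assms by (intro power_mono) auto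
  then show ?thesis using assms by (simp add: bump_grad_def)
qed

text \<open>The quadratic Taylor remainder of the bump is integrated against \<open>f\<close>. That
  \<open>f\<close> vanishes outside a bounded set keeps the Taylor constant uniform in
  \<open>a\<close>.\<close>

lemma GDERIV_bump_integral:
  fixes f :: "'a::euclidean_space \<Rightarrow> real"
  assumes f: "integrable lborel f" and B: "\<And>a. f a \<noteq> 0 \<Longrightarrow> norm a \<le> B" and h: "0 \<le> h"
  shows "GDERIV (\<lambda>x. \<integral>a. f a * bump h (x - a) \<partial>lborel) x :> (\<integral>a. f a *\<^sub>R bump_grad h (x - a) \<partial>lborel)"
proof (rule GDERIV_quadratic_bound)
  fix w :: 'a assume w: "norm w \<le> 1"
  have [measurable]: "f \<in> borel_measurable borel" using borel_measurable_integrable[OF f] by simp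
  define C where "C = (2 * (norm x + B) + 1)\<^sup>2 + 2 * h\<^sup>2"
  have C: "C \<ge> 0" by (simp add: C_def)
  have i1: "integrable lborel (\<lambda>a. f a * bump h (y - a))" for y
  proof (rule Bochner_Integration.integrable_bound[of _ "\<lambda>a. h ^ 4 * f a"])
    show "AE a in lborel. norm (f a * bump h (y - a)) \<le> norm (h ^ 4 * f a)"
      using bump_le[of h] by (intro AE_I2) (auto simp: abs_mult mult.commute[of _ "\<bar>f _\<bar>"] bump_nonneg intro!: mult_left_mono)
  qed (use f in auto)
  have i2: "integrable lborel (\<lambda>a. f a *\<^sub>R bump_grad h (x - a))"
  proof (rule Bochner_Integration.integrable_bound[of _ "\<lambda>a. (4 * h ^ 3) * f a"])
    show "AE a in lborel. norm (f a *\<^sub>R bump_grad h (x - a)) \<le> norm ((4 * h ^ 3) * f a)"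
      using norm_bump_grad_le[OF h] h by (intro AE_I2) (auto simp: abs_mult mult.commute[of _ "\<bar>f _\<bar>"] intro!: mult_left_mono)
  qed (use f in auto)
  have "(\<integral>a. f a * bump h (x + w - a) \<partial>lborel) - (\<integral>a. f a * bump h (x - a) \<partial>lborel) - w \<bullet> (\<integral>a. f a *\<^sub>R bump_grad h (x - a) \<partial>lborel)
    = (\<integral>a. f a * bump h (x + w - a) - f a * bump h (x - a) - w \<bullet> (f a *\<^sub>R bump_grad h (x - a)) \<partial>lborel)"
    using i1 i2 by (simp del: inner_scaleR_right)
  also have "\<bar>\<dots>\<bar> \<le> (\<integral>a. C * (norm w)\<^sup>2 * \<bar>f a\<bar> \<partial>lborel)"
  proof (rule order_trans[OF integral_abs_bound integral_mono])
    show "integrable lborel (\<lambda>a. \<bar>f a * bump h (x + w - a) - f a * bump h (x - a) - w \<bullet> (f a *\<^sub>R bump_grad h (x - a))\<bar>)"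
      using i1 i2 by (intro integrable_abs) (simp del: inner_scaleR_right)
    show "integrable lborel (\<lambda>a. C * (norm w)\<^sup>2 * \<bar>f a\<bar>)"
      using f by simp
    fix a
    show "\<bar>f a * bump h (x + w - a) - f a * bump h (x - a) - w \<bullet> (f a *\<^sub>R bump_grad h (x - a))\<bar> \<le> C * (norm w)\<^sup>2 * \<bar>f a\<bar>"
    proof (cases "f a = 0")
      case False
      have "norm (x - a) \<le> norm x + B"
        using B[OF False] norm_triangle_ineq4[of x a] by linarith
      from bump_taylor[OF this w, of h]
      have "\<bar>f a\<bar> * \<bar>bump h (x + w - a) - bump h (x - a) - w \<bullet> bump_grad h (x - a)\<bar> \<le> \<bar>f a\<bar> * (C * (norm w)\<^sup>2)"
        by (intro mult_left_mono) (auto simp: C_def bump_grad_def algebra_simps)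
      then show ?thesis
        by (simp add: abs_mult[symmetric] algebra_simps)
    qed auto
  qed
  also have "\<dots> = (C * (\<integral>a. \<bar>f a\<bar> \<partial>lborel)) * (norm w)\<^sup>2"
    by simp
  finally show "\<bar>(\<integral>a. f a * bump h (x + w - a) \<partial>lborel) - (\<integral>a. f a * bump h (x - a) \<partial>lborel) - w \<bullet> (\<integral>a. f a *\<^sub>R bump_grad h (x - a) \<partial>lborel)\<bar>
     \<le> ((\<lambda>x. (2 * (norm x + B) + 1)\<^sup>2 + 2 * h\<^sup>2) x * (\<integral>a. \<bar>f a\<bar> \<partial>lborel)) * (norm w)\<^sup>2"
    by (simp add: C_def)
qed

lemma continuous_on_bump_grad_integral:
  fixes f :: "'a::euclidean_space \<Rightarrow> real"
  assumes f: "integrable lborel f" and h: "0 \<le> h"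
  shows "continuous_on S (\<lambda>x. \<integral>a. f a *\<^sub>R bump_grad h (x - a) \<partial>lborel)"
proof (rule continuous_at_imp_continuous_on, rule ballI)
  fix x
  have [measurable]: "f \<in> borel_measurable borel" using borel_measurable_integrable[OF f] by simp
  show "isCont (\<lambda>x. \<integral>a. f a *\<^sub>R bump_grad h (x - a) \<partial>lborel) x"
    unfolding continuous_at_sequentially
  proof (intro allI impI)
    fix X assume X: "X \<longlonglongrightarrow> x"
    show "((\<lambda>x. \<integral>a. f a *\<^sub>R bump_grad h (x - a) \<partial>lborel) \<circ> X) \<longlonglongrightarrow> (\<integral>a. f a *\<^sub>R bump_grad h (x - a) \<partial>lborel)"
      unfolding o_def
    proof (rule integral_dominated_convergence[where w="\<lambda>a. (4 * h ^ 3) * \<bar>f a\<bar>"])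
      show "AE a in lborel. (\<lambda>i. f a *\<^sub>R bump_grad h (X i - a)) \<longlonglongrightarrow> f a *\<^sub>R bump_grad h (x - a)"
        unfolding bump_grad_def by (intro AE_I2 tendsto_intros X)
      show "AE a in lborel. norm (f a *\<^sub>R bump_grad h (X i - a)) \<le> (4 * h ^ 3) * \<bar>f a\<bar>" for i
        using norm_bump_grad_le[OF h] by (intro AE_I2) (auto simp: mult.commute[of _ "\<bar>f _\<bar>"] intro!: mult_left_mono)
    qed (use f in auto)
  qed
qed

section \<open>Exchange of integrals and kernel energies\<close>

lemma nn_integral_pair_lborel:
  fixes f :: "'a::euclidean_space \<Rightarrow> 'b::euclidean_space \<Rightarrow> ennreal"
  assumes "(\<lambda>w. f (fst w) (snd w)) \<in> borel_measurable (borel \<Otimes>\<^sub>M borel)"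
  shows "(\<integral>\<^sup>+x. \<integral>\<^sup>+y. f x y) = (\<integral>\<^sup>+w. f (fst w) (snd w))"
proof -
  have "(\<lambda>w. f (fst w) (snd w)) \<in> borel_measurable (lborel \<Otimes>\<^sub>M lborel)"
    using assms by (simp add: borel_prod lborel_prod)
  from lborel.nn_integral_fst[OF this] show ?thesis
    by (simp add: lborel_prod)
qed

text \<open>The device behind the energy estimates for averages. Jensen's inequality bounds the
  integrand at (x, y) by an integral of \<open>H a b\<close> against \<open>P x y a b\<close>; after
  exchanging the integrals only the total mass of \<open>P\<close> over (x, y) matters, and it
  becomes the new kernel at (a, b).\<close>

lemma nn_integral_transfer:
  fixes P :: "'a::euclidean_space \<Rightarrow> 'a \<Rightarrow> 'a \<Rightarrow> 'a \<Rightarrow> ennreal"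
  assumes P: "(\<lambda>w. P (fst (fst w)) (snd (fst w)) (fst (snd w)) (snd (snd w))) \<in> borel_measurable ((borel \<Otimes>\<^sub>M borel) \<Otimes>\<^sub>M (borel \<Otimes>\<^sub>M borel))"
    and H: "(\<lambda>w. H (fst w) (snd w)) \<in> borel_measurable (borel \<Otimes>\<^sub>M borel)"
    and G: "\<And>x y. G x y \<le> (\<integral>\<^sup>+a. \<integral>\<^sup>+b. P x y a b * H a b)"
    and K: "\<And>a b. (\<integral>\<^sup>+x. \<integral>\<^sup>+y. P x y a b) \<le> K a b"
  shows "(\<integral>\<^sup>+x. \<integral>\<^sup>+y. G x y) \<le> (\<integral>\<^sup>+a. \<integral>\<^sup>+b. K a b * H a b)"
proof -
  have P1: "(\<lambda>v. P x y (fst v) (snd v)) \<in> borel_measurable (borel \<Otimes>\<^sub>M borel)" for x y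
    using measurable_compose[OF _ P, of "\<lambda>v. ((x, y), v)"] by simp
  have P2: "(\<lambda>w. P (fst w) (snd w) a b) \<in> borel_measurable (borel \<Otimes>\<^sub>M borel)" for a b
    using measurable_compose[OF _ P, of "\<lambda>w. (w, (a, b))"] by simp
  define F where "F w v = P (fst w) (snd w) (fst v) (snd v) * H (fst v) (snd v)" for w v
  have F_meas: "(\<lambda>w. F (fst w) (snd w)) \<in> borel_measurable ((borel \<Otimes>\<^sub>M borel) \<Otimes>\<^sub>M (borel \<Otimes>\<^sub>M borel))"
    unfolding F_def by (intro borel_measurable_times_ennreal P measurable_compose[OF measurable_snd H])
  have F1: "(\<integral>\<^sup>+a. \<integral>\<^sup>+b. P x y a b * H a b) = (\<integral>\<^sup>+v. F (x, y) v)" for x y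
    unfolding F_def fst_conv snd_conv by (intro nn_integral_pair_lborel borel_measurable_times_ennreal P1 H)
  have F2: "(\<integral>\<^sup>+x. \<integral>\<^sup>+y. P x y a b) * H a b = (\<integral>\<^sup>+w. F w (a, b))" for a b
  proof -
    have "(\<lambda>w. P (fst w) (snd w) a b) \<in> borel_measurable lborel"
      using P2[of a b] by (simp add: borel_prod)
    then show ?thesis
      unfolding F_def fst_conv snd_conv
      by (subst nn_integral_pair_lborel[OF P2]) (simp add: nn_integral_multc)
  qed
  have F_borel: "(\<lambda>(w, v). F w v) \<in> borel_measurable (lborel \<Otimes>\<^sub>M lborel)"
    using F_meas by (simp add: borel_prod lborel_prod case_prod_beta')
  have F_borel': "(\<lambda>w. F (fst w) (snd w)) \<in> borel_measurable borel"
    using F_meas by (simp add: borel_prod)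
  have m1: "(\<lambda>w. \<integral>\<^sup>+v. F w v) \<in> borel_measurable borel"
    using lborel.borel_measurable_nn_integral_fst[of "\<lambda>w. F (fst w) (snd w)" lborel] F_borel
    by (simp add: case_prod_beta')
  have m2: "(\<lambda>v. \<integral>\<^sup>+w. F w v) \<in> borel_measurable borel"
    using lborel.borel_measurable_nn_integral_fst[of "\<lambda>w. F (snd w) (fst w)" lborel] F_borel
     measurable_pair_swap[of "\<lambda>(w, v). F w v" lborel lborel borel]
    by (simp add: case_prod_beta')
  have "(\<integral>\<^sup>+x. \<integral>\<^sup>+y. G x y) \<le> (\<integral>\<^sup>+x. \<integral>\<^sup>+y. (\<integral>\<^sup>+v. F (x, y) v))"
    using G by (intro nn_integral_mono) (simp add: F1)
  also have "\<dots> = (\<integral>\<^sup>+w. \<integral>\<^sup>+v. F w v)"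
    using m1 by (subst nn_integral_pair_lborel) (simp_all add: borel_prod)
  also have "\<dots> = (\<integral>\<^sup>+v. \<integral>\<^sup>+w. F w v)"
    using F_borel by (rule lborel_pair.Fubini'[symmetric])
  also have "\<dots> = (\<integral>\<^sup>+a. \<integral>\<^sup>+b. (\<integral>\<^sup>+w. F w (a, b)))"
    using m2 by (subst nn_integral_pair_lborel) (simp_all add: borel_prod)
  also have "\<dots> \<le> (\<integral>\<^sup>+a. \<integral>\<^sup>+b. K a b * H a b)"
    using K by (intro nn_integral_mono) (auto simp: F2[symmetric] intro: mult_right_mono)
  finally show ?thesis .
qed

text \<open>Both seminorms are of this form, with kernels \<open>nl_kernel\<close> and
  \<open>T_kernel\<close>, so most comparisons reduce to inequalities between functions of one real
  variable. The diagonal contributes nothing, because the difference vanishes there; kernels are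
  therefore compared for r > 0 only.\<close>

definition kenergy :: "(real \<Rightarrow> real) \<Rightarrow> real \<Rightarrow> 'a::euclidean_space set \<Rightarrow> ('a \<Rightarrow> real) \<Rightarrow> ennreal" where
  "kenergy \<kappa> p U u = (\<integral>\<^sup>+x. \<integral>\<^sup>+y. ennreal (\<kappa> (dist x y) * \<bar>u y - u x\<bar> powr p) * indicator U x * indicator U y)"

definition Lp_energy :: "real \<Rightarrow> 'a::euclidean_space set \<Rightarrow> ('a \<Rightarrow> real) \<Rightarrow> ennreal" where
  "Lp_energy p U u = (\<integral>\<^sup>+x. ennreal (\<bar>u x\<bar> powr p) * indicator U x)"

section \<open>Local averages on a set of positive lower density\<close>

lemma integrable_of_Lp:
  fixes u :: "'a::euclidean_space \<Rightarrow> real"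
  assumes [measurable]: "u \<in> borel_measurable borel" "U \<in> sets borel" and "bounded U" "p > 1"
    and fin: "Lp_energy p U u < \<infinity>"
  shows "integrable lborel (\<lambda>a. u a * indicator U a)"
proof (rule integrableI_bounded)
  have le: "\<bar>t\<bar> \<le> 1 + \<bar>t\<bar> powr p" for t :: real
  proof (cases "\<bar>t\<bar> \<le> 1")
    case False
    then have "\<bar>t\<bar> powr 1 \<le> \<bar>t\<bar> powr p" using assms by (intro powr_mono) auto
    then show ?thesis using False by simp
  qed (auto intro: add_increasing2)
  have "(\<integral>\<^sup>+a. ennreal (norm (u a * indicator U a)))
    \<le> (\<integral>\<^sup>+a. indicator U a + ennreal (\<bar>u a\<bar> powr p) * indicator U a)"
    using le by (intro nn_integral_mono)
      (auto simp: indicator_def ennreal_1[symmetric] ennreal_plus[symmetric] ennreal_mult[symmetric] simp del: ennreal_plus ennreal_1 intro!: ennreal_leI)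
  also have "\<dots> = emeasure lborel U + Lp_energy p U u"
    by (subst nn_integral_add) (auto simp: Lp_energy_def)
  also have "\<dots> < \<infinity>"
    using fin emeasure_bounded_finite[OF \<open>bounded U\<close>] by simp
  finally show "(\<integral>\<^sup>+a. ennreal (norm (u a * indicator U a))) < \<infinity>" .
qed auto

text \<open>A lower density condition in place of regularity of the boundary. It is imposed at
  points of the closure because the averages must be continuously differentiable up to the boundary,
  where their denominators must not vanish. Functions can then be smoothed without extending them
  beyond \<open>U\<close>.\<close>

locale fat_set =
  fixes U :: "'a::euclidean_space set" and h0 c :: real
  assumes U_borel[measurable]: "U \<in> sets borel" and U_bounded: "bounded U"
    and h0: "h0 > 0" and c: "c > 0"
    and fat: "\<And>x h. x \<in> closure U \<Longrightarrow> 0 < h \<Longrightarrow> h < h0 \<Longrightarrow>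
      ennreal (c * h ^ DIM('a)) \<le> emeasure lborel (U \<inter> ball x h)"
begin

definition ker :: "real \<Rightarrow> 'a \<Rightarrow> 'a \<Rightarrow> real" where
  "ker h x a = bump h (x - a) * indicator U a"

text \<open>The bump is at least \<open>9 / 16 * h ^ 4\<close> on the ball of radius
  \<open>h / 2\<close>, which meets \<open>U\<close> in measure at least
  \<open>c * (h / 2) ^ DIM('a)\<close>; the product is
  \<open>c1 * h ^ (DIM('a) + 4)\<close>.\<close>

definition c1 :: real where "c1 = 9 / 16 * c / 2 ^ DIM('a)"

lemma c1_pos: "c1 > 0"
  using c by (simp add: c1_def)

lemma ker_measurable[measurable]: "ker h x \<in> borel_measurable borel"
  unfolding ker_def by measurable

lemma ker_nonneg: "0 \<le> ker h x a"
  by (simp add: ker_def bump_nonneg)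

lemma ker_le: "0 \<le> h \<Longrightarrow> ker h x a \<le> h ^ 4 * indicator (ball x h) a * indicator U a"
  using bump_le[of h "x - a"] bump_eq_0[of h "x - a"]
  by (auto simp: ker_def indicator_def dist_norm)

lemma integrable_indicator_U: "integrable lborel (\<lambda>a. indicator U a :: real)"
  using emeasure_bounded_finite[OF U_bounded] by (intro integrable_real_indicator) auto

lemma integrable_ker_mult:
  assumes "integrable lborel (\<lambda>a. u a * indicator U a)"
  shows "integrable lborel (\<lambda>a. u a * ker h x a)"
proof (rule Bochner_Integration.integrable_bound[OF integrable_mult_right[OF assms, of "h ^ 4"]])
  have "(\<lambda>a. u a * indicator U a * bump h (x - a)) \<in> borel_measurable lborel"
    using borel_measurable_integrable[OF assms] by measurable
  then show "(\<lambda>a. u a * ker h x a) \<in> borel_measurable lborel"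
    by (simp add: ker_def mult_ac)
  show "AE a in lborel. norm (u a * ker h x a) \<le> norm (h ^ 4 * (u a * indicator U a))"
    using bump_le[of h]
    by (intro AE_I2) (auto simp: ker_def abs_mult indicator_def bump_nonneg mult.commute[of "h ^ 4"] intro!: mult_left_mono)
qed

lemma integrable_ker: "integrable lborel (ker h x)"
  using integrable_ker_mult[of "\<lambda>_. 1" h x] integrable_indicator_U by simp

lemma integral_ker_ge:
  assumes "x \<in> closure U" "0 < h" "h < h0"
  shows "c1 * h ^ (DIM('a) + 4) \<le> integral\<^sup>L lborel (ker h x)"
proof -
  have "ennreal (c1 * h ^ (DIM('a) + 4)) = ennreal (9 / 16 * h ^ 4) * ennreal (c * (h / 2) ^ DIM('a))"
    using assms c by (simp add: c1_def ennreal_mult[symmetric] power_add power_divide mult_ac)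
  also have "\<dots> \<le> ennreal (9 / 16 * h ^ 4) * emeasure lborel (U \<inter> ball x (h / 2))"
    using assms by (intro mult_left_mono fat) auto
  also have "\<dots> = (\<integral>\<^sup>+a. ennreal (9 / 16 * h ^ 4) * indicator (U \<inter> ball x (h / 2)) a)"
    by (rule nn_integral_cmult_indicator[symmetric]) auto
  also have "\<dots> \<le> (\<integral>\<^sup>+a. ennreal (ker h x a))"
    using bump_ge_half[of "x - _" h] by (intro nn_integral_mono) (auto simp: ker_def indicator_def dist_norm intro!: ennreal_leI)
  also have "\<dots> = ennreal (integral\<^sup>L lborel (ker h x))"
    by (rule nn_integral_eq_integral[OF integrable_ker]) (auto simp: ker_nonneg)
  finally show ?thesis
    by (subst (asm) ennreal_le_iff) (auto simp: ker_nonneg)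
qed

lemma integral_ker_pos:
  assumes "x \<in> closure U" "0 < h" "h < h0"
  shows "0 < integral\<^sup>L lborel (ker h x)"
  using integral_ker_ge[OF assms] c1_pos assms by (smt (verit) zero_less_mult_iff zero_less_power)

lemma averaging_ker:
  assumes "u \<in> borel_measurable borel" "integrable lborel (\<lambda>a. u a * indicator U a)"
    "x \<in> closure U" "0 < h" "h < h0"
  shows "averaging (ker h x) u"
  unfolding averaging_def
  using assms integral_ker_pos[of x h] integrable_ker integrable_ker_mult ker_nonneg by blast

lemma ker_div_le:
  assumes "x \<in> closure U" "0 < h" "h < h0"
  shows "ker h x a / integral\<^sup>L lborel (ker h x) \<le> 1 / c1 / h ^ DIM('a) * indicator (ball x h) a * indicator U a"
proof -
  have "ker h x a / integral\<^sup>L lborel (ker h x) \<le> (h ^ 4 * indicator (ball x h) a * indicator U a) / (c1 * h ^ (DIM('a) + 4))"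
    using assms c1_pos by (intro frac_le ker_le integral_ker_ge) auto
  also have "\<dots> = 1 / c1 / h ^ DIM('a) * indicator (ball x h) a * indicator U a"
    using assms c1_pos by (simp add: power_add field_simps)
  finally show ?thesis .
qed

text \<open>The average is a quotient of two integrals that are differentiable everywhere; the
  density condition makes the denominator nonzero on \<open>closure U\<close>.\<close>

lemma wavg_ker_C1:
  assumes u: "u \<in> borel_measurable borel" and iu: "integrable lborel (\<lambda>a. u a * indicator U a)"
    and h: "0 < h" "h < h0"
  shows "(\<lambda>x. wavg (ker h x) u) \<in> C1_closure U"
proof -
  obtain B where B: "\<And>a. a \<in> U \<Longrightarrow> norm a \<le> B"
    using U_bounded by (auto simp: bounded_iff)
  define N where "N x = (\<integral>a. (u a * indicator U a) * bump h (x - a) \<partial>lborel)" for x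
  define K where "K x = (\<integral>a. (indicator U a) * bump h (x - a) \<partial>lborel)" for x
  define DN where "DN x = (\<integral>a. (u a * indicator U a) *\<^sub>R bump_grad h (x - a) \<partial>lborel)" for x
  define DK where "DK x = (\<integral>a. (indicator U a) *\<^sub>R bump_grad h (x - a) \<partial>lborel)" for x
  have gN: "GDERIV N x :> DN x" for x
    unfolding N_def[abs_def] DN_def
    by (rule GDERIV_bump_integral[OF iu, where B=B]) (use B h in \<open>auto simp: indicator_def split: if_splits\<close>)
  have gK: "GDERIV K x :> DK x" for x
    unfolding K_def[abs_def] DK_def
    by (rule GDERIV_bump_integral[OF integrable_indicator_U, where B=B]) (use B h in \<open>auto simp: indicator_def split: if_splits\<close>)
  have cN: "continuous_on S N" and cK: "continuous_on S K" for S
    using gN gK unfolding gderiv_def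
    by (meson continuous_at_imp_continuous_on has_derivative_continuous)+
  have cDN: "continuous_on S DN" for S
    unfolding DN_def[abs_def] using h by (intro continuous_on_bump_grad_integral iu) auto
  have cDK: "continuous_on S DK" for S
    unfolding DK_def[abs_def] using h by (intro continuous_on_bump_grad_integral integrable_indicator_U) auto
  have K0: "K x \<noteq> 0" if "x \<in> closure U" for x
    using integral_ker_pos[OF that h] by (simp add: K_def ker_def[abs_def] mult.commute)
  have eq: "(\<lambda>x. wavg (ker h x) u) = (\<lambda>x. N x * inverse (K x))"
    by (simp add: wavg_def N_def K_def ker_def fun_eq_iff divide_inverse mult_ac)
  show ?thesis
    unfolding C1_closure_def eq mem_Collect_eq
  proof (intro conjI exI ballI)
    show "continuous_on (closure U) (\<lambda>x. N x * inverse (K x))"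
      using K0 by (intro continuous_intros cN cK) auto
    show "continuous_on (closure U) (\<lambda>x. N x *\<^sub>R (- (inverse (K x))\<^sup>2 *\<^sub>R DK x) + inverse (K x) *\<^sub>R DN x)"
      using K0 by (intro continuous_intros cN cK cDN cDK) auto
    fix x assume "x \<in> U"
    then have "K x \<noteq> 0" using K0 closure_subset by auto
    then show "GDERIV (\<lambda>x. N x * inverse (K x)) x :> N x *\<^sub>R (- (inverse (K x))\<^sup>2 *\<^sub>R DK x) + inverse (K x) *\<^sub>R DN x"
      by (intro GDERIV_mult GDERIV_inverse gN gK)
  qed
qed

end

lemma emeasure_ball_le:
  fixes x :: "'a::euclidean_space"
  assumes "r \<ge> 0"
  shows "emeasure lborel (ball x r) = ennreal (unit_ball_vol DIM('a) * r ^ DIM('a))"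
  using emeasure_ball[OF assms, of x] by simp

lemma emeasure_cball_powr:
  fixes x :: "'a::euclidean_space"
  assumes "r > 0"
  shows "emeasure lborel (V \<inter> cball x r) \<le> ennreal (unit_ball_vol DIM('a) * r powr DIM('a))"
proof -
  have "emeasure lborel (V \<inter> cball x r) \<le> emeasure lborel (cball x r)"
    by (intro emeasure_mono) auto
  then show ?thesis
    using emeasure_cball[of r x] assms by (simp add: powr_realpow)
qed

context fat_set
begin

definition Jball :: real where "Jball = unit_ball_vol DIM('a)"

lemma Jball_pos: "Jball > 0" by (simp add: Jball_def)

text \<open>Mass bound for pairs at distance at least \<open>h\<close>. If \<open>a\<close> and
  \<open>b\<close> are within \<open>h\<close> of \<open>x\<close> and \<open>y\<close>, then dist a
  b \<le> 3 * dist x y, and the volumes of the two balls cancel the normalisation. The diagonal a =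
  b is removed because \<open>0 powr (- \<beta>)\<close> is 0, so the right-hand side vanishes
  there.\<close>

lemma far_mass_le:
  assumes h: "0 < h" "h \<le> \<tau>" and \<beta>: "0 \<le> \<beta>"
  shows "(\<integral>\<^sup>+x. \<integral>\<^sup>+y. ennreal (dist x y powr (- \<beta>) * indicator {h..<\<tau>} (dist x y) * (1 / c1 / h ^ DIM('a))\<^sup>2 *
            indicator (ball x h) a * indicator (ball y h) b) * indicator (- {b}) a)
     \<le> ennreal (3 powr \<beta> * (Jball / c1)\<^sup>2 * (dist a b powr (- \<beta>) * indicator {..<5 * \<tau>} (dist a (b::'a))))"
    (is "?L \<le> _")
proof -
  define q where "q = 3 powr \<beta> * (dist a b powr (- \<beta>) * indicator {..<5 * \<tau>} (dist a b)) * (1 / c1 / h ^ DIM('a))\<^sup>2"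
  have q: "q \<ge> 0" by (simp add: q_def)
  have "?L \<le> (\<integral>\<^sup>+x. \<integral>\<^sup>+y. (ennreal q * indicator (ball a h) x) * indicator (ball b h) y)"
  proof (intro nn_integral_mono)
    fix x y :: 'a
    show "ennreal (dist x y powr (- \<beta>) * indicator {h..<\<tau>} (dist x y) * (1 / c1 / h ^ DIM('a))\<^sup>2 *
            indicator (ball x h) a * indicator (ball y h) b) * indicator (- {b}) a
       \<le> (ennreal q * indicator (ball a h) x) * indicator (ball b h) y"
    proof (cases "h \<le> dist x y \<and> dist x y < \<tau> \<and> dist x a < h \<and> dist y b < h \<and> a \<noteq> b")
      case True
      have le: "dist a b \<le> dist x y + 2 * h"
        using True dist_triangle[of a b x] dist_triangle[of x b y] by (simp add: dist_commute)
      then have "dist a b \<le> 3 * dist x y" and lt: "dist a b < 5 * \<tau>"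
        using True h by linarith+
      then have "(3 * dist x y) powr (- \<beta>) \<le> dist a b powr (- \<beta>)"
        using \<beta> True by (intro powr_mono2') auto
      then have "3 powr \<beta> * (3 * dist x y) powr (- \<beta>) \<le> 3 powr \<beta> * dist a b powr (- \<beta>)"
        by (intro mult_left_mono) auto
      moreover have "3 powr \<beta> * (3 * dist x y) powr (- \<beta>) = dist x y powr (- \<beta>)"
        by (simp add: powr_mult powr_minus)
      ultimately have "dist x y powr (- \<beta>) \<le> 3 powr \<beta> * dist a b powr (- \<beta>)"
        by (simp only:)
      then have "dist x y powr (- \<beta>) * (1 / c1 / h ^ DIM('a))\<^sup>2 \<le> q"
        using lt unfolding q_def by (intro mult_right_mono) auto
      then show ?thesis
        using True by (simp add: dist_commute ennreal_leI)
    next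
      case False
      then have "h \<le> dist x y \<Longrightarrow> dist x y < \<tau> \<Longrightarrow> dist x a < h \<Longrightarrow> dist y b < h \<Longrightarrow> a = b" by blast
      then show ?thesis
        by (auto simp: indicator_def)
    qed
  qed
  also have "\<dots> = (\<integral>\<^sup>+x. ennreal q * emeasure lborel (ball b h) * indicator (ball a h) x)"
    by (intro nn_integral_cong, subst nn_integral_cmult_indicator) (auto simp: mult_ac)
  also have "\<dots> = ennreal q * ennreal (Jball * h ^ DIM('a)) * ennreal (Jball * h ^ DIM('a))"
    using h by (subst nn_integral_cmult_indicator) (auto simp: Jball_def emeasure_ball_le)
  also have "\<dots> = ennreal (3 powr \<beta> * (Jball / c1)\<^sup>2 * (dist a b powr (- \<beta>) * indicator {..<5 * \<tau>} (dist a b)))"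
    using h c1_pos Jball_pos q
    by (simp add: ennreal_mult[symmetric] q_def power2_eq_square field_simps)
  finally show ?thesis .
qed

text \<open>Mass bound for pairs at distance at most \<open>h\<close>, where smoothness of the
  average contributes \<open>(dist x y / h) powr p\<close>. The kernel then has the exponent p -
  \<beta> > - d and is integrable at the diagonal. The constant may depend on \<beta>: it serves to
  show membership in the space, where no uniformity is at stake.\<close>

lemma near_mass_le:
  fixes p \<beta> :: real
  assumes p: "p > 1" and \<beta>: "0 \<le> \<beta>" "\<beta> < DIM('a) + p"
  shows "\<exists>C\<ge>0. \<forall>h \<tau> a b::'a. 0 < h \<longrightarrow> h \<le> \<tau> \<longrightarrow>
     (\<integral>\<^sup>+x. \<integral>\<^sup>+y. ennreal (dist x y powr (p - \<beta>) / h powr p * indicator {0<..h} (dist x y) * (1 / h ^ DIM('a))\<^sup>2 *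
            indicator (ball x (2 * h)) a * indicator (ball x (2 * h)) b) * indicator (- {b}) a)
     \<le> ennreal (C * (dist a b powr (- \<beta>) * indicator {..<5 * \<tau>} (dist a b)))"
proof -
  define \<alpha> where "\<alpha> = DIM('a) + p - \<beta>"
  have \<alpha>: "\<alpha> > 0" using \<beta> by (simp add: \<alpha>_def)
  define D where "D = 2 powr (\<bar>p - \<beta>\<bar> + 1) * Jball * (2 powr \<alpha> / \<alpha>)"
  have D: "D \<ge> 0" using \<alpha> Jball_pos by (simp add: D_def)
  define C where "C = D * Jball * 2 ^ DIM('a) * 4 powr \<beta>"
  have C: "C \<ge> 0" using D Jball_pos by (simp add: C_def)
  show ?thesis
  proof (intro exI conjI allI impI, rule C)
    fix h \<tau> :: real and a b :: 'a
    assume h: "0 < h" "h \<le> \<tau>"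
    define q where "q = (1 / h ^ DIM('a))\<^sup>2 / h powr p"
    have q: "q \<ge> 0" by (simp add: q_def)
    have ball: "(\<integral>\<^sup>+y. ennreal (dist x y powr (p - \<beta>)) * indicator {0<..h} (dist x y)) \<le> ennreal (D * h powr \<alpha>)" for x :: 'a
    proof -
      have "(\<integral>\<^sup>+y. ennreal (dist x y powr (\<alpha> - DIM('a))) * indicator UNIV y * indicator {0<..h} (dist x y))
        \<le> ennreal (2 powr (\<bar>\<alpha> - DIM('a)\<bar> + 1) * Jball * ((2 * h) powr \<alpha> / \<alpha>))"
        using \<alpha> h Jball_pos by (intro nn_integral_dist_powr_ball_le) (auto simp: Jball_def intro: emeasure_cball_powr[where V=UNIV, simplified])
      then show ?thesis
        by (simp add: \<alpha>_def D_def powr_mult mult_ac)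
    qed
    have "(\<integral>\<^sup>+x. \<integral>\<^sup>+y. ennreal (dist x y powr (p - \<beta>) / h powr p * indicator {0<..h} (dist x y) * (1 / h ^ DIM('a))\<^sup>2 *
            indicator (ball x (2 * h)) a * indicator (ball x (2 * h)) b) * indicator (- {b}) a)
      = (\<integral>\<^sup>+x. \<integral>\<^sup>+y. (ennreal q * indicator (ball a (2 * h)) x * indicator (ball b (2 * h)) x * indicator (- {b}) a) *
           (ennreal (dist x y powr (p - \<beta>)) * indicator {0<..h} (dist x y)))"
      by (intro nn_integral_cong) (auto simp: indicator_def q_def dist_commute ennreal_mult[symmetric] mult_ac)
    also have "\<dots> = (\<integral>\<^sup>+x. (ennreal q * indicator (ball a (2 * h)) x * indicator (ball b (2 * h)) x * indicator (- {b}) a) *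
           (\<integral>\<^sup>+y. ennreal (dist x y powr (p - \<beta>)) * indicator {0<..h} (dist x y)))"
      by (intro nn_integral_cong nn_integral_cmult) measurable
    also have "\<dots> \<le> (\<integral>\<^sup>+x. (ennreal q * indicator (ball a (2 * h)) x * indicator (ball b (2 * h)) x * indicator (- {b}) a) * ennreal (D * h powr \<alpha>))"
      using ball by (intro nn_integral_mono mult_left_mono) auto
    also have "\<dots> \<le> (\<integral>\<^sup>+x. (ennreal q * ennreal (D * h powr \<alpha>) * ennreal (indicator {..<4 * h} (dist a b)) * indicator (- {b}) a) * indicator (ball a (2 * h)) x)"
    proof (intro nn_integral_mono)
      fix x
      have "dist a b < 4 * h" if "dist a x < 2 * h" "dist b x < 2 * h"
        using dist_triangle2[of a b x] that by linarith
      then show "(ennreal q * indicator (ball a (2 * h)) x * indicator (ball b (2 * h)) x * indicator (- {b}) a) * ennreal (D * h powr \<alpha>)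
        \<le> (ennreal q * ennreal (D * h powr \<alpha>) * ennreal (indicator {..<4 * h} (dist a b)) * indicator (- {b}) a) * indicator (ball a (2 * h)) x"
        by (auto simp: indicator_def)
    qed
    also have "\<dots> = (ennreal q * ennreal (D * h powr \<alpha>) * ennreal (indicator {..<4 * h} (dist a b)) * indicator (- {b}) a) * ennreal (Jball * (2 * h) ^ DIM('a))"
      using h by (subst nn_integral_cmult_indicator) (auto simp: Jball_def emeasure_ball_le)
    also have "\<dots> \<le> ennreal (C * (dist a b powr (- \<beta>) * indicator {..<5 * \<tau>} (dist a b)))"
    proof (cases "a \<noteq> b \<and> dist a b < 4 * h")
      case True
      have "(4 * h) powr (- \<beta>) \<le> dist a b powr (- \<beta>)"
        using True \<beta> by (intro powr_mono2') auto
      then have "4 powr \<beta> * (4 * h) powr (- \<beta>) \<le> 4 powr \<beta> * dist a b powr (- \<beta>)"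
        by (intro mult_left_mono) auto
      moreover have "4 powr \<beta> * (4 * h) powr (- \<beta>) = h powr (- \<beta>)"
        by (simp add: powr_mult powr_minus)
      ultimately have "h powr (- \<beta>) \<le> 4 powr \<beta> * dist a b powr (- \<beta>)"
        by (simp only:)
      then have 1: "D * Jball * 2 ^ DIM('a) * h powr (- \<beta>) \<le> D * Jball * 2 ^ DIM('a) * (4 powr \<beta> * dist a b powr (- \<beta>))"
        using D Jball_pos by (intro mult_left_mono) auto
      have "q * (D * h powr \<alpha>) * (Jball * (2 * h) ^ DIM('a)) = D * Jball * 2 ^ DIM('a) * (h powr \<alpha> / h powr p / h ^ DIM('a))"
        using h by (simp add: q_def power_mult_distrib power2_eq_square field_simps)
      also have "h powr \<alpha> / h powr p / h ^ DIM('a) = h powr (- \<beta>)"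
        using h by (simp add: \<alpha>_def powr_realpow[symmetric] powr_diff[symmetric])
      also note 1
      also have "D * Jball * 2 ^ DIM('a) * (4 powr \<beta> * dist a b powr (- \<beta>)) = C * dist a b powr (- \<beta>)"
        by (simp add: C_def)
      finally have "q * (D * h powr \<alpha>) * (Jball * (2 * h) ^ DIM('a)) \<le> C * dist a b powr (- \<beta>)" .
      moreover have "dist a b < 5 * \<tau>" using True h by linarith
      ultimately show ?thesis
        using True q D Jball_pos h by (simp add: ennreal_mult[symmetric] ennreal_leI)
    qed (auto simp: indicator_def)
    finally show "(\<integral>\<^sup>+x. \<integral>\<^sup>+y. ennreal (dist x y powr (p - \<beta>) / h powr p * indicator {0<..h} (dist x y) * (1 / h ^ DIM('a))\<^sup>2 *
            indicator (ball x (2 * h)) a * indicator (ball x (2 * h)) b) * indicator (- {b}) a)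
     \<le> ennreal (C * (dist a b powr (- \<beta>) * indicator {..<5 * \<tau>} (dist a b)))" .
  qed
qed

lemma wavg_ker_measurable:
  assumes [measurable]: "u \<in> borel_measurable borel"
  shows "(\<lambda>x. wavg (ker h x) u) \<in> borel_measurable borel"
  unfolding wavg_def ker_def by measurable

lemma wavg_ker_far:
  assumes u[measurable]: "u \<in> borel_measurable borel" and iu: "integrable lborel (\<lambda>a. u a * indicator U a)"
    and p: "p > 1" and h: "0 < h" "h < h0" and xy: "x \<in> U" "y \<in> U"
  shows "ennreal (\<bar>wavg (ker h y) u - wavg (ker h x) u\<bar> powr p) \<le>
    (\<integral>\<^sup>+a. \<integral>\<^sup>+b. ennreal ((1 / c1 / h ^ DIM('a))\<^sup>2 * indicator (ball x h) a * indicator (ball y h) b) * indicator U a * indicator U b *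
       ennreal (\<bar>u b - u a\<bar> powr p))"
proof -
  have xy': "x \<in> closure U" "y \<in> closure U" using xy closure_subset by auto
  have "ennreal (\<bar>wavg (ker h x) u - wavg (ker h y) u\<bar> powr p) \<le>
    (\<integral>\<^sup>+a. \<integral>\<^sup>+b. ennreal (ker h x a / integral\<^sup>L lborel (ker h x)) * ennreal (ker h y b / integral\<^sup>L lborel (ker h y)) * ennreal (\<bar>u a - u b\<bar> powr p))"
    by (intro wavg_diff_powr_le averaging_ker u iu xy' h p)
  also have "\<dots> \<le> (\<integral>\<^sup>+a. \<integral>\<^sup>+b. ennreal (1 / c1 / h ^ DIM('a) * indicator (ball x h) a * indicator U a) *
      ennreal (1 / c1 / h ^ DIM('a) * indicator (ball y h) b * indicator U b) * ennreal (\<bar>u a - u b\<bar> powr p))"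
    using xy' h by (intro nn_integral_mono mult_right_mono mult_mono ennreal_leI ker_div_le) auto
  also have "\<dots> = (\<integral>\<^sup>+a. \<integral>\<^sup>+b. ennreal ((1 / c1 / h ^ DIM('a))\<^sup>2 * indicator (ball x h) a * indicator (ball y h) b) * indicator U a * indicator U b *
       ennreal (\<bar>u b - u a\<bar> powr p))"
    using c1_pos h by (intro nn_integral_cong)
      (auto simp: indicator_def ennreal_mult[symmetric] power2_eq_square abs_minus_commute)
  finally show ?thesis by (simp add: abs_minus_commute)
qed

text \<open>\<open>wavg_diff_lipschitz_powr_le\<close> with e = \<open>4 * dist x y / h\<close>: the
  bump has Lipschitz constant \<open>4 * h ^ 3\<close>, and the mass of \<open>ker h x\<close> is at
  least \<open>c1 * h ^ (DIM('a) + 4)\<close>. As dist x y < h, both kernels live in the ball of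
  radius \<open>2 * h\<close> around \<open>x\<close>.\<close>

lemma wavg_ker_near:
  assumes u[measurable]: "u \<in> borel_measurable borel" and iu: "integrable lborel (\<lambda>a. u a * indicator U a)"
    and p: "p > 1" and h: "0 < h" "h < h0" and xy: "x \<in> U" "y \<in> U" "dist x y < h"
  shows "ennreal (\<bar>wavg (ker h y) u - wavg (ker h x) u\<bar> powr p) \<le>
    ennreal ((4 * dist x y / h) powr p * (2 ^ DIM('a) * Jball / c1) powr (p - 1)) *
    (\<integral>\<^sup>+a. \<integral>\<^sup>+b. ennreal ((1 / c1 / h ^ DIM('a))\<^sup>2 * indicator (ball x (2 * h)) a * indicator (ball x (2 * h)) b) * indicator U a * indicator U b *
       ennreal (\<bar>u b - u a\<bar> powr p))"
proof -
  have xy': "x \<in> closure U" "y \<in> closure U" using xy closure_subset by auto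
  define g where "g a = 1 / c1 / h ^ DIM('a) * indicator (ball x (2 * h)) a * indicator U a" for a
  have [measurable]: "g \<in> borel_measurable borel" unfolding g_def by (intro borel_measurable_times borel_measurable_indicator borel_measurable_const) auto
  have Kpos: "0 < integral\<^sup>L lborel (ker h x)" "0 < integral\<^sup>L lborel (ker h y)"
    using integral_ker_pos xy' h by auto
  have sub: "ball y h \<subseteq> ball x (2 * h)"
  proof
    fix z assume "z \<in> ball y h"
    then show "z \<in> ball x (2 * h)"
      using xy(3) dist_triangle[of x z y] by simp
  qed
  have "ennreal (\<bar>wavg (ker h x) u - wavg (ker h y) u\<bar> powr p) \<le>
    ennreal ((4 * dist x y / h) powr p * (2 ^ DIM('a) * Jball / c1) powr (p - 1)) *
    (\<integral>\<^sup>+a. \<integral>\<^sup>+b. ennreal (g a) * ennreal (g b) * ennreal (\<bar>u a - u b\<bar> powr p))"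
  proof (rule wavg_diff_lipschitz_powr_le)
    show "averaging (ker h x) u" "averaging (ker h y) u"
      by (intro averaging_ker u iu xy' h)+
    show "p > 1" by (rule p)
    show "0 \<le> g a" for a using c1_pos h by (simp add: g_def)
    have "(\<integral>\<^sup>+a. ennreal (g a)) \<le> (\<integral>\<^sup>+a. ennreal (1 / c1 / h ^ DIM('a)) * indicator (ball x (2 * h)) a)"
      by (intro nn_integral_mono) (auto simp: g_def indicator_def)
    also have "\<dots> = ennreal (1 / c1 / h ^ DIM('a)) * ennreal (Jball * (2 * h) ^ DIM('a))"
      using h by (subst nn_integral_cmult_indicator) (auto simp: Jball_def emeasure_ball_le)
    also have "\<dots> = ennreal (2 ^ DIM('a) * Jball / c1)"
      using h c1_pos Jball_pos by (simp add: ennreal_mult[symmetric] power_mult_distrib)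
    finally show "(\<integral>\<^sup>+a. ennreal (g a)) \<le> ennreal (2 ^ DIM('a) * Jball / c1)" .
    show "0 < 2 ^ DIM('a) * Jball / c1" using c1_pos Jball_pos by simp
    show "0 \<le> 4 * dist x y / h" using h by simp
    show "\<bar>ker h x a - ker h y a\<bar> \<le> integral\<^sup>L lborel (ker h x) * (4 * dist x y / h) * g a" for a
    proof (cases "a \<in> U \<and> a \<in> ball x (2 * h)")
      case True
      have "\<bar>ker h x a - ker h y a\<bar> \<le> 4 * h ^ 3 * norm ((x - a) - (y - a))"
        using True bump_lipschitz[of h "x - a" "y - a"] h by (simp add: ker_def)
      also have "\<dots> = (c1 * h ^ (DIM('a) + 4)) * (4 * dist x y / h) * g a"
        using True h c1_pos by (simp add: g_def dist_norm power_add field_simps eval_nat_numeral)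
      also have "\<dots> \<le> integral\<^sup>L lborel (ker h x) * (4 * dist x y / h) * g a"
        using True h c1_pos integral_ker_ge[OF xy'(1) h] by (intro mult_right_mono) (auto simp: g_def)
      finally show ?thesis .
    next
      case False
      then have "a \<notin> U \<or> (a \<notin> ball x h \<and> a \<notin> ball y h)"
        using sub h by (auto simp: subset_eq)
      then have "ker h x a = 0 \<and> ker h y a = 0"
        using bump_eq_0[of h "x - a"] bump_eq_0[of h "y - a"] h by (auto simp: ker_def dist_norm)
      then show ?thesis
        using False by (auto simp: g_def)
    qed
    show "ker h y a \<le> integral\<^sup>L lborel (ker h y) * g a" for a
    proof -
      have "ker h y a / integral\<^sup>L lborel (ker h y) \<le> 1 / c1 / h ^ DIM('a) * indicator (ball y h) a * indicator U a"
        by (rule ker_div_le[OF xy'(2) h])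
      also have "\<dots> \<le> g a"
        using sub c1_pos h by (auto simp: g_def indicator_def subset_eq)
      finally show ?thesis using Kpos by (simp add: field_simps)
    qed
  qed auto
  also have "(\<integral>\<^sup>+a. \<integral>\<^sup>+b. ennreal (g a) * ennreal (g b) * ennreal (\<bar>u a - u b\<bar> powr p))
    = (\<integral>\<^sup>+a. \<integral>\<^sup>+b. ennreal ((1 / c1 / h ^ DIM('a))\<^sup>2 * indicator (ball x (2 * h)) a * indicator (ball x (2 * h)) b) * indicator U a * indicator U b *
       ennreal (\<bar>u b - u a\<bar> powr p))"
    using c1_pos h by (intro nn_integral_cong)
      (auto simp: g_def indicator_def ennreal_mult[symmetric] power2_eq_square abs_minus_commute)
  finally show ?thesis by (simp add: abs_minus_commute)
qed

end

lemma kenergy_measurable: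
  fixes u :: "'a::euclidean_space \<Rightarrow> real"
  assumes [measurable]: "u \<in> borel_measurable borel" "U \<in> sets borel" "\<kappa> \<in> borel_measurable borel"
  shows "(\<lambda>w. ennreal (\<kappa> (dist (fst w) (snd w)) * \<bar>u (snd w) - u (fst w)\<bar> powr p) * indicator U (fst w) * indicator U (snd w))
    \<in> borel_measurable (borel \<Otimes>\<^sub>M borel)"
  by measurable

text \<open>Dominated convergence on pairs: off the diagonal the truncated kernel is eventually 0,
  and on the diagonal the difference is 0.\<close>

lemma kenergy_small_scale:
  fixes u :: "'a::euclidean_space \<Rightarrow> real" and \<kappa> :: "real \<Rightarrow> real"
  assumes u[measurable]: "u \<in> borel_measurable borel" and U[measurable]: "U \<in> sets borel"
    and \<kappa>[measurable]: "\<kappa> \<in> borel_measurable borel" and fin: "kenergy \<kappa> p U u < \<infinity>" and e: "(e::real) > 0"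
  shows "\<exists>\<tau>>0. kenergy (\<lambda>r. \<kappa> r * indicator {..<\<tau>} r) p U u \<le> ennreal e"
proof -
  define F where "F \<tau> w = ennreal (\<kappa> (dist (fst w) (snd w)) * indicator {..<\<tau>} (dist (fst w) (snd w)) * \<bar>u (snd w) - u (fst w)\<bar> powr p) * indicator U (fst w) * indicator U (snd w)" for \<tau> w
  define G where "G w = ennreal (\<kappa> (dist (fst w) (snd w)) * \<bar>u (snd w) - u (fst w)\<bar> powr p) * indicator U (fst w) * indicator U (snd w)" for w
  have Fm: "F \<tau> \<in> borel_measurable (borel \<Otimes>\<^sub>M borel)" for \<tau>
    unfolding F_def using kenergy_measurable[OF u U, of "\<lambda>r. \<kappa> r * indicator {..<\<tau>} r"] by simp
  have Gm: "G \<in> borel_measurable (borel \<Otimes>\<^sub>M borel)"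
    unfolding G_def by (rule kenergy_measurable[OF u U \<kappa>])
  have FE: "kenergy (\<lambda>r. \<kappa> r * indicator {..<\<tau>} r) p U u = (\<integral>\<^sup>+w. F \<tau> w)" for \<tau>
    unfolding kenergy_def using Fm[of \<tau>] unfolding F_def by (rule nn_integral_pair_lborel)
  have GE: "kenergy \<kappa> p U u = (\<integral>\<^sup>+w. G w)"
    unfolding kenergy_def using Gm unfolding G_def by (rule nn_integral_pair_lborel)
  have "(\<lambda>n. \<integral>\<^sup>+w. F (1 / real (Suc n)) w) \<longlonglongrightarrow> (\<integral>\<^sup>+(w::'a \<times> 'a). 0)"
  proof (rule nn_integral_dominated_convergence[where w=G])
    show "AE w in lborel. (\<lambda>n. F (1 / real (Suc n)) w) \<longlonglongrightarrow> 0"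
    proof (rule AE_I2)
      fix w :: "'a \<times> 'a"
      show "(\<lambda>n. F (1 / real (Suc n)) w) \<longlonglongrightarrow> 0"
      proof (cases "fst w = snd w")
        case True
        then show ?thesis by (simp add: F_def)
      next
        case False
        have "(\<lambda>n. 1 / real (Suc n)) \<longlonglongrightarrow> 0"
          using LIMSEQ_inverse_real_of_nat by (simp add: inverse_eq_divide)
        then have "\<forall>\<^sub>F n in sequentially. 1 / real (Suc n) < dist (fst w) (snd w)"
          using False by (intro order_tendstoD) auto
        then have "\<forall>\<^sub>F n in sequentially. F (1 / real (Suc n)) w = 0"
          by eventually_elim (simp add: F_def)
        then show ?thesis by (rule tendsto_eventually)
      qed
    qed
    show "AE w in lborel. F (1 / real (Suc j)) w \<le> G w" for j
      by (intro AE_I2) (auto simp: F_def G_def indicator_def)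
  qed (use Fm Gm fin GE in \<open>simp_all add: borel_prod\<close>)
  then have "\<forall>\<^sub>F n in sequentially. (\<integral>\<^sup>+w. F (1 / real (Suc n)) w) < ennreal e"
    using e by (intro order_tendstoD) auto
  then obtain n where "(\<integral>\<^sup>+w. F (1 / real (Suc n)) w) < ennreal e"
    by (auto simp: eventually_sequentially)
  then show ?thesis
    by (intro exI[of _ "1 / real (Suc n)"]) (auto simp: FE)
qed

lemma kenergy_mono:
  assumes "\<And>r. r > 0 \<Longrightarrow> \<kappa> r \<le> \<kappa>' r"
  shows "kenergy \<kappa> p U u \<le> kenergy \<kappa>' p U u"
  unfolding kenergy_def
proof (intro nn_integral_mono)
  fix x y
  have "\<kappa> (dist x y) * \<bar>u y - u x\<bar> powr p \<le> \<kappa>' (dist x y) * \<bar>u y - u x\<bar> powr p"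
    using assms[of "dist x y"] by (cases "x = y") (auto intro: mult_right_mono)
  then show "ennreal (\<kappa> (dist x y) * \<bar>u y - u x\<bar> powr p) * indicator U x * indicator U y
    \<le> ennreal (\<kappa>' (dist x y) * \<bar>u y - u x\<bar> powr p) * indicator U x * indicator U y"
    by (intro mult_right_mono[OF mult_right_mono[OF ennreal_leI]]) auto
qed

context fat_set
begin

text \<open>The constant depends neither on \<open>h\<close> nor on \<tau>. Averaging therefore does
  not concentrate energy at small scales: what the averages carry below \<tau> is bounded by what
  \<open>u\<close> carries below \<open>5 * \<tau>\<close>, uniformly in the smoothing
  radius.\<close>

lemma kenergy_wavg_ker_le:
  fixes p \<beta> :: real
  assumes u[measurable]: "u \<in> borel_measurable borel" and iu: "integrable lborel (\<lambda>a. u a * indicator U a)"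
    and p: "p > 1" and \<beta>: "0 \<le> \<beta>" "\<beta> < DIM('a) + p"
  shows "\<exists>C\<ge>0. \<forall>h \<tau>. 0 < h \<longrightarrow> h < h0 \<longrightarrow> h \<le> \<tau> \<longrightarrow>
    kenergy (\<lambda>r. r powr (- \<beta>) * indicator {..<\<tau>} r) p U (\<lambda>x. wavg (ker h x) u) \<le>
      ennreal C * kenergy (\<lambda>r. r powr (- \<beta>) * indicator {..<5 * \<tau>} r) p U u"
proof -
  obtain C2 where C2: "C2 \<ge> 0" and near: "\<And>h \<tau> a b::'a. 0 < h \<Longrightarrow> h \<le> \<tau> \<Longrightarrow>
     (\<integral>\<^sup>+x. \<integral>\<^sup>+y. ennreal (dist x y powr (p - \<beta>) / h powr p * indicator {0<..h} (dist x y) * (1 / h ^ DIM('a))\<^sup>2 *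
            indicator (ball x (2 * h)) a * indicator (ball x (2 * h)) b) * indicator (- {b}) a)
     \<le> ennreal (C2 * (dist a b powr (- \<beta>) * indicator {..<5 * \<tau>} (dist a b)))"
    using near_mass_le[OF p \<beta>] by blast
  define C1 where "C1 = 3 powr \<beta> * (Jball / c1)\<^sup>2"
  define C3 where "C3 = 4 powr p * (2 ^ DIM('a) * Jball / c1) powr (p - 1) * (1 / c1)\<^sup>2"
  have C13: "C1 \<ge> 0" "C3 \<ge> 0" by (simp_all add: C1_def C3_def)
  show ?thesis
  proof (intro exI conjI allI impI)
    show "C1 + C3 * C2 \<ge> 0" using C13 C2 by simp
    fix h \<tau> :: real assume h: "0 < h" "h < h0" "h \<le> \<tau>"
    define p1 where "p1 x y a b = ennreal (dist x y powr (- \<beta>) * indicator {h..<\<tau>} (dist x y) * (1 / c1 / h ^ DIM('a))\<^sup>2 *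
            indicator (ball x h) a * indicator (ball y h) b) * indicator (- {b}) a" for x y a b :: 'a
    define p2 where "p2 x y a b = ennreal (dist x y powr (p - \<beta>) / h powr p * indicator {0<..h} (dist x y) * (1 / h ^ DIM('a))\<^sup>2 *
            indicator (ball x (2 * h)) a * indicator (ball x (2 * h)) b) * indicator (- {b}) a" for x y a b :: 'a
    \<comment> \<open>The far part \<open>p1\<close> and the near part \<open>p2\<close> are added
      rather than chosen by cases, so that one application of the transfer lemma covers both ranges
      of \<open>dist x y\<close>.\<close>
    define P where "P x y a b = p1 x y a b + ennreal C3 * p2 x y a b" for x y a b :: 'a
    define H where "H a b = ennreal (\<bar>u b - u a\<bar> powr p) * indicator U a * indicator U b" for a b
    define \<kappa> where "\<kappa> r = r powr (- \<beta>) * indicator {..<5 * \<tau>} r" for r :: real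
    \<comment> \<open>Membership written through the distance exposes joint measurability in both
      points.\<close>
    have ball_eq: "indicator (ball x r) a = (indicator {..<r} (dist x a) :: real)" for x a :: 'a and r
      by (simp add: indicator_def)
    have eq_eq: "indicator (- {b}) a = (indicator (- {0}) (dist a b) :: ennreal)" for a b :: 'a
      by (simp add: indicator_def)
    have m1: "(\<lambda>w. p1 (fst (fst w)) (snd (fst w)) (fst (snd w)) (snd (snd w))) \<in> borel_measurable ((borel \<Otimes>\<^sub>M borel) \<Otimes>\<^sub>M (borel \<Otimes>\<^sub>M borel))"
      unfolding p1_def ball_eq eq_eq by measurable
    have m2: "(\<lambda>w. p2 (fst (fst w)) (snd (fst w)) (fst (snd w)) (snd (snd w))) \<in> borel_measurable ((borel \<Otimes>\<^sub>M borel) \<Otimes>\<^sub>M (borel \<Otimes>\<^sub>M borel))"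
      unfolding p2_def ball_eq eq_eq by measurable
    have m1': "(\<lambda>w. p1 (fst w) (snd w) a b) \<in> borel_measurable (borel \<Otimes>\<^sub>M borel)" for a b
      using measurable_compose[OF _ m1, of "\<lambda>w. (w, (a, b))"] by simp
    have m2': "(\<lambda>w. p2 (fst w) (snd w) a b) \<in> borel_measurable (borel \<Otimes>\<^sub>M borel)" for a b
      using measurable_compose[OF _ m2, of "\<lambda>w. (w, (a, b))"] by simp
    have "kenergy (\<lambda>r. r powr (- \<beta>) * indicator {..<\<tau>} r) p U (\<lambda>x. wavg (ker h x) u) \<le>
      (\<integral>\<^sup>+a. \<integral>\<^sup>+b. ennreal ((C1 + C3 * C2) * \<kappa> (dist a b)) * H a b)"
      unfolding kenergy_def
    proof (rule nn_integral_transfer[where P=P])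
      show "(\<lambda>w. P (fst (fst w)) (snd (fst w)) (fst (snd w)) (snd (snd w))) \<in> borel_measurable ((borel \<Otimes>\<^sub>M borel) \<Otimes>\<^sub>M (borel \<Otimes>\<^sub>M borel))"
        unfolding P_def using m1 m2 by simp
      show "(\<lambda>w. H (fst w) (snd w)) \<in> borel_measurable (borel \<Otimes>\<^sub>M borel)"
        unfolding H_def by measurable
    next
      fix a b :: 'a
      have "(\<integral>\<^sup>+x. \<integral>\<^sup>+y. P x y a b) = (\<integral>\<^sup>+x. \<integral>\<^sup>+y. p1 x y a b) + ennreal C3 * (\<integral>\<^sup>+x. \<integral>\<^sup>+y. p2 x y a b)"
        unfolding P_def using m1'[of a b] m2'[of a b]
        by (simp add: nn_integral_pair_lborel nn_integral_add nn_integral_cmult borel_prod)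
      also have "\<dots> \<le> ennreal (C1 * \<kappa> (dist a b)) + ennreal C3 * ennreal (C2 * \<kappa> (dist a b))"
        unfolding p1_def p2_def C1_def \<kappa>_def using far_mass_le[OF h(1,3) \<beta>(1)] near[OF h(1,3)]
        by (intro add_mono mult_left_mono) auto
      also have "\<dots> = ennreal ((C1 + C3 * C2) * \<kappa> (dist a b))"
        using C13 C2 by (simp add: \<kappa>_def ennreal_mult[symmetric] ennreal_plus[symmetric] distrib_right mult.assoc del: ennreal_plus)
      finally show "(\<integral>\<^sup>+x. \<integral>\<^sup>+y. P x y a b) \<le> ennreal ((C1 + C3 * C2) * \<kappa> (dist a b))" .
    next
      fix x y :: 'a
      let ?R = "\<integral>\<^sup>+a. \<integral>\<^sup>+b. P x y a b * H a b"
      show "ennreal (dist x y powr (- \<beta>) * indicator {..<\<tau>} (dist x y) * \<bar>wavg (ker h y) u - wavg (ker h x) u\<bar> powr p) * indicator U x * indicator U y \<le> ?R"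
      proof (cases "x \<in> U \<and> y \<in> U \<and> dist x y < \<tau> \<and> x \<noteq> y")
        case True
        then have xy: "x \<in> U" "y \<in> U" "dist x y < \<tau>" "dist x y > 0" by auto
        let ?W = "ennreal (\<bar>wavg (ker h y) u - wavg (ker h x) u\<bar> powr p)"
        have "ennreal (dist x y powr (- \<beta>)) * ?W \<le> ?R"
        proof (cases "dist x y < h")
          case False
          let ?F = "\<lambda>a b. ennreal ((1 / c1 / h ^ DIM('a))\<^sup>2 * indicator (ball x h) a * indicator (ball y h) b) * indicator U a * indicator U b * ennreal (\<bar>u b - u a\<bar> powr p)"
          have "ennreal (dist x y powr (- \<beta>)) * ?W \<le> ennreal (dist x y powr (- \<beta>)) * (\<integral>\<^sup>+a. \<integral>\<^sup>+b. ?F a b)"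
            using wavg_ker_far[OF u iu p h(1,2) xy(1,2)] by (rule mult_left_mono) auto
          also have "\<dots> = (\<integral>\<^sup>+a. \<integral>\<^sup>+b. ennreal (dist x y powr (- \<beta>)) * ?F a b)"
            by (simp add: nn_integral_cmult ball_eq)
          also have "\<dots> \<le> (\<integral>\<^sup>+a. \<integral>\<^sup>+b. p1 x y a b * H a b)"
            using False xy by (intro nn_integral_mono) (auto simp: p1_def H_def indicator_def ennreal_mult[symmetric] mult_ac)
          also have "\<dots> \<le> ?R"
            by (intro nn_integral_mono mult_right_mono) (auto simp: P_def)
          finally show ?thesis .
        next
          case True
          let ?F = "\<lambda>a b. ennreal ((1 / c1 / h ^ DIM('a))\<^sup>2 * indicator (ball x (2 * h)) a * indicator (ball x (2 * h)) b) * indicator U a * indicator U b * ennreal (\<bar>u b - u a\<bar> powr p)"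
          let ?c = "(4 * dist x y / h) powr p * (2 ^ DIM('a) * Jball / c1) powr (p - 1)"
          have "ennreal (dist x y powr (- \<beta>)) * ?W \<le> ennreal (dist x y powr (- \<beta>)) * (ennreal ?c * (\<integral>\<^sup>+a. \<integral>\<^sup>+b. ?F a b))"
            using wavg_ker_near[OF u iu p h(1,2) xy(1,2) True] by (rule mult_left_mono) auto
          also have "\<dots> = (\<integral>\<^sup>+a. \<integral>\<^sup>+b. ennreal (dist x y powr (- \<beta>)) * (ennreal ?c * ?F a b))"
            by (simp add: nn_integral_cmult ball_eq)
          also have "\<dots> \<le> (\<integral>\<^sup>+a. \<integral>\<^sup>+b. ennreal C3 * p2 x y a b * H a b)"
          proof (intro nn_integral_mono)
            fix a b
            have "dist x y powr (- \<beta>) * (?c * (1 / c1 / h ^ DIM('a))\<^sup>2) = C3 * (dist x y powr (p - \<beta>) / h powr p * (1 / h ^ DIM('a))\<^sup>2)"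
              using xy h c1_pos by (simp add: C3_def powr_mult powr_divide powr_diff powr_minus field_simps)
            then show "ennreal (dist x y powr (- \<beta>)) * (ennreal ?c * ?F a b) \<le> ennreal C3 * p2 x y a b * H a b"
              using True xy C13 by (auto simp: p2_def H_def indicator_def ennreal_mult[symmetric] mult.assoc[symmetric])
          qed
          also have "\<dots> \<le> ?R"
            by (intro nn_integral_mono mult_right_mono) (auto simp: P_def)
          finally show ?thesis .
        qed
        then show ?thesis using xy by (simp add: ennreal_mult)
      qed (auto simp: indicator_def)
    qed
    also have "\<dots> = ennreal (C1 + C3 * C2) * (\<integral>\<^sup>+a. \<integral>\<^sup>+b. ennreal (\<kappa> (dist a b)) * H a b)"
    proof -
      have [measurable]: "(\<lambda>w. H (fst w) (snd w)) \<in> borel_measurable (borel \<Otimes>\<^sub>M borel)"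
        unfolding H_def by measurable
      have [measurable]: "\<kappa> \<in> borel_measurable borel" unfolding \<kappa>_def by measurable
      have "(\<lambda>w. ennreal (\<kappa> (dist (fst w) (snd w))) * H (fst w) (snd w)) \<in> borel_measurable (borel \<Otimes>\<^sub>M borel)"
        by measurable
      then show ?thesis
        using C13 C2 by (simp add: ennreal_mult' mult.assoc nn_integral_pair_lborel nn_integral_cmult borel_prod \<kappa>_def)
    qed
    also have "(\<integral>\<^sup>+a. \<integral>\<^sup>+b. ennreal (\<kappa> (dist a b)) * H a b) = kenergy (\<lambda>r. r powr (- \<beta>) * indicator {..<5 * \<tau>} r) p U u"
      unfolding kenergy_def H_def \<kappa>_def by (intro nn_integral_cong) (auto simp: ennreal_mult mult.assoc)
    finally show "kenergy (\<lambda>r. r powr (- \<beta>) * indicator {..<\<tau>} r) p U (\<lambda>x. wavg (ker h x) u) \<le>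
      ennreal (C1 + C3 * C2) * kenergy (\<lambda>r. r powr (- \<beta>) * indicator {..<5 * \<tau>} r) p U u" .
  qed
qed

text \<open>Jensen's inequality and the substitution a = x + z bound the error by an average, over
  the shifts \<open>z\<close> of norm below \<open>h\<close>, of the L^p distance between
  \<open>u\<close> extended by 0 and its translates.\<close>

lemma Lp_wavg_ker_small:
  assumes u[measurable]: "u \<in> borel_measurable borel" and p: "p > 1" and fin: "Lp_energy p U u < \<infinity>" and e: "(e::real) > 0"
  shows "\<exists>\<eta>>0. \<forall>h. 0 < h \<longrightarrow> h < \<eta> \<longrightarrow> Lp_energy p U (\<lambda>x. wavg (ker h x) u - u x) \<le> ennreal e"
proof -
  define v where "v x = u x * indicator U x" for x
  have [measurable]: "v \<in> borel_measurable borel" unfolding v_def by measurable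
  have iu: "integrable lborel (\<lambda>a. u a * indicator U a)"
    by (rule integrable_of_Lp[OF u U_borel U_bounded p fin])
  have "(\<integral>\<^sup>+x. ennreal (\<bar>v x\<bar> powr p)) = Lp_energy p U u"
    unfolding Lp_energy_def v_def by (intro nn_integral_cong) (auto simp: indicator_def)
  then have vfin: "(\<integral>\<^sup>+x. ennreal (\<bar>v x\<bar> powr p)) < \<infinity>" using fin by simp
  \<comment> \<open>Makes the density bound \<open>1 / c1 / h ^ DIM('a)\<close> times the volume of
    the ball of radius \<open>h\<close> times \<open>e1\<close> equal to \<open>e\<close>.\<close>
  define e1 where "e1 = e * c1 / Jball"
  have e1: "e1 > 0" using e c1_pos Jball_pos by (simp add: e1_def)
  have "\<forall>\<^sub>F z in nhds 0. (\<integral>\<^sup>+x. ennreal (\<bar>v (x + z) - v x\<bar> powr p)) \<le> ennreal e1"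
    using vfin e1 p by (intro eventually_Lp_shift_small) auto
  then obtain \<eta> where \<eta>: "\<eta> > 0" "\<And>z. dist z 0 < \<eta> \<Longrightarrow> (\<integral>\<^sup>+x. ennreal (\<bar>v (x + z) - v x\<bar> powr p)) \<le> ennreal e1"
    unfolding eventually_nhds_metric by blast
  show ?thesis
  proof (intro exI conjI allI impI)
    show "min \<eta> h0 > 0" using \<eta> h0 by simp
    fix h assume "0 < h" "h < min \<eta> h0"
    then have h: "0 < h" "h < h0" "h < \<eta>" by auto
    define q where "q = 1 / c1 / h ^ DIM('a)"
    have q: "q \<ge> 0" using c1_pos h by (simp add: q_def)
    have "Lp_energy p U (\<lambda>x. wavg (ker h x) u - u x) \<le>
      (\<integral>\<^sup>+x. \<integral>\<^sup>+a. ennreal (q * indicator {..<h} (dist x a)) * ennreal (\<bar>v a - v x\<bar> powr p))"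
      unfolding Lp_energy_def
    proof (intro nn_integral_mono)
      fix x
      show "ennreal (\<bar>wavg (ker h x) u - u x\<bar> powr p) * indicator U x \<le>
        (\<integral>\<^sup>+a. ennreal (q * indicator {..<h} (dist x a)) * ennreal (\<bar>v a - v x\<bar> powr p))"
      proof (cases "x \<in> U")
        case True
        then have x: "x \<in> closure U" using closure_subset by auto
        have "ennreal (\<bar>wavg (ker h x) u - u x\<bar> powr p) \<le>
          (\<integral>\<^sup>+a. ennreal (ker h x a / integral\<^sup>L lborel (ker h x)) * ennreal (\<bar>u a - u x\<bar> powr p))"
          by (intro wavg_minus_powr_le averaging_ker u iu x h p)
        also have "\<dots> \<le> (\<integral>\<^sup>+a. ennreal (q * indicator {..<h} (dist x a)) * ennreal (\<bar>v a - v x\<bar> powr p))"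
        proof (intro nn_integral_mono)
          fix a
          have "ker h x a / integral\<^sup>L lborel (ker h x) \<le> q * indicator (ball x h) a * indicator U a"
            unfolding q_def by (rule ker_div_le[OF x h(1,2)])
          moreover have "u a = v a" if "a \<in> U" using that by (simp add: v_def)
          moreover have "u x = v x" using True by (simp add: v_def)
          ultimately show "ennreal (ker h x a / integral\<^sup>L lborel (ker h x)) * ennreal (\<bar>u a - u x\<bar> powr p)
            \<le> ennreal (q * indicator {..<h} (dist x a)) * ennreal (\<bar>v a - v x\<bar> powr p)"
            by (cases "a \<in> U") (auto simp: indicator_def ennreal_neg intro!: mult_right_mono ennreal_leI split: if_splits)
        qed
        finally show ?thesis using True by simp
      qed auto
    qed
    also have "\<dots> = (\<integral>\<^sup>+x. \<integral>\<^sup>+z. ennreal (q * indicator {..<h} (norm z)) * ennreal (\<bar>v (x + z) - v x\<bar> powr p))"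
    proof (rule nn_integral_cong)
      fix x
      show "(\<integral>\<^sup>+a. ennreal (q * indicator {..<h} (dist x a)) * ennreal (\<bar>v a - v x\<bar> powr p))
        = (\<integral>\<^sup>+z. ennreal (q * indicator {..<h} (norm z)) * ennreal (\<bar>v (x + z) - v x\<bar> powr p))"
        using nn_integral_lborel_shift[of "\<lambda>a. ennreal (q * indicator {..<h} (dist x a)) * ennreal (\<bar>v a - v x\<bar> powr p)" x]
        by (simp add: dist_norm add.commute)
    qed
    also have "\<dots> = (\<integral>\<^sup>+z. \<integral>\<^sup>+x. ennreal (q * indicator {..<h} (norm z)) * ennreal (\<bar>v (x + z) - v x\<bar> powr p))"
      by (rule lborel_pair.Fubini'[symmetric]) measurable
    also have "\<dots> \<le> (\<integral>\<^sup>+z. ennreal q * ennreal e1 * indicator (ball (0::'a) h) z)"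
    proof (rule nn_integral_mono)
      fix z :: 'a
      show "(\<integral>\<^sup>+x. ennreal (q * indicator {..<h} (norm z)) * ennreal (\<bar>v (x + z) - v x\<bar> powr p)) \<le> ennreal q * ennreal e1 * indicator (ball 0 h) z"
        using \<eta>(2)[of z] h by (auto simp: nn_integral_cmult indicator_def intro: mult_left_mono)
    qed
    also have "\<dots> = ennreal q * ennreal e1 * ennreal (Jball * h ^ DIM('a))"
      using h by (subst nn_integral_cmult_indicator) (auto simp: Jball_def emeasure_ball_le)
    also have "\<dots> = ennreal e"
      using q e1 h Jball_pos c1_pos by (simp add: ennreal_mult[symmetric]) (simp add: q_def e1_def)
    finally show "Lp_energy p U (\<lambda>x. wavg (ker h x) u - u x) \<le> ennreal e" .
  qed
qed

end

section \<open>Algebra of kernel energies\<close>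

lemma kenergy_eq_pair:
  fixes u :: "'a::euclidean_space \<Rightarrow> real"
  assumes "u \<in> borel_measurable borel" "U \<in> sets borel" "\<kappa> \<in> borel_measurable borel"
  shows "kenergy \<kappa> p U u = (\<integral>\<^sup>+w. ennreal (\<kappa> (dist (fst w) (snd w)) * \<bar>u (snd w) - u (fst w)\<bar> powr p) * indicator U (fst w) * indicator U (snd w))"
  unfolding kenergy_def using kenergy_measurable[OF assms] by (rule nn_integral_pair_lborel)

lemma kenergy_cmult:
  fixes u :: "'a::euclidean_space \<Rightarrow> real"
  assumes [measurable]: "u \<in> borel_measurable borel" "U \<in> sets borel" "\<kappa> \<in> borel_measurable borel" and A: "A \<ge> 0"
  shows "kenergy (\<lambda>r. A * \<kappa> r) p U u = ennreal A * kenergy \<kappa> p U u"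
proof -
  have m: "(\<lambda>r. A * \<kappa> r) \<in> borel_measurable borel" by measurable
  have "kenergy (\<lambda>r. A * \<kappa> r) p U u = (\<integral>\<^sup>+w. ennreal A * (ennreal (\<kappa> (dist (fst w) (snd w)) * \<bar>u (snd w) - u (fst w)\<bar> powr p) * indicator U (fst w) * indicator U (snd w)))"
    unfolding kenergy_eq_pair[OF assms(1,2) m] using A
    by (intro nn_integral_cong) (simp add: mult.assoc ennreal_mult')
  also have "\<dots> = ennreal A * kenergy \<kappa> p U u"
    unfolding kenergy_eq_pair[OF assms(1-3)]
    using kenergy_measurable[OF assms(1-3)] by (intro nn_integral_cmult) (simp add: borel_prod)
  finally show ?thesis .
qed

lemma kenergy_add_le:
  fixes u v :: "'a::euclidean_space \<Rightarrow> real"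
  assumes [measurable]: "u \<in> borel_measurable borel" "v \<in> borel_measurable borel" "U \<in> sets borel" "\<kappa> \<in> borel_measurable borel"
    and \<kappa>: "\<And>r. \<kappa> r \<ge> 0" and p: "p \<ge> 0"
  shows "kenergy \<kappa> p U (\<lambda>x. u x + v x) \<le> ennreal (2 powr p) * (kenergy \<kappa> p U u + kenergy \<kappa> p U v)"
proof -
  have m: "(\<lambda>x. u x + v x) \<in> borel_measurable borel" by measurable
  let ?F = "\<lambda>u w. ennreal (\<kappa> (dist (fst w) (snd w)) * \<bar>u (snd w) - u (fst w)\<bar> powr p) * indicator U (fst w) * indicator U (snd w)"
  have mu: "?F u \<in> borel_measurable lborel" "?F v \<in> borel_measurable lborel"
    using kenergy_measurable[OF assms(1,3,4)] kenergy_measurable[OF assms(2,3,4)] by (simp_all add: borel_prod)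
  have "kenergy \<kappa> p U (\<lambda>x. u x + v x) \<le> (\<integral>\<^sup>+w. ennreal (2 powr p) * (?F u w + ?F v w))"
    unfolding kenergy_eq_pair[OF m assms(3,4)]
  proof (rule nn_integral_mono)
    fix w :: "'a \<times> 'a"
    have "\<bar>(u (snd w) + v (snd w)) - (u (fst w) + v (fst w))\<bar> powr p \<le> 2 powr p * (\<bar>u (snd w) - u (fst w)\<bar> powr p + \<bar>v (snd w) - v (fst w)\<bar> powr p)"
      using powr_abs_add_le[OF p, of "u (snd w) - u (fst w)" "v (snd w) - v (fst w)"] by (simp add: algebra_simps)
    from mult_left_mono[OF this \<kappa>[of "dist (fst w) (snd w)"]]
    show "?F (\<lambda>x. u x + v x) w \<le> ennreal (2 powr p) * (?F u w + ?F v w)"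
      using \<kappa> by (auto simp: indicator_def ennreal_mult[symmetric] ennreal_plus[symmetric] algebra_simps simp del: ennreal_plus intro!: ennreal_leI)
  qed
  also have "\<dots> = ennreal (2 powr p) * (kenergy \<kappa> p U u + kenergy \<kappa> p U v)"
    unfolding kenergy_eq_pair[OF assms(1,3,4)] kenergy_eq_pair[OF assms(2,3,4)]
    using mu by (simp add: nn_integral_cmult nn_integral_add)
  finally show ?thesis .
qed

lemma Lp_energy_add_le:
  fixes u v :: "'a::euclidean_space \<Rightarrow> real"
  assumes [measurable]: "u \<in> borel_measurable borel" "v \<in> borel_measurable borel" "U \<in> sets borel" and p: "p \<ge> 0"
  shows "Lp_energy p U (\<lambda>x. u x + v x) \<le> ennreal (2 powr p) * (Lp_energy p U u + Lp_energy p U v)"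
proof -
  have "Lp_energy p U (\<lambda>x. u x + v x) \<le> (\<integral>\<^sup>+x. ennreal (2 powr p) * (ennreal (\<bar>u x\<bar> powr p) * indicator U x + ennreal (\<bar>v x\<bar> powr p) * indicator U x))"
    unfolding Lp_energy_def using powr_abs_add_le[OF p]
    by (intro nn_integral_mono) (auto simp: indicator_def ennreal_mult[symmetric] ennreal_plus[symmetric] simp del: ennreal_plus intro!: ennreal_leI)
  also have "\<dots> = ennreal (2 powr p) * (Lp_energy p U u + Lp_energy p U v)"
    unfolding Lp_energy_def by (simp add: nn_integral_cmult nn_integral_add)
  finally show ?thesis .
qed

lemma kenergy_bounded_kernel_le:
  fixes f :: "'a::euclidean_space \<Rightarrow> real"
  assumes [measurable]: "f \<in> borel_measurable borel" "U \<in> sets borel"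
    and \<kappa>: "\<And>r. r > 0 \<Longrightarrow> \<kappa> r \<le> A" and A: "A \<ge> 0" and p: "p \<ge> 0"
  shows "kenergy \<kappa> p U f \<le> ennreal (2 powr p * A) * (2 * emeasure lborel U * Lp_energy p U f)"
proof -
  let ?c = "2 powr p * A"
  have "kenergy \<kappa> p U f \<le> (\<integral>\<^sup>+x. \<integral>\<^sup>+y. ennreal ?c * (ennreal (\<bar>f x\<bar> powr p) * indicator U x * indicator U y + ennreal (\<bar>f y\<bar> powr p) * indicator U x * indicator U y))"
    unfolding kenergy_def
  proof (intro nn_integral_mono)
    fix x y
    have "\<kappa> (dist x y) * \<bar>f y - f x\<bar> powr p \<le> A * (2 powr p * (\<bar>f x\<bar> powr p + \<bar>f y\<bar> powr p))"
    proof (cases "x = y")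
      case False
      have "\<bar>f y - f x\<bar> powr p \<le> 2 powr p * (\<bar>f x\<bar> powr p + \<bar>f y\<bar> powr p)"
        using powr_abs_add_le[OF p, of "f y" "- f x"] by (simp add: add.commute)
      with False A show ?thesis by (intro mult_mono \<kappa>) auto
    qed (use A in auto)
    then show "ennreal (\<kappa> (dist x y) * \<bar>f y - f x\<bar> powr p) * indicator U x * indicator U y \<le>
      ennreal ?c * (ennreal (\<bar>f x\<bar> powr p) * indicator U x * indicator U y + ennreal (\<bar>f y\<bar> powr p) * indicator U x * indicator U y)"
      using A by (cases "x \<in> U"; cases "y \<in> U")
        (simp_all add: ennreal_mult[symmetric] ennreal_plus[symmetric] ennreal_leI mult_ac del: ennreal_plus)
  qed
  also have "\<dots> = (\<integral>\<^sup>+x. ennreal ?c * (ennreal (\<bar>f x\<bar> powr p) * indicator U x * emeasure lborel U + indicator U x * Lp_energy p U f))"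
  proof (rule nn_integral_cong)
    fix x
    have 1: "(\<integral>\<^sup>+y. ennreal (\<bar>f x\<bar> powr p) * indicator U x * indicator U y) = ennreal (\<bar>f x\<bar> powr p) * indicator U x * emeasure lborel U"
      by (rule nn_integral_cmult_indicator) simp
    have 2: "(\<integral>\<^sup>+y. ennreal (\<bar>f y\<bar> powr p) * indicator U x * indicator U y) = indicator U x * Lp_energy p U f"
      unfolding Lp_energy_def by (subst nn_integral_cmult[symmetric]) (auto intro!: nn_integral_cong simp: mult_ac)
    show "(\<integral>\<^sup>+y. ennreal ?c * (ennreal (\<bar>f x\<bar> powr p) * indicator U x * indicator U y + ennreal (\<bar>f y\<bar> powr p) * indicator U x * indicator U y))
      = ennreal ?c * (ennreal (\<bar>f x\<bar> powr p) * indicator U x * emeasure lborel U + indicator U x * Lp_energy p U f)"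
      by (subst nn_integral_cmult, measurable, subst nn_integral_add, measurable) (simp only: 1 2)
  qed
  also have "\<dots> = ennreal ?c * (Lp_energy p U f * emeasure lborel U + emeasure lborel U * Lp_energy p U f)"
    by (subst nn_integral_cmult, measurable, subst nn_integral_add, measurable)
      (simp add: Lp_energy_def nn_integral_multc)
  also have "Lp_energy p U f * emeasure lborel U + emeasure lborel U * Lp_energy p U f = 2 * emeasure lborel U * Lp_energy p U f"
    by (simp add: mult_2 distrib_right distrib_left mult.commute)
  finally show ?thesis .
qed

lemma kenergy_kernel_add_le:
  fixes f :: "'a::euclidean_space \<Rightarrow> real"
  assumes m: "f \<in> borel_measurable borel" "U \<in> sets borel" "\<kappa>1 \<in> borel_measurable borel" "\<kappa>2 \<in> borel_measurable borel"
    and \<kappa>: "\<And>r. r > 0 \<Longrightarrow> \<kappa> r \<le> \<kappa>1 r + \<kappa>2 r" and nn: "\<And>r. 0 \<le> \<kappa>1 r" "\<And>r. 0 \<le> \<kappa>2 r"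
  shows "kenergy \<kappa> p U f \<le> kenergy \<kappa>1 p U f + kenergy \<kappa>2 p U f"
proof -
  let ?F = "\<lambda>\<kappa> w. ennreal (\<kappa> (dist (fst w) (snd w)) * \<bar>f (snd w) - f (fst w)\<bar> powr p) * indicator U (fst w) * indicator U (snd w)"
  have mm: "?F \<kappa>1 \<in> borel_measurable lborel" "?F \<kappa>2 \<in> borel_measurable lborel"
    using kenergy_measurable[OF m(1,2,3)] kenergy_measurable[OF m(1,2,4)] by (simp_all add: borel_prod)
  have "kenergy \<kappa> p U f \<le> kenergy (\<lambda>r. \<kappa>1 r + \<kappa>2 r) p U f"
    by (intro kenergy_mono \<kappa>)
  also have "\<dots> = (\<integral>\<^sup>+w. ?F \<kappa>1 w + ?F \<kappa>2 w)"
    using m(3,4) nn by (subst kenergy_eq_pair[OF m(1,2)]) (auto intro!: nn_integral_cong simp: distrib_right)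
  also have "\<dots> = kenergy \<kappa>1 p U f + kenergy \<kappa>2 p U f"
    unfolding kenergy_eq_pair[OF m(1,2,3)] kenergy_eq_pair[OF m(1,2,4)] by (rule nn_integral_add[OF mm])
  finally show ?thesis .
qed

text \<open>The singularity is confined to distances below \<tau>; beyond \<tau> the kernel is
  bounded, and on a set of finite measure the energy is then controlled by the L^p norm.\<close>

lemma kenergy_le_small_scale_plus_Lp:
  fixes f :: "'a::euclidean_space \<Rightarrow> real"
  assumes [measurable]: "f \<in> borel_measurable borel" "U \<in> sets borel" and \<beta>: "\<beta> \<ge> 0" and \<tau>: "\<tau> > 0" and p: "p \<ge> 0"
  shows "kenergy (\<lambda>r. r powr (- \<beta>) * indicator {..<\<delta>} r) p U f \<le>
    kenergy (\<lambda>r. r powr (- \<beta>) * indicator {..<\<tau>} r) p U f +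
    ennreal (2 powr p * \<tau> powr (- \<beta>)) * (2 * emeasure lborel U * Lp_energy p U f)"
proof -
  have "kenergy (\<lambda>r. r powr (- \<beta>) * indicator {..<\<delta>} r) p U f \<le>
    kenergy (\<lambda>r. r powr (- \<beta>) * indicator {..<\<tau>} r) p U f + kenergy (\<lambda>r. r powr (- \<beta>) * indicator {\<tau>..} r) p U f"
    by (intro kenergy_kernel_add_le) (auto simp: indicator_def)
  also have "kenergy (\<lambda>r. r powr (- \<beta>) * indicator {\<tau>..} r) p U f \<le> ennreal (2 powr p * \<tau> powr (- \<beta>)) * (2 * emeasure lborel U * Lp_energy p U f)"
    using \<beta> \<tau> p by (intro kenergy_bounded_kernel_le) (auto simp: indicator_def intro!: powr_mono2')
  finally show ?thesis by (simp add: add_left_mono)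
qed

lemma nl_kernel_eq:
  "nl_kernel d p \<beta> \<delta> = (\<lambda>r. ((real d + p - \<beta>) / sphere_area d / \<delta> powr (real d + p - \<beta>)) * (r powr (- \<beta>) * indicator {..<\<delta>} r))"
  by (simp add: nl_kernel_def fun_eq_iff)

lemma sphere_area_pos: "d > 0 \<Longrightarrow> 0 < sphere_area d"
  by (simp add: sphere_area_def)

lemma nl_kernel_measurable[measurable]: "nl_kernel d p \<beta> \<delta> \<in> borel_measurable borel"
  unfolding nl_kernel_def[abs_def] by measurable

lemma nl_kernel_nonneg: "\<beta> \<le> real d + p \<Longrightarrow> 0 \<le> nl_kernel d p \<beta> \<delta> r"
  by (cases "d = 0") (auto simp: nl_kernel_def sphere_area_def intro!: mult_nonneg_nonneg divide_nonneg_nonneg)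

text \<open>Translations are continuous in L^p, but nothing comparable is shown for the singular
  energy. Instead \<tau> is fixed first, so small that \<open>u\<close> and all its averages have
  little energy below \<tau>; then \<open>h\<close> is chosen, and above \<tau> convergence in L^p
  suffices.\<close>

lemma (in fat_set) C1_approximation:
  fixes p \<beta> :: real
  assumes u[measurable]: "u \<in> borel_measurable borel" and p: "p > 1" and \<beta>: "0 \<le> \<beta>" "\<beta> < DIM('a) + p" and \<delta>: "\<delta> > 0"
    and Lfin: "Lp_energy p U u < \<infinity>" and Kfin: "kenergy (\<lambda>r. r powr (- \<beta>) * indicator {..<\<delta>} r) p U u < \<infinity>" and e: "(e::real) > 0"
  shows "\<exists>\<phi>\<in>C1_closure U. \<phi> \<in> borel_measurable borel \<and> Lp_energy p U (\<lambda>x. \<phi> x - u x) \<le> ennreal e \<and>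
    kenergy (\<lambda>r. r powr (- \<beta>) * indicator {..<\<delta>} r) p U (\<lambda>x. \<phi> x - u x) \<le> ennreal e"
proof -
  let ?k = "\<lambda>\<tau> r. r powr (- \<beta>) * indicator {..<\<tau>} r"
  have iu: "integrable lborel (\<lambda>a. u a * indicator U a)"
    by (rule integrable_of_Lp[OF u U_borel U_bounded p Lfin])
  obtain C where C: "C \<ge> 0" and CE: "\<And>h \<tau>. 0 < h \<Longrightarrow> h < h0 \<Longrightarrow> h \<le> \<tau> \<Longrightarrow>
    kenergy (?k \<tau>) p U (\<lambda>x. wavg (ker h x) u) \<le> ennreal C * kenergy (?k (5 * \<tau>)) p U u"
    using kenergy_wavg_ker_le[OF u iu p \<beta>] by blast
  define e1 where "e1 = e / (2 * 2 powr p * (C + 1))"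
  have e1: "e1 > 0" using e C by (simp add: e1_def)
  obtain \<tau>0 where \<tau>0: "\<tau>0 > 0" "kenergy (\<lambda>r. ?k \<delta> r * indicator {..<\<tau>0} r) p U u \<le> ennreal e1"
    using kenergy_small_scale[OF u U_borel _ Kfin e1] by auto
  \<comment> \<open>The division by 5 compensates the loss of scale in
    \<open>kenergy_wavg_ker_le\<close>.\<close>
  define \<tau> where "\<tau> = min \<tau>0 \<delta> / 5"
  have \<tau>: "\<tau> > 0" using \<tau>0 \<delta> by (simp add: \<tau>_def)
  have Eu5: "kenergy (?k (5 * \<tau>)) p U u \<le> ennreal e1"
    by (rule order_trans[OF kenergy_mono \<tau>0(2)]) (auto simp: \<tau>_def indicator_def)
  have Eu: "kenergy (?k \<tau>) p U u \<le> ennreal e1"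
    by (rule order_trans[OF kenergy_mono Eu5]) (use \<tau> in \<open>auto simp: indicator_def\<close>)
  obtain m where m: "emeasure lborel U = ennreal m" "m \<ge> 0"
    using emeasure_bounded_finite[OF U_bounded] by (cases "emeasure lborel U") auto
  \<comment> \<open>The second bound makes the contribution of distances above \<tau> at most e / 2;
    \<open>m + 1\<close> avoids division by 0.\<close>
  define e2 where "e2 = min e (e / 2 / (2 powr p * \<tau> powr (- \<beta>) * (2 * (m + 1))))"
  have e2: "e2 > 0" using e \<tau> m by (simp add: e2_def)
  obtain \<eta> where \<eta>: "\<eta> > 0" "\<And>h. 0 < h \<Longrightarrow> h < \<eta> \<Longrightarrow> Lp_energy p U (\<lambda>x. wavg (ker h x) u - u x) \<le> ennreal e2"
    using Lp_wavg_ker_small[OF u p Lfin e2] by blast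
  define h where "h = Min {\<eta>, h0, \<tau>} / 2"
  have h: "0 < h" "h < h0" "h \<le> \<tau>" "h < \<eta>" using \<eta> h0 \<tau> by (auto simp: h_def)
  define \<phi> where "\<phi> x = wavg (ker h x) u" for x
  have [measurable]: "\<phi> \<in> borel_measurable borel"
    unfolding \<phi>_def by (rule wavg_ker_measurable[OF u])
  have L: "Lp_energy p U (\<lambda>x. \<phi> x - u x) \<le> ennreal e2"
    unfolding \<phi>_def using \<eta>(2) h by auto
  have E\<phi>: "kenergy (?k \<tau>) p U \<phi> \<le> ennreal C * ennreal e1"
    unfolding \<phi>_def by (rule order_trans[OF CE[OF h(1-3)] mult_left_mono[OF Eu5]]) auto
  have "kenergy (?k \<tau>) p U (\<lambda>x. - u x) = kenergy (?k \<tau>) p U u"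
    by (simp add: kenergy_def abs_minus_commute)
  then have near: "kenergy (?k \<tau>) p U (\<lambda>x. \<phi> x - u x) \<le> ennreal (2 powr p) * (ennreal C * ennreal e1 + ennreal e1)"
    using kenergy_add_le[of \<phi> "\<lambda>x. - u x" U "?k \<tau>" p] E\<phi> Eu p
    by (auto elim!: order_trans intro!: mult_left_mono add_mono)
  have "kenergy (?k \<delta>) p U (\<lambda>x. \<phi> x - u x) \<le> kenergy (?k \<tau>) p U (\<lambda>x. \<phi> x - u x) +
    ennreal (2 powr p * \<tau> powr (- \<beta>)) * (2 * emeasure lborel U * Lp_energy p U (\<lambda>x. \<phi> x - u x))"
    using \<beta> \<tau> p by (intro kenergy_le_small_scale_plus_Lp) auto
  also have "\<dots> \<le> ennreal (2 powr p) * (ennreal C * ennreal e1 + ennreal e1) + ennreal (2 powr p * \<tau> powr (- \<beta>)) * (2 * ennreal m * ennreal e2)"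
    unfolding m by (intro add_mono near mult_left_mono L) auto
  also have "\<dots> = ennreal (2 powr p * (C * e1 + e1) + 2 powr p * \<tau> powr (- \<beta>) * (2 * m * e2))"
    using C e1 m e2 by (simp add: ennreal_mult ennreal_numeral[symmetric] del: ennreal_numeral)
  also have "\<dots> \<le> ennreal e"
  proof (rule ennreal_leI)
    have "2 powr p * (C * e1 + e1) = (2 powr p * (C + 1)) * e1" by (simp add: algebra_simps)
    also have "\<dots> = e / 2"
    proof -
      define X where "X = 2 powr p * (C + 1)"
      have "X \<noteq> 0" using C by (simp add: X_def)
      then have "X * (e / (2 * X)) = e / 2" by simp
      then show ?thesis by (simp only: e1_def X_def mult.assoc)
    qed
    finally have 1: "2 powr p * (C * e1 + e1) = e / 2" .
    have "2 powr p * \<tau> powr (- \<beta>) * (2 * m * e2) \<le> 2 powr p * \<tau> powr (- \<beta>) * (2 * (m + 1) * e2)"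
      using e2 m by (intro mult_left_mono mult_right_mono) auto
    also have "\<dots> = (2 powr p * \<tau> powr (- \<beta>) * (2 * (m + 1))) * e2" by (simp add: mult_ac)
    also have "\<dots> \<le> (2 powr p * \<tau> powr (- \<beta>) * (2 * (m + 1))) * (e / 2 / (2 powr p * \<tau> powr (- \<beta>) * (2 * (m + 1))))"
      using m by (intro mult_left_mono) (auto simp: e2_def)
    also have "\<dots> = e / 2"
    proof -
      define X where "X = 2 powr p * \<tau> powr (- \<beta>) * (2 * (m + 1))"
      have "X \<noteq> 0" using m \<tau> by (simp add: X_def)
      then have "X * (e / 2 / X) = e / 2" by simp
      then show ?thesis by (simp only: X_def)
    qed
    finally show "2 powr p * (C * e1 + e1) + 2 powr p * \<tau> powr (- \<beta>) * (2 * m * e2) \<le> e"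
      using 1 by simp
  qed
  finally have K: "kenergy (?k \<delta>) p U (\<lambda>x. \<phi> x - u x) \<le> ennreal e" .
  have "\<phi> \<in> C1_closure U"
    unfolding \<phi>_def using wavg_ker_C1[OF u iu h(1,2)] .
  moreover have "Lp_energy p U (\<lambda>x. \<phi> x - u x) \<le> ennreal e"
    using L by (rule order_trans) (auto simp: e2_def intro: ennreal_leI)
  ultimately show ?thesis
    using K by (intro bexI[of _ \<phi>]) auto
qed

section \<open>The norms of the theorem as kernel energies\<close>

lemma Lp_pow_eq:
  fixes U :: "'a::euclidean_space set"
  assumes "U \<in> sets borel"
  shows "Lp_pow p U u = Lp_energy p U u"
  unfolding Lp_pow_def Lp_energy_def using assms by (simp add: nn_integral_lebesgue_on)

lemma nn_integral_lebesgue_on_pair: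
  fixes f :: "'a::euclidean_space \<Rightarrow> 'a \<Rightarrow> ennreal"
  assumes "U \<in> sets borel"
  shows "(\<integral>\<^sup>+x. \<integral>\<^sup>+y. f x y \<partial>lebesgue_on U \<partial>lebesgue_on U) = (\<integral>\<^sup>+x. \<integral>\<^sup>+y. f x y * indicator U x * indicator U y)"
  using assms by (simp add: nn_integral_lebesgue_on) (auto intro!: nn_integral_cong simp: indicator_def)

lemma S_semi_pow_eq:
  fixes U :: "'a::euclidean_space set"
  assumes "U \<in> sets borel"
  shows "S_semi_pow p \<beta> \<delta> U u = kenergy (nl_kernel DIM('a) p \<beta> \<delta>) p U u"
  unfolding S_semi_pow_def kenergy_def nn_integral_lebesgue_on_pair[OF assms]
  by (simp add: dist_norm norm_minus_commute)

definition T_kernel :: "nat \<Rightarrow> real \<Rightarrow> real \<Rightarrow> real \<Rightarrow> real \<Rightarrow> real" where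
  "T_kernel d p \<beta> \<delta> r = \<delta> powr (\<beta> - 2) / (max r \<delta> powr (real d + p - 2) * min r \<delta> powr \<beta>)"

lemma T_kernel_measurable[measurable]: "T_kernel d p \<beta> \<delta> \<in> borel_measurable borel"
  unfolding T_kernel_def[abs_def] by measurable

lemma T_kernel_nonneg: "0 \<le> T_kernel d p \<beta> \<delta> r"
  by (simp add: T_kernel_def)

lemma kenergy_cong_AE:
  assumes "AE x in lborel. x \<in> U \<longrightarrow> u x = v x"
  shows "kenergy \<kappa> p U u = kenergy \<kappa> p U v"
  unfolding kenergy_def
proof (rule nn_integral_cong_AE, use assms in eventually_elim)
  fix x assume x: "x \<in> U \<longrightarrow> u x = v x"
  show "(\<integral>\<^sup>+y. ennreal (\<kappa> (dist x y) * \<bar>u y - u x\<bar> powr p) * indicator U x * indicator U y) =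
    (\<integral>\<^sup>+y. ennreal (\<kappa> (dist x y) * \<bar>v y - v x\<bar> powr p) * indicator U x * indicator U y)"
    by (rule nn_integral_cong_AE, use assms in eventually_elim) (use x in \<open>auto simp: indicator_def\<close>)
qed

lemma Lp_energy_cong_AE:
  assumes "AE x in lborel. x \<in> U \<longrightarrow> u x = v x"
  shows "Lp_energy p U u = Lp_energy p U v"
  unfolding Lp_energy_def
  by (rule nn_integral_cong_AE, use assms in eventually_elim) (auto simp: indicator_def)

lemma T_semi_pow_eq:
  fixes U :: "'a::euclidean_space set"
  assumes [measurable]: "U \<in> sets borel" "u \<in> borel_measurable borel"
  shows "T_semi_pow p \<beta> \<delta> U u = kenergy (T_kernel DIM('a) p \<beta> \<delta>) p U u"
proof -
  define \<kappa> where "\<kappa> r = 1 / (max r \<delta> powr (real DIM('a) + p - 2) * min r \<delta> powr \<beta>)" for r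
  have [measurable]: "\<kappa> \<in> borel_measurable borel" unfolding \<kappa>_def[abs_def] by measurable
  have "T_semi_pow p \<beta> \<delta> U u = ennreal (\<delta> powr (\<beta> - 2)) * kenergy \<kappa> p U u"
    unfolding T_semi_pow_def kenergy_def nn_integral_lebesgue_on_pair[OF assms(1)]
    by (simp add: dist_norm norm_minus_commute \<kappa>_def)
  also have "\<dots> = kenergy (\<lambda>r. \<delta> powr (\<beta> - 2) * \<kappa> r) p U u"
    by (rule kenergy_cmult[symmetric]) auto
  also have "(\<lambda>r. \<delta> powr (\<beta> - 2) * \<kappa> r) = T_kernel DIM('a) p \<beta> \<delta>"
    by (simp add: T_kernel_def \<kappa>_def fun_eq_iff)
  finally show ?thesis .
qed

lemma T_semi_pow_cong_AE:
  assumes "U \<in> sets borel" "AE x in lborel. x \<in> U \<longrightarrow> u x = v x"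
  shows "T_semi_pow p \<beta> \<delta> U u = T_semi_pow p \<beta> \<delta> U v"
proof -
  have "(\<integral>\<^sup>+x. \<integral>\<^sup>+y. ennreal (\<bar>u y - u x\<bar> powr p / (max (norm (y - x)) \<delta> powr (real DIM('a) + p - 2) * min (norm (y - x)) \<delta> powr \<beta>)) * indicator U x * indicator U y)
    = (\<integral>\<^sup>+x. \<integral>\<^sup>+y. ennreal (\<bar>v y - v x\<bar> powr p / (max (norm (y - x)) \<delta> powr (real DIM('a) + p - 2) * min (norm (y - x)) \<delta> powr \<beta>)) * indicator U x * indicator U y)"
  proof (rule nn_integral_cong_AE, use assms(2) in eventually_elim)
    fix x assume x: "x \<in> U \<longrightarrow> u x = v x"
    show "(\<integral>\<^sup>+y. ennreal (\<bar>u y - u x\<bar> powr p / (max (norm (y - x)) \<delta> powr (real DIM('a) + p - 2) * min (norm (y - x)) \<delta> powr \<beta>)) * indicator U x * indicator U y)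
    = (\<integral>\<^sup>+y. ennreal (\<bar>v y - v x\<bar> powr p / (max (norm (y - x)) \<delta> powr (real DIM('a) + p - 2) * min (norm (y - x)) \<delta> powr \<beta>)) * indicator U x * indicator U y)"
      by (rule nn_integral_cong_AE, use assms(2) in eventually_elim) (use x in \<open>auto simp: indicator_def\<close>)
  qed
  then show ?thesis
    unfolding T_semi_pow_def nn_integral_lebesgue_on_pair[OF assms(1)] by simp
qed

text \<open>Elements of the spaces are only Lebesgue measurable on \<open>U\<close>. A Borel
  representative makes Fubini available on \<open>lborel\<close>, and equality almost everywhere on
  \<open>U\<close> preserves all norms.\<close>

lemma borel_version:
  fixes u :: "'a::euclidean_space \<Rightarrow> real"
  assumes "u \<in> borel_measurable (lebesgue_on U)" "U \<in> sets borel"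
  obtains v where "v \<in> borel_measurable borel" "AE x in lborel. x \<in> U \<longrightarrow> u x = v x"
proof -
  have "(\<lambda>x. indicator U x *\<^sub>R u x) \<in> borel_measurable lebesgue"
    using assms by (subst borel_measurable_restrict_space_iff[symmetric]) auto
  from completion_ex_borel_measurable_real[OF this[unfolded real_scaleR_def]]
  obtain v where "v \<in> borel_measurable lborel" "AE x in lborel. indicator U x * u x = v x"
    by auto
  then show thesis
    by (intro that[of v]) (auto elim!: eventually_mono simp: indicator_def split: if_splits)
qed

lemma AE_lebesgue_on_iff:
  fixes U :: "'a::euclidean_space set"
  assumes "U \<in> sets borel"
  shows "(AE x in lebesgue_on U. P x) \<longleftrightarrow> (AE x in lborel. x \<in> U \<longrightarrow> P x)"
  using assms by (subst AE_restrict_space_iff) (auto simp: AE_completion_iff)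

lemma borel_imp_lebesgue_on:
  assumes "v \<in> borel_measurable borel"
  shows "v \<in> borel_measurable (lebesgue_on U)"
  using measurable_completion[of v lborel borel] assms by (intro measurable_restrict_space1) auto

text \<open>On a set with the density condition a finite norm already implies membership in the
  completion. For the extension operator this leaves only a norm estimate to prove.\<close>

lemma (in fat_set) S_space_memI:
  fixes p \<beta> :: real
  assumes u: "u \<in> borel_measurable (lebesgue_on U)" and p: "p > 1" and \<beta>: "0 \<le> \<beta>" "\<beta> < DIM('a) + p"
    and \<delta>: "\<delta> > 0" and fin: "S_pow p \<beta> \<delta> U u < \<infinity>"
  shows "u \<in> S_space p \<beta> \<delta> U"
proof -
  obtain v where v[measurable]: "v \<in> borel_measurable borel" and uv: "AE x in lborel. x \<in> U \<longrightarrow> u x = v x"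
    using borel_version[OF u U_borel] by blast
  define A where "A = (real DIM('a) + p - \<beta>) / sphere_area DIM('a) / \<delta> powr (real DIM('a) + p - \<beta>)"
  have A: "A > 0"
    using \<beta> \<delta> sphere_area_pos[of "DIM('a)"] by (simp add: A_def)
  let ?k = "\<lambda>r. r powr (- \<beta>) * indicator {..<\<delta>} r"
  have S_eq: "S_pow p \<beta> \<delta> U f = Lp_energy p U f + ennreal A * kenergy ?k p U f" if [measurable]: "f \<in> borel_measurable borel" for f
    unfolding S_pow_def Lp_pow_eq[OF U_borel] S_semi_pow_eq[OF U_borel] nl_kernel_eq A_def[symmetric]
    using A by (subst kenergy_cmult) auto
  have cong: "S_pow p \<beta> \<delta> U f = S_pow p \<beta> \<delta> U g" if "AE x in lborel. x \<in> U \<longrightarrow> f x = g x" for f g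
    unfolding S_pow_def Lp_pow_eq[OF U_borel] S_semi_pow_eq[OF U_borel]
    using Lp_energy_cong_AE[OF that] kenergy_cong_AE[OF that] by simp
  have vfin: "Lp_energy p U v + ennreal A * kenergy ?k p U v < \<infinity>"
    using fin cong[OF uv] S_eq[OF v] by simp
  then have Lv: "Lp_energy p U v < \<infinity>" and Kv: "kenergy ?k p U v < \<infinity>"
    using A by (auto simp: ennreal_mult_less_top)
  have "\<forall>n. \<exists>\<phi>. \<phi> \<in> C1_closure U \<and> \<phi> \<in> borel_measurable borel \<and> Lp_energy p U (\<lambda>x. \<phi> x - v x) \<le> ennreal (1 / real (Suc n)) \<and>
    kenergy ?k p U (\<lambda>x. \<phi> x - v x) \<le> ennreal (1 / real (Suc n))"
    using C1_approximation[OF v p \<beta> \<delta> Lv Kv] by (simp add: Bex_def)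
  from choice[OF this] obtain \<phi> where \<phi>: "\<And>n. \<phi> n \<in> C1_closure U" and \<phi>m[measurable]: "\<And>n. \<phi> n \<in> borel_measurable borel"
    and L: "\<And>n. Lp_energy p U (\<lambda>x. \<phi> n x - v x) \<le> ennreal (1 / real (Suc n))"
    and K: "\<And>n. kenergy ?k p U (\<lambda>x. \<phi> n x - v x) \<le> ennreal (1 / real (Suc n))"
    by blast
  have fin\<phi>: "S_pow p \<beta> \<delta> U (\<phi> n) < \<infinity>" for n
  proof -
    have "Lp_energy p U (\<lambda>x. (\<phi> n x - v x) + v x) \<le> ennreal (2 powr p) * (Lp_energy p U (\<lambda>x. \<phi> n x - v x) + Lp_energy p U v)"
      using p by (intro Lp_energy_add_le) auto
    also have "\<dots> < \<infinity>" using le_less_trans[OF L[of n]] Lv by (simp add: ennreal_mult_less_top)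
    finally have 1: "Lp_energy p U (\<phi> n) < \<infinity>" by simp
    have "kenergy ?k p U (\<lambda>x. (\<phi> n x - v x) + v x) \<le> ennreal (2 powr p) * (kenergy ?k p U (\<lambda>x. \<phi> n x - v x) + kenergy ?k p U v)"
      using p by (intro kenergy_add_le) auto
    also have "\<dots> < \<infinity>" using le_less_trans[OF K[of n]] Kv by (simp add: ennreal_mult_less_top)
    finally have 2: "kenergy ?k p U (\<phi> n) < \<infinity>" by simp
    show ?thesis using 1 2 by (simp add: S_eq ennreal_mult_less_top)
  qed
  have le: "S_pow p \<beta> \<delta> U (\<lambda>x. \<phi> n x - u x) \<le> ennreal ((1 + A) * (1 / real (Suc n)))" for n
  proof -
    have "S_pow p \<beta> \<delta> U (\<lambda>x. \<phi> n x - u x) = S_pow p \<beta> \<delta> U (\<lambda>x. \<phi> n x - v x)"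
      by (rule cong) (use uv in \<open>auto elim: eventually_mono\<close>)
    also have "\<dots> \<le> ennreal (1 / real (Suc n)) + ennreal A * ennreal (1 / real (Suc n))"
      by (subst S_eq, measurable) (intro add_mono mult_left_mono L K, auto)
    also have "\<dots> = ennreal ((1 + A) * (1 / real (Suc n)))"
      using A by (simp add: ennreal_mult[symmetric] ennreal_plus[symmetric] distrib_right add_divide_distrib del: ennreal_plus)
    finally show ?thesis .
  qed
  have "(\<lambda>n. (1 + A) * (1 / real (Suc n))) \<longlonglongrightarrow> (1 + A) * 0"
    using LIMSEQ_inverse_real_of_nat by (intro tendsto_mult tendsto_const) (simp add: inverse_eq_divide)
  then have lim0: "(\<lambda>n. ennreal ((1 + A) * (1 / real (Suc n)))) \<longlonglongrightarrow> 0"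
    using tendsto_ennrealI by force
  have lim: "(\<lambda>n. S_pow p \<beta> \<delta> U (\<lambda>x. \<phi> n x - u x)) \<longlonglongrightarrow> 0"
    by (rule tendsto_sandwich[OF _ _ tendsto_const lim0]) (use le in auto)
  show ?thesis
    unfolding S_space_def using u fin \<phi> fin\<phi> lim by blast
qed

section \<open>Cone condition at the boundary\<close>

text \<open>One direction \<open>e\<close> serves all points of \<Omega> near \<open>z\<close>, so
  chains starting at different points can run almost parallel into \<Omega>.\<close>

definition cone_at :: "'a::euclidean_space set \<Rightarrow> real \<Rightarrow> real \<Rightarrow> 'a \<Rightarrow> 'a \<Rightarrow> bool" where
  "cone_at \<Omega> r \<eta> z e \<longleftrightarrow> norm e = 1 \<and> (\<forall>x\<in>\<Omega> \<inter> ball z r. \<forall>v\<in>ball e \<eta>. \<forall>s. 0 \<le> s \<and> s \<le> r \<longrightarrow> x + s *\<^sub>R v \<in> \<Omega>)"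

text \<open>Moving by s along v = e + w raises the height over the hyperplane by at least
  \<open>s * (1 - norm w)\<close>, while the graph rises by at most \<open>L * s * norm w\<close>.
  The point stays above the graph as long as \<open>(L + 1) * norm w \<le> 1\<close>, which dictates
  \<open>\<eta>\<close>.\<close>

lemma cone_at_frontier:
  fixes \<Omega> :: "'a::euclidean_space set"
  assumes "lipschitz_domain \<Omega>" "z \<in> frontier \<Omega>"
  shows "\<exists>r>0. \<exists>\<eta>>0. \<eta> \<le> 1 \<and> (\<exists>e. cone_at \<Omega> r \<eta> z e)"
proof -
  obtain \<rho> e L and g :: "'a \<Rightarrow> real" where \<rho>: "\<rho> > 0" and e: "norm e = 1" and L: "L-lipschitz_on {y. e \<bullet> y = 0} g"
    and eq: "\<Omega> \<inter> ball z \<rho> = {x \<in> ball z \<rho>. e \<bullet> x > g (x - (e \<bullet> x) *\<^sub>R e)}"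
    using assms unfolding lipschitz_domain_def by blast
  have L0: "L \<ge> 0" using L by (rule lipschitz_on_nonneg)
  define \<eta> where "\<eta> = 1 / (L + 1)"
  have \<eta>: "0 < \<eta>" "\<eta> \<le> 1" "(L + 1) * \<eta> = 1" using L0 by (auto simp: \<eta>_def field_simps)
  have ee: "e \<bullet> e = 1" using e by (simp add: dot_square_norm)
  show ?thesis
  proof (intro exI conjI)
    \<comment> \<open>A third of the chart radius: the starting point uses one third, and
      \<open>s *\<^sub>R v\<close>, where \<open>v\<close> has norm at most 2, uses the other
      two.\<close>
    show "\<rho> / 3 > 0" "\<eta> > 0" "\<eta> \<le> 1" using \<rho> \<eta> by auto
    show "cone_at \<Omega> (\<rho> / 3) \<eta> z e"
      unfolding cone_at_def
    proof (intro conjI ballI allI impI e)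
      fix x v s assume x: "x \<in> \<Omega> \<inter> ball z (\<rho> / 3)" and v: "v \<in> ball e \<eta>" and s: "0 \<le> s \<and> s \<le> \<rho> / 3"
      define P where "P y = y - (e \<bullet> y) *\<^sub>R e" for y
      have P0: "e \<bullet> P y = 0" for y by (simp add: P_def inner_diff_right ee)
      define w where "w = v - e"
      have w: "norm w < \<eta>" using v by (simp add: w_def dist_norm norm_minus_commute)
      have vw: "v = e + w" by (simp add: w_def)
      have "norm v \<le> 2" using w \<eta> e norm_triangle_ineq[of e w] by (simp add: vw)
      have "dist z (x + s *\<^sub>R v) \<le> dist z x + norm (s *\<^sub>R v)"
        by (metis dist_norm dist_triangle add_diff_cancel_left' norm_minus_commute)
      also have "norm (s *\<^sub>R v) \<le> (\<rho> / 3) * 2"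
        unfolding norm_scaleR using s \<open>norm v \<le> 2\<close> by (intro mult_mono) auto
      finally have inb: "x + s *\<^sub>R v \<in> ball z \<rho>" using x by simp
      have xin: "x \<in> \<Omega> \<inter> ball z \<rho>" using x \<rho> by auto
      then have gx: "g (P x) < e \<bullet> x" unfolding eq by (simp add: P_def)
      have ew: "e \<bullet> w \<ge> - norm w"
        using Cauchy_Schwarz_ineq2[of e w] e by (simp add: abs_le_iff)
      have nP: "norm (P w) \<le> norm w"
      proof -
        have "(norm (P w))\<^sup>2 = (norm w)\<^sup>2 - (e \<bullet> w)\<^sup>2"
          unfolding power2_norm_eq_inner by (simp add: P_def inner_diff_left inner_diff_right ee inner_commute power2_eq_square)
        then have "(norm (P w))\<^sup>2 \<le> (norm w)\<^sup>2" by simp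
        then show ?thesis by (simp add: power2_le_iff_abs_le)
      qed
      have "P (x + s *\<^sub>R v) - P x = s *\<^sub>R P w"
        by (simp add: P_def vw inner_add_right ee algebra_simps)
      then have "\<bar>g (P (x + s *\<^sub>R v)) - g (P x)\<bar> \<le> L * (s * norm (P w))"
        using lipschitz_onD[OF L, of "P (x + s *\<^sub>R v)" "P x"] P0 s by (simp add: dist_norm)
      also have "\<dots> \<le> L * (s * norm w)"
        using L0 s nP by (intro mult_left_mono) auto
      finally have "g (P (x + s *\<^sub>R v)) < e \<bullet> x + L * (s * norm w)"
        using gx by linarith
      also have "\<dots> \<le> e \<bullet> x + s * (1 - norm w)"
      proof -
        have "(L + 1) * norm w \<le> 1" using mult_left_mono[of "norm w" \<eta> "L + 1"] w \<eta> L0 by simp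
        then have "s * ((L + 1) * norm w) \<le> s * 1" using s by (intro mult_left_mono) auto
        then show ?thesis by (simp add: algebra_simps)
      qed
      also have "\<dots> \<le> e \<bullet> x + s * (e \<bullet> v)"
        using ew s by (intro add_left_mono mult_left_mono) (auto simp: vw inner_add_right ee)
      also have "\<dots> = e \<bullet> (x + s *\<^sub>R v)" by (simp add: inner_add_right)
      finally have "x + s *\<^sub>R v \<in> {x \<in> ball z \<rho>. e \<bullet> x > g (x - (e \<bullet> x) *\<^sub>R e)}"
        using inb by (simp add: P_def)
      then show "x + s *\<^sub>R v \<in> \<Omega>" using eq by blast
    qed
  qed
qed

lemma cone_at_interior:
  fixes \<Omega> :: "'a::euclidean_space set"
  assumes "open \<Omega>" "z \<in> \<Omega>"
  shows "\<exists>r>0. \<exists>\<eta>>0. \<eta> \<le> 1 \<and> (\<exists>e. cone_at \<Omega> r \<eta> z e)"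
proof -
  obtain \<rho> where \<rho>: "\<rho> > 0" "ball z \<rho> \<subseteq> \<Omega>" using assms open_contains_ball by blast
  obtain e :: 'a where e: "norm e = 1" using vector_choose_size[of 1] by auto
  show ?thesis
  proof (intro exI conjI)
    show "\<rho> / 3 > 0" "(1::real) > 0" using \<rho> by auto
    show "cone_at \<Omega> (\<rho> / 3) 1 z e"
      unfolding cone_at_def
    proof (intro conjI ballI allI impI e)
      fix x v s assume x: "x \<in> \<Omega> \<inter> ball z (\<rho> / 3)" and v: "v \<in> ball e 1" and s: "0 \<le> s \<and> s \<le> \<rho> / 3"
      have "norm v \<le> 2" using v e norm_triangle_ineq[of e "v - e"] by (simp add: dist_norm norm_minus_commute)
      have "dist z (x + s *\<^sub>R v) \<le> dist z x + norm (s *\<^sub>R v)"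
        by (metis dist_norm dist_triangle add_diff_cancel_left' norm_minus_commute)
      also have "norm (s *\<^sub>R v) \<le> (\<rho> / 3) * 2"
        unfolding norm_scaleR using s \<open>norm v \<le> 2\<close> by (intro mult_mono) auto
      finally show "x + s *\<^sub>R v \<in> \<Omega>" using x \<rho> by auto
    qed
  qed simp
qed

lemma cone_at_mono:
  assumes "cone_at \<Omega> r \<eta> z e" "ball z' r' \<subseteq> ball z r" "r' \<le> r" "\<eta>' \<le> \<eta>"
  shows "cone_at \<Omega> r' \<eta>' z' e"
  using assms unfolding cone_at_def by (auto simp: subset_eq)

lemma uniform_cone:
  fixes \<Omega> :: "'a::euclidean_space set"
  assumes "bounded \<Omega>" "lipschitz_domain \<Omega>"
  shows "\<exists>r>0. \<exists>\<eta>>0. \<eta> \<le> 1 \<and> (\<forall>z\<in>closure \<Omega>. \<exists>e. cone_at \<Omega> r \<eta> z e)"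
proof -
  have op: "open \<Omega>" and ne: "\<Omega> \<noteq> {}" using assms by (auto simp: lipschitz_domain_def)
  have "\<exists>r>0. \<exists>\<eta>>0. \<eta> \<le> 1 \<and> (\<exists>e. cone_at \<Omega> r \<eta> z e)" if "z \<in> closure \<Omega>" for z
    using that cone_at_frontier[OF assms(2), of z] cone_at_interior[OF op, of z] op
    by (cases "z \<in> \<Omega>") (auto simp: frontier_def interior_open)
  then have "\<forall>z\<in>closure \<Omega>. \<exists>r \<eta>. r > 0 \<and> \<eta> > 0 \<and> \<eta> \<le> 1 \<and> (\<exists>e. cone_at \<Omega> r \<eta> z e)" by blast
  then obtain r \<eta> where r\<eta>: "\<And>z. z \<in> closure \<Omega> \<Longrightarrow> r z > 0 \<and> \<eta> z > 0 \<and> \<eta> z \<le> 1 \<and> (\<exists>e. cone_at \<Omega> (r z) (\<eta> z) z e)"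
    by metis
  have "compact (closure \<Omega>)" using assms by (simp add: compact_closure)
  then obtain Z where Z: "Z \<subseteq> closure \<Omega>" "finite Z" "closure \<Omega> \<subseteq> (\<Union>z\<in>Z. ball z (r z / 2))"
  proof (rule compactE_image[of "closure \<Omega>" "closure \<Omega>" "\<lambda>z. ball z (r z / 2)"])
    show "closure \<Omega> \<subseteq> (\<Union>c\<in>closure \<Omega>. ball c (r c / 2))"
      using r\<eta> by force
  qed auto
  have Zne: "Z \<noteq> {}" using Z ne closure_subset by fastforce
  \<comment> \<open>The cover uses half radii, so a ball of radius \<open>r0\<close> around any
    point of the closure lies in the full ball of one of the finitely many centres.\<close>
  define r0 where "r0 = Min (r ` Z) / 2"
  define \<eta>0 where "\<eta>0 = Min (\<eta> ` Z)"
  have r0: "r0 > 0" "\<And>z. z \<in> Z \<Longrightarrow> r0 \<le> r z / 2"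
    using Z Zne r\<eta> by (auto simp: r0_def)
  have \<eta>0: "\<eta>0 > 0" "\<And>z. z \<in> Z \<Longrightarrow> \<eta>0 \<le> \<eta> z"
    using Z Zne r\<eta> by (auto simp: \<eta>0_def)
  moreover have "\<eta>0 \<le> 1"
    using \<eta>0 Zne Z r\<eta> by (metis all_not_in_conv order_trans subsetD)
  moreover have "\<exists>e. cone_at \<Omega> r0 \<eta>0 z e" if z: "z \<in> closure \<Omega>" for z
  proof -
    obtain y where y: "y \<in> Z" "z \<in> ball y (r y / 2)" using Z z by blast
    then obtain e where e: "cone_at \<Omega> (r y) (\<eta> y) y e" using r\<eta> Z by blast
    have "ball z r0 \<subseteq> ball y (r y)"
    proof
      fix x assume "x \<in> ball z r0"
      then show "x \<in> ball y (r y)"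
        using y r0(2)[OF y(1)] dist_triangle[of y x z] by simp
    qed
    moreover have "r0 \<le> r y" using r0(2)[OF y(1)] r\<eta>[of y] y Z by fastforce
    ultimately show ?thesis using cone_at_mono[OF e] \<eta>0 y by blast
  qed
  ultimately show ?thesis using r0 by blast
qed

text \<open>The estimates below use the local geometry through the uniform radius \<open>r\<close>
  and aperture \<open>\<eta>\<close> instead of graphs. The threshold for \<delta> will be
  \<open>r * \<eta> / 16\<close>.\<close>

locale cone_domain =
  fixes \<Omega> :: "'a::euclidean_space set" and r \<eta> :: real
  assumes open_\<Omega>: "open \<Omega>" and bounded_\<Omega>: "bounded \<Omega>" and \<Omega>_nonempty: "\<Omega> \<noteq> {}"
    and r_pos: "0 < r" and \<eta>_pos: "0 < \<eta>" and \<eta>_le_1: "\<eta> \<le> 1"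
    and cone: "z \<in> closure \<Omega> \<Longrightarrow> \<exists>e. cone_at \<Omega> r \<eta> z e"
begin

abbreviation rim :: "real \<Rightarrow> 'a set" where "rim \<delta> \<equiv> collar \<delta> \<Omega>"

abbreviation nbhd :: "real \<Rightarrow> 'a set" where "nbhd \<delta> \<equiv> \<Omega> \<union> rim \<delta>"

abbreviation rim_integrable :: "real \<Rightarrow> ('a \<Rightarrow> real) \<Rightarrow> bool" where
  "rim_integrable \<delta> u \<equiv> integrable lborel (\<lambda>a. u a * indicator (rim \<delta>) a)"

abbreviation T_energy :: "real \<Rightarrow> real \<Rightarrow> real \<Rightarrow> ('a \<Rightarrow> real) \<Rightarrow> ennreal" where
  "T_energy p \<beta> \<delta> \<equiv> kenergy (T_kernel DIM('a) p \<beta> \<delta>) p (rim \<delta>)"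

abbreviation S_energy :: "real \<Rightarrow> real \<Rightarrow> real \<Rightarrow> ('a \<Rightarrow> real) \<Rightarrow> ennreal" where
  "S_energy p \<beta> \<delta> \<equiv> kenergy (nl_kernel DIM('a) p \<beta> \<delta>) p (nbhd \<delta>)"

abbreviation nl_jump :: "real \<Rightarrow> real \<Rightarrow> real \<Rightarrow> ('a \<Rightarrow> real) \<Rightarrow> 'a \<Rightarrow> 'a \<Rightarrow> ennreal" where
  "nl_jump p \<beta> \<delta> v x y \<equiv> ennreal (nl_kernel DIM('a) p \<beta> \<delta> (dist x y) * \<bar>v y - v x\<bar> powr p)"

abbreviation chain_jump :: "real \<Rightarrow> ('a \<Rightarrow> real) \<Rightarrow> 'a \<Rightarrow> nat \<Rightarrow> 'a \<Rightarrow> real" where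
  "chain_jump p u w j x \<equiv> \<bar>u (x + real (Suc j) *\<^sub>R w) - u (x + real j *\<^sub>R w)\<bar> powr p"

section \<open>Geometry of the collar under the cone condition\<close>

lemma nbhd_iff: "0 < \<delta> \<Longrightarrow> x \<in> nbhd \<delta> \<longleftrightarrow> infdist x \<Omega> < \<delta>"
  by (auto simp: collar_def)

lemma infdist_less_iff: "infdist x \<Omega> < \<delta> \<longleftrightarrow> (\<exists>y\<in>\<Omega>. dist x y < \<delta>)"
proof
  assume l: "infdist x \<Omega> < \<delta>"
  then have "(INF y\<in>\<Omega>. dist x y) < \<delta>" using \<Omega>_nonempty by (simp add: infdist_def)
  then show "\<exists>y\<in>\<Omega>. dist x y < \<delta>"
    using \<Omega>_nonempty by (subst (asm) cINF_less_iff) auto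
qed (meson infdist_le le_less_trans)

lemma nbhdE:
  assumes "x \<in> nbhd \<delta>" "0 < \<delta>"
  obtains y where "y \<in> \<Omega>" "dist x y < \<delta>"
  using assms nbhd_iff infdist_less_iff by blast

lemma nbhdI:
  assumes "y \<in> \<Omega>" "dist x y < \<delta>"
  shows "x \<in> nbhd \<delta>"
  using assms infdist_less_iff[of x \<delta>] le_less_trans[OF zero_le_dist assms(2)] by (subst nbhd_iff) auto

lemma nbhd_borel[measurable]: "\<Omega> \<in> sets borel" "rim \<delta> \<in> sets borel" "nbhd \<delta> \<in> sets borel"
proof -
  have [measurable]: "(\<lambda>x. infdist x \<Omega>) \<in> borel_measurable borel"
    by (intro borel_measurable_continuous_onI continuous_intros)
  show [measurable]: "\<Omega> \<in> sets borel" using open_\<Omega> by simp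
  show [measurable]: "rim \<delta> \<in> sets borel"
    unfolding collar_def by measurable
  show "nbhd \<delta> \<in> sets borel" by simp
qed

lemma bounded_nbhd: "bounded (nbhd \<delta>)"
proof (cases "\<delta> > 0")
  case True
  obtain B where B: "\<And>y. y \<in> \<Omega> \<Longrightarrow> norm y \<le> B" using bounded_\<Omega> by (auto simp: bounded_iff)
  show ?thesis
    unfolding bounded_iff
  proof (intro exI ballI)
    fix x assume "x \<in> nbhd \<delta>"
    then obtain y where "y \<in> \<Omega>" "dist x y < \<delta>" using nbhdE True by blast
    then show "norm x \<le> B + \<delta>"
      using B[of y] norm_triangle_ineq[of y "x - y"] by (simp add: dist_norm)
  qed
next
  case False
  then have "nbhd \<delta> = \<Omega>" using infdist_nonneg[of _ \<Omega>] by (auto simp: collar_def) (meson le_less_trans not_less)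
  then show ?thesis using bounded_\<Omega> by simp
qed

lemma bounded_collar: "bounded (rim \<delta>)"
  using bounded_nbhd[of \<delta>] by (rule bounded_subset) auto

lemma nbhd_cone:
  assumes e: "cone_at \<Omega> r \<eta> z e" and \<delta>: "0 < \<delta>" "\<delta> \<le> r / 2" and x: "x \<in> nbhd \<delta>" "dist z x < r / 2"
    and v: "v \<in> ball e \<eta>" and s: "0 \<le> s" "s \<le> r"
  shows "x + s *\<^sub>R v \<in> nbhd \<delta>"
proof -
  obtain y where y: "y \<in> \<Omega>" "dist x y < \<delta>" using nbhdE x \<delta> by blast
  then have "y \<in> ball z r" using x \<delta> dist_triangle[of z y x] by simp
  then have "y + s *\<^sub>R v \<in> \<Omega>" using e v s y by (auto simp: cone_at_def)
  then show ?thesis using y by (intro nbhdI[of "y + s *\<^sub>R v"]) (auto simp: dist_norm)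
qed

text \<open>If \<open>y\<close> in \<Omega> is within \<delta> of \<open>x\<close>, going from
  \<open>x\<close> along \<open>v\<close> for length \<open>s\<close> ends where going from
  \<open>y\<close> along \<open>v + (x - y) /\<^sub>R s\<close> ends. For s \<ge> 2 * \<delta> /
  \<eta> the correction has norm at most \<eta> / 2. Thus every inward path has left the collar
  after length 2 * \<delta> / \<eta>, which yields both the volume bound for the collar and the
  bounded overlap of chains.\<close>

lemma nbhd_enter:
  assumes e: "cone_at \<Omega> r \<eta> z e" and \<delta>: "0 < \<delta>" "\<delta> \<le> r / 2" and x: "x \<in> nbhd \<delta>" "dist z x < r / 2"
    and v: "v \<in> ball e (\<eta> / 2)" and s: "2 * \<delta> / \<eta> \<le> s" "s \<le> r"
  shows "x + s *\<^sub>R v \<in> \<Omega>"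
proof -
  obtain y where y: "y \<in> \<Omega>" "dist x y < \<delta>" using nbhdE x \<delta> by blast
  then have yb: "y \<in> ball z r" using x \<delta> dist_triangle[of z y x] by simp
  have s0: "s > 0" using s(1) \<delta> \<eta>_pos by (smt (verit) divide_pos_pos)
  define w where "w = (x - y) /\<^sub>R s"
  define v' where "v' = v + w"
  have "norm w \<le> \<delta> / s"
    using y s0 by (simp add: w_def dist_norm divide_inverse mult.commute)
  also have "\<dots> \<le> \<eta> / 2" using s s0 \<eta>_pos by (simp add: field_simps)
  finally have "v' \<in> ball e \<eta>"
    using v norm_triangle_ineq[of "e - v" "- w"] by (simp add: v'_def dist_norm algebra_simps)
  then have "y + s *\<^sub>R v' \<in> \<Omega>" using e s s0 y yb by (auto simp: cone_at_def)
  also have "y + s *\<^sub>R v' = x + s *\<^sub>R v" using s0 by (simp add: v'_def w_def scaleR_add_right)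
  finally show ?thesis .
qed

text \<open>The cone at a point of the neighbourhood close to \<open>x\<close> contains a ball of
  radius \<open>h / 4 * \<eta>\<close> centred \<open>h / 4\<close> away, and all of it stays within
  \<open>h\<close> of \<open>x\<close>.\<close>

lemma fat_nbhd:
  assumes \<delta>: "0 < \<delta>" "\<delta> < r / 2"
  shows "fat_set (nbhd \<delta>) r (unit_ball_vol DIM('a) * (\<eta> / 4) ^ DIM('a))"
proof
  show "nbhd \<delta> \<in> sets borel" by simp
  show "bounded (nbhd \<delta>)" by (rule bounded_nbhd)
  show "0 < r" "0 < unit_ball_vol DIM('a) * (\<eta> / 4) ^ DIM('a)" using r_pos \<eta>_pos by auto
  fix x h assume x: "x \<in> closure (nbhd \<delta>)" and h: "0 < h" "h < r"
  then obtain x' where x': "x' \<in> nbhd \<delta>" "dist x' x < h / 4"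
    by (meson closure_approachable divide_pos_pos zero_less_numeral)
  obtain y where y: "y \<in> \<Omega>" "dist x' y < \<delta>" using nbhdE x' \<delta> by blast
  then obtain e where e: "cone_at \<Omega> r \<eta> y e" using cone closure_subset by blast
  have ne: "norm e = 1" using e by (simp add: cone_at_def)
  have "ball (x' + (h / 4) *\<^sub>R e) (h / 4 * \<eta>) \<subseteq> nbhd \<delta> \<inter> ball x h"
  proof
    fix w assume w: "w \<in> ball (x' + (h / 4) *\<^sub>R e) (h / 4 * \<eta>)"
    define v where "v = (w - x') /\<^sub>R (h / 4)"
    have wv: "w = x' + (h / 4) *\<^sub>R v" using h by (simp add: v_def)
    have "norm ((h / 4) *\<^sub>R (e - v)) < h / 4 * \<eta>"
      using w unfolding wv by (simp add: dist_norm algebra_simps)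
    then have v: "v \<in> ball e \<eta>" using h by (simp add: dist_norm)
    have "x' + (h / 4) *\<^sub>R v \<in> nbhd \<delta>"
      using \<delta> y h by (intro nbhd_cone[OF e] x' v) (auto simp: dist_commute)
    moreover have "dist x w < h"
    proof -
      have "norm v \<le> 2" using v ne \<eta>_le_1 norm_triangle_ineq[of e "v - e"] by (simp add: dist_norm norm_minus_commute)
      then have "norm ((h / 4) *\<^sub>R v) \<le> h / 2" using h by simp
      then have "dist x' w \<le> h / 2" by (simp add: wv dist_norm)
      then show ?thesis using x' dist_triangle[of x w x'] h by (simp add: dist_commute)
    qed
    ultimately show "w \<in> nbhd \<delta> \<inter> ball x h" by (simp add: wv)
  qed
  then have "emeasure lborel (ball (x' + (h / 4) *\<^sub>R e) (h / 4 * \<eta>)) \<le> emeasure lborel (nbhd \<delta> \<inter> ball x h)"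
    by (intro emeasure_mono) auto
  also have "emeasure lborel (ball (x' + (h / 4) *\<^sub>R e) (h / 4 * \<eta>)) = ennreal (unit_ball_vol DIM('a) * (\<eta> / 4) ^ DIM('a) * h ^ DIM('a))"
    using h \<eta>_pos by (simp add: emeasure_ball_le power_mult_distrib power_divide mult_ac)
  finally show "ennreal (unit_ball_vol DIM('a) * (\<eta> / 4) ^ DIM('a) * h ^ DIM('a)) \<le> emeasure lborel (nbhd \<delta> \<inter> ball x h)" .
qed

end

section \<open>Volume of the collar and overlap of chains\<close>

lemma emeasure_lborel_shift:
  fixes c :: "'a::euclidean_space"
  assumes [measurable]: "A \<in> sets borel"
  shows "emeasure lborel {b. b + c \<in> A} = emeasure lborel A" "{b. b + c \<in> A} \<in> sets borel"
proof -
  show [measurable]: "{b. b + c \<in> A} \<in> sets borel" by measurable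
  have "emeasure lborel {b. b + c \<in> A} = (\<integral>\<^sup>+b. indicator {b. b + c \<in> A} b)"
    by simp
  also have "\<dots> = (\<integral>\<^sup>+b. indicator A (b + c))"
    by (intro nn_integral_cong) (simp add: indicator_def)
  also have "\<dots> = emeasure lborel A"
    by (subst nn_integral_lborel_shift) auto
  finally show "emeasure lborel {b. b + c \<in> A} = emeasure lborel A" .
qed

context cone_domain
begin

text \<open>Shifting a piece of the collar upwards by multiples of \<open>2 * \<delta> / \<eta>\<close> gives disjoint sets.\<close>

lemma collar_ball_small:
  assumes \<delta>: "0 < \<delta>" "\<delta> \<le> \<rho>" and \<rho>: "\<rho> \<le> r * \<eta> / 8"
  shows "emeasure lborel (rim \<delta> \<inter> cball x \<rho>) \<le> ennreal (unit_ball_vol DIM('a) * (1 + 2 / \<eta>) ^ DIM('a) * \<delta> * \<rho> powr (real DIM('a) - 1))"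
proof (cases "rim \<delta> \<inter> cball x \<rho> = {}")
  case False
  define A where "A = rim \<delta> \<inter> cball x \<rho>"
  obtain w where w: "w \<in> rim \<delta>" "dist x w \<le> \<rho>" using False by auto
  then obtain z where z: "z \<in> \<Omega>" "dist w z < \<delta>" using nbhdE[of w \<delta>] \<delta> by blast
  then obtain e where e: "cone_at \<Omega> r \<eta> z e" using cone closure_subset by blast
  have ne: "norm e = 1" using e by (simp add: cone_at_def)
  have r\<eta>: "r * \<eta> \<le> r" using \<eta>_le_1 r_pos by simp
  have \<rho>0: "\<rho> > 0" using \<delta> by linarith
  have \<delta>r: "\<delta> \<le> r / 2" using \<delta> \<rho> r\<eta> r_pos by linarith
  have near: "a \<in> nbhd \<delta>" "dist z a < r / 2" "a \<notin> \<Omega>" if "a \<in> A" for a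
  proof -
    have "dist z a \<le> dist z w + dist w x + dist x a"
      using dist_triangle[of z a w] dist_triangle[of w a x] by linarith
    also have "\<dots> < 3 * \<rho>" using z w that \<delta> by (simp add: A_def dist_commute)
    finally show "dist z a < r / 2" using \<rho> r\<eta> r_pos by linarith
  qed (use that in \<open>auto simp: A_def collar_def\<close>)
  define M where "M = 2 * \<delta> / \<eta>"
  have M: "M > 0" using \<delta> \<eta>_pos by (simp add: M_def)
  \<comment> \<open>About \<rho> / \<delta> disjoint copies fit, and
    \<open>real K * M \<le> 2 * \<rho> / \<eta>\<close> keeps them in a ball of comparable radius.
    Comparing volumes, the measure of \<open>A\<close> is at most of order \<delta> / \<rho> *
    \<rho>^d.\<close>
  define K where "K = nat \<lfloor>\<rho> / \<delta>\<rfloor>"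
  have K: "real K \<le> \<rho> / \<delta>" "\<rho> / \<delta> < real K + 1"
    using \<rho>0 \<delta> by (auto simp: K_def)
  have KM: "real K * M \<le> 2 * \<rho> / \<eta>"
    using mult_right_mono[OF K(1), of M] M \<delta> by (simp add: M_def mult.commute)
  also have "\<dots> \<le> r" using \<rho> \<rho>0 \<eta>_pos r_pos by (simp add: field_simps)
  finally have KMr: "real K * M \<le> r" .
  define B where "B k = {b. b + (- (real k * M) *\<^sub>R e) \<in> A}" for k :: nat
  have [measurable]: "A \<in> sets borel" unfolding A_def by measurable
  have Bm: "emeasure lborel (B k) = emeasure lborel A" "B k \<in> sets borel" for k
    unfolding B_def by (rule emeasure_lborel_shift, simp)+
  have disj: "B k \<inter> B l = {}" if "k < l" "l \<le> K" for k l
  proof (rule ccontr)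
    assume "B k \<inter> B l \<noteq> {}"
    then obtain b where b: "b + (- (real k * M) *\<^sub>R e) \<in> A" "b + (- (real l * M) *\<^sub>R e) \<in> A"
      by (auto simp: B_def)
    define s where "s = (real l - real k) * M"
    have "real l - real k \<ge> 1" using that by linarith
    then have "1 * M \<le> s" unfolding s_def using M by (intro mult_right_mono) auto
    moreover have "s \<le> real K * M" unfolding s_def using that M by (intro mult_right_mono) auto
    \<comment> \<open>If two copies met, the lower of the two collar points, moved up by at least
      \<open>M\<close>, would be in \<Omega>; but it arrives at the upper one, which is outside
      \<Omega>.\<close>
    ultimately have "b + (- (real l * M) *\<^sub>R e) + s *\<^sub>R e \<in> \<Omega>"
      using \<eta>_pos KMr \<delta> by (intro nbhd_enter[OF e \<delta>(1) \<delta>r near(1,2)[OF b(2)]]) (auto simp: M_def)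
    moreover have "b + (- (real l * M) *\<^sub>R e) + s *\<^sub>R e = b + (- (real k * M) *\<^sub>R e)"
      by (simp add: s_def algebra_simps)
    ultimately show False using near(3)[OF b(1)] by (simp only:)
  qed
  have dis: "disjoint_family_on B {..K}"
    unfolding disjoint_family_on_def using disj by (metis Int_commute atMost_iff linorder_neqE_nat)
  have "(\<Union>k\<le>K. B k) \<subseteq> cball x (\<rho> * (1 + 2 / \<eta>))"
  proof
    fix b assume "b \<in> (\<Union>k\<le>K. B k)"
    then obtain k where k: "k \<le> K" "b + (- (real k * M) *\<^sub>R e) \<in> A" by (auto simp: B_def)
    have "dist x b \<le> dist x (b + (- (real k * M) *\<^sub>R e)) + dist (b + (- (real k * M) *\<^sub>R e)) b"
      by (rule dist_triangle)
    also have "\<dots> \<le> \<rho> + real k * M" using k M ne by (simp add: A_def dist_norm)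
    also have "real k * M \<le> real K * M" using k M by (intro mult_right_mono) auto
    also note KM
    finally show "b \<in> cball x (\<rho> * (1 + 2 / \<eta>))" by (simp add: algebra_simps)
  qed
  then have "emeasure lborel (\<Union>k\<le>K. B k) \<le> emeasure lborel (cball x (\<rho> * (1 + 2 / \<eta>)))"
    by (intro emeasure_mono) auto
  also have "\<dots> = ennreal (unit_ball_vol DIM('a) * (\<rho> * (1 + 2 / \<eta>)) ^ DIM('a))"
    using \<rho>0 \<eta>_pos by (intro emeasure_cball) (auto intro: add_nonneg_nonneg)
  also have "emeasure lborel (\<Union>k\<le>K. B k) = (\<Sum>k\<le>K. emeasure lborel (B k))"
    using Bm dis by (intro sum_emeasure[symmetric]) auto
  also have "\<dots> = of_nat (Suc K) * emeasure lborel A"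
    by (simp add: Bm)
  finally have le: "of_nat (Suc K) * emeasure lborel A \<le> ennreal (unit_ball_vol DIM('a) * (\<rho> * (1 + 2 / \<eta>)) ^ DIM('a))" .
  have "emeasure lborel A < \<infinity>"
    by (rule emeasure_bounded_finite) (auto simp: A_def)
  then obtain m where m: "emeasure lborel A = ennreal m" "m \<ge> 0"
    by (cases "emeasure lborel A") auto
  have "real (Suc K) * m \<le> unit_ball_vol DIM('a) * (\<rho> * (1 + 2 / \<eta>)) ^ DIM('a)"
    using le m \<rho>0 \<eta>_pos by (simp add: ennreal_of_nat_eq_real_of_nat ennreal_mult[symmetric] del: of_nat_Suc) 
  moreover have "\<rho> / \<delta> * m \<le> real (Suc K) * m"
    using K m by (intro mult_right_mono) auto
  ultimately have "\<rho> / \<delta> * m \<le> unit_ball_vol DIM('a) * (\<rho> * (1 + 2 / \<eta>)) ^ DIM('a)" by linarith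
  moreover define q where "q = (1 + 2 / \<eta>) ^ DIM('a)"
  ultimately have "\<rho> / \<delta> * m \<le> unit_ball_vol DIM('a) * (\<rho> ^ DIM('a) * q)"
    by (simp only: power_mult_distrib q_def)
  then have "m \<le> unit_ball_vol DIM('a) * q * \<delta> * (\<rho> ^ DIM('a) / \<rho>)"
    using \<rho>0 \<delta> by (simp add: field_simps)
  also have "\<rho> ^ DIM('a) / \<rho> = \<rho> powr (real DIM('a) - 1)"
    using \<rho>0 by (simp add: powr_realpow[symmetric] powr_diff)
  finally show ?thesis using m by (simp add: A_def[symmetric] q_def ennreal_leI)
qed simp

text \<open>For radii up to \<open>r * \<eta> / 8\<close> this is the local bound. For a larger ball
  the whole collar is covered by finitely many balls of that radius, whose number depends on neither
  \<delta> nor \<rho>.\<close>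

lemma collar_ball_measure:
  "\<exists>C>0. \<forall>\<delta> x \<rho>. 0 < \<delta> \<longrightarrow> \<delta> < r * \<eta> / 16 \<longrightarrow> \<delta> \<le> \<rho> \<longrightarrow>
     emeasure lborel (rim \<delta> \<inter> cball x \<rho>) \<le> ennreal (C * \<delta> * \<rho> powr (real DIM('a) - 1))"
proof -
  define \<rho>0 where "\<rho>0 = r * \<eta> / 8"
  have \<rho>0: "\<rho>0 > 0" using r_pos \<eta>_pos by (simp add: \<rho>0_def)
  define C0 where "C0 = unit_ball_vol DIM('a) * (1 + 2 / \<eta>) ^ DIM('a)"
  have C0: "C0 > 0" using \<eta>_pos by (simp add: C0_def add_pos_pos)
  have "compact (closure \<Omega>)" using bounded_\<Omega> by (simp add: compact_closure)
  then obtain Z where Z: "finite Z" "closure \<Omega> \<subseteq> (\<Union>z\<in>Z. ball z (\<rho>0 / 2))"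
    using compact_eq_totally_bounded[of "closure \<Omega>"] \<rho>0 half_gt_zero by metis
  define N where "N = real (card Z)"
  show ?thesis
  proof (intro exI conjI allI impI)
    show "(N + 1) * C0 > 0" using C0 by (simp add: N_def add_nonneg_pos)
    fix \<delta> x \<rho> assume \<delta>: "0 < \<delta>" "\<delta> < r * \<eta> / 16" "\<delta> \<le> (\<rho>::real)"
    let ?V = "rim \<delta>"
    have small: "emeasure lborel (?V \<inter> cball y \<sigma>) \<le> ennreal (C0 * \<delta> * \<sigma> powr (real DIM('a) - 1))" if "\<delta> \<le> \<sigma>" "\<sigma> \<le> \<rho>0" for y \<sigma>
      using collar_ball_small[of \<delta> \<sigma> y] that \<delta> by (simp add: C0_def \<rho>0_def)
    show "emeasure lborel (?V \<inter> cball x \<rho>) \<le> ennreal ((N + 1) * C0 * \<delta> * \<rho> powr (real DIM('a) - 1))"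
    proof (cases "\<rho> \<le> \<rho>0")
      case True
      have "C0 * \<delta> * \<rho> powr (real DIM('a) - 1) \<le> (N + 1) * (C0 * \<delta> * \<rho> powr (real DIM('a) - 1))"
        using mult_right_mono[of 1 "N + 1" "C0 * \<delta> * \<rho> powr (real DIM('a) - 1)"] C0 \<delta> by (simp add: N_def)
      then show ?thesis
        using small[OF \<delta>(3) True, of x] by (elim order_trans) (simp add: ennreal_leI mult.assoc)
    next
      case False
      have "?V \<subseteq> (\<Union>z\<in>Z. ?V \<inter> cball z \<rho>0)"
      proof
        fix v assume v: "v \<in> ?V"
        then obtain y where y: "y \<in> \<Omega>" "dist v y < \<delta>" using nbhdE[of v \<delta>] \<delta> by blast
        then obtain z where "z \<in> Z" "y \<in> ball z (\<rho>0 / 2)" using Z closure_subset by blast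
        then show "v \<in> (\<Union>z\<in>Z. ?V \<inter> cball z \<rho>0)"
          using v y \<delta> dist_triangle[of z v y] by (intro UN_I[of z]) (auto simp: \<rho>0_def dist_commute)
      qed
      then have "emeasure lborel (?V \<inter> cball x \<rho>) \<le> emeasure lborel (\<Union>z\<in>Z. ?V \<inter> cball z \<rho>0)"
        using Z by (intro emeasure_mono sets.finite_UN) auto
      also have "\<dots> \<le> (\<Sum>z\<in>Z. emeasure lborel (?V \<inter> cball z \<rho>0))"
        using Z by (intro emeasure_subadditive_finite) auto
      also have "\<dots> \<le> (\<Sum>z\<in>Z. ennreal (C0 * \<delta> * \<rho>0 powr (real DIM('a) - 1)))"
        using \<delta> by (intro sum_mono small) (auto simp: \<rho>0_def)
      also have "\<dots> = ennreal (N * (C0 * \<delta> * \<rho>0 powr (real DIM('a) - 1)))"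
        using C0 \<delta> by (simp add: N_def ennreal_of_nat_eq_real_of_nat ennreal_mult[symmetric])
      also have "\<dots> \<le> ennreal ((N + 1) * (C0 * \<delta> * \<rho> powr (real DIM('a) - 1)))"
        using False C0 \<delta> \<rho>0 by (intro ennreal_leI mult_mono powr_mono2) (auto simp: N_def)
      finally show ?thesis by (simp add: mult.assoc)
    qed
  qed
qed

text \<open>For fixed \<open>y\<close> the indices \<open>j\<close> for which \<open>y\<close>,
  moved back by j steps, lies in \<open>A\<close> form a window of length at most 4 / \<eta>: a
  larger gap would mean that a path starting in the collar travels at least 2 * \<delta> / \<eta>
  and nevertheless ends outside \<Omega>. So the sum over about r / \<delta> links costs a constant
  independent of \<delta>.\<close>

lemma chain_overlap:
  assumes e: "cone_at \<Omega> r \<eta> z e" and \<delta>: "0 < \<delta>" "\<delta> \<le> r / 2" and v: "v \<in> ball e (\<eta> / 2)"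
    and A: "A \<in> sets borel" "A \<subseteq> rim \<delta> \<inter> ball z (r / 2)" and K: "real K * (\<delta> / 2) \<le> r"
    and f[measurable]: "f \<in> borel_measurable borel"
  shows "(\<Sum>j<K. \<integral>\<^sup>+x. f (x + (real j * (\<delta> / 2)) *\<^sub>R v) * indicator A x)
    \<le> ennreal (4 / \<eta> + 1) * (\<integral>\<^sup>+y. f y * indicator (nbhd \<delta>) y)"
proof -
  note [measurable] = A(1)
  define c where "c j = (real j * (\<delta> / 2)) *\<^sub>R v" for j :: nat
  have "(\<Sum>j<K. \<integral>\<^sup>+x. f (x + c j) * indicator A x) = (\<Sum>j<K. \<integral>\<^sup>+y. f y * indicator A (y - c j))"
  proof (rule sum.cong)
    fix j
    show "(\<integral>\<^sup>+x. f (x + c j) * indicator A x) = (\<integral>\<^sup>+y. f y * indicator A (y - c j))"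
      using nn_integral_lborel_shift[of "\<lambda>y. f y * indicator A (y - c j)" "c j"] by simp
  qed simp
  also have "\<dots> = (\<integral>\<^sup>+y. (\<Sum>j<K. f y * indicator A (y - c j)))"
    by (rule nn_integral_sum[symmetric]) measurable
  also have "\<dots> \<le> (\<integral>\<^sup>+y. ennreal (4 / \<eta> + 1) * (f y * indicator (nbhd \<delta>) y))"
  proof (rule nn_integral_mono)
    fix y
    define J where "J = {j. j < K \<and> y - c j \<in> A}"
    have fin: "finite J" by (simp add: J_def)
    have "(\<Sum>j<K. f y * indicator A (y - c j)) = (\<Sum>j<K. if y - c j \<in> A then f y else 0)"
      by (rule sum.cong) (auto simp: indicator_def)
    also have "\<dots> = (\<Sum>j\<in>J. f y)"
      by (subst sum.inter_filter[symmetric]) (auto simp: J_def intro!: sum.cong)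
    finally have S: "(\<Sum>j<K. f y * indicator A (y - c j)) = of_nat (card J) * f y" by simp
    show "(\<Sum>j<K. f y * indicator A (y - c j)) \<le> ennreal (4 / \<eta> + 1) * (f y * indicator (nbhd \<delta>) y)"
    proof (cases "J = {}")
      case False
      define j0 where "j0 = Min J"
      have j0: "j0 \<in> J" "\<And>j. j \<in> J \<Longrightarrow> j0 \<le> j" using fin False by (auto simp: j0_def)
      have inA: "y - c j \<in> A" "real j * (\<delta> / 2) \<le> r" if "j \<in> J" for j
      proof -
        show "y - c j \<in> A" using that by (simp add: J_def)
        have "real j * (\<delta> / 2) \<le> real K * (\<delta> / 2)" using that \<delta> by (intro mult_right_mono) (auto simp: J_def)
        then show "real j * (\<delta> / 2) \<le> r" using K by simp
      qed
      have chart: "a \<in> nbhd \<delta>" "dist z a < r / 2" "a \<notin> \<Omega>" if "a \<in> A" for a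
        using that A(2) by (auto simp: collar_def)
      have v': "v \<in> ball e \<eta>" using v \<eta>_pos by auto
      have "(y - c j0) + (real j0 * (\<delta> / 2)) *\<^sub>R v \<in> nbhd \<delta>"
        using inA[OF j0(1)] \<delta> by (intro nbhd_cone[OF e \<delta>] chart v') auto
      then have yD: "y \<in> nbhd \<delta>" by (simp add: c_def)
      have lt: "real j - real j0 < 4 / \<eta>" if "j \<in> J" for j
      proof (rule ccontr)
        assume "\<not> real j - real j0 < 4 / \<eta>"
        then have "4 / \<eta> * (\<delta> / 2) \<le> (real j - real j0) * (\<delta> / 2)"
          using \<delta> by (intro mult_right_mono) auto
        moreover have "(real j - real j0) * (\<delta> / 2) \<le> r"
          using inA(2)[OF that] \<delta> by (smt (verit) mult_right_mono of_nat_0_le_iff half_gt_zero)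
        ultimately have "(y - c j) + ((real j - real j0) * (\<delta> / 2)) *\<^sub>R v \<in> \<Omega>"
          by (intro nbhd_enter[OF e \<delta>] chart inA that v) auto
        moreover have "(y - c j) + ((real j - real j0) * (\<delta> / 2)) *\<^sub>R v = y - c j0"
          unfolding c_def left_diff_distrib scaleR_diff_left by simp
        ultimately show False using chart(3)[OF inA(1)[OF j0(1)]] by (simp only:)
      qed
      have "J \<subseteq> {j0..j0 + nat \<lfloor>4 / \<eta>\<rfloor>}"
      proof
        fix j assume j: "j \<in> J"
        then have "real (j - j0) \<le> 4 / \<eta>" using lt[OF j] j0(2)[OF j] by simp
        then have "j - j0 \<le> nat \<lfloor>4 / \<eta>\<rfloor>" using le_nat_floor by blast
        then show "j \<in> {j0..j0 + nat \<lfloor>4 / \<eta>\<rfloor>}" using j0(2)[OF j] by auto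
      qed
      then have "card J \<le> card {j0..j0 + nat \<lfloor>4 / \<eta>\<rfloor>}" by (intro card_mono) auto
      then have "real (card J) \<le> real (nat \<lfloor>4 / \<eta>\<rfloor>) + 1" by simp
      also have "\<dots> \<le> 4 / \<eta> + 1" using \<eta>_pos by simp
      finally have "ennreal (real (card J)) \<le> ennreal (4 / \<eta> + 1)" by (rule ennreal_leI)
      then show ?thesis unfolding S using yD
        by (auto simp: ennreal_of_nat_eq_real_of_nat intro: mult_right_mono)
    qed (simp add: S)
  qed
  also have "\<dots> = ennreal (4 / \<eta> + 1) * (\<integral>\<^sup>+y. f y * indicator (nbhd \<delta>) y)"
    by (rule nn_integral_cmult) measurable
  finally show ?thesis by (simp add: c_def)
qed

end

section \<open>The trace estimate\<close>

text \<open>A discrete Hardy inequality. The weights (j + 1)^(-1/2) sum to at most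
  \<open>2 * sqrt K\<close>, so the length of the chain costs only K^((p-1)/2), where equal weights
  would cost K^(p-1). The saved power makes the later integral over the distance of the pair
  converge, and there the factor (j + 1)^((p-1)/2) paid by link \<open>j\<close> is
  recovered.\<close>

lemma powr_diff_chain_le:
  fixes u :: "'a::real_vector \<Rightarrow> real"
  assumes p: "p > 1"
  shows "\<bar>u x - u (x + real K *\<^sub>R w)\<bar> powr p \<le>
    (2 * sqrt (real K)) powr (p - 1) * (\<Sum>j<K. real (Suc j) powr ((p - 1) / 2) * \<bar>u (x + real (Suc j) *\<^sub>R w) - u (x + real j *\<^sub>R w)\<bar> powr p)"
proof -
  define a where "a j = \<bar>u (x + real (Suc j) *\<^sub>R w) - u (x + real j *\<^sub>R w)\<bar>" for j
  define \<mu> where "\<mu> j = real (Suc j) powr (- 1 / 2)" for j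
  \<comment> \<open>The induction step is sqrt K + 1 / (2 * s) \<le> s for s = sqrt (K + 1).\<close>
  have sum\<mu>: "(\<Sum>j<K. \<mu> j) \<le> 2 * sqrt (real K)"
  proof (induction K)
    case (Suc K)
    define s where "s = sqrt (real (Suc K))"
    have s: "s > 0" "s\<^sup>2 = real (Suc K)" by (auto simp: s_def)
    have "(sqrt (real K))\<^sup>2 = s\<^sup>2 - 1" using s by simp
    also have "\<dots> \<le> (s - 1 / (2 * s))\<^sup>2" using s by (simp add: power2_diff)
    finally have "sqrt (real K) \<le> \<bar>s - 1 / (2 * s)\<bar>" by (rule real_le_rsqrt[THEN order_trans]) simp
    moreover have "s - 1 / (2 * s) \<ge> 0"
    proof -
      have "1 \<le> 2 * s\<^sup>2" using s by simp
      then show ?thesis using s(1) by (simp add: field_simps power2_eq_square)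
    qed
    ultimately have "sqrt (real K) \<le> s - 1 / (2 * s)" by simp
    moreover have "\<mu> K = 1 / s"
      by (simp add: \<mu>_def s_def powr_minus_divide powr_half_sqrt del: of_nat_Suc)
    ultimately show ?case using Suc by (simp add: s_def[symmetric] del: of_nat_Suc)
  qed simp
  have "u (x + real K *\<^sub>R w) - u x = (\<Sum>j<K. u (x + real (Suc j) *\<^sub>R w) - u (x + real j *\<^sub>R w))"
    using sum_lessThan_telescope[of "\<lambda>j. u (x + real j *\<^sub>R w)" K] by simp
  then have "\<bar>u x - u (x + real K *\<^sub>R w)\<bar> \<le> (\<Sum>j<K. a j)"
    unfolding a_def by (subst abs_minus_commute) (simp only: sum_abs)
  then have "\<bar>u x - u (x + real K *\<^sub>R w)\<bar> powr p \<le> (\<Sum>j<K. a j) powr p"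
    using p by (intro powr_mono2) auto
  also have "\<dots> \<le> (\<Sum>j<K. \<mu> j) powr (p - 1) * (\<Sum>j<K. \<mu> j powr (1 - p) * a j powr p)"
    using p by (intro powr_sum_le_weighted) (auto simp: a_def \<mu>_def)
  also have "\<dots> \<le> (2 * sqrt (real K)) powr (p - 1) * (\<Sum>j<K. \<mu> j powr (1 - p) * a j powr p)"
    using sum\<mu> p by (intro mult_right_mono powr_mono2 sum_nonneg) (auto simp: \<mu>_def)
  also have "(\<Sum>j<K. \<mu> j powr (1 - p) * a j powr p) = (\<Sum>j<K. real (Suc j) powr ((p - 1) / 2) * a j powr p)"
  proof -
    have "- 1 / 2 * (1 - p) = (p - 1) / 2" by (simp add: field_simps)
    then show ?thesis by (simp only: \<mu>_def powr_powr)
  qed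
  finally show ?thesis by (simp add: a_def)
qed

text \<open>The value at \<open>x\<close> is compared with the values at all \<open>K\<close> points
  of the chain instead of one. Since the chains overlap boundedly and \<open>K\<close> will be of
  order r / \<delta>, dividing by \<open>K\<close> produces the factor \<delta> that reflects the
  thinness of the collar. Equal weights suffice because no integral over the distance of a pair
  follows.\<close>

lemma sum_of_chain_powr_le:
  fixes u :: "'a::real_vector \<Rightarrow> real"
  assumes p: "p > 1"
  shows "real K * \<bar>u x\<bar> powr p \<le> 2 powr p * ((\<Sum>k<K. \<bar>u (x + real k *\<^sub>R w)\<bar> powr p) +
    real K powr p * (\<Sum>j<K. \<bar>u (x + real (Suc j) *\<^sub>R w) - u (x + real j *\<^sub>R w)\<bar> powr p))"
proof (cases "K = 0")
  case False
  define a where "a j = \<bar>u (x + real (Suc j) *\<^sub>R w) - u (x + real j *\<^sub>R w)\<bar>" for j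
  have each: "\<bar>u x\<bar> powr p \<le> 2 powr p * (\<bar>u (x + real k *\<^sub>R w)\<bar> powr p + real K powr (p - 1) * (\<Sum>j<K. a j powr p))" if k: "k < K" for k
  proof -
    have "u (x + real k *\<^sub>R w) - u x = (\<Sum>j<k. u (x + real (Suc j) *\<^sub>R w) - u (x + real j *\<^sub>R w))"
      using sum_lessThan_telescope[of "\<lambda>j. u (x + real j *\<^sub>R w)" k] by simp
    then have "\<bar>u x - u (x + real k *\<^sub>R w)\<bar> \<le> (\<Sum>j<k. a j)"
      unfolding a_def by (subst abs_minus_commute) (simp only: sum_abs)
    also have "\<dots> \<le> (\<Sum>j<K. a j)" using k by (intro sum_mono2) (auto simp: a_def)
    finally have "\<bar>u x - u (x + real k *\<^sub>R w)\<bar> powr p \<le> (\<Sum>j<K. a j) powr p"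
      using p by (intro powr_mono2) auto
    also have "\<dots> \<le> (\<Sum>j<K. 1) powr (p - 1) * (\<Sum>j<K. 1 powr (1 - p) * a j powr p)"
      using p by (intro powr_sum_le_weighted) (auto simp: a_def)
    finally have 1: "\<bar>u x - u (x + real k *\<^sub>R w)\<bar> powr p \<le> real K powr (p - 1) * (\<Sum>j<K. a j powr p)" by simp
    have "\<bar>u x\<bar> powr p \<le> 2 powr p * (\<bar>u (x + real k *\<^sub>R w)\<bar> powr p + \<bar>u x - u (x + real k *\<^sub>R w)\<bar> powr p)"
      using powr_abs_add_le[of p "u (x + real k *\<^sub>R w)" "u x - u (x + real k *\<^sub>R w)"] p by simp
    also have "\<dots> \<le> 2 powr p * (\<bar>u (x + real k *\<^sub>R w)\<bar> powr p + real K powr (p - 1) * (\<Sum>j<K. a j powr p))"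
      using 1 by (intro mult_left_mono add_left_mono) auto
    finally show ?thesis .
  qed
  have "real K * \<bar>u x\<bar> powr p = (\<Sum>k<K. \<bar>u x\<bar> powr p)" by simp
  also have "\<dots> \<le> (\<Sum>k<K. 2 powr p * (\<bar>u (x + real k *\<^sub>R w)\<bar> powr p + real K powr (p - 1) * (\<Sum>j<K. a j powr p)))"
    using each by (intro sum_mono) auto
  also have "\<dots> = 2 powr p * ((\<Sum>k<K. \<bar>u (x + real k *\<^sub>R w)\<bar> powr p) + (real K * real K powr (p - 1)) * (\<Sum>j<K. a j powr p))"
    by (simp add: sum_distrib_left[symmetric] sum.distrib mult.assoc)
  also have "real K * real K powr (p - 1) = real K powr p"
    using False by (simp add: powr_diff)
  finally show ?thesis by (simp add: a_def)
qed simp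

text \<open>A constant kernel on close pairs: chains are estimated without any reference to
  \<beta>.\<close>

abbreviation close_energy :: "real \<Rightarrow> real \<Rightarrow> 'a::euclidean_space set \<Rightarrow> ('a \<Rightarrow> real) \<Rightarrow> ennreal" where
  "close_energy p \<delta> U u \<equiv> kenergy (indicator {..<\<delta>}) p U u"

lemma shift_energy_le_close_energy:
  fixes u :: "'a::euclidean_space \<Rightarrow> real"
  assumes [measurable]: "u \<in> borel_measurable borel" "D \<in> sets borel" "W \<in> sets borel" and W: "W \<subseteq> ball 0 \<delta>"
  shows "(\<integral>\<^sup>+w. (\<integral>\<^sup>+y. ennreal (\<bar>u (y + w) - u y\<bar> powr p) * indicator D y * indicator D (y + w)) * indicator W w)
    \<le> close_energy p \<delta> D u"
proof -
  have "(\<integral>\<^sup>+w. (\<integral>\<^sup>+y. ennreal (\<bar>u (y + w) - u y\<bar> powr p) * indicator D y * indicator D (y + w)) * indicator W w)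
    = (\<integral>\<^sup>+w. (\<integral>\<^sup>+y. ennreal (\<bar>u (y + w) - u y\<bar> powr p) * indicator D y * indicator D (y + w) * indicator W w))"
    by (simp add: nn_integral_multc)
  also have "\<dots> = (\<integral>\<^sup>+y. (\<integral>\<^sup>+w. ennreal (\<bar>u (y + w) - u y\<bar> powr p) * indicator D y * indicator D (y + w) * indicator W w))"
    by (rule lborel_pair.Fubini') measurable
  also have "\<dots> \<le> (\<integral>\<^sup>+y. (\<integral>\<^sup>+w. ennreal (indicator {..<\<delta>} (norm w) * \<bar>u (y + w) - u y\<bar> powr p) * indicator D y * indicator D (y + w)))"
    using W by (intro nn_integral_mono) (auto simp: indicator_def)
  also have "\<dots> = close_energy p \<delta> D u"
    unfolding kenergy_def
  proof (rule nn_integral_cong)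
    fix y
    show "(\<integral>\<^sup>+w. ennreal (indicator {..<\<delta>} (norm w) * \<bar>u (y + w) - u y\<bar> powr p) * indicator D y * indicator D (y + w))
      = (\<integral>\<^sup>+x. ennreal (indicator {..<\<delta>} (dist y x) * \<bar>u x - u y\<bar> powr p) * indicator D y * indicator D x)"
      using nn_integral_lborel_shift[of "\<lambda>x. ennreal (indicator {..<\<delta>} (dist y x) * \<bar>u x - u y\<bar> powr p) * indicator D y * indicator D x" y]
      by (simp add: dist_norm add.commute)
  qed
  finally show ?thesis .
qed

section \<open>Chains of short steps and the L^p norm on the collar\<close>

context cone_domain
begin

text \<open>Multiplied by 2 / \<delta>, a step lies in \<open>ball e (\<eta> / 2)\<close>, the
  aperture for which \<open>nbhd_enter\<close> holds; and its length stays below \<delta>, so that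
  consecutive points of a chain form a close pair.\<close>

definition steps :: "real \<Rightarrow> 'a \<Rightarrow> 'a set" where
  "steps \<delta> e = ball ((\<delta> / 2) *\<^sub>R e) (\<delta> * \<eta> / 4)"

lemma steps_borel[measurable]: "steps \<delta> e \<in> sets borel"
  by (simp add: steps_def)

lemma steps_subset:
  assumes "norm e = 1" "0 < \<delta>"
  shows "steps \<delta> e \<subseteq> ball 0 \<delta>"
proof
  fix w assume "w \<in> steps \<delta> e"
  then have "dist ((\<delta> / 2) *\<^sub>R e) w < \<delta> * \<eta> / 4" by (simp add: steps_def)
  moreover have "\<delta> * \<eta> / 4 \<le> \<delta> / 4" using assms \<eta>_le_1 by simp
  moreover have "dist 0 ((\<delta> / 2) *\<^sub>R e) = \<delta> / 2" using assms by simp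
  ultimately have "dist 0 w < \<delta>"
    using dist_triangle[of 0 w "(\<delta> / 2) *\<^sub>R e"] assms(2) by linarith
  then show "w \<in> ball 0 \<delta>" by simp
qed

lemma steps_direction:
  assumes "w \<in> steps \<delta> e" "0 < \<delta>"
  shows "(2 / \<delta>) *\<^sub>R w \<in> ball e (\<eta> / 2)"
proof -
  have "e - (2 / \<delta>) *\<^sub>R w = (2 / \<delta>) *\<^sub>R ((\<delta> / 2) *\<^sub>R e - w)"
    using assms by (simp add: scaleR_diff_right)
  then have "norm (e - (2 / \<delta>) *\<^sub>R w) = 2 / \<delta> * norm ((\<delta> / 2) *\<^sub>R e - w)"
    using assms by simp
  also have "\<dots> < 2 / \<delta> * (\<delta> * \<eta> / 4)"
    using assms by (intro mult_strict_left_mono) (auto simp: steps_def dist_norm)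
  finally show ?thesis using assms by (simp add: dist_norm)
qed

lemma chain_value_le:
  assumes e: "cone_at \<Omega> r \<eta> z e" and \<delta>: "0 < \<delta>" "\<delta> \<le> r / 2" and w: "w \<in> steps \<delta> e"
    and A: "A \<in> sets borel" "A \<subseteq> rim \<delta> \<inter> ball z (r / 2)" and K: "real K * (\<delta> / 2) \<le> r"
    and u[measurable]: "u \<in> borel_measurable borel"
  shows "(\<Sum>j<K. \<integral>\<^sup>+x. ennreal (\<bar>u (x + real j *\<^sub>R w)\<bar> powr p) * indicator A x)
    \<le> ennreal (4 / \<eta> + 1) * Lp_energy p (nbhd \<delta>) u"
  using chain_overlap[OF e \<delta> steps_direction[OF w \<delta>(1)] A K, of "\<lambda>x. ennreal (\<bar>u x\<bar> powr p)"] \<delta>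
  by (simp add: Lp_energy_def)

lemma chain_diff_le:
  assumes e: "cone_at \<Omega> r \<eta> z e" and \<delta>: "0 < \<delta>" "\<delta> \<le> r / 2" and w: "w \<in> steps \<delta> e"
    and A: "A \<in> sets borel" "A \<subseteq> rim \<delta> \<inter> ball z (r / 2)" and K: "real K * (\<delta> / 2) \<le> r"
    and u[measurable]: "u \<in> borel_measurable borel"
  shows "(\<Sum>j<K. \<integral>\<^sup>+x. ennreal (chain_jump p u w j x) * indicator A x)
    \<le> ennreal (4 / \<eta> + 1) * (\<integral>\<^sup>+y. ennreal (\<bar>u (y + w) - u y\<bar> powr p) * indicator (nbhd \<delta>) y * indicator (nbhd \<delta>) (y + w))"
proof -
  let ?f = "\<lambda>y. ennreal (\<bar>u (y + w) - u y\<bar> powr p) * indicator (nbhd \<delta>) (y + w)"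
  have "(\<Sum>j<K. \<integral>\<^sup>+x. ennreal (chain_jump p u w j x) * indicator A x)
    = (\<Sum>j<K. \<integral>\<^sup>+x. ?f (x + (real j * (\<delta> / 2)) *\<^sub>R ((2 / \<delta>) *\<^sub>R w)) * indicator A x)"
  proof (intro sum.cong refl nn_integral_cong)
    fix j x assume "j \<in> {..<K}"
    then have "real (Suc j) * (\<delta> / 2) \<le> real K * (\<delta> / 2)" using \<delta> by (intro mult_right_mono) auto
    then have j: "real (Suc j) * (\<delta> / 2) \<le> r" using K by linarith
    have sh: "x + (real j * (\<delta> / 2)) *\<^sub>R ((2 / \<delta>) *\<^sub>R w) = x + real j *\<^sub>R w" using \<delta> by simp
    have sh': "x + real j *\<^sub>R w + w = x + real (Suc j) *\<^sub>R w" by (simp add: algebra_simps)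
    have "x + real (Suc j) *\<^sub>R w \<in> nbhd \<delta>" if "x \<in> A"
    proof -
      have "x + (real (Suc j) * (\<delta> / 2)) *\<^sub>R ((2 / \<delta>) *\<^sub>R w) \<in> nbhd \<delta>"
        using that A(2) j \<delta> \<eta>_pos steps_direction[OF w \<delta>(1)] by (intro nbhd_cone[OF e \<delta>]) auto
      then show ?thesis using \<delta> by simp
    qed
    then show "ennreal (chain_jump p u w j x) * indicator A x =
      ?f (x + (real j * (\<delta> / 2)) *\<^sub>R ((2 / \<delta>) *\<^sub>R w)) * indicator A x"
      unfolding sh sh' by (auto simp: indicator_def)
  qed
  also have "\<dots> \<le> ennreal (4 / \<eta> + 1) * (\<integral>\<^sup>+y. ?f y * indicator (nbhd \<delta>) y)"
    by (rule chain_overlap[OF e \<delta> steps_direction[OF w \<delta>(1)] A K]) measurable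
  finally show ?thesis by (simp add: mult_ac)
qed

text \<open>For a single step the differences are taken along one vector. Integrating over the steps
  turns them into a double integral, hence into \<open>close_energy\<close>; this is why the chains
  are averaged over a full ball of steps.\<close>

lemma chain_diff_average_le:
  assumes e: "cone_at \<Omega> r \<eta> z e" and \<delta>: "0 < \<delta>" "\<delta> \<le> r / 2"
    and A: "A \<in> sets borel" "A \<subseteq> rim \<delta> \<inter> ball z (r / 2)" and K: "real K * (\<delta> / 2) \<le> r"
    and u[measurable]: "u \<in> borel_measurable borel"
  shows "(\<integral>\<^sup>+w. (\<Sum>j<K. \<integral>\<^sup>+x. ennreal (chain_jump p u w j x) * indicator A x) * indicator (steps \<delta> e) w)
    \<le> ennreal (4 / \<eta> + 1) * close_energy p \<delta> (nbhd \<delta>) u"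
proof -
  have ne: "norm e = 1" using e by (simp add: cone_at_def)
  let ?\<Phi> = "\<lambda>w. \<integral>\<^sup>+y. ennreal (\<bar>u (y + w) - u y\<bar> powr p) * indicator (nbhd \<delta>) y * indicator (nbhd \<delta>) (y + w)"
  have "(\<integral>\<^sup>+w. (\<Sum>j<K. \<integral>\<^sup>+x. ennreal (chain_jump p u w j x) * indicator A x) * indicator (steps \<delta> e) w)
    \<le> (\<integral>\<^sup>+w. ennreal (4 / \<eta> + 1) * (?\<Phi> w * indicator (steps \<delta> e) w))"
  proof (rule nn_integral_mono)
    fix w
    show "(\<Sum>j<K. \<integral>\<^sup>+x. ennreal (chain_jump p u w j x) * indicator A x) * indicator (steps \<delta> e) w
      \<le> ennreal (4 / \<eta> + 1) * (?\<Phi> w * indicator (steps \<delta> e) w)"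
      using chain_diff_le[OF e \<delta> _ A K u, of w p] by (cases "w \<in> steps \<delta> e") auto
  qed
  also have "\<dots> = ennreal (4 / \<eta> + 1) * (\<integral>\<^sup>+w. ?\<Phi> w * indicator (steps \<delta> e) w)"
    by (rule nn_integral_cmult) measurable
  also have "\<dots> \<le> ennreal (4 / \<eta> + 1) * close_energy p \<delta> (nbhd \<delta>) u"
    using steps_subset[OF ne \<delta>(1)] by (intro mult_left_mono shift_energy_le_close_energy) auto
  finally show ?thesis .
qed

lemma emeasure_steps:
  "0 < \<delta> \<Longrightarrow> emeasure lborel (steps \<delta> e) = ennreal (unit_ball_vol DIM('a) * (\<delta> * \<eta> / 4) ^ DIM('a))"
  using \<eta>_pos by (simp add: steps_def emeasure_ball_le)

lemma chart_Lp_le: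
  assumes e: "cone_at \<Omega> r \<eta> z e" and \<delta>: "0 < \<delta>" "\<delta> \<le> r / 2" and p: "p > 1"
    and u[measurable]: "u \<in> borel_measurable borel"
  shows "Lp_energy p (rim \<delta> \<inter> ball z (r / 2)) u \<le>
    ennreal (2 powr p * (4 / \<eta> + 1) * (2 * \<delta> / r)) * Lp_energy p (nbhd \<delta>) u +
    ennreal (2 powr p * (4 / \<eta> + 1) * ((r / \<delta>) powr (p - 1) / (unit_ball_vol DIM('a) * (\<delta> * \<eta> / 4) ^ DIM('a)))) * close_energy p \<delta> (nbhd \<delta>) u"
proof -
  define A where "A = rim \<delta> \<inter> ball z (r / 2)"
  have A: "A \<in> sets borel" "A \<subseteq> rim \<delta> \<inter> ball z (r / 2)" by (auto simp: A_def)
  note [measurable] = A(1)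
  \<comment> \<open>A chain this long, with steps of length about \<delta> / 2, stays within the
    range \<open>r\<close> of the cone, and at least r / (2 * \<delta>) points are
    available.\<close>
  define K where "K = nat \<lfloor>r / \<delta>\<rfloor>"
  have rd: "r / \<delta> \<ge> 2" using \<delta> by (simp add: field_simps)
  have K: "real K \<le> r / \<delta>" "r / \<delta> < real K + 1"
    using rd by (auto simp: K_def)
  then have K2: "r / \<delta> \<le> 2 * real K" "real K > 0" using rd by linarith+
  have Kr: "real K * (\<delta> / 2) \<le> r"
    using mult_right_mono[OF K(1), of "\<delta> / 2"] \<delta> r_pos by simp
  define M where "M = 4 / \<eta> + 1"
  have M: "M > 0" using \<eta>_pos by (simp add: M_def add_pos_pos)
  define W where "W = unit_ball_vol DIM('a) * (\<delta> * \<eta> / 4) ^ DIM('a)"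
  have W: "W > 0" using \<delta> \<eta>_pos by (simp add: W_def)
  let ?L = "Lp_energy p (nbhd \<delta>) u"
  let ?N = "close_energy p \<delta> (nbhd \<delta>) u"
  let ?v = "\<lambda>w k x. ennreal (\<bar>u (x + real k *\<^sub>R w)\<bar> powr p)"
  let ?a = "\<lambda>w j x. ennreal (chain_jump p u w j x)"
  have each: "ennreal (real K) * Lp_energy p A u \<le> ennreal (2 powr p) * (ennreal M * ?L + ennreal (real K powr p) * (\<Sum>j<K. \<integral>\<^sup>+x. ?a w j x * indicator A x))"
    if w: "w \<in> steps \<delta> e" for w
  proof -
    have "ennreal (real K) * Lp_energy p A u = (\<integral>\<^sup>+x. ennreal (real K) * (ennreal (\<bar>u x\<bar> powr p) * indicator A x))"
      unfolding Lp_energy_def by (rule nn_integral_cmult[symmetric]) measurable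
    also have "\<dots> \<le> (\<integral>\<^sup>+x. ennreal (2 powr p) * ((\<Sum>k<K. ?v w k x * indicator A x) + ennreal (real K powr p) * (\<Sum>j<K. ?a w j x * indicator A x)))"
    proof (rule nn_integral_mono)
      fix x
      have "ennreal (real K * \<bar>u x\<bar> powr p) \<le> ennreal (2 powr p * ((\<Sum>k<K. \<bar>u (x + real k *\<^sub>R w)\<bar> powr p) +
         real K powr p * (\<Sum>j<K. chain_jump p u w j x)))"
        by (intro ennreal_leI sum_of_chain_powr_le p)
      also have "\<dots> = ennreal (2 powr p) * ((\<Sum>k<K. ?v w k x) + ennreal (real K powr p) * (\<Sum>j<K. ?a w j x))"
        by (simp add: ennreal_mult sum_nonneg sum_ennreal)
      finally show "ennreal (real K) * (ennreal (\<bar>u x\<bar> powr p) * indicator A x) \<le>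
        ennreal (2 powr p) * ((\<Sum>k<K. ?v w k x * indicator A x) + ennreal (real K powr p) * (\<Sum>j<K. ?a w j x * indicator A x))"
        by (cases "x \<in> A") (auto simp: ennreal_mult)
    qed
    also have "\<dots> = ennreal (2 powr p) * ((\<Sum>k<K. \<integral>\<^sup>+x. ?v w k x * indicator A x) + ennreal (real K powr p) * (\<Sum>j<K. \<integral>\<^sup>+x. ?a w j x * indicator A x))"
      by (subst nn_integral_cmult, measurable, subst nn_integral_add, measurable, subst nn_integral_cmult, measurable,
          subst nn_integral_sum, measurable, subst nn_integral_sum, measurable)
    also have "\<dots> \<le> ennreal (2 powr p) * (ennreal M * ?L + ennreal (real K powr p) * (\<Sum>j<K. \<integral>\<^sup>+x. ?a w j x * indicator A x))"
      unfolding M_def by (intro mult_left_mono add_right_mono chain_value_le[OF e \<delta> w A Kr u]) auto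
    finally show ?thesis .
  qed
  have "ennreal (W * real K) * Lp_energy p A u = (\<integral>\<^sup>+w. (ennreal (real K) * Lp_energy p A u) * indicator (steps \<delta> e) w)"
    using W \<delta> by (subst nn_integral_cmult_indicator) (auto simp: emeasure_steps W_def[symmetric] ennreal_mult mult_ac)
  also have "\<dots> \<le> (\<integral>\<^sup>+w. ennreal (2 powr p) * (ennreal M * ?L * indicator (steps \<delta> e) w +
      ennreal (real K powr p) * ((\<Sum>j<K. \<integral>\<^sup>+x. ?a w j x * indicator A x) * indicator (steps \<delta> e) w)))"
    using each by (intro nn_integral_mono) (auto simp: indicator_def)
  also have "\<dots> = ennreal (2 powr p) * (ennreal M * ?L * ennreal W +
      ennreal (real K powr p) * (\<integral>\<^sup>+w. (\<Sum>j<K. \<integral>\<^sup>+x. ?a w j x * indicator A x) * indicator (steps \<delta> e) w))"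
    using \<delta> by (simp add: nn_integral_cmult nn_integral_add nn_integral_cmult_indicator emeasure_steps W_def[symmetric])
  also have "\<dots> \<le> ennreal (2 powr p) * (ennreal M * ?L * ennreal W + ennreal (real K powr p) * (ennreal M * ?N))"
    unfolding M_def by (intro mult_left_mono add_left_mono chain_diff_average_le[OF e \<delta> A Kr u]) auto
  finally have main: "ennreal (W * real K) * Lp_energy p A u \<le> ennreal (2 powr p) * (ennreal M * ?L * ennreal W + ennreal (real K powr p) * (ennreal M * ?N))" .
  have "Lp_energy p A u = ennreal (1 / (W * real K)) * (ennreal (W * real K) * Lp_energy p A u)"
    using W K2 by (simp add: mult.assoc[symmetric] ennreal_mult[symmetric])
  also have "\<dots> \<le> ennreal (1 / (W * real K)) * (ennreal (2 powr p) * (ennreal M * ?L * ennreal W + ennreal (real K powr p) * (ennreal M * ?N)))"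
    by (intro mult_left_mono main) auto
  also have "\<dots> = ennreal (2 powr p * M * (1 / real K)) * ?L + ennreal (2 powr p * M * (real K powr p / real K / W)) * ?N"
  proof -
    have 1: "ennreal (2 powr p * M * (1 / real K)) = ennreal (1 / (W * real K)) * (ennreal (2 powr p) * (ennreal M * ennreal W))"
      using W K2 M by (simp add: ennreal_mult[symmetric])
    have 2: "ennreal (2 powr p * M * (real K powr p / real K / W)) = ennreal (1 / (W * real K)) * (ennreal (2 powr p) * (ennreal (real K powr p) * ennreal M))"
      using W K2 M by (simp add: ennreal_mult[symmetric] mult_ac)
    show ?thesis unfolding 1 2 by (simp add: distrib_left mult_ac)
  qed
  also have "\<dots> \<le> ennreal (2 powr p * M * (2 * \<delta> / r)) * ?L + ennreal (2 powr p * M * ((r / \<delta>) powr (p - 1) / W)) * ?N"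
  proof (intro add_mono mult_right_mono ennreal_leI mult_left_mono)
    show "1 / real K \<le> 2 * \<delta> / r" using K2 \<delta> r_pos by (simp add: field_simps)
    have "real K powr p / real K = real K powr (p - 1)" using K2 by (simp add: powr_diff)
    also have "\<dots> \<le> (r / \<delta>) powr (p - 1)" using K p by (intro powr_mono2) auto
    finally show "real K powr p / real K / W \<le> (r / \<delta>) powr (p - 1) / W" using W by (intro divide_right_mono) auto
  qed (use M in auto)
  finally show ?thesis by (simp add: A_def M_def W_def)
qed

section \<open>Long-range pairs in one chart\<close>

definition chain_part :: "real \<Rightarrow> real \<Rightarrow> 'a \<Rightarrow> ('a \<Rightarrow> real) \<Rightarrow> nat \<Rightarrow> 'a \<Rightarrow> ennreal" where
  "chain_part p \<delta> e u j x = (\<integral>\<^sup>+w. ennreal (chain_jump p u w j x) * indicator (steps \<delta> e) w)"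

lemma chain_part_measurable:
  assumes [measurable]: "u \<in> borel_measurable borel"
  shows "chain_part p \<delta> e u j \<in> borel_measurable borel"
  unfolding chain_part_def[abs_def] by measurable

lemma sum_chain_part_le:
  assumes e: "cone_at \<Omega> r \<eta> z e" and \<delta>: "0 < \<delta>" "\<delta> \<le> r / 2"
    and A: "A \<in> sets borel" "A \<subseteq> rim \<delta> \<inter> ball z (r / 2)" and K: "real K * (\<delta> / 2) \<le> r"
    and u[measurable]: "u \<in> borel_measurable borel"
  shows "(\<Sum>j<K. \<integral>\<^sup>+x. chain_part p \<delta> e u j x * indicator A x)
    \<le> ennreal (4 / \<eta> + 1) * close_energy p \<delta> (nbhd \<delta>) u"
proof -
  note [measurable] = A(1)
  let ?a = "\<lambda>w j x. ennreal (chain_jump p u w j x)"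
  have "(\<Sum>j<K. \<integral>\<^sup>+x. chain_part p \<delta> e u j x * indicator A x)
    = (\<Sum>j<K. \<integral>\<^sup>+w. (\<integral>\<^sup>+x. ?a w j x * indicator A x) * indicator (steps \<delta> e) w)"
  proof (intro sum.cong refl)
    fix j
    have "(\<integral>\<^sup>+x. chain_part p \<delta> e u j x * indicator A x) = (\<integral>\<^sup>+x. \<integral>\<^sup>+w. ?a w j x * indicator (steps \<delta> e) w * indicator A x)"
      unfolding chain_part_def by (subst nn_integral_multc[symmetric]) measurable
    also have "\<dots> = (\<integral>\<^sup>+w. \<integral>\<^sup>+x. ?a w j x * indicator (steps \<delta> e) w * indicator A x)"
      by (rule lborel_pair.Fubini') measurable
    also have "\<dots> = (\<integral>\<^sup>+w. (\<integral>\<^sup>+x. ?a w j x * indicator A x) * indicator (steps \<delta> e) w)"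
    proof (rule nn_integral_cong)
      fix w
      show "(\<integral>\<^sup>+x. ?a w j x * indicator (steps \<delta> e) w * indicator A x) = (\<integral>\<^sup>+x. ?a w j x * indicator A x) * indicator (steps \<delta> e) w"
        by (cases "w \<in> steps \<delta> e") auto
    qed
    finally show "(\<integral>\<^sup>+x. chain_part p \<delta> e u j x * indicator A x) = (\<integral>\<^sup>+w. (\<integral>\<^sup>+x. ?a w j x * indicator A x) * indicator (steps \<delta> e) w)" .
  qed
  also have "\<dots> = (\<integral>\<^sup>+w. (\<Sum>j<K. \<integral>\<^sup>+x. ?a w j x * indicator A x) * indicator (steps \<delta> e) w)"
    by (subst nn_integral_sum[symmetric]) (measurable, simp add: sum_distrib_right)
  also have "\<dots> \<le> ennreal (4 / \<eta> + 1) * close_energy p \<delta> (nbhd \<delta>) u"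
    by (rule chain_diff_average_le[OF e \<delta> A K u])
  finally show ?thesis .
qed

text \<open>Coefficient of link \<open>j\<close> for a pair at distance \<rho>: the kernel times the
  Hardy factor \<open>(2 * sqrt K) powr (p - 1)\<close> with K \<le> 9 * \<rho> / (\<delta> *
  \<eta>), whence 6 = 2 * 3. The indicator records that link \<open>j\<close> is used only by pairs
  whose chains are longer than \<open>j\<close>, that is, with \<rho> at least of order (j + 1) *
  \<delta>.\<close>

definition far_weight :: "real \<Rightarrow> real \<Rightarrow> nat \<Rightarrow> real \<Rightarrow> real" where
  "far_weight p \<delta> j \<rho> = 6 powr (p - 1) * (\<delta> * \<eta>) powr (- (p - 1) / 2) *
     (\<rho> powr (- (real DIM('a) - 1) - (p - 1) / 2) * indicator {max (real (Suc j) * \<delta> * \<eta> / 16) \<delta>..} \<rho>)"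

lemma far_weight_nonneg: "0 \<le> far_weight p \<delta> j \<rho>"
  by (simp add: far_weight_def)

lemma far_weight_measurable[measurable]: "far_weight p \<delta> j \<in> borel_measurable borel"
  unfolding far_weight_def[abs_def] by measurable

definition far_part :: "real \<Rightarrow> real \<Rightarrow> 'a \<Rightarrow> ('a \<Rightarrow> real) \<Rightarrow> nat \<Rightarrow> 'a \<Rightarrow> real \<Rightarrow> ennreal" where
  "far_part p \<delta> e u N x \<rho> = (\<Sum>j<N. ennreal (far_weight p \<delta> j \<rho> * real (Suc j) powr ((p - 1) / 2)) * chain_part p \<delta> e u j x)"

lemma chain_le_far_part:
  assumes \<delta>: "0 < \<delta>" and p: "p > 1" and u[measurable]: "u \<in> borel_measurable borel"
    and \<rho>: "\<delta> \<le> \<rho>" and K: "real K < 8 * \<rho> / (\<delta> * \<eta>) + 1" "K \<le> N"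
  shows "ennreal (\<rho> powr (- (real DIM('a) + p - 2))) * (\<integral>\<^sup>+w. ennreal (\<bar>u x - u (x + real K *\<^sub>R w)\<bar> powr p) * indicator (steps \<delta> e) w)
    \<le> far_part p \<delta> e u N x \<rho>"
proof -
  define \<alpha> where "\<alpha> = (p - 1) / 2"
  have \<alpha>: "\<alpha> > 0" using p by (simp add: \<alpha>_def)
  have \<rho>0: "\<rho> > 0" using \<delta> \<rho> by linarith
  have \<delta>\<eta>: "0 < \<delta> * \<eta>" "\<delta> * \<eta> \<le> \<rho>"
  proof -
    show "0 < \<delta> * \<eta>" using \<delta> \<eta>_pos by simp
    have "\<delta> * \<eta> \<le> \<delta> * 1" using \<delta> \<eta>_le_1 by (intro mult_left_mono) auto
    then show "\<delta> * \<eta> \<le> \<rho>" using \<rho> by linarith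
  qed
  let ?q = "\<rho> powr (- (real DIM('a) + p - 2))"
  let ?a = "\<lambda>w j. chain_jump p u w j x"
  let ?c = "\<lambda>j. far_weight p \<delta> j \<rho> * real (Suc j) powr \<alpha>"
  have K9: "real K \<le> 9 * (\<rho> / (\<delta> * \<eta>))"
  proof -
    have "1 \<le> \<rho> / (\<delta> * \<eta>)" using \<delta>\<eta> by simp
    then show ?thesis using K(1) by simp
  qed
  \<comment> \<open>For j < K the bound on \<open>K\<close> gives j * \<delta> * \<eta> < 8 *
    \<rho>. So the indicator in \<open>far_weight\<close> is 1; the 16 leaves room for the passage
    from \<open>j\<close> to j + 1.\<close>
  have coef: "?q * ((2 * sqrt (real K)) powr (p - 1) * real (Suc j) powr \<alpha>) \<le> ?c j" if j: "j < K" for j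
  proof -
    have "real j < 8 * \<rho> / (\<delta> * \<eta>)" using j K(1) by linarith
    then have "real j * (\<delta> * \<eta>) < 8 * \<rho>" using \<delta>\<eta> by (simp add: field_simps)
    then have "real (Suc j) * \<delta> * \<eta> / 16 \<le> \<rho>" using \<delta>\<eta> by (simp add: algebra_simps)
    then have ind: "indicator {max (real (Suc j) * \<delta> * \<eta> / 16) \<delta>..} \<rho> = (1::real)" using \<rho> by simp
    have "2 * sqrt (real K) \<le> 2 * sqrt (9 * (\<rho> / (\<delta> * \<eta>)))" using K9 by simp
    also have "\<dots> = 6 * sqrt (\<rho> / (\<delta> * \<eta>))"
    proof -
      have "sqrt 9 = (3::real)" by (rule real_sqrt_unique) auto
      then show ?thesis by (simp only: real_sqrt_mult[of 9 "\<rho> / (\<delta> * \<eta>)"])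
    qed
    finally have "(2 * sqrt (real K)) powr (p - 1) \<le> (6 * sqrt (\<rho> / (\<delta> * \<eta>))) powr (p - 1)"
      using p by (intro powr_mono2) auto
    also have "\<dots> = 6 powr (p - 1) * (\<rho> / (\<delta> * \<eta>)) powr \<alpha>"
      using \<rho>0 \<delta>\<eta> by (simp add: powr_mult powr_half_sqrt[symmetric] powr_powr \<alpha>_def)
    finally have "?q * (2 * sqrt (real K)) powr (p - 1) \<le> ?q * (6 powr (p - 1) * (\<rho> / (\<delta> * \<eta>)) powr \<alpha>)"
      by (intro mult_left_mono) auto
    also have "\<dots> = 6 powr (p - 1) * (\<delta> * \<eta>) powr (- \<alpha>) * (?q * \<rho> powr \<alpha>)"
      using \<rho>0 \<delta>\<eta> by (simp add: powr_divide powr_minus field_simps)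
    also have "?q * \<rho> powr \<alpha> = \<rho> powr (- (real DIM('a) - 1) - \<alpha>)"
    proof -
      have "- (real DIM('a) + p - 2) + \<alpha> = - (real DIM('a) - 1) - \<alpha>" by (simp add: \<alpha>_def field_simps)
      then show ?thesis by (simp only: powr_add[symmetric])
    qed
    also have "6 powr (p - 1) * (\<delta> * \<eta>) powr (- \<alpha>) * \<rho> powr (- (real DIM('a) - 1) - \<alpha>) = far_weight p \<delta> j \<rho>"
    proof -
      have "- (p - 1) / 2 = - \<alpha>" by (simp add: \<alpha>_def field_simps)
      then show ?thesis by (simp only: far_weight_def ind mult_1_right \<alpha>_def[symmetric])
    qed
    finally have "?q * (2 * sqrt (real K)) powr (p - 1) * real (Suc j) powr \<alpha> \<le> far_weight p \<delta> j \<rho> * real (Suc j) powr \<alpha>"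
      by (intro mult_right_mono) auto
    then show ?thesis by (simp only: mult.assoc)
  qed
  have "ennreal ?q * (\<integral>\<^sup>+w. ennreal (\<bar>u x - u (x + real K *\<^sub>R w)\<bar> powr p) * indicator (steps \<delta> e) w)
    = (\<integral>\<^sup>+w. ennreal ?q * (ennreal (\<bar>u x - u (x + real K *\<^sub>R w)\<bar> powr p) * indicator (steps \<delta> e) w))"
    by (rule nn_integral_cmult[symmetric]) measurable
  also have "\<dots> \<le> (\<integral>\<^sup>+w. (\<Sum>j<N. ennreal (?c j) * (ennreal (?a w j) * indicator (steps \<delta> e) w)))"
  proof (rule nn_integral_mono)
    fix w
    have "?q * \<bar>u x - u (x + real K *\<^sub>R w)\<bar> powr p \<le> ?q * ((2 * sqrt (real K)) powr (p - 1) * (\<Sum>j<K. real (Suc j) powr \<alpha> * ?a w j))"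
      unfolding \<alpha>_def by (intro mult_left_mono powr_diff_chain_le p) auto
    also have "\<dots> = (\<Sum>j<K. ?q * ((2 * sqrt (real K)) powr (p - 1) * real (Suc j) powr \<alpha>) * ?a w j)"
      by (simp only: sum_distrib_left mult.assoc)
    also have "\<dots> \<le> (\<Sum>j<K. ?c j * ?a w j)"
      using coef by (intro sum_mono mult_right_mono) auto
    also have "\<dots> \<le> (\<Sum>j<N. ?c j * ?a w j)"
      using K(2) by (intro sum_mono2) (auto intro!: mult_nonneg_nonneg far_weight_nonneg)
    finally have le: "?q * \<bar>u x - u (x + real K *\<^sub>R w)\<bar> powr p \<le> (\<Sum>j<N. ?c j * ?a w j)" .
    have "ennreal ?q * ennreal (\<bar>u x - u (x + real K *\<^sub>R w)\<bar> powr p) \<le> (\<Sum>j<N. ennreal (?c j) * ennreal (?a w j))"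
    proof -
      have "(\<Sum>j<N. ennreal (?c j) * ennreal (?a w j)) = (\<Sum>j<N. ennreal (?c j * ?a w j))"
        by (intro sum.cong refl ennreal_mult[symmetric] mult_nonneg_nonneg far_weight_nonneg) auto
      also have "\<dots> = ennreal (\<Sum>j<N. ?c j * ?a w j)"
        by (intro sum_ennreal mult_nonneg_nonneg far_weight_nonneg) auto
      finally show ?thesis using le by (simp add: ennreal_mult[symmetric] ennreal_leI)
    qed
    then show "ennreal ?q * (ennreal (\<bar>u x - u (x + real K *\<^sub>R w)\<bar> powr p) * indicator (steps \<delta> e) w) \<le> (\<Sum>j<N. ennreal (?c j) * (ennreal (?a w j) * indicator (steps \<delta> e) w))"
      by (cases "w \<in> steps \<delta> e") auto
  qed
  also have "\<dots> = far_part p \<delta> e u N x \<rho>"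
    unfolding far_part_def chain_part_def \<alpha>_def
    by (subst nn_integral_sum, measurable, subst nn_integral_cmult, measurable)
  finally show ?thesis .
qed

text \<open>Two chains starting at \<open>x\<close> and \<open>y\<close> with steps \<open>w\<close> and \<open>w + (x - y) / K\<close> meet after \<open>K\<close> steps.\<close>

lemma far_pair_le:
  assumes \<delta>: "0 < \<delta>" and p: "p > 1" and u[measurable]: "u \<in> borel_measurable borel"
    and xy: "\<delta> \<le> dist x y" "dist x y \<le> r * \<eta> / 8"
  shows "ennreal (unit_ball_vol DIM('a) * (\<delta> * \<eta> / 8) ^ DIM('a) * (dist x y powr (- (real DIM('a) + p - 2)) * \<bar>u y - u x\<bar> powr p))
    \<le> ennreal (2 powr p) * (far_part p \<delta> e u (nat \<lfloor>2 * r / \<delta>\<rfloor>) x (dist x y) + far_part p \<delta> e u (nat \<lfloor>2 * r / \<delta>\<rfloor>) y (dist x y))"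
proof -
  define \<rho> where "\<rho> = dist x y"
  define N where "N = nat \<lfloor>2 * r / \<delta>\<rfloor>"
  have \<rho>: "\<rho> > 0" "\<delta> \<le> \<rho>" "\<rho> \<le> r * \<eta> / 8" using \<delta> xy by (auto simp: \<rho>_def)
  have \<delta>\<eta>: "0 < \<delta> * \<eta>" "\<delta> * \<eta> \<le> \<rho>"
  proof -
    show "0 < \<delta> * \<eta>" using \<delta> \<eta>_pos by simp
    have "\<delta> * \<eta> \<le> \<delta> * 1" using \<delta> \<eta>_le_1 by (intro mult_left_mono) auto
    then show "\<delta> * \<eta> \<le> \<rho>" using \<rho> by linarith
  qed
  \<comment> \<open>With this many steps the correction (x - y) / K has norm at most \<delta> *
    \<eta> / 8, half the radius of \<open>steps\<close>. For \<open>w\<close> in the concentric ball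
    \<open>W\<close> of half that radius both chains therefore use admissible steps.\<close>
  define K where "K = nat \<lceil>8 * \<rho> / (\<delta> * \<eta>)\<rceil>"
  have q0: "8 * \<rho> / (\<delta> * \<eta>) > 0" using \<rho> \<delta>\<eta> by simp
  then have K: "8 * \<rho> / (\<delta> * \<eta>) \<le> real K" "real K < 8 * \<rho> / (\<delta> * \<eta>) + 1"
    by (auto simp: K_def) linarith
  have K0: "real K > 0" using K q0 by linarith
  \<comment> \<open>Uses \<rho> \<le> r * \<eta> / 8. All chains then fit into one common number
    \<open>N\<close> of links, and \<open>N\<close> steps of length \<delta> / 2 do not exceed
    \<open>r\<close>.\<close>
  have KN: "K \<le> N"
  proof -
    have "1 \<le> \<rho> / (\<delta> * \<eta>)" using \<delta>\<eta> by simp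
    then have "real K \<le> 9 * (\<rho> / (\<delta> * \<eta>))" using K(2) by simp
    also have "\<dots> \<le> 9 * ((r * \<eta> / 8) / (\<delta> * \<eta>))" using \<rho> \<delta>\<eta> by (intro mult_left_mono divide_right_mono) auto
    also have "\<dots> \<le> 2 * r / \<delta>" using \<eta>_pos \<delta> r_pos by (simp add: field_simps)
    finally show ?thesis unfolding N_def by (rule le_nat_floor)
  qed
  define c where "c = (x - y) /\<^sub>R real K"
  have c: "norm c \<le> \<delta> * \<eta> / 8"
  proof -
    have "norm c = \<rho> / real K" using K0 by (simp add: c_def \<rho>_def dist_norm divide_inverse mult.commute)
    also have "\<dots> \<le> \<rho> / (8 * \<rho> / (\<delta> * \<eta>))" using K q0 \<rho> by (intro divide_left_mono mult_pos_pos) auto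
    also have "\<dots> = \<delta> * \<eta> / 8" using \<rho> \<delta>\<eta> by simp
    finally show ?thesis .
  qed
  define W where "W = ball ((\<delta> / 2) *\<^sub>R e) (\<delta> * \<eta> / 8)"
  have W: "w \<in> steps \<delta> e" "w + c \<in> steps \<delta> e" if "w \<in> W" for w
  proof -
    have "dist ((\<delta> / 2) *\<^sub>R e) w < \<delta> * \<eta> / 8" using that by (simp add: W_def)
    moreover have "dist ((\<delta> / 2) *\<^sub>R e) (w + c) \<le> dist ((\<delta> / 2) *\<^sub>R e) w + norm c"
      using dist_triangle[of "(\<delta> / 2) *\<^sub>R e" "w + c" w] by (simp add: dist_norm)
    ultimately show "w \<in> steps \<delta> e" "w + c \<in> steps \<delta> e" using c \<delta>\<eta>(1) by (auto simp: steps_def)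
  qed
  have meet: "x + real K *\<^sub>R w = y + real K *\<^sub>R (w + c)" for w
    using K0 by (simp add: c_def scaleR_add_right)
  define vol where "vol = unit_ball_vol DIM('a) * (\<delta> * \<eta> / 8) ^ DIM('a)"
  have vol: "emeasure lborel W = ennreal vol" "vol \<ge> 0"
    using \<delta>\<eta> by (auto simp: W_def vol_def emeasure_ball_le)
  let ?I = "\<lambda>x. \<integral>\<^sup>+w. ennreal (\<bar>u x - u (x + real K *\<^sub>R w)\<bar> powr p) * indicator (steps \<delta> e) w"
  have [measurable]: "W \<in> sets borel" by (simp add: W_def)
  have "ennreal (vol * \<bar>u y - u x\<bar> powr p) = (\<integral>\<^sup>+w. ennreal (\<bar>u y - u x\<bar> powr p) * indicator W w)"
    using vol by (subst nn_integral_cmult_indicator) (auto simp: ennreal_mult mult.commute)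
  also have "\<dots> \<le> (\<integral>\<^sup>+w. ennreal (2 powr p) * (ennreal (\<bar>u x - u (x + real K *\<^sub>R w)\<bar> powr p) * indicator (steps \<delta> e) w +
      ennreal (\<bar>u y - u (y + real K *\<^sub>R (w + c))\<bar> powr p) * indicator (steps \<delta> e) (w + c)))"
  proof (rule nn_integral_mono)
    fix w
    have "\<bar>u y - u x\<bar> powr p \<le> 2 powr p * (\<bar>u x - u (x + real K *\<^sub>R w)\<bar> powr p + \<bar>u y - u (y + real K *\<^sub>R (w + c))\<bar> powr p)"
      using powr_abs_add_le[of p "u x - u (x + real K *\<^sub>R w)" "- (u y - u (y + real K *\<^sub>R (w + c)))"] p
      unfolding meet by (simp add: abs_minus_commute)
    then show "ennreal (\<bar>u y - u x\<bar> powr p) * indicator W w \<le> ennreal (2 powr p) * (ennreal (\<bar>u x - u (x + real K *\<^sub>R w)\<bar> powr p) * indicator (steps \<delta> e) w +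
      ennreal (\<bar>u y - u (y + real K *\<^sub>R (w + c))\<bar> powr p) * indicator (steps \<delta> e) (w + c))"
      using W[of w] by (cases "w \<in> W")
        (simp_all add: ennreal_mult[symmetric] ennreal_plus[symmetric] ennreal_leI del: ennreal_plus)
  qed
  also have "\<dots> = ennreal (2 powr p) * (?I x + (\<integral>\<^sup>+w. ennreal (\<bar>u y - u (y + real K *\<^sub>R (w + c))\<bar> powr p) * indicator (steps \<delta> e) (w + c)))"
    by (subst nn_integral_cmult, measurable, subst nn_integral_add, measurable)
  also have "(\<integral>\<^sup>+w. ennreal (\<bar>u y - u (y + real K *\<^sub>R (w + c))\<bar> powr p) * indicator (steps \<delta> e) (w + c)) = ?I y"
    by (rule nn_integral_lborel_shift) measurable
  finally have main: "ennreal (vol * \<bar>u y - u x\<bar> powr p) \<le> ennreal (2 powr p) * (?I x + ?I y)" .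
  let ?q = "\<rho> powr (- (real DIM('a) + p - 2))"
  have "ennreal (vol * (?q * \<bar>u y - u x\<bar> powr p)) = ennreal ?q * ennreal (vol * \<bar>u y - u x\<bar> powr p)"
    using vol by (simp add: ennreal_mult[symmetric] mult_ac)
  also have "\<dots> \<le> ennreal ?q * (ennreal (2 powr p) * (?I x + ?I y))"
    by (intro mult_left_mono main) auto
  also have "\<dots> = ennreal (2 powr p) * (ennreal ?q * ?I x + ennreal ?q * ?I y)"
    by (simp add: distrib_left mult_ac)
  also have "\<dots> \<le> ennreal (2 powr p) * (far_part p \<delta> e u N x \<rho> + far_part p \<delta> e u N y \<rho>)"
    by (intro mult_left_mono add_mono chain_le_far_part \<delta> p u \<rho> K KN) auto
  finally show ?thesis by (simp add: vol_def \<rho>_def N_def)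
qed

end

lemma kenergy_subset_mono: "U \<subseteq> V \<Longrightarrow> kenergy \<kappa> p U u \<le> kenergy \<kappa> p V u"
  unfolding kenergy_def by (intro nn_integral_mono) (auto simp: indicator_def)

context cone_domain
begin

text \<open>Over the (d-1)-dimensional collar the tail of \<rho>^(-(d-1)-(p-1)/2) from (j + 1) *
  \<delta> * \<eta> / 16 on is of order ((j + 1) * \<delta>)^(-(p-1)/2), times \<delta> for the
  width of the collar. The power of j + 1 is exactly the inverse of the one paid in
  \<open>powr_diff_chain_le\<close>.\<close>

lemma far_weight_integral_le:
  assumes p: "p > 1"
  shows "\<exists>C>0. \<forall>\<delta> x j. 0 < \<delta> \<longrightarrow> \<delta> < r * \<eta> / 16 \<longrightarrow>
    (\<integral>\<^sup>+y. ennreal (far_weight p \<delta> j (dist x y)) * indicator (rim \<delta>) y) \<le>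
      ennreal (C * \<delta> powr (2 - p) * real (Suc j) powr (- (p - 1) / 2))"
proof -
  obtain C0 where C0: "C0 > 0" and meas: "\<And>\<delta> x \<rho>. 0 < \<delta> \<Longrightarrow> \<delta> < r * \<eta> / 16 \<Longrightarrow> \<delta> \<le> \<rho> \<Longrightarrow>
     emeasure lborel (rim \<delta> \<inter> cball x \<rho>) \<le> ennreal (C0 * \<delta> * \<rho> powr (real DIM('a) - 1))"
    using collar_ball_measure by blast
  define \<alpha> where "\<alpha> = (p - 1) / 2"
  have \<alpha>: "\<alpha> > 0" "- (p - 1) / 2 = - \<alpha>" using p by (auto simp: \<alpha>_def field_simps)
  define s where "s = real DIM('a) - 1"
  define B where "B = 2 powr (\<bar>s + \<alpha>\<bar> + 1) / \<alpha>"
  define C where "C = 6 powr (p - 1) * \<eta> powr (- \<alpha>) * B * C0 * (\<eta> / 16) powr (- \<alpha>)"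
  show ?thesis
  proof (intro exI conjI allI impI)
    show "C > 0" using \<eta>_pos C0 \<alpha> by (simp add: C_def B_def)
    fix \<delta> x j assume \<delta>: "0 < \<delta>" "\<delta> < r * \<eta> / 16"
    define \<tau> where "\<tau> = max (real (Suc j) * \<delta> * \<eta> / 16) \<delta>"
    have \<tau>: "\<tau> > 0" "\<delta> \<le> \<tau>" using \<delta> by (auto simp: \<tau>_def)
    define c where "c = 6 powr (p - 1) * (\<delta> * \<eta>) powr (- \<alpha>)"
    have "(\<integral>\<^sup>+y. ennreal (far_weight p \<delta> j (dist x y)) * indicator (rim \<delta>) y)
      = (\<integral>\<^sup>+y. ennreal c * (ennreal (dist x y powr (- s - \<alpha>)) * indicator (rim \<delta>) y * indicator {\<tau>..} (dist x y)))"
      unfolding far_weight_def \<alpha>(2) \<tau>_def[symmetric] c_def[symmetric] s_def[symmetric] \<alpha>_def[symmetric]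
      by (intro nn_integral_cong) (auto simp: indicator_def ennreal_mult c_def)
    also have "\<dots> = ennreal c * (\<integral>\<^sup>+y. ennreal (dist x y powr (- s - \<alpha>)) * indicator (rim \<delta>) y * indicator {\<tau>..} (dist x y))"
      by (rule nn_integral_cmult) measurable
    also have "\<dots> \<le> ennreal c * ennreal (2 powr (\<bar>s + \<alpha>\<bar> + 1) * (C0 * \<delta>) * (\<tau> powr (- \<alpha>) / \<alpha>))"
      unfolding s_def using \<alpha> \<tau> C0 \<delta>
      by (intro mult_left_mono nn_integral_dist_powr_tail_le meas) auto
    also have "\<dots> = ennreal (c * (B * (C0 * \<delta>)) * \<tau> powr (- \<alpha>))"
      using C0 \<delta> \<alpha> by (simp add: ennreal_mult[symmetric] c_def B_def mult_ac)
    also have "\<dots> \<le> ennreal (c * (B * (C0 * \<delta>)) * (real (Suc j) * \<delta> * \<eta> / 16) powr (- \<alpha>))"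
      using \<delta> \<eta>_pos \<alpha> C0 by (intro ennreal_leI mult_left_mono powr_mono2') (auto simp: \<tau>_def c_def B_def)
    also have "c * (B * (C0 * \<delta>)) * (real (Suc j) * \<delta> * \<eta> / 16) powr (- \<alpha>) = C * \<delta> powr (2 - p) * real (Suc j) powr (- \<alpha>)"
    proof -
      have 1: "(real (Suc j) * \<delta> * \<eta> / 16) powr (- \<alpha>) = real (Suc j) powr (- \<alpha>) * \<delta> powr (- \<alpha>) * (\<eta> / 16) powr (- \<alpha>)"
        using \<delta> \<eta>_pos by (simp add: powr_mult[symmetric] del: of_nat_Suc)
      have 2: "c = 6 powr (p - 1) * \<delta> powr (- \<alpha>) * \<eta> powr (- \<alpha>)"
        using \<delta> \<eta>_pos by (simp add: c_def powr_mult)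
      have eqn: "- \<alpha> + (1 + (- \<alpha>)) = 2 - p" by (simp add: \<alpha>_def field_simps)
      then have 3: "\<delta> powr (2 - p) = \<delta> powr (- \<alpha>) * (\<delta> * \<delta> powr (- \<alpha>))"
      proof -
        have "\<delta> powr (- \<alpha> + (1 + (- \<alpha>))) = \<delta> powr (- \<alpha>) * (\<delta> powr 1 * \<delta> powr (- \<alpha>))"
          by (simp only: powr_add)
        moreover have "\<delta> powr 1 = \<delta>" using \<delta> by simp
        ultimately show ?thesis by (simp only: eqn)
      qed
      show ?thesis unfolding 1 2 3 C_def by (simp only: mult_ac)
    qed
    finally show "(\<integral>\<^sup>+y. ennreal (far_weight p \<delta> j (dist x y)) * indicator (rim \<delta>) y) \<le>
      ennreal (C * \<delta> powr (2 - p) * real (Suc j) powr (- (p - 1) / 2))" unfolding \<alpha>(2) .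
  qed
qed

text \<open>By symmetry one of the two chains suffices. Integrating out the other endpoint first
  gives all links the same coefficient, so a plain sum over the links remains, to which bounded
  overlap applies.\<close>

lemma chart_far_le:
  assumes p: "p > 1"
  shows "\<exists>C>0. \<forall>\<delta> z e u. cone_at \<Omega> r \<eta> z e \<longrightarrow> 0 < \<delta> \<longrightarrow> \<delta> < r * \<eta> / 16 \<longrightarrow> u \<in> borel_measurable borel \<longrightarrow>
    kenergy (\<lambda>\<rho>. \<rho> powr (- (real DIM('a) + p - 2)) * indicator {\<delta>..r * \<eta> / 8} \<rho>) p (rim \<delta> \<inter> ball z (r / 2)) u
      \<le> ennreal (C * \<delta> powr (2 - p - DIM('a))) * close_energy p \<delta> (nbhd \<delta>) u"
proof -
  obtain C1 where C1: "C1 > 0" and fw: "\<And>\<delta> x j. 0 < \<delta> \<Longrightarrow> \<delta> < r * \<eta> / 16 \<Longrightarrow>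
    (\<integral>\<^sup>+y. ennreal (far_weight p \<delta> j (dist x y)) * indicator (rim \<delta>) y) \<le>
      ennreal (C1 * \<delta> powr (2 - p) * real (Suc j) powr (- (p - 1) / 2))"
    using far_weight_integral_le[OF p] by blast
  define v0 where "v0 = unit_ball_vol DIM('a) * (\<eta> / 8) ^ DIM('a)"
  have v0: "v0 > 0" using \<eta>_pos by (simp add: v0_def)
  define M where "M = 4 / \<eta> + 1"
  have M: "M > 0" using \<eta>_pos by (simp add: M_def add_pos_pos)
  show ?thesis
  proof (intro exI conjI allI impI)
    show "2 * 2 powr p * C1 * M / v0 > 0" using C1 M v0 by simp
    fix \<delta> z e and u :: "'a \<Rightarrow> real"
    assume e: "cone_at \<Omega> r \<eta> z e" and \<delta>: "0 < \<delta>" "\<delta> < r * \<eta> / 16" and u[measurable]: "u \<in> borel_measurable borel"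
    have r\<eta>: "r * \<eta> \<le> r" using \<eta>_le_1 r_pos by simp
    then have \<delta>r: "\<delta> \<le> r / 2" using \<delta> r_pos by linarith
    define A where "A = rim \<delta> \<inter> ball z (r / 2)"
    have A: "A \<in> sets borel" "A \<subseteq> rim \<delta> \<inter> ball z (r / 2)" by (auto simp: A_def)
    note [measurable] = A(1) chain_part_measurable[OF u]
    define N where "N = nat \<lfloor>2 * r / \<delta>\<rfloor>"
    have "real N \<le> 2 * r / \<delta>" using r_pos \<delta> by (simp add: N_def)
    then have N: "real N * (\<delta> / 2) \<le> r" using \<delta> by (simp add: field_simps)
    define R where "R x y = far_part p \<delta> e u N x (dist x y)" for x y
    have Rm[measurable]: "(\<lambda>w. R (fst w) (snd w)) \<in> borel_measurable (borel \<Otimes>\<^sub>M borel)"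
      unfolding R_def far_part_def by measurable
    define F where "F x y = R x y * indicator A x * indicator A y" for x y
    have Fm: "(\<lambda>w. F (fst w) (snd w)) \<in> borel_measurable (borel \<Otimes>\<^sub>M borel)"
      unfolding F_def by measurable
    have Fm': "(\<lambda>w. F (snd w) (fst w)) \<in> borel_measurable (borel \<Otimes>\<^sub>M borel)"
      using measurable_compose[OF _ Fm, of "\<lambda>w. (snd w, fst w)"] by simp
    define vol where "vol = unit_ball_vol DIM('a) * (\<delta> * \<eta> / 8) ^ DIM('a)"
    have vol: "vol = v0 * \<delta> ^ DIM('a)" by (simp add: vol_def v0_def power_mult_distrib power_divide)
    then have vol0: "vol > 0" using v0 \<delta> by simp
    let ?\<kappa> = "\<lambda>\<rho>. \<rho> powr (- (real DIM('a) + p - 2)) * indicator {\<delta>..r * \<eta> / 8} \<rho>"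
    have "ennreal vol * kenergy ?\<kappa> p A u = kenergy (\<lambda>r. vol * ?\<kappa> r) p A u"
      using vol0 by (intro kenergy_cmult[symmetric]) auto
    also have "\<dots> \<le> (\<integral>\<^sup>+x. \<integral>\<^sup>+y. ennreal (2 powr p) * (F x y + F y x))"
      unfolding kenergy_def
    proof (intro nn_integral_mono)
      fix x y
      show "ennreal (vol * ?\<kappa> (dist x y) * \<bar>u y - u x\<bar> powr p) * indicator A x * indicator A y \<le> ennreal (2 powr p) * (F x y + F y x)"
      proof (cases "x \<in> A \<and> y \<in> A \<and> \<delta> \<le> dist x y \<and> dist x y \<le> r * \<eta> / 8")
        case True
        have "ennreal (vol * (dist x y powr (- (real DIM('a) + p - 2)) * \<bar>u y - u x\<bar> powr p)) \<le> ennreal (2 powr p) * (R x y + R y x)"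
          using far_pair_le[OF \<delta>(1) p u, of x y e] True by (simp add: R_def N_def vol_def dist_commute)
        then show ?thesis using True by (simp add: mult.assoc F_def)
      qed (auto simp: indicator_def)
    qed
    also have "\<dots> = ennreal (2 powr p) * ((\<integral>\<^sup>+x. \<integral>\<^sup>+y. F x y) + (\<integral>\<^sup>+x. \<integral>\<^sup>+y. F y x))"
      using Fm Fm' by (simp add: nn_integral_pair_lborel nn_integral_add nn_integral_cmult borel_prod)
    also have "(\<integral>\<^sup>+x. \<integral>\<^sup>+y. F y x) = (\<integral>\<^sup>+y. \<integral>\<^sup>+x. F y x)"
      using Fm by (intro lborel_pair.Fubini') (simp add: case_prod_beta' borel_prod lborel_prod)
    finally have main: "ennreal vol * kenergy ?\<kappa> p A u \<le> ennreal (2 powr p) * (2 * (\<integral>\<^sup>+x. \<integral>\<^sup>+y. R x y * indicator A x * indicator A y))"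
      by (simp add: mult_2 F_def)
    have "(\<integral>\<^sup>+x. \<integral>\<^sup>+y. R x y * indicator A x * indicator A y) \<le>
      (\<integral>\<^sup>+x. (\<Sum>j<N. ennreal (C1 * \<delta> powr (2 - p)) * (chain_part p \<delta> e u j x * indicator A x)))"
    proof (rule nn_integral_mono)
      fix x
      have "(\<integral>\<^sup>+y. R x y * indicator A x * indicator A y) \<le>
        (\<integral>\<^sup>+y. (\<Sum>j<N. (ennreal (real (Suc j) powr ((p - 1) / 2)) * (chain_part p \<delta> e u j x * indicator A x)) * (ennreal (far_weight p \<delta> j (dist x y)) * indicator (rim \<delta>) y)))"
      proof (rule nn_integral_mono)
        fix y
        show "R x y * indicator A x * indicator A y \<le> (\<Sum>j<N. (ennreal (real (Suc j) powr ((p - 1) / 2)) * (chain_part p \<delta> e u j x * indicator A x)) * (ennreal (far_weight p \<delta> j (dist x y)) * indicator (rim \<delta>) y))"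
        proof (cases "x \<in> A \<and> y \<in> A")
          case True
          then have "y \<in> rim \<delta>" using A(2) by auto
          then show ?thesis using True by (simp add: R_def far_part_def ennreal_mult far_weight_nonneg mult_ac)
        qed auto
      qed
      also have "\<dots> = (\<Sum>j<N. (ennreal (real (Suc j) powr ((p - 1) / 2)) * (chain_part p \<delta> e u j x * indicator A x)) * (\<integral>\<^sup>+y. ennreal (far_weight p \<delta> j (dist x y)) * indicator (rim \<delta>) y))"
        by (subst nn_integral_sum, measurable, subst nn_integral_cmult, measurable)
      also have "\<dots> \<le> (\<Sum>j<N. (ennreal (real (Suc j) powr ((p - 1) / 2)) * (chain_part p \<delta> e u j x * indicator A x)) * ennreal (C1 * \<delta> powr (2 - p) * real (Suc j) powr (- (p - 1) / 2)))"
        using fw[OF \<delta>] by (intro sum_mono mult_left_mono) auto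
      also have "\<dots> = (\<Sum>j<N. ennreal (C1 * \<delta> powr (2 - p)) * (chain_part p \<delta> e u j x * indicator A x))"
      proof (intro sum.cong refl)
        fix j
        have "real (Suc j) powr ((p - 1) / 2) * real (Suc j) powr (- (p - 1) / 2) = 1"
        proof -
          have "(p - 1) / 2 + - (p - 1) / 2 = 0" by (simp add: field_simps)
          then show ?thesis by (simp only: powr_add[symmetric]) simp
        qed
        then have "ennreal (real (Suc j) powr ((p - 1) / 2)) * ennreal (C1 * \<delta> powr (2 - p) * real (Suc j) powr (- (p - 1) / 2)) = ennreal (C1 * \<delta> powr (2 - p))"
          using C1 by (simp add: ennreal_mult[symmetric] mult_ac del: of_nat_Suc)
        then show "(ennreal (real (Suc j) powr ((p - 1) / 2)) * (chain_part p \<delta> e u j x * indicator A x)) * ennreal (C1 * \<delta> powr (2 - p) * real (Suc j) powr (- (p - 1) / 2))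
          = ennreal (C1 * \<delta> powr (2 - p)) * (chain_part p \<delta> e u j x * indicator A x)"
          by (simp only: mult_ac)
      qed
      finally show "(\<integral>\<^sup>+y. R x y * indicator A x * indicator A y) \<le> (\<Sum>j<N. ennreal (C1 * \<delta> powr (2 - p)) * (chain_part p \<delta> e u j x * indicator A x))" .
    qed
    also have "\<dots> = ennreal (C1 * \<delta> powr (2 - p)) * (\<Sum>j<N. \<integral>\<^sup>+x. chain_part p \<delta> e u j x * indicator A x)"
      by (subst nn_integral_sum, measurable, subst nn_integral_cmult, measurable) (simp only: sum_distrib_left)
    also have "\<dots> \<le> ennreal (C1 * \<delta> powr (2 - p)) * (ennreal M * close_energy p \<delta> (nbhd \<delta>) u)"
      unfolding M_def by (intro mult_left_mono sum_chain_part_le[OF e \<delta>(1) \<delta>r A N u]) auto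
    finally have Rle: "(\<integral>\<^sup>+x. \<integral>\<^sup>+y. R x y * indicator A x * indicator A y) \<le> ennreal (C1 * \<delta> powr (2 - p)) * (ennreal M * close_energy p \<delta> (nbhd \<delta>) u)" .
    have "kenergy ?\<kappa> p A u = ennreal (1 / vol) * (ennreal vol * kenergy ?\<kappa> p A u)"
      using vol0 by (simp add: mult.assoc[symmetric] ennreal_mult[symmetric])
    also have "\<dots> \<le> ennreal (1 / vol) * (ennreal (2 powr p) * (2 * (ennreal (C1 * \<delta> powr (2 - p)) * (ennreal M * close_energy p \<delta> (nbhd \<delta>) u))))"
      by (intro mult_left_mono order_trans[OF main] Rle) auto
    also have "\<dots> = (ennreal (1 / vol) * (ennreal (2 powr p) * (ennreal 2 * (ennreal (C1 * \<delta> powr (2 - p)) * ennreal M)))) * close_energy p \<delta> (nbhd \<delta>) u"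
      by (simp only: ennreal_numeral mult.assoc)
    also have "ennreal (1 / vol) * (ennreal (2 powr p) * (ennreal 2 * (ennreal (C1 * \<delta> powr (2 - p)) * ennreal M))) = ennreal (1 / vol * (2 powr p * (2 * (C1 * \<delta> powr (2 - p) * M))))"
      using vol0 C1 M by (simp add: ennreal_mult[symmetric] del: ennreal_numeral)
    also have "1 / vol * (2 powr p * (2 * (C1 * \<delta> powr (2 - p) * M))) = 2 * 2 powr p * C1 * M / v0 * \<delta> powr (2 - p - DIM('a))"
      unfolding vol using \<delta> v0 by (simp add: powr_diff powr_add powr_realpow field_simps)
    finally show "kenergy ?\<kappa> p (rim \<delta> \<inter> ball z (r / 2)) u \<le> ennreal (2 * 2 powr p * C1 * M / v0 * \<delta> powr (2 - p - DIM('a))) * close_energy p \<delta> (nbhd \<delta>) u"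
      by (simp only: A_def)
  qed
qed

section \<open>From charts to the whole collar\<close>

lemma finite_charts:
  "\<exists>Z. finite Z \<and> Z \<subseteq> closure \<Omega> \<and> (\<forall>\<delta> x. 0 < \<delta> \<longrightarrow> \<delta> < r * \<eta> / 16 \<longrightarrow> x \<in> rim \<delta> \<longrightarrow> (\<exists>z\<in>Z. dist z x < r / 4))"
proof -
  have "compact (closure \<Omega>)" using bounded_\<Omega> by (simp add: compact_closure)
  then obtain Z where Z: "finite Z" "Z \<subseteq> closure \<Omega>" "closure \<Omega> \<subseteq> (\<Union>z\<in>Z. ball z (r / 8))"
  proof (rule compactE_image[of "closure \<Omega>" "closure \<Omega>" "\<lambda>z. ball z (r / 8)"])
    show "closure \<Omega> \<subseteq> (\<Union>z\<in>closure \<Omega>. ball z (r / 8))"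
      using r_pos by force
  qed auto
  have r\<eta>: "r * \<eta> \<le> r" using \<eta>_le_1 r_pos by simp
  \<comment> \<open>Radius r / 4 rather than r / 2, so that a second point at distance at most
    \<open>r * \<eta> / 8\<close> lies in the same chart.\<close>
  have "\<exists>z\<in>Z. dist z x < r / 4" if d: "0 < \<delta>" "\<delta> < r * \<eta> / 16" "x \<in> rim \<delta>" for \<delta> x
  proof -
    obtain y where y: "y \<in> \<Omega>" "dist x y < \<delta>" using nbhdE[of x \<delta>] d by blast
    then obtain z where z: "z \<in> Z" "y \<in> ball z (r / 8)" using Z closure_subset by blast
    have "dist z x \<le> dist z y + dist y x" by (rule dist_triangle)
    also have "\<dots> < r / 8 + r * \<eta> / 16" using z y d by (auto simp: dist_commute)
    also have "\<dots> \<le> r / 4" using r\<eta> r_pos by linarith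
    finally show ?thesis using z by blast
  qed
  then show ?thesis using Z by blast
qed

lemma collar_measure_le:
  "\<exists>C>0. \<forall>\<delta>. 0 < \<delta> \<longrightarrow> \<delta> < r * \<eta> / 16 \<longrightarrow> emeasure lborel (rim \<delta>) \<le> ennreal (C * \<delta>)"
proof -
  obtain C where C: "C > 0" and meas: "\<And>\<delta> x \<rho>. 0 < \<delta> \<Longrightarrow> \<delta> < r * \<eta> / 16 \<Longrightarrow> \<delta> \<le> \<rho> \<Longrightarrow>
     emeasure lborel (rim \<delta> \<inter> cball x \<rho>) \<le> ennreal (C * \<delta> * \<rho> powr (real DIM('a) - 1))"
    using collar_ball_measure by blast
  obtain B where B: "\<And>y. y \<in> nbhd (r * \<eta> / 16) \<Longrightarrow> norm y \<le> B" using bounded_nbhd[of "r * \<eta> / 16"] unfolding bounded_iff by blast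
  define \<rho> where "\<rho> = max B (r * \<eta> / 16)"
  have \<rho>: "\<rho> > 0" using r_pos \<eta>_pos by (simp add: \<rho>_def less_max_iff_disj)
  show ?thesis
  proof (intro exI conjI allI impI)
    show "C * \<rho> powr (real DIM('a) - 1) > 0" using C \<rho> by simp
    fix \<delta> assume \<delta>: "0 < \<delta>" "\<delta> < r * \<eta> / 16"
    have "rim \<delta> \<inter> cball 0 \<rho> = rim \<delta>"
    proof -
      have "norm x \<le> \<rho>" if "x \<in> rim \<delta>" for x
        using B[of x] that \<delta> by (auto simp: \<rho>_def collar_def)
      then show ?thesis by auto
    qed
    then show "emeasure lborel (rim \<delta>) \<le> ennreal (C * \<rho> powr (real DIM('a) - 1) * \<delta>)"
      using meas[OF \<delta>, of \<rho> 0] \<delta> by (simp add: \<rho>_def mult_ac)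
  qed
qed

text \<open>For every \<beta> this is bounded by the p-th power of the norm of S up to a constant
  over d + p - \<beta>: for r < \<delta> one has r^(-\<beta>) \<ge> \<delta>^(-\<beta>), so the
  kernel of S is at least a multiple of (d + p - \<beta>) * \<delta>^(-d-p).\<close>

definition scaled_energy :: "real \<Rightarrow> real \<Rightarrow> ('a \<Rightarrow> real) \<Rightarrow> ennreal" where
  "scaled_energy p \<delta> u = Lp_energy p (nbhd \<delta>) u + ennreal (\<delta> powr (- p - DIM('a))) * close_energy p \<delta> (nbhd \<delta>) u"

text \<open>Gathers the chart estimates. Since (r / \<delta>)^(p-1) * \<delta>^(-d) equals r^(p-1) *
  \<delta> * \<delta>^(-p-d), both terms of \<open>chart_Lp_le\<close> carry the same factor
  \<delta>.\<close>

lemma collar_Lp_le: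
  assumes p: "p > 1"
  shows "\<exists>C>0. \<forall>\<delta> u. 0 < \<delta> \<longrightarrow> \<delta> < r * \<eta> / 16 \<longrightarrow> u \<in> borel_measurable borel \<longrightarrow>
    Lp_energy p (rim \<delta>) u \<le> ennreal (C * \<delta>) * scaled_energy p \<delta> u"
proof -
  obtain Z where Z: "finite Z" "Z \<subseteq> closure \<Omega>" and cover: "\<And>\<delta> x. 0 < \<delta> \<Longrightarrow> \<delta> < r * \<eta> / 16 \<Longrightarrow> x \<in> rim \<delta> \<Longrightarrow> \<exists>z\<in>Z. dist z x < r / 4"
    using finite_charts by blast
  define M where "M = 2 powr p * (4 / \<eta> + 1)"
  have M: "M > 0" using \<eta>_pos by (simp add: M_def add_pos_pos)
  define v0 where "v0 = unit_ball_vol DIM('a) * (\<eta> / 4) ^ DIM('a)"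
  have v0: "v0 > 0" using \<eta>_pos by (simp add: v0_def)
  define c where "c = M * (2 / r) + M * (r powr (p - 1) / v0)"
  have c: "c > 0" using M r_pos v0 by (simp add: c_def add_pos_pos)
  show ?thesis
  proof (intro exI conjI allI impI)
    show "(real (card Z) + 1) * c > 0" using c by (simp add: add_nonneg_pos)
    fix \<delta> and u :: "'a \<Rightarrow> real" assume \<delta>: "0 < \<delta>" "\<delta> < r * \<eta> / 16" and u[measurable]: "u \<in> borel_measurable borel"
    have r\<eta>: "r * \<eta> \<le> r" using \<eta>_le_1 r_pos by simp
    then have \<delta>r: "\<delta> \<le> r / 2" using \<delta> r_pos by linarith
    have piece: "Lp_energy p (rim \<delta> \<inter> ball z (r / 2)) u \<le> ennreal (c * \<delta>) * scaled_energy p \<delta> u" if zZ: "z \<in> Z" for z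
    proof -
      obtain e where e: "cone_at \<Omega> r \<eta> z e" using zZ Z cone by blast
      have e1: "2 powr p * (4 / \<eta> + 1) * (2 * \<delta> / r) \<le> c * \<delta>"
      proof -
        have "2 powr p * (4 / \<eta> + 1) * (2 * \<delta> / r) = M * (2 / r) * \<delta>" by (simp add: M_def)
        also have "\<dots> \<le> c * \<delta>" using \<delta> M v0 by (intro mult_right_mono) (auto simp: c_def)
        finally show ?thesis .
      qed
      have "2 powr p * (4 / \<eta> + 1) * ((r / \<delta>) powr (p - 1) / (unit_ball_vol DIM('a) * (\<delta> * \<eta> / 4) ^ DIM('a))) = M * (r powr (p - 1) / v0) * (1 / (\<delta> powr (p - 1) * \<delta> ^ DIM('a)))"
        using \<delta> r_pos by (simp add: M_def v0_def powr_divide power_mult_distrib power_divide field_simps)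
      also have "1 / (\<delta> powr (p - 1) * \<delta> ^ DIM('a)) = \<delta> * \<delta> powr (- p - DIM('a))"
        using \<delta> by (simp add: powr_diff powr_minus powr_realpow field_simps)
      also have "M * (r powr (p - 1) / v0) * (\<delta> * \<delta> powr (- p - DIM('a))) \<le> c * (\<delta> * \<delta> powr (- p - DIM('a)))"
        using \<delta> M r_pos by (intro mult_right_mono) (auto simp: c_def)
      finally have e2: "2 powr p * (4 / \<eta> + 1) * ((r / \<delta>) powr (p - 1) / (unit_ball_vol DIM('a) * (\<delta> * \<eta> / 4) ^ DIM('a))) \<le> c * \<delta> * \<delta> powr (- p - DIM('a))"
        by (simp only: mult.assoc)
      have "Lp_energy p (rim \<delta> \<inter> ball z (r / 2)) u \<le> ennreal (c * \<delta>) * Lp_energy p (nbhd \<delta>) u + ennreal (c * \<delta> * \<delta> powr (- p - DIM('a))) * close_energy p \<delta> (nbhd \<delta>) u"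
        by (rule order_trans[OF chart_Lp_le[OF e \<delta>(1) \<delta>r p u]]) (intro add_mono mult_right_mono ennreal_leI e1 e2, auto)
      then show ?thesis
        using c \<delta> by (simp add: scaled_energy_def distrib_left ennreal_mult mult.assoc)
    qed
    have "Lp_energy p (rim \<delta>) u \<le> (\<integral>\<^sup>+x. (\<Sum>z\<in>Z. ennreal (\<bar>u x\<bar> powr p) * indicator (rim \<delta> \<inter> ball z (r / 2)) x))"
      unfolding Lp_energy_def
    proof (rule nn_integral_mono)
      fix x
      show "ennreal (\<bar>u x\<bar> powr p) * indicator (rim \<delta>) x \<le> (\<Sum>z\<in>Z. ennreal (\<bar>u x\<bar> powr p) * indicator (rim \<delta> \<inter> ball z (r / 2)) x)"
      proof (cases "x \<in> rim \<delta>")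
        case True
        then obtain z where z: "z \<in> Z" "dist z x < r / 4" using cover \<delta> by blast
        have "ennreal (\<bar>u x\<bar> powr p) * indicator (rim \<delta>) x = ennreal (\<bar>u x\<bar> powr p) * indicator (rim \<delta> \<inter> ball z (r / 2)) x"
          using True z r_pos by (auto simp: indicator_def)
        also have "\<dots> \<le> (\<Sum>z\<in>Z. ennreal (\<bar>u x\<bar> powr p) * indicator (rim \<delta> \<inter> ball z (r / 2)) x)"
          using Z z by (intro member_le_sum) auto
        finally show ?thesis .
      qed auto
    qed
    also have "\<dots> = (\<Sum>z\<in>Z. Lp_energy p (rim \<delta> \<inter> ball z (r / 2)) u)"
      unfolding Lp_energy_def
      by (intro nn_integral_sum borel_measurable_times_ennreal borel_measurable_indicator) simp_all
    also have "\<dots> \<le> (\<Sum>z\<in>Z. ennreal (c * \<delta>) * scaled_energy p \<delta> u)"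
      by (intro sum_mono piece)
    also have "\<dots> = ennreal (real (card Z) * (c * \<delta>)) * scaled_energy p \<delta> u"
      using c \<delta> by (simp add: ennreal_mult ennreal_of_nat_eq_real_of_nat mult.assoc)
    also have "\<dots> \<le> ennreal ((real (card Z) + 1) * c * \<delta>) * scaled_energy p \<delta> u"
      using c \<delta> by (intro mult_right_mono ennreal_leI) (auto simp: algebra_simps)
    finally show "Lp_energy p (rim \<delta>) u \<le> ennreal ((real (card Z) + 1) * c * \<delta>) * scaled_energy p \<delta> u" .
  qed
qed

text \<open>Pairs at distance up to \<open>r * \<eta> / 8\<close> share a chart, and
  \<delta>^(2-p-d) is \<delta>^2 times the scaling in \<open>scaled_energy\<close>. For the
  remaining pairs the kernel is bounded, and \<delta>^2 arises as the measure of the collar times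
  the factor \<delta> in \<open>collar_Lp_le\<close>.\<close>

lemma collar_far_le:
  assumes p: "p > 1"
  shows "\<exists>C>0. \<forall>\<delta> u. 0 < \<delta> \<longrightarrow> \<delta> < r * \<eta> / 16 \<longrightarrow> u \<in> borel_measurable borel \<longrightarrow>
    kenergy (\<lambda>\<rho>. \<rho> powr (- (real DIM('a) + p - 2)) * indicator {\<delta>..} \<rho>) p (rim \<delta>) u \<le> ennreal (C * \<delta>\<^sup>2) * scaled_energy p \<delta> u"
proof -
  obtain Z where Z: "finite Z" "Z \<subseteq> closure \<Omega>" and cover: "\<And>\<delta> x. 0 < \<delta> \<Longrightarrow> \<delta> < r * \<eta> / 16 \<Longrightarrow> x \<in> rim \<delta> \<Longrightarrow> \<exists>z\<in>Z. dist z x < r / 4"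
    using finite_charts by blast
  obtain C1 where C1: "C1 > 0" and far: "\<And>\<delta> z e u. cone_at \<Omega> r \<eta> z e \<Longrightarrow> 0 < \<delta> \<Longrightarrow> \<delta> < r * \<eta> / 16 \<Longrightarrow> u \<in> borel_measurable borel \<Longrightarrow>
    kenergy (\<lambda>\<rho>. \<rho> powr (- (real DIM('a) + p - 2)) * indicator {\<delta>..r * \<eta> / 8} \<rho>) p (rim \<delta> \<inter> ball z (r / 2)) u
      \<le> ennreal (C1 * \<delta> powr (2 - p - DIM('a))) * close_energy p \<delta> (nbhd \<delta>) u"
    using chart_far_le[OF p] by blast
  obtain C2 where C2: "C2 > 0" and Lp: "\<And>\<delta> u. 0 < \<delta> \<Longrightarrow> \<delta> < r * \<eta> / 16 \<Longrightarrow> u \<in> borel_measurable borel \<Longrightarrow>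
    Lp_energy p (rim \<delta>) u \<le> ennreal (C2 * \<delta>) * scaled_energy p \<delta> u"
    using collar_Lp_le[OF p] by blast
  obtain C3 where C3: "C3 > 0" and vol: "\<And>\<delta>. 0 < \<delta> \<Longrightarrow> \<delta> < r * \<eta> / 16 \<Longrightarrow> emeasure lborel (rim \<delta>) \<le> ennreal (C3 * \<delta>)"
    using collar_measure_le by blast
  let ?e = "- (real DIM('a) + p - 2)"
  define R where "R = r * \<eta> / 8"
  have R: "R > 0" using r_pos \<eta>_pos by (simp add: R_def)
  have r\<eta>: "r * \<eta> \<le> r" using \<eta>_le_1 r_pos by simp
  define C where "C = real (card Z) * C1 + 2 powr p * R powr ?e * (2 * C3 * C2)"
  have C0: "2 powr p * R powr ?e * (2 * C3 * C2) > 0" using R C2 C3 by simp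
  have C: "C > 0" using C1 C0 unfolding C_def by (intro add_nonneg_pos) auto
  have exponent: "?e \<le> 0"
  proof -
    have "real DIM('a) \<ge> 1" using DIM_positive[where 'a='a] by linarith
    then show ?thesis using p by linarith
  qed
  show ?thesis
  proof (intro exI conjI allI impI, rule C)
    fix \<delta> and u :: "'a \<Rightarrow> real" assume \<delta>: "0 < \<delta>" "\<delta> < r * \<eta> / 16" and u[measurable]: "u \<in> borel_measurable borel"
    let ?V = "rim \<delta>" and ?X = "scaled_energy p \<delta> u"
    let ?k1 = "\<lambda>\<rho>. \<rho> powr ?e * indicator {\<delta>..R} \<rho>" and ?k2 = "\<lambda>\<rho>. \<rho> powr ?e * indicator {R<..} \<rho>"
    have "kenergy (\<lambda>\<rho>. \<rho> powr ?e * indicator {\<delta>..} \<rho>) p ?V u \<le> kenergy ?k1 p ?V u + kenergy ?k2 p ?V u"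
      by (intro kenergy_kernel_add_le) (auto simp: indicator_def)
    also have "kenergy ?k1 p ?V u \<le> ennreal (real (card Z) * C1 * \<delta>\<^sup>2) * ?X"
    proof -
      let ?F = "\<lambda>z w. ennreal (?k1 (dist (fst w) (snd w)) * \<bar>u (snd w) - u (fst w)\<bar> powr p) * indicator (?V \<inter> ball z (r / 2)) (fst w) * indicator (?V \<inter> ball z (r / 2)) (snd w)"
      have k1m: "?k1 \<in> borel_measurable borel" by measurable
      have Vz: "?V \<inter> ball z (r / 2) \<in> sets borel" for z by measurable
      have Fm: "?F z \<in> borel_measurable lborel" for z
        using kenergy_measurable[OF u Vz k1m] by (simp add: borel_prod)
      have Vm: "?V \<in> sets borel" by measurable
      have "kenergy ?k1 p ?V u \<le> (\<integral>\<^sup>+w. (\<Sum>z\<in>Z. ?F z w))"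
        unfolding kenergy_eq_pair[OF u Vm k1m]
      proof (rule nn_integral_mono)
        fix w :: "'a \<times> 'a"
        obtain x y where w: "w = (x, y)" by (cases w)
        show "ennreal (?k1 (dist (fst w) (snd w)) * \<bar>u (snd w) - u (fst w)\<bar> powr p) * indicator ?V (fst w) * indicator ?V (snd w) \<le> (\<Sum>z\<in>Z. ?F z w)"
        proof (cases "x \<in> ?V \<and> y \<in> ?V \<and> \<delta> \<le> dist x y \<and> dist x y \<le> R")
          case True
          then obtain z where z: "z \<in> Z" "dist z x < r / 4" using cover \<delta> by blast
          have "dist z y \<le> dist z x + dist x y" by (rule dist_triangle)
          also have "\<dots> < r / 4 + R" using z True by linarith
          finally have "dist z y < r / 2" using r\<eta> r_pos unfolding R_def by linarith
          then have "ennreal (?k1 (dist (fst w) (snd w)) * \<bar>u (snd w) - u (fst w)\<bar> powr p) * indicator ?V (fst w) * indicator ?V (snd w) = ?F z w"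
            using True z r_pos by (simp add: w)
          also have "\<dots> \<le> (\<Sum>z\<in>Z. ?F z w)" using Z z by (intro member_le_sum) auto
          finally show ?thesis .
        qed (auto simp: w indicator_def)
      qed
      also have "\<dots> = (\<Sum>z\<in>Z. kenergy ?k1 p (?V \<inter> ball z (r / 2)) u)"
        unfolding kenergy_eq_pair[OF u Vz k1m] using Fm by (rule nn_integral_sum)
      also have "\<dots> \<le> (\<Sum>z\<in>Z. ennreal (C1 * \<delta> powr (2 - p - DIM('a))) * close_energy p \<delta> (nbhd \<delta>) u)"
      proof (rule sum_mono)
        fix z assume "z \<in> Z"
        then obtain e where "cone_at \<Omega> r \<eta> z e" using Z cone by blast
        from far[OF this \<delta> u]
        show "kenergy ?k1 p (?V \<inter> ball z (r / 2)) u \<le> ennreal (C1 * \<delta> powr (2 - p - DIM('a))) * close_energy p \<delta> (nbhd \<delta>) u"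
          by (simp only: R_def)
      qed
      also have "\<dots> = ennreal (real (card Z) * C1 * \<delta>\<^sup>2) * (ennreal (\<delta> powr (- p - DIM('a))) * close_energy p \<delta> (nbhd \<delta>) u)"
      proof -
        have "\<delta> powr (2 - p - DIM('a)) = \<delta>\<^sup>2 * \<delta> powr (- p - DIM('a))"
        proof -
          have "2 - p - real DIM('a) = 2 + (- p - real DIM('a))" by simp
          then have "\<delta> powr (2 - p - real DIM('a)) = \<delta> powr 2 * \<delta> powr (- p - real DIM('a))"
            by (simp only: powr_add)
          then show ?thesis using \<delta> by simp
        qed
        then show ?thesis using C1
          by (simp add: ennreal_of_nat_eq_real_of_nat ennreal_mult[symmetric] mult.assoc[symmetric])
      qed
      also have "\<dots> \<le> ennreal (real (card Z) * C1 * \<delta>\<^sup>2) * ?X"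
        by (intro mult_left_mono) (auto simp: scaled_energy_def)
      finally show ?thesis .
    qed
    also have "kenergy ?k2 p ?V u \<le> ennreal (2 powr p * R powr ?e * (2 * C3 * C2) * \<delta>\<^sup>2) * ?X"
    proof -
      have "kenergy ?k2 p ?V u \<le> ennreal (2 powr p * R powr ?e) * (2 * emeasure lborel ?V * Lp_energy p ?V u)"
      proof (rule kenergy_bounded_kernel_le)
        show "\<rho> powr ?e * indicator {R<..} \<rho> \<le> R powr ?e" for \<rho>
          using R exponent by (auto simp: indicator_def intro!: powr_mono2')
      qed (use p in auto)
      also have "\<dots> \<le> ennreal (2 powr p * R powr ?e) * (ennreal 2 * ennreal (C3 * \<delta>) * (ennreal (C2 * \<delta>) * ?X))"
        using vol[OF \<delta>] Lp[OF \<delta> u] by (intro mult_left_mono mult_mono) auto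
      also have "\<dots> = (ennreal (2 powr p * R powr ?e) * (ennreal 2 * (ennreal (C3 * \<delta>) * ennreal (C2 * \<delta>)))) * ?X"
        by (simp only: mult.assoc)
      also have "ennreal (2 powr p * R powr ?e) * (ennreal 2 * (ennreal (C3 * \<delta>) * ennreal (C2 * \<delta>))) = ennreal (2 powr p * R powr ?e * (2 * C3 * C2) * \<delta>\<^sup>2)"
        using C2 C3 \<delta> by (simp add: ennreal_mult[symmetric] power2_eq_square mult_ac del: ennreal_numeral)
      finally show ?thesis .
    qed
    finally have "kenergy (\<lambda>\<rho>. \<rho> powr ?e * indicator {\<delta>..} \<rho>) p ?V u \<le> ennreal (real (card Z) * C1 * \<delta>\<^sup>2) * ?X + ennreal (2 powr p * R powr ?e * (2 * C3 * C2) * \<delta>\<^sup>2) * ?X"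
      by (simp add: add_mono)
    also have "\<dots> = (ennreal (real (card Z) * C1 * \<delta>\<^sup>2) + ennreal (2 powr p * R powr ?e * (2 * C3 * C2) * \<delta>\<^sup>2)) * ?X"
      by (simp only: distrib_right)
    also have "ennreal (real (card Z) * C1 * \<delta>\<^sup>2) + ennreal (2 powr p * R powr ?e * (2 * C3 * C2) * \<delta>\<^sup>2) = ennreal (C * \<delta>\<^sup>2)"
    proof -
      have nn: "0 \<le> real (card Z) * C1 * \<delta>\<^sup>2" "0 \<le> 2 powr p * R powr ?e * (2 * C3 * C2) * \<delta>\<^sup>2" using C1 C0 by auto
      have "real (card Z) * C1 * \<delta>\<^sup>2 + 2 powr p * R powr ?e * (2 * C3 * C2) * \<delta>\<^sup>2 = C * \<delta>\<^sup>2"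
        by (simp only: C_def distrib_right)
      then show ?thesis using nn by (simp only: ennreal_plus[symmetric])
    qed
    finally show "kenergy (\<lambda>\<rho>. \<rho> powr ?e * indicator {\<delta>..} \<rho>) p ?V u \<le> ennreal (C * \<delta>\<^sup>2) * ?X" .
  qed
qed

text \<open>Here \<beta> enters, through a comparison of kernels. Below \<delta> the trace kernel is
  exactly \<open>sphere_area\<close> / (d + p - \<beta>) times \<open>nl_kernel\<close>; from
  \<delta> on it is \<delta>^(-2) * \<rho>^(-(d+p-2)), and the prefactor cancels the \<delta>^2 of
  \<open>collar_far_le\<close>.\<close>

lemma trace_energy_le:
  fixes p :: real
  assumes p: "p > 1"
  shows "\<exists>C>0. \<forall>\<delta> \<beta> u. 0 < \<delta> \<longrightarrow> \<delta> < r * \<eta> / 16 \<longrightarrow> 0 \<le> \<beta> \<longrightarrow> \<beta> < DIM('a) + p \<longrightarrow> u \<in> borel_measurable borel \<longrightarrow>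
    ennreal (1 / \<delta>) * Lp_energy p (rim \<delta>) u + T_energy p \<beta> \<delta> u \<le>
      ennreal (C / (DIM('a) + p - \<beta>)) * (Lp_energy p (nbhd \<delta>) u + S_energy p \<beta> \<delta> u)"
proof -
  obtain C1 where C1: "C1 > 0" and Lp: "\<And>\<delta> u. 0 < \<delta> \<Longrightarrow> \<delta> < r * \<eta> / 16 \<Longrightarrow> u \<in> borel_measurable borel \<Longrightarrow>
    Lp_energy p (rim \<delta>) u \<le> ennreal (C1 * \<delta>) * scaled_energy p \<delta> u"
    using collar_Lp_le[OF p] by blast
  obtain C2 where C2: "C2 > 0" and far: "\<And>\<delta> u. 0 < \<delta> \<Longrightarrow> \<delta> < r * \<eta> / 16 \<Longrightarrow> u \<in> borel_measurable borel \<Longrightarrow>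
    kenergy (\<lambda>\<rho>. \<rho> powr (- (real DIM('a) + p - 2)) * indicator {\<delta>..} \<rho>) p (rim \<delta>) u \<le> ennreal (C2 * \<delta>\<^sup>2) * scaled_energy p \<delta> u"
    using collar_far_le[OF p] by blast
  define s where "s = sphere_area DIM('a)"
  have s: "s > 0" using sphere_area_pos[of "DIM('a)"] by (simp add: s_def)
  define d where "d = real DIM('a)"
  have d: "d \<ge> 1" using DIM_positive[where 'a='a] unfolding d_def by linarith
  define C where "C = (C1 + C2) * (d + p + s) + s"
  have C: "C > 0" using C1 C2 d p s by (simp add: C_def add_pos_pos)
  show ?thesis
  proof (intro exI conjI allI impI, rule C)
    fix \<delta> \<beta> and u :: "'a \<Rightarrow> real"
    assume \<delta>: "0 < \<delta>" "\<delta> < r * \<eta> / 16" and \<beta>: "0 \<le> \<beta>" "\<beta> < DIM('a) + p" and u[measurable]: "u \<in> borel_measurable borel"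
    define b where "b = d + p - \<beta>"
    have b: "b > 0" "b \<le> d + p" using \<beta> by (auto simp: b_def d_def)
    let ?V = "rim \<delta>" and ?D = "nbhd \<delta>" and ?nl = "nl_kernel DIM('a) p \<beta> \<delta>"
    let ?S = "Lp_energy p ?D u + kenergy ?nl p ?D u"
    let ?far = "\<lambda>\<rho>. \<rho> powr (- (real DIM('a) + p - 2)) * indicator {\<delta>..} \<rho>"
    have nl: "s / b * ?nl \<rho> = \<delta> powr (- b) * (\<rho> powr (- \<beta>) * indicator {..<\<delta>} \<rho>)" for \<rho>
      using s b by (simp add: nl_kernel_eq s_def[symmetric] d_def[symmetric] b_def[symmetric] powr_minus_divide)
    have close: "\<delta> powr (- p - d) * indicator {..<\<delta>} \<rho> \<le> s / b * ?nl \<rho>" if "\<rho> > 0" for \<rho>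
    proof (cases "\<rho> < \<delta>")
      case True
      have e: "- p - d = - b + - \<beta>" by (simp add: b_def)
      have "\<delta> powr (- p - d) = \<delta> powr (- b) * \<delta> powr (- \<beta>)" by (simp only: e powr_add)
      also have "\<dots> \<le> \<delta> powr (- b) * \<rho> powr (- \<beta>)"
        using True that \<beta> by (intro mult_left_mono powr_mono2') auto
      finally show ?thesis unfolding nl using True by simp
    next
      case False
      then show ?thesis unfolding nl by simp
    qed
    have "ennreal (\<delta> powr (- p - d)) * close_energy p \<delta> ?D u = kenergy (\<lambda>\<rho>. \<delta> powr (- p - d) * indicator {..<\<delta>} \<rho>) p ?D u"
      by (rule kenergy_cmult[symmetric]) auto
    also have "\<dots> \<le> kenergy (\<lambda>\<rho>. s / b * ?nl \<rho>) p ?D u"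
      by (intro kenergy_mono close)
    also have "\<dots> = ennreal (s / b) * kenergy ?nl p ?D u"
      using s b by (intro kenergy_cmult) auto
    finally have 1: "ennreal (\<delta> powr (- p - d)) * close_energy p \<delta> ?D u \<le> ennreal (s / b) * kenergy ?nl p ?D u" .
    \<comment> \<open>Since d + p - \<beta> \<le> d + p, the coefficient 1 of the L^p term is also
      at most a constant over d + p - \<beta>.\<close>
    have X: "scaled_energy p \<delta> u \<le> ennreal ((d + p + s) / b) * ?S"
    proof -
      have "scaled_energy p \<delta> u \<le> ennreal 1 * Lp_energy p ?D u + ennreal (s / b) * kenergy ?nl p ?D u"
        using 1 by (simp add: scaled_energy_def d_def add_left_mono)
      also have "\<dots> \<le> ennreal ((d + p + s) / b) * Lp_energy p ?D u + ennreal ((d + p + s) / b) * kenergy ?nl p ?D u"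
        using b s d p by (intro add_mono mult_right_mono ennreal_leI divide_right_mono) auto
      finally show ?thesis by (simp add: distrib_left)
    qed
    have T: "T_kernel DIM('a) p \<beta> \<delta> \<rho> \<le> s / b * ?nl \<rho> + \<delta> powr (- 2) * ?far \<rho>" if "\<rho> > 0" for \<rho>
    proof (cases "\<rho> < \<delta>")
      case True
      have e: "\<beta> - 2 - (d + p - 2) = - b" by (simp add: b_def)
      have "T_kernel DIM('a) p \<beta> \<delta> \<rho> = \<delta> powr (\<beta> - 2) / \<delta> powr (d + p - 2) * \<rho> powr (- \<beta>)"
        using True by (simp add: T_kernel_def d_def powr_minus field_simps)
      also have "\<delta> powr (\<beta> - 2) / \<delta> powr (d + p - 2) = \<delta> powr (- b)"
        by (simp only: powr_diff[symmetric] e)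
      finally show ?thesis unfolding nl using True by simp
    next
      case False
      have "T_kernel DIM('a) p \<beta> \<delta> \<rho> = \<delta> powr (\<beta> - 2) / \<delta> powr \<beta> * \<rho> powr (- (d + p - 2))"
        unfolding T_kernel_def d_def[symmetric] powr_minus_divide using False by (simp add: max_def min_def mult.commute)
      also have "\<delta> powr (\<beta> - 2) / \<delta> powr \<beta> = \<delta> powr (- 2)"
        by (simp add: powr_diff[symmetric])
      finally show ?thesis unfolding nl using False by (simp add: d_def)
    qed
    have "kenergy (T_kernel DIM('a) p \<beta> \<delta>) p ?V u \<le> kenergy (\<lambda>\<rho>. s / b * ?nl \<rho>) p ?V u + kenergy (\<lambda>\<rho>. \<delta> powr (- 2) * ?far \<rho>) p ?V u"
    proof (rule kenergy_kernel_add_le)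
      show "0 \<le> s / b * ?nl \<rho>" for \<rho> unfolding nl by simp
    qed (use T in auto)
    also have "kenergy (\<lambda>\<rho>. s / b * ?nl \<rho>) p ?V u \<le> ennreal (s / b) * kenergy ?nl p ?D u"
    proof -
      have "kenergy (\<lambda>\<rho>. s / b * ?nl \<rho>) p ?V u \<le> kenergy (\<lambda>\<rho>. s / b * ?nl \<rho>) p ?D u"
        by (rule kenergy_subset_mono) auto
      also have "\<dots> = ennreal (s / b) * kenergy ?nl p ?D u"
        using s b by (intro kenergy_cmult) auto
      finally show ?thesis .
    qed
    also have "kenergy (\<lambda>\<rho>. \<delta> powr (- 2) * ?far \<rho>) p ?V u \<le> ennreal C2 * scaled_energy p \<delta> u"
    proof -
      have "kenergy (\<lambda>\<rho>. \<delta> powr (- 2) * ?far \<rho>) p ?V u = ennreal (\<delta> powr (- 2)) * kenergy ?far p ?V u"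
        by (intro kenergy_cmult) auto
      also have "\<dots> \<le> ennreal (\<delta> powr (- 2)) * (ennreal (C2 * \<delta>\<^sup>2) * scaled_energy p \<delta> u)"
        by (intro mult_left_mono far \<delta> u) auto
      also have "\<dots> = ennreal C2 * scaled_energy p \<delta> u"
      proof -
        have "\<delta> powr (- 2) * (C2 * \<delta>\<^sup>2) = C2" using \<delta> by (simp add: powr_minus)
        moreover have "ennreal (\<delta> powr (- 2)) * ennreal (C2 * \<delta>\<^sup>2) = ennreal (\<delta> powr (- 2) * (C2 * \<delta>\<^sup>2))"
          using C2 by (intro ennreal_mult[symmetric]) auto
        ultimately have "ennreal (\<delta> powr (- 2)) * ennreal (C2 * \<delta>\<^sup>2) = ennreal C2" by (simp only:)
        then show ?thesis by (simp only: mult.assoc[symmetric])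
      qed
      finally show ?thesis .
    qed
    finally have K: "kenergy (T_kernel DIM('a) p \<beta> \<delta>) p ?V u \<le> ennreal (s / b) * kenergy ?nl p ?D u + ennreal C2 * scaled_energy p \<delta> u"
      by (simp add: add_mono)
    have L: "ennreal (1 / \<delta>) * Lp_energy p ?V u \<le> ennreal C1 * scaled_energy p \<delta> u"
    proof -
      have "ennreal (1 / \<delta>) * Lp_energy p ?V u \<le> ennreal (1 / \<delta>) * (ennreal (C1 * \<delta>) * scaled_energy p \<delta> u)"
        by (intro mult_left_mono Lp \<delta> u) auto
      also have "\<dots> = ennreal C1 * scaled_energy p \<delta> u"
        using \<delta> C1 by (simp add: mult.assoc[symmetric] ennreal_mult[symmetric])
      finally show ?thesis .
    qed
    have "ennreal (1 / \<delta>) * Lp_energy p ?V u + kenergy (T_kernel DIM('a) p \<beta> \<delta>) p ?V u \<le>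
      ennreal C1 * scaled_energy p \<delta> u + (ennreal (s / b) * kenergy ?nl p ?D u + ennreal C2 * scaled_energy p \<delta> u)"
      by (intro add_mono L K)
    also have "\<dots> \<le> ennreal C1 * (ennreal ((d + p + s) / b) * ?S) + (ennreal (s / b) * ?S + ennreal C2 * (ennreal ((d + p + s) / b) * ?S))"
      by (intro add_mono mult_left_mono X) auto
    also have "\<dots> = (ennreal C1 * ennreal ((d + p + s) / b) + (ennreal (s / b) + ennreal C2 * ennreal ((d + p + s) / b))) * ?S"
      by (simp only: distrib_right mult.assoc)
    also have "ennreal C1 * ennreal ((d + p + s) / b) + (ennreal (s / b) + ennreal C2 * ennreal ((d + p + s) / b)) = ennreal (C / b)"
    proof -
      have "C1 * ((d + p + s) / b) + (s / b + C2 * ((d + p + s) / b)) = C / b"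
        by (simp add: C_def add_divide_distrib algebra_simps)
      moreover define q where "q = (d + p + s) / b"
      moreover have "0 \<le> q" "0 \<le> s / b" using d p s b by (auto simp: q_def)
      then have "ennreal C1 * ennreal q + (ennreal (s / b) + ennreal C2 * ennreal q) = ennreal (C1 * q + (s / b + C2 * q))"
        using C1 C2 by (simp add: ennreal_mult ennreal_plus)
      ultimately show ?thesis by (simp only:)
    qed
    finally show "ennreal (1 / \<delta>) * Lp_energy p ?V u + kenergy (T_kernel DIM('a) p \<beta> \<delta>) p ?V u \<le> ennreal (C / (DIM('a) + p - \<beta>)) * ?S"
      by (simp add: b_def d_def)
  qed
qed

text \<open>Moving down from \<open>y\<close> one step of length \<open>\<mu>\<close> below the last point outside \<open>\<Omega>\<close> reaches
  the collar at distance at least \<open>\<eta> * \<mu>\<close> from \<open>\<Omega>\<close>.\<close>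

lemma collar_point_on_chain:
  assumes e: "cone_at \<Omega> r \<eta> z e" and \<mu>: "0 < \<mu>" "2 * \<mu> < \<delta>" and N: "N > 0" "6 * s + \<mu> \<le> r" "real N * \<mu> = 2 * s"
    and y: "dist y z \<le> 2 * s" "y \<notin> \<Omega>" "y + (2 * s) *\<^sub>R e \<in> \<Omega>"
  shows "\<exists>k\<in>{1..N}. y + ((real k - 2) * \<mu>) *\<^sub>R e \<in> {a \<in> rim \<delta>. \<eta> * \<mu> \<le> infdist a \<Omega> \<and> dist a z \<le> 4 * s}"
proof -
  have ne: "norm e = 1" using e by (simp add: cone_at_def)
  have s0: "s > 0" using N \<mu> by (smt (verit) mult_pos_pos of_nat_0_less_iff)
  define P where "P k \<longleftrightarrow> y + (real k * \<mu>) *\<^sub>R e \<in> \<Omega>" for k :: nat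
  have PN: "P N" and P0: "\<not> P 0" using y N by (auto simp: P_def)
  define k where "k = (LEAST k. P k)"
  have k: "P k" "k \<le> N" "k > 0"
    using LeastI[of P, OF PN] Least_le[of P, OF PN] P0 by (auto simp: k_def intro: gr0I)
  have nPk: "\<not> P (k - 1)" using not_less_Least[of "k - 1" P] k by (simp add: k_def)
  \<comment> \<open>Index k - 1 is the last one before the path first enters \<Omega>, and
    \<open>a\<close> is one step before it. For k = 1 the factor \<open>real k - 2\<close> is -1,
    and \<open>a\<close> lies behind the starting point.\<close>
  define a where "a = y + ((real k - 2) * \<mu>) *\<^sub>R e"
  have a1: "a + \<mu> *\<^sub>R e = y + (real (k - 1) * \<mu>) *\<^sub>R e"
  proof -
    have "real (k - 1) * \<mu> = (real k - 2) * \<mu> + \<mu>" using k by (simp add: of_nat_diff algebra_simps)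
    then show ?thesis by (simp add: a_def scaleR_add_left)
  qed
  have a2: "a + (2 * \<mu>) *\<^sub>R e = y + (real k * \<mu>) *\<^sub>R e"
  proof -
    have "real k * \<mu> = (real k - 2) * \<mu> + 2 * \<mu>" by (simp add: algebra_simps)
    then show ?thesis by (simp add: a_def scaleR_add_left)
  qed
  have daz: "dist a z \<le> 4 * s"
  proof -
    have "\<bar>real k - 2\<bar> \<le> real N" using k by (auto simp: abs_le_iff)
    then have "\<bar>real k - 2\<bar> * \<mu> \<le> real N * \<mu>" using \<mu> by (intro mult_right_mono) auto
    then have "dist a y \<le> 2 * s" using N \<mu> ne by (simp add: a_def dist_norm abs_mult)
    then show ?thesis using y dist_triangle[of a z y] by linarith
  qed
  \<comment> \<open>A point of \<Omega> within \<eta> * \<mu> of \<open>a\<close> could be moved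
    along a vector of the cone to \<open>a + \<mu> *\<^sub>R e\<close>, which is outside
    \<Omega>.\<close>
  have far: "\<not> infdist a \<Omega> < \<eta> * \<mu>"
  proof
    assume "infdist a \<Omega> < \<eta> * \<mu>"
    then obtain q where q: "q \<in> \<Omega>" "dist a q < \<eta> * \<mu>" using infdist_less_iff by blast
    define v where "v = e + (a - q) /\<^sub>R \<mu>"
    have "dist z q \<le> dist z a + dist a q" by (rule dist_triangle)
    also have "\<dots> < 4 * s + \<mu>"
    proof -
      have "\<eta> * \<mu> \<le> 1 * \<mu>" using \<eta>_le_1 \<mu> by (intro mult_right_mono) auto
      then show ?thesis using daz q by (simp add: dist_commute)
    qed
    finally have "q \<in> ball z r" using N s0 by simp
    moreover have "v \<in> ball e \<eta>"
    proof -
      have "norm ((a - q) /\<^sub>R \<mu>) = dist a q / \<mu>" using \<mu> by (simp add: dist_norm divide_inverse mult.commute)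
      also have "\<dots> < \<eta>" using q \<mu> by (simp add: field_simps)
      finally show ?thesis by (simp add: v_def dist_norm)
    qed
    ultimately have "q + \<mu> *\<^sub>R v \<in> \<Omega>" using e q \<mu> N s0 by (auto simp: cone_at_def)
    also have "q + \<mu> *\<^sub>R v = a + \<mu> *\<^sub>R e" using \<mu> by (simp add: v_def scaleR_add_right)
    finally show False using nPk by (simp add: P_def a1)
  qed
  have "a + (2 * \<mu>) *\<^sub>R e \<in> \<Omega>" using k by (simp add: P_def a2)
  then have "infdist a \<Omega> \<le> dist a (a + (2 * \<mu>) *\<^sub>R e)" by (rule infdist_le)
  also have "\<dots> = 2 * \<mu>" using ne \<mu> by (simp add: dist_norm)
  finally have up: "infdist a \<Omega> < \<delta>" using \<mu> by linarith
  have "infdist a \<Omega> > 0" using far \<mu> \<eta>_pos by (smt (verit) mult_pos_pos)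
  then have "a \<notin> \<Omega>" by auto
  then have "a \<in> {a \<in> rim \<delta>. \<eta> * \<mu> \<le> infdist a \<Omega> \<and> dist a z \<le> 4 * s}"
    using up far daz by (auto simp: collar_def)
  then show ?thesis using k by (intro bexI[of _ k]) (auto simp: a_def)
qed

text \<open>Opposite to the cone, the ball around z - s * e of radius s * \<eta> avoids \<Omega>,
  and each of its points is in \<Omega> after moving by 2 * s along \<open>e\<close>. By
  \<open>collar_point_on_chain\<close> one of N shifts carries it into the part \<open>A\<close> of
  the collar with height at least \<eta> * \<mu>, so \<open>A\<close> has at least 1 / N of the
  measure of the ball. With m = min s \<delta>, N of order s / m and \<mu> of order m, the integral
  is at least of order m * (m / s) * s^d.\<close>

lemma collar_weight_lower_local:
  assumes z: "z \<in> frontier \<Omega>" and s: "0 < s" "s \<le> r / 16" and \<delta>: "0 < \<delta>"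
  shows "ennreal (2 * unit_ball_vol DIM('a) * \<eta> ^ (DIM('a) + 1) / 81 * (min s \<delta>)\<^sup>2 * s ^ (DIM('a) - 1))
    \<le> (\<integral>\<^sup>+a. ennreal (infdist a \<Omega>) * indicator (rim \<delta> \<inter> cball z (4 * s)) a)"
proof -
  have zc: "z \<in> closure \<Omega>" and zn: "z \<notin> \<Omega>"
    using z open_\<Omega> by (auto simp: frontier_def interior_open)
  obtain e where e: "cone_at \<Omega> r \<eta> z e" using cone[OF zc] by blast
  have ne: "norm e = 1" using e by (simp add: cone_at_def)
  define m where "m = min s \<delta>"
  have m: "0 < m" "m \<le> s" "m \<le> \<delta>" using s \<delta> by (auto simp: m_def)
  \<comment> \<open>With 8 * s / m \<le> N \<le> 9 * s / m the step \<mu> = 2 * s / N lies between 2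
    * m / 9 and m / 4. The constant 2 / 81 in the claim is the product of 2 / 9 and 1 / 9.\<close>
  define N where "N = nat \<lceil>8 * s / m\<rceil>"
  have sm: "8 * s / m \<ge> 8" using m by (simp add: field_simps)
  have N: "8 * s / m \<le> real N" "real N \<le> 9 * s / m" "N > 0"
  proof -
    show "8 * s / m \<le> real N" using sm by (simp add: N_def)
    have "real N \<le> 8 * s / m + 1" using sm by (simp add: N_def)
    also have "\<dots> \<le> 9 * s / m" using m by (simp add: field_simps)
    finally show "real N \<le> 9 * s / m" .
    show "N > 0" using sm by (simp add: N_def)
  qed
  define \<mu> where "\<mu> = 2 * s / real N"
  have N\<mu>: "real N * \<mu> = 2 * s" using N by (simp add: \<mu>_def)
  have \<mu>: "0 < \<mu>" "4 * \<mu> \<le> m" "2 * m / 9 \<le> \<mu>"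
    using N s m by (auto simp: \<mu>_def field_simps)
  define A where "A = {a \<in> rim \<delta>. \<eta> * \<mu> \<le> infdist a \<Omega> \<and> dist a z \<le> 4 * s}"
  have [measurable]: "(\<lambda>x. infdist x \<Omega>) \<in> borel_measurable borel"
    by (intro borel_measurable_continuous_onI continuous_intros)
  have A_eq: "A = rim \<delta> \<inter> {a. \<eta> * \<mu> \<le> infdist a \<Omega>} \<inter> cball z (4 * s)"
    by (auto simp: A_def dist_commute)
  have [measurable]: "A \<in> sets borel" unfolding A_eq by measurable
  have sub: "ball (z - s *\<^sub>R e) (s * \<eta>) \<subseteq> (\<Union>k\<in>{1..N}. {y. y + ((real k - 2) * \<mu>) *\<^sub>R e \<in> A})"
  proof
    fix y assume y: "y \<in> ball (z - s *\<^sub>R e) (s * \<eta>)"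
    define v where "v = (z - y) /\<^sub>R s"
    have yv: "y = z - s *\<^sub>R v" using s by (simp add: v_def)
    have "norm (s *\<^sub>R (v - e)) < s * \<eta>" using y unfolding yv by (simp add: dist_norm algebra_simps)
    then have v: "norm (v - e) < \<eta>" using s by simp
    have nv: "norm v \<le> 2" using v ne \<eta>_le_1 norm_triangle_ineq[of e "v - e"] by simp
    have yz: "dist y z \<le> 2 * s" using nv s by (simp add: yv dist_norm)
    have "y \<notin> \<Omega>"
    proof
      assume "y \<in> \<Omega>"
      moreover have "y \<in> ball z r" using yz s r_pos by (simp add: dist_commute)
      moreover have "v \<in> ball e \<eta>" using v by (simp add: dist_norm norm_minus_commute)
      ultimately have "y + s *\<^sub>R v \<in> \<Omega>" using e s r_pos by (auto simp: cone_at_def)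
      then show False using zn by (simp add: yv)
    qed
    \<comment> \<open>The endpoint is z + s * (2 * e - v), and 2 * e - v is as close to
      \<open>e\<close> as \<open>v\<close> is. As \<open>z\<close> itself is not in \<Omega>, the
      cone is applied at a nearby \<open>z'\<close> in \<Omega> with a slightly corrected
      direction.\<close>
    moreover have "y + (2 * s) *\<^sub>R e \<in> \<Omega>"
    proof -
      define w where "w = 2 *\<^sub>R e - v"
      have "w - e = - (v - e)" by (simp add: w_def algebra_simps) (simp add: scaleR_2)
      then have w: "norm (w - e) < \<eta>" using v by (metis norm_minus_cancel)
      define g where "g = min (s * (\<eta> - norm (w - e))) r"
      have g: "g > 0" using s w r_pos by (simp add: g_def)
      have "\<exists>z'\<in>\<Omega>. dist z' z < g" using zc g by (simp add: closure_approachable)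
      then obtain z' where z': "z' \<in> \<Omega>" "dist z' z < g" by (elim bexE)
      define w' where "w' = w + (z - z') /\<^sub>R s"
      have dn: "dist z' z = norm (z - z')" unfolding dist_norm by (rule norm_minus_commute)
      have "norm ((z - z') /\<^sub>R s) = dist z' z / s" unfolding norm_scaleR dn using s by (simp only: abs_of_pos positive_imp_inverse_positive divide_inverse mult.commute)
      also have "\<dots> < \<eta> - norm (w - e)" using z' s by (simp add: g_def field_simps)
      finally have "norm (w' - e) < \<eta>"
        using norm_triangle_ineq[of "w - e" "(z - z') /\<^sub>R s"] by (simp add: w'_def algebra_simps)
      then have "w' \<in> ball e \<eta>" by (simp add: dist_norm norm_minus_commute)
      moreover have "z' \<in> ball z r" using z' by (simp add: g_def dist_commute)
      ultimately have "z' + s *\<^sub>R w' \<in> \<Omega>" using e z' s r_pos by (auto simp: cone_at_def)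
      also have "z' + s *\<^sub>R w' = z + s *\<^sub>R w" using s by (simp add: w'_def scaleR_add_right)
      also have "\<dots> = y + (2 * s) *\<^sub>R e" by (simp add: yv w_def algebra_simps)
      finally show ?thesis .
    qed
    ultimately show "y \<in> (\<Union>k\<in>{1..N}. {y. y + ((real k - 2) * \<mu>) *\<^sub>R e \<in> A})"
      using collar_point_on_chain[OF e \<mu>(1) _ N(3) _ N\<mu> yz, of \<delta>] \<mu> m s by (auto simp: A_def)
  qed
  have sh: "emeasure lborel {y. y + c \<in> A} = emeasure lborel A" "{y. y + c \<in> A} \<in> sets borel" for c
    by (rule emeasure_lborel_shift, simp)+
  have "ennreal (unit_ball_vol DIM('a) * (s * \<eta>) ^ DIM('a)) = emeasure lborel (ball (z - s *\<^sub>R e) (s * \<eta>))"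
    using s \<eta>_pos by (simp add: emeasure_ball_le)
  also have "\<dots> \<le> emeasure lborel (\<Union>k\<in>{1..N}. {y. y + ((real k - 2) * \<mu>) *\<^sub>R e \<in> A})"
    using sub sh by (intro emeasure_mono) auto
  also have "\<dots> \<le> (\<Sum>k\<in>{1..N}. emeasure lborel {y. y + ((real k - 2) * \<mu>) *\<^sub>R e \<in> A})"
    using sh by (intro emeasure_subadditive_finite) auto
  also have "\<dots> = ennreal (real N) * emeasure lborel A"
    by (simp add: sh ennreal_of_nat_eq_real_of_nat)
  also have "\<dots> \<le> ennreal (9 * s / m) * emeasure lborel A"
    using N by (intro mult_right_mono ennreal_leI) auto
  finally have vol: "ennreal (unit_ball_vol DIM('a) * (s * \<eta>) ^ DIM('a)) \<le> ennreal (9 * s / m) * emeasure lborel A" .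
  have "2 * unit_ball_vol DIM('a) * \<eta> ^ (DIM('a) + 1) / 81 * m\<^sup>2 * s ^ (DIM('a) - 1) = \<eta> * (2 * m / 9) * (m / (9 * s)) * (unit_ball_vol DIM('a) * (s * \<eta>) ^ DIM('a))"
  proof -
    have "s ^ DIM('a) = s * s ^ (DIM('a) - 1)" using DIM_positive[where 'a='a] by (metis power_eq_if neq0_conv)
    then show ?thesis using s by (simp add: power_mult_distrib power2_eq_square field_simps)
  qed
  then have "ennreal (2 * unit_ball_vol DIM('a) * \<eta> ^ (DIM('a) + 1) / 81 * m\<^sup>2 * s ^ (DIM('a) - 1)) =
    ennreal (\<eta> * (2 * m / 9) * (m / (9 * s))) * ennreal (unit_ball_vol DIM('a) * (s * \<eta>) ^ DIM('a))"
    using \<eta>_pos m s by (simp add: ennreal_mult[symmetric])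
  also have "\<dots> \<le> ennreal (\<eta> * (2 * m / 9) * (m / (9 * s))) * (ennreal (9 * s / m) * emeasure lborel A)"
    by (intro mult_left_mono vol) auto
  also have "\<dots> = ennreal (\<eta> * (2 * m / 9)) * emeasure lborel A"
  proof -
    have "\<eta> * (2 * m / 9) * (m / (9 * s)) * (9 * s / m) = \<eta> * (2 * m / 9)"
      using s m by (simp add: field_simps)
    moreover have "ennreal (\<eta> * (2 * m / 9) * (m / (9 * s))) * ennreal (9 * s / m) = ennreal (\<eta> * (2 * m / 9) * (m / (9 * s)) * (9 * s / m))"
      using \<eta>_pos m s by (intro ennreal_mult[symmetric]) auto
    ultimately have "ennreal (\<eta> * (2 * m / 9) * (m / (9 * s))) * ennreal (9 * s / m) = ennreal (\<eta> * (2 * m / 9))"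
      by (simp only:)
    then show ?thesis by (simp only: mult.assoc[symmetric])
  qed
  also have "\<dots> \<le> ennreal (\<eta> * \<mu>) * emeasure lborel A"
    using \<mu> \<eta>_pos by (intro mult_right_mono ennreal_leI mult_left_mono) auto
  also have "\<dots> = (\<integral>\<^sup>+a. ennreal (\<eta> * \<mu>) * indicator A a)"
    by (rule nn_integral_cmult_indicator[symmetric]) simp
  also have "\<dots> \<le> (\<integral>\<^sup>+a. ennreal (infdist a \<Omega>) * indicator (rim \<delta> \<inter> cball z (4 * s)) a)"
    by (intro nn_integral_mono) (auto simp: indicator_def A_def dist_commute intro!: ennreal_leI)
  finally show ?thesis by (simp add: m_def)
qed

end

section \<open>The extension operator\<close>

lemma nn_integral_max_dist_powr_le:
  fixes a :: "'a::euclidean_space"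
  assumes \<alpha>: "\<alpha> > 0" and \<tau>: "\<tau> > 0"
  shows "(\<integral>\<^sup>+x. ennreal (max (dist a x) \<tau> powr (- real DIM('a) - \<alpha>))) \<le>
    ennreal (unit_ball_vol DIM('a) * (1 + 2 powr (real DIM('a) + \<alpha> + 1) / \<alpha>) * \<tau> powr (- \<alpha>))"
proof -
  let ?d = "real DIM('a)" and ?v = "unit_ball_vol (real DIM('a))"
  define A where "A = \<tau> powr (- ?d - \<alpha>)"
  define F where "F x = ennreal (dist a x powr (- ?d - \<alpha>)) * indicator UNIV x * indicator {\<tau>..} (dist a x)" for x
  have F[measurable]: "F \<in> borel_measurable borel" unfolding F_def[abs_def] by measurable
  have "(\<integral>\<^sup>+x. ennreal (max (dist a x) \<tau> powr (- ?d - \<alpha>))) \<le> (\<integral>\<^sup>+x. ennreal A * indicator (ball a \<tau>) x + F x)"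
  proof (rule nn_integral_mono)
    fix x
    show "ennreal (max (dist a x) \<tau> powr (- ?d - \<alpha>)) \<le> ennreal A * indicator (ball a \<tau>) x + F x"
      by (cases "dist a x < \<tau>") (simp_all add: max_def A_def F_def)
  qed
  also have "\<dots> = (\<integral>\<^sup>+x. ennreal A * indicator (ball a \<tau>) x) + integral\<^sup>N lborel F"
    by (rule nn_integral_add) (simp_all add: F borel_measurable_times_ennreal borel_measurable_indicator)
  also have "(\<integral>\<^sup>+x. ennreal A * indicator (ball a \<tau>) x) = ennreal A * ennreal (?v * \<tau> ^ DIM('a))"
    using \<tau> by (simp add: nn_integral_cmult_indicator emeasure_ball_le)
  also have "\<dots> = ennreal (?v * \<tau> powr (- \<alpha>))"
  proof -
    have "A * \<tau> ^ DIM('a) = \<tau> powr (- \<alpha>)"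
      using \<tau> by (simp add: A_def powr_realpow[symmetric] powr_add[symmetric])
    then have "A * (?v * \<tau> ^ DIM('a)) = ?v * \<tau> powr (- \<alpha>)" by (metis mult.left_commute)
    then show ?thesis using \<tau> by (simp add: ennreal_mult[symmetric] A_def)
  qed
  also have "integral\<^sup>N lborel F \<le> ennreal (2 powr (\<bar>?d + \<alpha>\<bar> + 1) * ?v * (\<tau> powr (- \<alpha>) / \<alpha>))"
    unfolding F_def using \<tau> by (intro nn_integral_dist_powr_tail_le[OF _ \<alpha> \<tau>] emeasure_cball_powr) auto
  also have "ennreal (?v * \<tau> powr (- \<alpha>)) + \<dots> = ennreal (?v * \<tau> powr (- \<alpha>) + 2 powr (\<bar>?d + \<alpha>\<bar> + 1) * ?v * (\<tau> powr (- \<alpha>) / \<alpha>))"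
    using \<alpha> by (intro ennreal_plus[symmetric]) auto
  also have "\<bar>?d + \<alpha>\<bar> = ?d + \<alpha>" using \<alpha> by simp
  also have "?v * \<tau> powr (- \<alpha>) + 2 powr (?d + \<alpha> + 1) * ?v * (\<tau> powr (- \<alpha>) / \<alpha>) = ?v * (1 + 2 powr (?d + \<alpha> + 1) / \<alpha>) * \<tau> powr (- \<alpha>)"
    by (simp add: algebra_simps)
  finally show ?thesis by (simp add: add_left_mono)
qed

section \<open>The averaging kernel of the extension and its mass\<close>

context cone_domain
begin

definition depth :: "'a \<Rightarrow> real" where "depth x = infdist x (- \<Omega>)"

definition height :: "'a \<Rightarrow> real" where "height a = infdist a \<Omega>"

lemma depth_measurable[measurable]: "depth \<in> borel_measurable borel"
  unfolding depth_def[abs_def] by (intro borel_measurable_continuous_onI continuous_intros)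

lemma height_measurable[measurable]: "height \<in> borel_measurable borel"
  unfolding height_def[abs_def] by (intro borel_measurable_continuous_onI continuous_intros)

lemma Compl_nonempty: "- \<Omega> \<noteq> {}"
proof
  assume "- \<Omega> = {}"
  then have "\<Omega> = UNIV" by auto
  then show False using bounded_\<Omega> not_bounded_UNIV by metis
qed

lemma depth_pos: "x \<in> \<Omega> \<Longrightarrow> 0 < depth x"
  using open_\<Omega> Compl_nonempty unfolding depth_def
  by (metis ComplD closed_Compl in_closed_iff_infdist_zero infdist_nonneg less_le)

lemma depth_nonneg: "0 \<le> depth x" by (simp add: depth_def infdist_nonneg)
lemma height_nonneg: "0 \<le> height x" by (simp add: height_def infdist_nonneg)

lemma depth_le: "y \<notin> \<Omega> \<Longrightarrow> depth x \<le> dist x y"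
  unfolding depth_def by (rule infdist_le) auto

lemma height_le: "x \<in> \<Omega> \<Longrightarrow> height a \<le> dist x a"
  unfolding height_def by (subst dist_commute) (rule infdist_le)

lemma depth_lipschitz: "depth x \<le> depth y + dist x y"
  unfolding depth_def by (rule infdist_triangle)

lemma height_less: "a \<in> rim \<delta> \<Longrightarrow> height a < \<delta>"
  by (simp add: collar_def height_def)

lemma nearest_frontier:
  assumes "x \<in> \<Omega>"
  obtains z where "z \<in> frontier \<Omega>" "dist x z = depth x"
proof -
  have "closed (- \<Omega>)" using open_\<Omega> by auto
  then obtain z where z: "z \<in> - \<Omega>" "infdist x (- \<Omega>) = dist x z"
    using infdist_attains_inf[OF _ Compl_nonempty] by blast
  have sub: "ball x (depth x) \<subseteq> \<Omega>"
    using depth_le by (fastforce simp: not_less[symmetric])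
  have "z \<in> cball x (depth x)" using z by (simp add: depth_def)
  also have "cball x (depth x) = closure (ball x (depth x))"
    using depth_pos[OF assms] by simp
  also have "\<dots> \<subseteq> closure \<Omega>" using sub by (rule closure_mono)
  finally have "z \<in> frontier \<Omega>"
    using z open_\<Omega> by (simp add: frontier_def interior_open)
  then show thesis using that z by (simp add: depth_def)
qed

lemma depth_bounded: "\<exists>T>0. \<forall>x\<in>\<Omega>. depth x \<le> T"
proof -
  obtain q where q: "q \<notin> \<Omega>" using Compl_nonempty by auto
  obtain B where B: "\<And>x. x \<in> \<Omega> \<Longrightarrow> norm x \<le> B" using bounded_\<Omega> by (auto simp: bounded_iff)
  have "depth x \<le> max 1 (B + norm q)" if "x \<in> \<Omega>" for x
    using depth_le[OF q, of x] B[OF that] norm_triangle_ineq4[of x q] by (simp add: dist_norm)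
  then show ?thesis by (intro exI[of _ "max 1 (B + norm q)"]) auto
qed

text \<open>The local bound is used at scale \<open>min (depth x) (r / 16)\<close>, around a nearest
  boundary point. Depths are bounded on \<Omega>, so this scale is at least a fixed multiple of the
  depth. Points within four times the scale of the boundary point are within 5 * depth x of
  \<open>x\<close>.\<close>

lemma collar_weight_lower:
  "\<exists>c>0. \<forall>\<delta> x. 0 < \<delta> \<longrightarrow> \<delta> < r / 16 \<longrightarrow> x \<in> \<Omega> \<longrightarrow>
    ennreal (c * ((min (depth x) \<delta>)\<^sup>2 * depth x ^ (DIM('a) - 1)))
      \<le> (\<integral>\<^sup>+a. ennreal (height a) * indicator (rim \<delta> \<inter> cball x (6 * depth x)) a)"
proof -
  obtain T where T: "T > 0" "\<And>x. x \<in> \<Omega> \<Longrightarrow> depth x \<le> T" using depth_bounded by blast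
  define k where "k = min 1 (r / 16 / T)"
  have k: "k > 0" "k \<le> 1" using r_pos T by (auto simp: k_def)
  define c0 where "c0 = 2 * unit_ball_vol DIM('a) * \<eta> ^ (DIM('a) + 1) / 81"
  have c0: "c0 > 0" using \<eta>_pos by (simp add: c0_def)
  show ?thesis
  proof (intro exI conjI allI impI)
    show "c0 * k ^ (DIM('a) - 1) > 0" using c0 k by simp
    fix \<delta> x assume \<delta>: "0 < \<delta>" "\<delta> < r / 16" and x: "x \<in> \<Omega>"
    define t where "t = depth x"
    have t: "t > 0" "t \<le> T" using depth_pos[OF x] T(2)[OF x] by (auto simp: t_def)
    obtain z where z: "z \<in> frontier \<Omega>" "dist x z = t" using nearest_frontier[OF x] by (auto simp: t_def)
    define s where "s = min t (r / 16)"
    have s: "0 < s" "s \<le> r / 16" "s \<le> t" using t r_pos by (auto simp: s_def)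
    have m: "min s \<delta> = min t \<delta>" using \<delta> by (auto simp: s_def)
    have ks: "k * t \<le> s"
    proof -
      have "k * t \<le> 1 * t" using k t by (intro mult_right_mono) auto
      moreover have "k * t \<le> r / 16 / T * T" using k t T by (intro mult_mono) (auto simp: k_def)
      ultimately show ?thesis using T by (simp add: s_def)
    qed
    have "ennreal (c0 * k ^ (DIM('a) - 1) * ((min t \<delta>)\<^sup>2 * t ^ (DIM('a) - 1))) = ennreal (c0 * (min s \<delta>)\<^sup>2 * (k * t) ^ (DIM('a) - 1))"
      unfolding m by (simp add: power_mult_distrib mult_ac)
    also have "\<dots> \<le> ennreal (c0 * (min s \<delta>)\<^sup>2 * s ^ (DIM('a) - 1))"
      using c0 ks k t by (intro ennreal_leI mult_left_mono power_mono) auto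
    also have "\<dots> \<le> (\<integral>\<^sup>+a. ennreal (infdist a \<Omega>) * indicator (rim \<delta> \<inter> cball z (4 * s)) a)"
      unfolding c0_def by (rule collar_weight_lower_local[OF z(1) s(1,2) \<delta>(1)])
    also have "\<dots> \<le> (\<integral>\<^sup>+a. ennreal (height a) * indicator (rim \<delta> \<inter> cball x (6 * t)) a)"
    proof (intro nn_integral_mono)
      fix a
      have "dist x a \<le> 6 * t" if "dist z a \<le> 4 * s"
        using that z(2) s t dist_triangle[of x a z] by linarith
      then show "ennreal (infdist a \<Omega>) * indicator (rim \<delta> \<inter> cball z (4 * s)) a \<le> ennreal (height a) * indicator (rim \<delta> \<inter> cball x (6 * t)) a"
        by (auto simp: indicator_def height_def)
    qed
    finally show "ennreal (c0 * k ^ (DIM('a) - 1) * ((min (depth x) \<delta>)\<^sup>2 * depth x ^ (DIM('a) - 1))) \<le> (\<integral>\<^sup>+a. ennreal (height a) * indicator (rim \<delta> \<inter> cball x (6 * depth x)) a)"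
      by (simp only: t_def)
  qed
qed

text \<open>The weight \<open>height a\<close> keeps the averages away from the boundary; it is what makes all the
  estimates below uniform in the exponent of the kernel.\<close>

definition ext_ker :: "real \<Rightarrow> 'a \<Rightarrow> 'a \<Rightarrow> real" where
  "ext_ker \<delta> x a = max 0 (12 * depth x - dist x a) * height a * indicator (rim \<delta>) a"

text \<open>Order of magnitude of the integral of \<open>height\<close> over the part of the collar
  within a multiple of the depth: heights range up to about min (depth x) \<delta>, which
  contributes a square, and the lateral extent is (d-1)-dimensional.\<close>

definition mass :: "real \<Rightarrow> 'a \<Rightarrow> real" where
  "mass \<delta> x = (min (depth x) \<delta>)\<^sup>2 * depth x ^ (DIM('a) - 1)"

text \<open>Majorant of the normalised kernel, up to a constant. The radius is 24 times the depth
  although \<open>ext_ker\<close> reaches only 12 times, so that the kernels of all points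
  \<open>y\<close> with dist x y < depth x / 2 are covered as well.\<close>

definition envelope :: "real \<Rightarrow> 'a \<Rightarrow> 'a \<Rightarrow> real" where
  "envelope \<delta> x a = height a / mass \<delta> x * indicator {..<24 * depth x} (dist x a) * indicator (rim \<delta>) a * indicator \<Omega> x"

lemma ext_ker_measurable[measurable]: "ext_ker \<delta> x \<in> borel_measurable borel"
  unfolding ext_ker_def[abs_def] by measurable

lemma mass_measurable[measurable]: "mass \<delta> \<in> borel_measurable borel"
  unfolding mass_def[abs_def] by measurable

lemma envelope_measurable2[measurable]:
  "(\<lambda>w. envelope \<delta> (fst w) (snd w)) \<in> borel_measurable (borel \<Otimes>\<^sub>M borel)"
proof -
  have "envelope \<delta> x a = (if dist x a < 24 * depth x then height a / mass \<delta> x else 0) * indicator (rim \<delta>) a * indicator \<Omega> x" for x a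
    by (simp add: envelope_def)
  then show ?thesis by (simp only:) measurable
qed

lemma mass_nonneg: "0 \<le> mass \<delta> x"
  by (simp add: mass_def depth_nonneg)

lemma mass_pos: "0 < \<delta> \<Longrightarrow> x \<in> \<Omega> \<Longrightarrow> 0 < mass \<delta> x"
  using depth_pos[of x] by (simp add: mass_def)

lemma envelope_nonneg: "0 \<le> envelope \<delta> x a"
  by (simp add: envelope_def mass_nonneg height_nonneg)

lemma ext_ker_nonneg: "0 \<le> ext_ker \<delta> x a"
  by (simp add: ext_ker_def height_nonneg)

lemma ext_ker_le: "0 \<le> \<delta> \<Longrightarrow> ext_ker \<delta> x a \<le> 12 * depth x * \<delta> * indicator (rim \<delta>) a"
  using height_less[of a \<delta>] height_nonneg[of a] depth_nonneg[of x]
  by (auto simp: ext_ker_def indicator_def intro!: mult_mono)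

lemma integrable_ext_ker_mult:
  assumes "0 < \<delta>" and u: "rim_integrable \<delta> u"
  shows "integrable lborel (\<lambda>a. u a * ext_ker \<delta> x a)"
proof (rule Bochner_Integration.integrable_bound[OF integrable_mult_right[OF u, of "12 * depth x * \<delta>"]])
  have "(\<lambda>a. (u a * indicator (rim \<delta>) a) * (max 0 (12 * depth x - dist x a) * height a)) \<in> borel_measurable lborel"
    using borel_measurable_integrable[OF u] by measurable
  then show "(\<lambda>a. u a * ext_ker \<delta> x a) \<in> borel_measurable lborel"
    by (simp add: ext_ker_def mult_ac)
  show "AE a in lborel. norm (u a * ext_ker \<delta> x a) \<le> norm (12 * depth x * \<delta> * (u a * indicator (rim \<delta>) a))"
  proof (rule AE_I2)
    fix a
    have "\<bar>u a\<bar> * ext_ker \<delta> x a \<le> \<bar>u a\<bar> * (12 * depth x * \<delta> * indicator (rim \<delta>) a)"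
      using assms by (intro mult_left_mono ext_ker_le) auto
    then show "norm (u a * ext_ker \<delta> x a) \<le> norm (12 * depth x * \<delta> * (u a * indicator (rim \<delta>) a))"
      using assms depth_nonneg[of x] by (simp add: abs_mult ext_ker_nonneg mult_ac)
  qed
qed

lemma integrable_ext_ker:
  assumes "0 < \<delta>"
  shows "integrable lborel (ext_ker \<delta> x)"
proof -
  have "integrable lborel (\<lambda>a. indicator (rim \<delta>) a :: real)"
    using emeasure_bounded_finite[OF bounded_collar] by (intro integrable_real_indicator) auto
  then show ?thesis
    using integrable_ext_ker_mult[OF assms, of "\<lambda>_. 1" x] by simp
qed

text \<open>On the ball of radius 6 * depth x the tent factor of \<open>ext_ker\<close> is at least
  6 * depth x, and there \<open>collar_weight_lower\<close> bounds the integral of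
  \<open>height\<close> from below.\<close>

lemma ext_ker_integral_lower:
  "\<exists>c>0. \<forall>\<delta> x. 0 < \<delta> \<longrightarrow> \<delta> < r / 16 \<longrightarrow> x \<in> \<Omega> \<longrightarrow> c * (depth x * mass \<delta> x) \<le> integral\<^sup>L lborel (ext_ker \<delta> x)"
proof -
  obtain c where c: "c > 0" and lower: "\<And>\<delta> x. 0 < \<delta> \<Longrightarrow> \<delta> < r / 16 \<Longrightarrow> x \<in> \<Omega> \<Longrightarrow>
    ennreal (c * ((min (depth x) \<delta>)\<^sup>2 * depth x ^ (DIM('a) - 1)))
      \<le> (\<integral>\<^sup>+a. ennreal (height a) * indicator (rim \<delta> \<inter> cball x (6 * depth x)) a)"
    using collar_weight_lower by blast
  show ?thesis
  proof (intro exI conjI allI impI)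
    show "6 * c > 0" using c by simp
    fix \<delta> x assume \<delta>: "0 < \<delta>" "\<delta> < r / 16" and x: "x \<in> \<Omega>"
    have d: "depth x > 0" using x by (rule depth_pos)
    have "ennreal (6 * c * (depth x * mass \<delta> x)) = ennreal (6 * depth x) * ennreal (c * mass \<delta> x)"
      using c d mass_nonneg[of \<delta> x] by (simp add: ennreal_mult[symmetric] mult_ac)
    also have "\<dots> \<le> ennreal (6 * depth x) * (\<integral>\<^sup>+a. ennreal (height a) * indicator (rim \<delta> \<inter> cball x (6 * depth x)) a)"
      using lower[OF \<delta> x] by (intro mult_left_mono) (auto simp: mass_def)
    also have "\<dots> = (\<integral>\<^sup>+a. ennreal (6 * depth x) * (ennreal (height a) * indicator (rim \<delta> \<inter> cball x (6 * depth x)) a))"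
      by (rule nn_integral_cmult[symmetric]) (auto intro!: borel_measurable_times_ennreal borel_measurable_indicator)
    also have "\<dots> \<le> (\<integral>\<^sup>+a. ennreal (ext_ker \<delta> x a))"
    proof (rule nn_integral_mono)
      fix a
      have "6 * depth x * height a \<le> max 0 (12 * depth x - dist x a) * height a" if "dist x a \<le> 6 * depth x"
        using that height_nonneg[of a] by (intro mult_right_mono) auto
      then show "ennreal (6 * depth x) * (ennreal (height a) * indicator (rim \<delta> \<inter> cball x (6 * depth x)) a) \<le> ennreal (ext_ker \<delta> x a)"
        using d height_nonneg[of a] by (auto simp: indicator_def ext_ker_def ennreal_mult[symmetric] intro!: ennreal_leI)
    qed
    also have "\<dots> = ennreal (integral\<^sup>L lborel (ext_ker \<delta> x))"
      by (rule nn_integral_eq_integral[OF integrable_ext_ker[OF \<delta>(1)]]) (auto simp: ext_ker_nonneg)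
    finally show "6 * c * (depth x * mass \<delta> x) \<le> integral\<^sup>L lborel (ext_ker \<delta> x)"
      by (subst (asm) ennreal_le_iff) (auto simp: ext_ker_nonneg)
  qed
qed

lemma averaging_ext_ker:
  assumes "0 < \<delta>" "\<delta> < r / 16" "x \<in> \<Omega>" "u \<in> borel_measurable borel" "rim_integrable \<delta> u"
  shows "averaging (ext_ker \<delta> x) u"
proof -
  obtain c where "c > 0" "c * (depth x * mass \<delta> x) \<le> integral\<^sup>L lborel (ext_ker \<delta> x)"
    using ext_ker_integral_lower assms(1-3) by meson
  moreover have "0 < depth x * mass \<delta> x" using depth_pos[OF assms(3)] mass_pos[OF assms(1,3)] by simp
  ultimately have "0 < integral\<^sup>L lborel (ext_ker \<delta> x)" by (smt (verit) mult_pos_pos)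
  then show ?thesis
    unfolding averaging_def
    using assms(4) integrable_ext_ker[OF assms(1)] integrable_ext_ker_mult[OF assms(1,5)] by (simp add: ext_ker_nonneg)
qed

lemma ext_ker_div_le:
  "\<exists>C>0. \<forall>\<delta> x a. 0 < \<delta> \<longrightarrow> \<delta> < r / 16 \<longrightarrow> x \<in> \<Omega> \<longrightarrow>
    ext_ker \<delta> x a / integral\<^sup>L lborel (ext_ker \<delta> x) \<le> C * envelope \<delta> x a"
proof -
  obtain c where c: "c > 0" and lower: "\<And>\<delta> x. 0 < \<delta> \<Longrightarrow> \<delta> < r / 16 \<Longrightarrow> x \<in> \<Omega> \<Longrightarrow> c * (depth x * mass \<delta> x) \<le> integral\<^sup>L lborel (ext_ker \<delta> x)"
    using ext_ker_integral_lower by blast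
  show ?thesis
  proof (intro exI conjI allI impI)
    show "12 / c > 0" using c by simp
    fix \<delta> x a assume \<delta>: "0 < \<delta>" "\<delta> < r / 16" and x: "x \<in> \<Omega>"
    have d: "depth x > 0" "mass \<delta> x > 0" using depth_pos[OF x] mass_pos[OF \<delta>(1) x] by auto
    have "ext_ker \<delta> x a \<le> 12 * depth x * height a * indicator {..<24 * depth x} (dist x a) * indicator (rim \<delta>) a"
      using d height_nonneg[of a] by (auto simp: ext_ker_def indicator_def intro!: mult_right_mono)
    then have "ext_ker \<delta> x a / integral\<^sup>L lborel (ext_ker \<delta> x) \<le>
      (12 * depth x * height a * indicator {..<24 * depth x} (dist x a) * indicator (rim \<delta>) a) / (c * (depth x * mass \<delta> x))"
      using c d lower[OF \<delta> x] height_nonneg[of a] by (intro frac_le) auto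
    also have "\<dots> = 12 / c * envelope \<delta> x a"
      using d x c by (simp add: envelope_def field_simps)
    finally show "ext_ker \<delta> x a / integral\<^sup>L lborel (ext_ker \<delta> x) \<le> 12 / c * envelope \<delta> x a" .
  qed
qed

end

lemma powr_neg_scale_le:
  fixes M t k s :: real
  assumes "M \<le> k * t" "0 < M" "0 < k" "0 \<le> s"
  shows "t powr (- s) \<le> k powr s * M powr (- s)"
proof -
  have t: "0 < t" using assms by (smt (verit) zero_less_mult_pos)
  have "t powr (- s) = k powr s * (k * t) powr (- s)"
    using t assms by (simp add: powr_mult powr_add[symmetric] mult.assoc[symmetric])
  also have "\<dots> \<le> k powr s * M powr (- s)"
    using assms t by (intro mult_left_mono powr_mono2') auto
  finally show ?thesis .
qed

lemma T_kernel_eq: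
  "T_kernel d p \<beta> \<delta> \<rho> = \<delta> powr (\<beta> - 2) * max \<rho> \<delta> powr (- (real d + p - 2)) * min \<rho> \<delta> powr (- \<beta>)"
  unfolding T_kernel_def powr_minus divide_inverse by (simp only: inverse_mult_distrib mult.assoc)

text \<open>For \<rho> > \<delta> the factor \<rho>^(-\<beta>) is at most \<delta>^(-\<beta>), so
  the short-range form of the trace kernel may be used up to distance \<open>A * \<delta>\<close>,
  and the loss is a power of \<open>A\<close> with an exponent free of \<beta>.\<close>

lemma powr_le_T_kernel:
  assumes "0 < \<rho>" "\<rho> \<le> A * \<delta>" "1 \<le> A" "0 < \<delta>" "0 \<le> \<beta>" "2 \<le> real d + p"
  shows "\<delta> powr (- (real d + p - \<beta>)) * \<rho> powr (- \<beta>) \<le> A powr (real d + p - 2) * T_kernel d p \<beta> \<delta> \<rho>"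
proof -
  let ?\<alpha> = "real d + p - 2"
  note eq = T_kernel_eq[of d p \<beta> \<delta> \<rho>]
  show ?thesis
  proof (cases "\<rho> \<le> \<delta>")
    case True
    then have "T_kernel d p \<beta> \<delta> \<rho> = \<delta> powr (- (real d + p - \<beta>)) * \<rho> powr (- \<beta>)"
      using assms by (simp add: eq max_def powr_add[symmetric] algebra_simps)
    moreover have "1 \<le> A powr ?\<alpha>" using assms by (simp add: ge_one_powr_ge_zero)
    ultimately show ?thesis
      using mult_right_mono[of 1 "A powr ?\<alpha>" "T_kernel d p \<beta> \<delta> \<rho>"] T_kernel_nonneg[of d p \<beta> \<delta> \<rho>] by simp
  next
    case False
    then have e: "T_kernel d p \<beta> \<delta> \<rho> = \<delta> powr (- 2) * \<rho> powr (- ?\<alpha>)"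
      using assms by (simp add: eq powr_add[symmetric])
    have "\<delta> powr (- (real d + p - \<beta>)) * \<rho> powr (- \<beta>) \<le> \<delta> powr (- (real d + p - \<beta>)) * \<delta> powr (- \<beta>)"
      using False assms by (intro mult_left_mono powr_mono2') auto
    also have "\<dots> = \<delta> powr (- 2) * \<delta> powr (- ?\<alpha>)"
      using assms by (simp add: powr_add[symmetric])
    also have "\<dots> \<le> \<delta> powr (- 2) * (A powr ?\<alpha> * \<rho> powr (- ?\<alpha>))"
      using assms by (intro mult_left_mono powr_neg_scale_le) auto
    finally show ?thesis by (simp add: e mult_ac)
  qed
qed

text \<open>As min \<rho> \<delta> \<le> \<delta>, its power - \<beta> is at least the one of
  \<delta>. The resulting bound without \<beta> absorbs the contribution of deep points to the
  extension.\<close>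

lemma T_kernel_ge:
  assumes "0 < \<rho>" "0 < \<delta>" "0 \<le> \<beta>"
  shows "\<delta> powr (- 2) * max \<rho> \<delta> powr (- (real d + p - 2)) \<le> T_kernel d p \<beta> \<delta> \<rho>"
proof -
  have "\<delta> powr (- 2) * max \<rho> \<delta> powr (- (real d + p - 2)) = \<delta> powr (\<beta> - 2) * max \<rho> \<delta> powr (- (real d + p - 2)) * \<delta> powr (- \<beta>)"
    using assms by (simp add: powr_add[symmetric] mult.commute mult.left_commute)
  also have "\<dots> \<le> \<delta> powr (\<beta> - 2) * max \<rho> \<delta> powr (- (real d + p - 2)) * min \<rho> \<delta> powr (- \<beta>)"
    using assms by (intro mult_left_mono powr_mono2') auto
  also have "\<dots> = T_kernel d p \<beta> \<delta> \<rho>"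
    by (rule T_kernel_eq[symmetric])
  finally show ?thesis .
qed

section \<open>Integrals of the envelope\<close>

context cone_domain
begin

lemma envelope_measurable[measurable (raw)]:
  assumes [measurable]: "f \<in> M \<rightarrow>\<^sub>M borel" "g \<in> M \<rightarrow>\<^sub>M borel"
  shows "(\<lambda>w. envelope \<delta> (f w) (g w)) \<in> borel_measurable M"
  using measurable_compose[of "\<lambda>w. (f w, g w)", OF _ envelope_measurable2] by simp

lemma envelope_support:
  assumes "envelope \<delta> x a \<noteq> 0"
  shows "x \<in> \<Omega>" "a \<in> rim \<delta>" "dist x a < 24 * depth x" "0 < height a"
  using assms height_nonneg[of a] by (auto simp: envelope_def indicator_def less_le split: if_splits)

lemma envelope_eq:
  assumes "envelope \<delta> x a \<noteq> 0"
  shows "envelope \<delta> x a = height a / mass \<delta> x"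
  using envelope_support[OF assms] by (simp add: envelope_def)

lemma mass_ge_near:
  assumes "0 < \<delta>" "x \<in> \<Omega>" "depth x \<le> 3 * \<delta>"
  shows "depth x powr (real DIM('a) + 1) / 9 \<le> mass \<delta> x"
proof -
  have t: "0 < depth x" using depth_pos assms by simp
  have "depth x powr (real DIM('a) + 1) / 9 = (depth x / 3)\<^sup>2 * depth x ^ (DIM('a) - 1)"
  proof -
    have "depth x powr (real DIM('a) + 1) = depth x ^ (2 + (DIM('a) - 1))"
      using t DIM_positive[where 'a='a] by (subst powr_realpow[symmetric]) (simp_all add: of_nat_diff add.commute)
    then show ?thesis by (simp only: power_add power_divide) simp
  qed
  also have "\<dots> \<le> mass \<delta> x"
    unfolding mass_def using t assms by (intro mult_right_mono power_mono) auto
  finally show ?thesis .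
qed

lemma mass_far:
  assumes "0 < \<delta>" "\<delta> \<le> depth x"
  shows "mass \<delta> x = \<delta>\<^sup>2 * depth x powr (real DIM('a) - 1)"
proof -
  have "depth x powr (real DIM('a) - 1) = depth x ^ (DIM('a) - 1)"
    using assms DIM_positive[where 'a='a] by (subst powr_realpow[symmetric]) (simp_all add: of_nat_diff)
  then show ?thesis using assms by (simp add: mass_def min_def)
qed

lemma envelope_le_near:
  assumes "0 < \<delta>" "depth x \<le> 3 * \<delta>" "envelope \<delta> x a \<noteq> 0"
  shows "envelope \<delta> x a \<le> 9 * height a * depth x powr (- real DIM('a) - 1)"
proof -
  note s = envelope_support[OF assms(3)]
  have t: "0 < depth x" using depth_pos s by simp
  have "envelope \<delta> x a \<le> height a / (depth x powr (real DIM('a) + 1) / 9)"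
    unfolding envelope_eq[OF assms(3)] using mass_ge_near[OF assms(1) s(1) assms(2)] s t
    by (intro divide_left_mono) (auto intro!: mult_pos_pos mass_pos assms)
  also have "\<dots> = 9 * height a * depth x powr (- (real DIM('a) + 1))"
    unfolding powr_minus by (simp add: field_simps)
  finally show ?thesis by simp
qed

lemma envelope_le_far:
  assumes "0 < \<delta>" "\<delta> \<le> depth x"
  shows "envelope \<delta> x a \<le> 1 / \<delta> * depth x powr (1 - real DIM('a))"
proof (cases "envelope \<delta> x a = 0")
  case True
  then show ?thesis using assms by simp
next
  case False
  have "envelope \<delta> x a \<le> \<delta> / (\<delta>\<^sup>2 * depth x powr (real DIM('a) - 1))"
    unfolding envelope_eq[OF False] mass_far[OF assms]
    using height_less[OF envelope_support(2)[OF False]] assms by (intro divide_right_mono) auto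
  also have "\<dots> = 1 / \<delta> * depth x powr (- (real DIM('a) - 1))"
    using assms unfolding powr_minus by (simp add: field_simps power2_eq_square)
  finally show ?thesis by simp
qed

text \<open>At fixed \<open>a\<close> the envelope is at most a multiple of \<open>height a\<close>
  times the power - d - 1 of the larger of \<open>dist a x\<close> and \<open>height a\<close>,
  since both are below 24 * depth x. The weight exactly balances the integral, which is of order 1 /
  height a; an unweighted average would leave the power - d and a logarithm of \<delta> / height
  a.\<close>

lemma envelope_near_mass:
  "\<exists>C>0. \<forall>\<delta> a. 0 < \<delta> \<longrightarrow>
     (\<integral>\<^sup>+x. ennreal (envelope \<delta> x a) * indicator {x. depth x \<le> 3 * \<delta>} x) \<le> ennreal C"
proof -
  let ?D = "real DIM('a)"
  define c where "c = 9 * 24 powr (?D + 1)"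
  define C where "C = c * (unit_ball_vol ?D * (1 + 2 powr (?D + 1 + 1) / 1))"
  have c: "c > 0" by (simp add: c_def)
  have C: "C > 0" using c by (simp add: C_def add_pos_pos)
  have "(\<integral>\<^sup>+x. ennreal (envelope \<delta> x a) * indicator {x. depth x \<le> 3 * \<delta>} x) \<le> ennreal C" if \<delta>: "0 < \<delta>" for \<delta> a
  proof (cases "height a = 0")
    case True
    then show ?thesis by (simp add: envelope_def)
  next
    case False
    then have h: "height a > 0" using height_nonneg[of a] by simp
    have "(\<integral>\<^sup>+x. ennreal (envelope \<delta> x a) * indicator {x. depth x \<le> 3 * \<delta>} x) \<le>
      (\<integral>\<^sup>+x. ennreal (c * height a) * ennreal (max (dist a x) (height a) powr (- ?D - 1)))"
    proof (rule nn_integral_mono)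
      fix x
      show "ennreal (envelope \<delta> x a) * indicator {x. depth x \<le> 3 * \<delta>} x \<le> ennreal (c * height a) * ennreal (max (dist a x) (height a) powr (- ?D - 1))"
      proof (cases "envelope \<delta> x a \<noteq> 0 \<and> depth x \<le> 3 * \<delta>")
        case True
        note s = envelope_support[OF conjunct1[OF True]]
        have "envelope \<delta> x a \<le> 9 * height a * depth x powr (- (?D + 1))"
          using envelope_le_near[OF \<delta>] True by simp
        also have "\<dots> \<le> 9 * height a * (24 powr (?D + 1) * max (dist a x) (height a) powr (- (?D + 1)))"
          using s h height_le[OF s(1), of a]
          by (intro mult_left_mono powr_neg_scale_le) (auto simp: dist_commute max_def)
        finally have "envelope \<delta> x a \<le> c * height a * max (dist a x) (height a) powr (- ?D - 1)"
          by (simp add: c_def mult_ac)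
        then show ?thesis using True c h by (simp add: ennreal_mult[symmetric])
      qed auto
    qed
    also have "\<dots> = ennreal (c * height a) * (\<integral>\<^sup>+x. ennreal (max (dist a x) (height a) powr (- ?D - 1)))"
      by (rule nn_integral_cmult) measurable
    also have "\<dots> \<le> ennreal (c * height a) * ennreal (unit_ball_vol ?D * (1 + 2 powr (?D + 1 + 1) / 1) * height a powr (- 1))"
      by (intro mult_left_mono nn_integral_max_dist_powr_le h) auto
    also have "\<dots> = ennreal C"
    proof -
      have "c * height a * (unit_ball_vol ?D * (1 + 2 powr (?D + 1 + 1) / 1) * height a powr (- 1)) = C"
        using h by (simp add: C_def powr_minus)
      then show ?thesis using h c by (subst ennreal_mult[symmetric]) auto
    qed
    finally show ?thesis .
  qed
  then show ?thesis using C by blast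
qed

text \<open>For depths above 3 * \<delta> the average runs over a piece of the collar of volume
  about \<delta> * depth^(d-1), and integrating its inverse over the bounded domain gives the loss 1
  / \<delta>. The same factor stands before the L^p norm in the norm of T.\<close>

lemma envelope_mass:
  "\<exists>C>0. \<forall>\<delta> a. 0 < \<delta> \<longrightarrow> \<delta> < r / 16 \<longrightarrow>
     (\<integral>\<^sup>+x. ennreal (envelope \<delta> x a)) \<le> ennreal (C / \<delta>)"
proof -
  let ?D = "real DIM('a)"
  obtain C1 where C1: "C1 > 0" and near: "\<And>\<delta> a. 0 < \<delta> \<Longrightarrow>
     (\<integral>\<^sup>+x. ennreal (envelope \<delta> x a) * indicator {x. depth x \<le> 3 * \<delta>} x) \<le> ennreal C1"
    using envelope_near_mass by blast
  obtain R where R: "R > 0" "\<And>x y. x \<in> nbhd r \<Longrightarrow> y \<in> nbhd r \<Longrightarrow> dist x y \<le> R"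
  proof -
    have b: "bounded (nbhd r)" by (rule bounded_nbhd)
    show ?thesis
      using diameter_ge_0[OF b]
      by (intro that[of "diameter (nbhd r) + 1"]) (auto intro: order_trans[OF diameter_bounded_bound[OF b]])
  qed
  define C2 where "C2 = 24 powr (?D - 1) * (2 powr (\<bar>1 - ?D\<bar> + 1) * unit_ball_vol ?D * ((2 * R) powr 1 / 1))"
  have C2: "C2 > 0" using R by (simp add: C2_def)
  have "(\<integral>\<^sup>+x. ennreal (envelope \<delta> x a)) \<le> ennreal ((C1 * r + C2) / \<delta>)" if \<delta>: "0 < \<delta>" "\<delta> < r / 16" for \<delta> a
  proof -
    have "(\<integral>\<^sup>+x. ennreal (envelope \<delta> x a)) \<le> (\<integral>\<^sup>+x. ennreal (envelope \<delta> x a) * indicator {x. depth x \<le> 3 * \<delta>} x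
        + ennreal (24 powr (?D - 1) / \<delta>) * (ennreal (dist a x powr (1 - ?D)) * indicator UNIV x * indicator {0<..R} (dist a x)))"
    proof (rule nn_integral_mono)
      fix x
      show "ennreal (envelope \<delta> x a) \<le> ennreal (envelope \<delta> x a) * indicator {x. depth x \<le> 3 * \<delta>} x
        + ennreal (24 powr (?D - 1) / \<delta>) * (ennreal (dist a x powr (1 - ?D)) * indicator UNIV x * indicator {0<..R} (dist a x))"
      proof (cases "envelope \<delta> x a \<noteq> 0 \<and> \<not> depth x \<le> 3 * \<delta>")
        case True
        note s = envelope_support[OF conjunct1[OF True]]
        have "a \<noteq> x" using s(1,2) by (auto simp: collar_def)
        moreover have "dist a x \<le> R"
          using s \<delta> r_pos by (intro R(2)) (auto simp: collar_def)
        ultimately have i: "dist a x \<in> {0<..R}" by simp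
        have "envelope \<delta> x a \<le> 1 / \<delta> * depth x powr (- (?D - 1))"
          using envelope_le_far[of \<delta> x a] True \<delta> by simp
        also have "\<dots> \<le> 1 / \<delta> * (24 powr (?D - 1) * dist a x powr (- (?D - 1)))"
          using s \<delta> i DIM_ge_Suc0[where 'a='a] by (intro mult_left_mono powr_neg_scale_le) (auto simp: dist_commute)
        finally have "envelope \<delta> x a \<le> 24 powr (?D - 1) / \<delta> * dist a x powr (1 - ?D)"
          by (simp add: mult_ac)
        then have "ennreal (envelope \<delta> x a) \<le> ennreal (24 powr (?D - 1) / \<delta>) * ennreal (dist a x powr (1 - ?D))"
          using \<delta> by (simp add: ennreal_mult[symmetric] ennreal_leI)
        then show ?thesis using True i by (simp only: indicator_simps UNIV_I mult_1_right) (simp add: add_increasing)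
      qed auto
    qed
    also have "\<dots> = (\<integral>\<^sup>+x. ennreal (envelope \<delta> x a) * indicator {x. depth x \<le> 3 * \<delta>} x)
        + ennreal (24 powr (?D - 1) / \<delta>) * (\<integral>\<^sup>+x. ennreal (dist a x powr (1 - ?D)) * indicator UNIV x * indicator {0<..R} (dist a x))"
      by (subst nn_integral_add, measurable, subst nn_integral_cmult, measurable)
    also have "\<dots> \<le> ennreal C1 + ennreal (24 powr (?D - 1) / \<delta>) * ennreal (2 powr (\<bar>1 - ?D\<bar> + 1) * unit_ball_vol ?D * ((2 * R) powr 1 / 1))"
      using R(1) by (intro add_mono near[OF \<delta>(1)] mult_left_mono nn_integral_dist_powr_ball_le emeasure_cball_powr) auto
    also have "\<dots> = ennreal (C1 + C2 / \<delta>)"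
      using \<delta> C1 C2 by (simp add: C2_def ennreal_mult[symmetric] ennreal_plus[symmetric] del: ennreal_plus)
    also have "\<dots> \<le> ennreal ((C1 * r + C2) / \<delta>)"
      using \<delta> C1 r_pos by (intro ennreal_leI) (simp add: field_simps)
    finally show ?thesis .
  qed
  moreover have "C1 * r + C2 > 0" using C1 C2 r_pos by (simp add: add_pos_pos)
  ultimately show ?thesis by blast
qed

text \<open>For depth below \<delta> the volume of a ball is enough. For larger depth it would be
  too large by the factor depth / \<delta>, and the volume bound for the collar is used
  instead.\<close>

lemma envelope_dual_mass:
  "\<exists>C>0. \<forall>\<delta> x. 0 < \<delta> \<longrightarrow> \<delta> < r * \<eta> / 16 \<longrightarrow>
     (\<integral>\<^sup>+a. ennreal (envelope \<delta> x a)) \<le> ennreal C"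
proof -
  let ?D = "real DIM('a)"
  obtain C0 where C0: "C0 > 0" and cm: "\<And>\<delta> x \<rho>. 0 < \<delta> \<Longrightarrow> \<delta> < r * \<eta> / 16 \<Longrightarrow> \<delta> \<le> \<rho> \<Longrightarrow>
     emeasure lborel (rim \<delta> \<inter> cball x \<rho>) \<le> ennreal (C0 * \<delta> * \<rho> powr (?D - 1))"
    using collar_ball_measure by blast
  define C1 where "C1 = 216 * unit_ball_vol ?D * 24 powr ?D"
  define C2 where "C2 = C0 * 24 powr (?D - 1)"
  have C: "C1 > 0" "C2 > 0" using C0 by (simp_all add: C1_def C2_def)
  have "(\<integral>\<^sup>+a. ennreal (envelope \<delta> x a)) \<le> ennreal (C1 + C2)" if \<delta>: "0 < \<delta>" "\<delta> < r * \<eta> / 16" for \<delta> x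
  proof (cases "x \<in> \<Omega>")
    case False
    then show ?thesis by (simp add: envelope_def)
  next
    case x: True
    have t: "0 < depth x" by (rule depth_pos[OF x])
    show ?thesis
    proof (cases "depth x < \<delta>")
      case True
      have "(\<integral>\<^sup>+a. ennreal (envelope \<delta> x a)) \<le> (\<integral>\<^sup>+a. ennreal (216 * depth x powr (- ?D)) * indicator (cball x (24 * depth x)) a)"
      proof (rule nn_integral_mono)
        fix a
        show "ennreal (envelope \<delta> x a) \<le> ennreal (216 * depth x powr (- ?D)) * indicator (cball x (24 * depth x)) a"
        proof (cases "envelope \<delta> x a = 0")
          case False
          note s = envelope_support[OF False]
          have "envelope \<delta> x a \<le> 9 * height a * depth x powr (- ?D - 1)"
            using True \<delta> by (intro envelope_le_near False) auto
          also have "\<dots> \<le> 9 * (24 * depth x) * depth x powr (- ?D - 1)"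
            using height_le[OF x, of a] s by (intro mult_right_mono mult_left_mono) auto
          also have "\<dots> = 216 * depth x powr (- ?D)"
            using t by (simp add: powr_diff powr_minus field_simps)
          finally show ?thesis using s by (simp add: ennreal_leI)
        qed simp
      qed
      also have "\<dots> = ennreal (216 * depth x powr (- ?D)) * emeasure lborel (UNIV \<inter> cball x (24 * depth x))"
        by (simp add: nn_integral_cmult_indicator)
      also have "\<dots> \<le> ennreal (216 * depth x powr (- ?D)) * ennreal (unit_ball_vol ?D * (24 * depth x) powr ?D)"
        using t by (intro mult_left_mono emeasure_cball_powr) auto
      also have "\<dots> = ennreal C1"
        using t by (simp add: C1_def ennreal_mult[symmetric] powr_mult powr_minus field_simps)
      also have "\<dots> \<le> ennreal (C1 + C2)" using C by (intro ennreal_leI) auto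
      finally show ?thesis .
    next
      case False
      have "(\<integral>\<^sup>+a. ennreal (envelope \<delta> x a)) \<le> (\<integral>\<^sup>+a. ennreal (1 / \<delta> * depth x powr (1 - ?D)) * indicator (rim \<delta> \<inter> cball x (24 * depth x)) a)"
      proof (rule nn_integral_mono)
        fix a
        show "ennreal (envelope \<delta> x a) \<le> ennreal (1 / \<delta> * depth x powr (1 - ?D)) * indicator (rim \<delta> \<inter> cball x (24 * depth x)) a"
        proof (cases "envelope \<delta> x a = 0")
          case nz: False
          show ?thesis
            using envelope_support[OF nz] envelope_le_far[of \<delta> x a] False \<delta> by (simp add: ennreal_leI)
        qed simp
      qed
      also have "\<dots> = ennreal (1 / \<delta> * depth x powr (1 - ?D)) * emeasure lborel (rim \<delta> \<inter> cball x (24 * depth x))"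
        by (rule nn_integral_cmult_indicator) auto
      also have "\<dots> \<le> ennreal (1 / \<delta> * depth x powr (1 - ?D)) * ennreal (C0 * \<delta> * (24 * depth x) powr (?D - 1))"
        using t False \<delta> by (intro mult_left_mono cm) auto
      also have "\<dots> = ennreal C2"
      proof -
        have "depth x powr (1 - ?D) * depth x powr (?D - 1) = 1" using t by (simp add: powr_add[symmetric])
        then have "1 / \<delta> * depth x powr (1 - ?D) * (C0 * \<delta> * (24 * depth x) powr (?D - 1)) = C2"
          using t \<delta> by (simp add: C2_def powr_mult)
        then show ?thesis using C0 \<delta> by (simp add: ennreal_mult[symmetric])
      qed
      also have "\<dots> \<le> ennreal (C1 + C2)" using C by (intro ennreal_leI) auto
      finally show ?thesis .
    qed
  qed
  moreover have "C1 + C2 > 0" using C by simp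
  ultimately show ?thesis by blast
qed

text \<open>The weight on the left is what remains of the kernel of S after integration over the
  points near \<open>x\<close>, with the gain (dist x y / depth x)^p included. Points of depth below
  \<delta> reproduce the short-range form of the trace kernel at (a, b), with one envelope left to
  be integrated. Deep points give \<delta>^(-2) * depth^(-(d+\<alpha>)), and the integral of this is
  of the form that \<open>T_kernel_ge\<close> bounds.\<close>

lemma envelope_pair_mass:
  assumes p: "p > 1"
  shows "\<exists>C>0. \<forall>\<delta> \<beta> a b. 0 < \<delta> \<longrightarrow> 0 \<le> \<beta> \<longrightarrow> \<beta> < real DIM('a) + p \<longrightarrow> a \<noteq> b \<longrightarrow>
     (\<integral>\<^sup>+x. ennreal ((min (depth x) \<delta> / \<delta>) powr (real DIM('a) + p - \<beta>) * depth x powr (- p)) *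
        (ennreal (envelope \<delta> x a) * ennreal (envelope \<delta> x b)))
     \<le> ennreal (C * T_kernel DIM('a) p \<beta> \<delta> (dist a b))"
proof -
  let ?D = "real DIM('a)"
  define \<alpha> where "\<alpha> = ?D + p - 2"
  have D1: "?D \<ge> 1" using DIM_ge_Suc0[where 'a='a] by simp
  have \<alpha>: "\<alpha> > 0" using D1 p unfolding \<alpha>_def by linarith
  obtain C1 where C1: "C1 > 0" and near: "\<And>\<delta> a. 0 < \<delta> \<Longrightarrow>
     (\<integral>\<^sup>+x. ennreal (envelope \<delta> x a) * indicator {x. depth x \<le> 3 * \<delta>} x) \<le> ennreal C1"
    using envelope_near_mass by blast
  define Cn where "Cn = 216 * 48 powr (?D + p) * 48 powr \<alpha>"
  define Cf where "Cf = 48 powr (?D + \<alpha>)"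
  define V where "V = unit_ball_vol ?D * (1 + 2 powr (?D + \<alpha> + 1) / \<alpha>)"
  have pos: "Cn > 0" "Cf > 0" "V > 0" using \<alpha> by (simp_all add: Cn_def Cf_def V_def add_pos_pos)
  define w where "w \<delta> \<beta> x = (min (depth x) \<delta> / \<delta>) powr (?D + p - \<beta>) * depth x powr (- p)" for \<delta> \<beta> :: real and x :: 'a
  have "(\<integral>\<^sup>+x. ennreal (w \<delta> \<beta> x) * (ennreal (envelope \<delta> x a) * ennreal (envelope \<delta> x b)))
     \<le> ennreal ((Cn * C1 + Cf * V) * T_kernel DIM('a) p \<beta> \<delta> (dist a b))"
    if \<delta>: "0 < \<delta>" and \<beta>: "0 \<le> \<beta>" "\<beta> < ?D + p" and ab: "a \<noteq> b" for \<delta> \<beta> :: real and a b :: 'a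
  proof -
    let ?T = "T_kernel DIM('a) p \<beta> \<delta> (dist a b)"
    have \<rho>: "0 < dist a b" using ab by simp
    have "(\<integral>\<^sup>+x. ennreal (w \<delta> \<beta> x) * (ennreal (envelope \<delta> x a) * ennreal (envelope \<delta> x b)))
      \<le> (\<integral>\<^sup>+x. ennreal (Cn * ?T) * (ennreal (envelope \<delta> x a) * indicator {x. depth x \<le> 3 * \<delta>} x) +
          ennreal (\<delta> powr (- 2) * Cf) * ennreal (max (dist a x) (max (dist a b) \<delta>) powr (- ?D - \<alpha>)))"
    proof (rule nn_integral_mono)
      fix x
      let ?l = "ennreal (w \<delta> \<beta> x) * (ennreal (envelope \<delta> x a) * ennreal (envelope \<delta> x b))"
      show "?l \<le> ennreal (Cn * ?T) * (ennreal (envelope \<delta> x a) * indicator {x. depth x \<le> 3 * \<delta>} x) +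
          ennreal (\<delta> powr (- 2) * Cf) * ennreal (max (dist a x) (max (dist a b) \<delta>) powr (- ?D - \<alpha>))"
      proof (cases "envelope \<delta> x a = 0 \<or> envelope \<delta> x b = 0")
        case True
        then show ?thesis by auto
      next
        case nz: False
        then have nz: "envelope \<delta> x a \<noteq> 0" "envelope \<delta> x b \<noteq> 0" by auto
        note s = envelope_support[OF nz(1)] envelope_support[OF nz(2)]
        have t: "0 < depth x" using s depth_pos by simp
        \<comment> \<open>Both points are within 24 * depth x of \<open>x\<close>; hence 48.\<close>
        have \<rho>t: "dist a b \<le> 48 * depth x" using s(3,7) dist_triangle3[of a b x] by linarith
        have w0: "0 \<le> w \<delta> \<beta> x" by (simp add: w_def)
        have leq: "?l = ennreal (w \<delta> \<beta> x * envelope \<delta> x b * envelope \<delta> x a)"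
          using w0 by (simp add: ennreal_mult[symmetric] envelope_nonneg mult_ac)
        show ?thesis
        proof (cases "depth x < \<delta>")
          case True
          have "envelope \<delta> x b \<le> 9 * height b * depth x powr (- ?D - 1)"
            using True \<delta> by (intro envelope_le_near nz) auto
          also have "\<dots> \<le> 9 * (24 * depth x) * depth x powr (- ?D - 1)"
            using height_le[OF s(1), of b] s by (intro mult_right_mono mult_left_mono) auto
          also have "\<dots> = 216 * (depth x powr 1 * depth x powr (- ?D - 1))"
            using t by simp
          also have "\<dots> = 216 * depth x powr (- ?D)"
            by (simp only: powr_add[symmetric]) simp
          finally have eb: "envelope \<delta> x b \<le> 216 * depth x powr (- ?D)" .
          have "w \<delta> \<beta> x * envelope \<delta> x b \<le> w \<delta> \<beta> x * (216 * depth x powr (- ?D))"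
            by (rule mult_left_mono[OF eb w0])
          also have "\<dots> = 216 * \<delta> powr (- (?D + p - \<beta>)) * (depth x powr (?D + p - \<beta>) * depth x powr (- p) * depth x powr (- ?D))"
          proof -
            have "(depth x / \<delta>) powr (?D + p - \<beta>) = depth x powr (?D + p - \<beta>) * \<delta> powr (- (?D + p - \<beta>))"
              using powr_divide[of "depth x" \<delta> "?D + p - \<beta>"] t \<delta> unfolding powr_minus by (simp only: divide_inverse less_imp_le)
            moreover have "min (depth x) \<delta> = depth x" using True by simp
            ultimately show ?thesis unfolding w_def by (simp only: mult_ac)
          qed
          also have "\<dots> = 216 * \<delta> powr (- (?D + p - \<beta>)) * depth x powr (- \<beta>)"
            by (simp only: powr_add[symmetric]) simp
          also have "\<dots> \<le> 216 * \<delta> powr (- (?D + p - \<beta>)) * (48 powr \<beta> * dist a b powr (- \<beta>))"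
            using \<rho>t \<rho> \<beta> by (intro mult_left_mono powr_neg_scale_le) auto
          \<comment> \<open>Replaces the exponent \<beta> by d + p, so that the constant no longer
            depends on \<beta>.\<close>
          also have "\<dots> \<le> 216 * \<delta> powr (- (?D + p - \<beta>)) * (48 powr (?D + p) * dist a b powr (- \<beta>))"
            using \<beta> by (intro mult_left_mono mult_right_mono powr_mono) auto
          also have "\<dots> = 216 * 48 powr (?D + p) * (\<delta> powr (- (?D + p - \<beta>)) * dist a b powr (- \<beta>))"
            by (simp only: mult_ac)
          also have "\<dots> \<le> 216 * 48 powr (?D + p) * (48 powr (?D + p - 2) * ?T)"
            using \<rho> \<rho>t True \<delta> \<beta> \<alpha> by (intro mult_left_mono powr_le_T_kernel) (auto simp: \<alpha>_def)
          also have "\<dots> = Cn * ?T" by (simp add: Cn_def \<alpha>_def)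
          finally have "w \<delta> \<beta> x * envelope \<delta> x b * envelope \<delta> x a \<le> Cn * ?T * envelope \<delta> x a"
            by (rule mult_right_mono) (rule envelope_nonneg)
          then have "?l \<le> ennreal (Cn * ?T) * ennreal (envelope \<delta> x a)"
            unfolding leq using pos by (subst ennreal_mult[symmetric]) (auto simp: T_kernel_nonneg envelope_nonneg intro: ennreal_leI)
          then show ?thesis using True \<delta> by (simp add: add_increasing2)
        next
          case False
          then have far: "\<delta> \<le> depth x" by simp
          define M where "M = max (dist a x) (max (dist a b) \<delta>)"
          have M: "0 < M" "M \<le> 48 * depth x" using \<delta> far \<rho>t s t by (auto simp: M_def dist_commute)
          have w1: "w \<delta> \<beta> x = depth x powr (- p)" using far \<delta> by (simp add: w_def min_def)
          have "w \<delta> \<beta> x * envelope \<delta> x b * envelope \<delta> x a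
            \<le> depth x powr (- p) * (1 / \<delta> * depth x powr (1 - ?D)) * (1 / \<delta> * depth x powr (1 - ?D))"
            unfolding w1 using \<delta> by (intro mult_mono mult_left_mono envelope_le_far[OF \<delta> far]) (auto simp: envelope_nonneg)
          also have "\<dots> = \<delta> powr (- 2) * (depth x powr (- p) * depth x powr (1 - ?D) * depth x powr (1 - ?D))"
            using \<delta> by (simp add: powr_minus_divide power2_eq_square)
          also have "\<dots> = \<delta> powr (- 2) * depth x powr (- (?D + \<alpha>))"
            by (simp only: powr_add[symmetric]) (simp add: \<alpha>_def algebra_simps)
          also have "\<dots> \<le> \<delta> powr (- 2) * (48 powr (?D + \<alpha>) * M powr (- (?D + \<alpha>)))"
            using M \<alpha> by (intro mult_left_mono powr_neg_scale_le) auto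
          also have "\<dots> = (\<delta> powr (- 2) * Cf) * M powr (- ?D - \<alpha>)"
            by (simp add: Cf_def)
          finally have "?l \<le> ennreal (\<delta> powr (- 2) * Cf) * ennreal (M powr (- ?D - \<alpha>))"
            unfolding leq using pos by (subst ennreal_mult[symmetric]) (auto intro: ennreal_leI)
          then show ?thesis unfolding M_def by (simp add: add_increasing)
        qed
      qed
    qed
    also have "\<dots> = ennreal (Cn * ?T) * (\<integral>\<^sup>+x. ennreal (envelope \<delta> x a) * indicator {x. depth x \<le> 3 * \<delta>} x) +
          ennreal (\<delta> powr (- 2) * Cf) * (\<integral>\<^sup>+x. ennreal (max (dist a x) (max (dist a b) \<delta>) powr (- ?D - \<alpha>)))"
      by (subst nn_integral_add, measurable, subst nn_integral_cmult, measurable, subst nn_integral_cmult, measurable)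
    also have "\<dots> \<le> ennreal (Cn * ?T) * ennreal C1 + ennreal (\<delta> powr (- 2) * Cf) * ennreal (V * max (dist a b) \<delta> powr (- \<alpha>))"
      unfolding V_def using \<delta> by (intro add_mono mult_left_mono near[OF \<delta>] nn_integral_max_dist_powr_le \<alpha>) auto
    also have "\<dots> = ennreal (Cn * C1 * ?T + Cf * V * (\<delta> powr (- 2) * max (dist a b) \<delta> powr (- \<alpha>)))"
      using pos C1 by (simp add: ennreal_mult[symmetric] ennreal_plus[symmetric] T_kernel_nonneg mult_ac del: ennreal_plus)
    also have "\<dots> \<le> ennreal (Cn * C1 * ?T + Cf * V * ?T)"
      using pos T_kernel_ge[OF \<rho> \<delta> \<beta>(1), of "DIM('a)" p]
      by (intro ennreal_leI add_left_mono mult_left_mono) (auto simp: \<alpha>_def)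
    finally show ?thesis by (simp add: distrib_right)
  qed
  moreover have "Cn * C1 + Cf * V > 0" using pos C1 by (simp add: add_pos_pos)
  ultimately show ?thesis unfolding w_def by blast
qed

end

text \<open>The factor d + p - \<beta> of the normalised kernel is simply bounded by d + p, so
  nothing degenerates as \<beta> approaches d + p. The distances may differ by a factor
  \<open>A\<close>, at the price of powers of \<open>A\<close> with exponents free of
  \<beta>.\<close>

lemma nl_kernel_le_T_kernel:
  assumes "0 < \<rho>'" "\<rho>' \<le> A * \<rho>" "0 < \<rho>" "1 \<le> A" "0 < \<delta>" "0 \<le> \<beta>" "\<beta> < real d + p" "2 \<le> real d + p" "0 < d" "0 < p"
  shows "nl_kernel d p \<beta> \<delta> \<rho> \<le> (real d + p) / sphere_area d * A powr (real d + p) * A powr (real d + p - 2) * T_kernel d p \<beta> \<delta> \<rho>'"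
proof (cases "\<rho> < \<delta>")
  case False
  then show ?thesis using sphere_area_pos[OF \<open>0 < d\<close>] assms by (simp add: nl_kernel_def T_kernel_nonneg)
next
  case True
  have sa: "sphere_area d > 0" using assms by (intro sphere_area_pos)
  have "nl_kernel d p \<beta> \<delta> \<rho> = (real d + p - \<beta>) / sphere_area d * (\<delta> powr (- (real d + p - \<beta>)) * \<rho> powr (- \<beta>))"
    using True unfolding nl_kernel_def powr_minus divide_inverse by simp
  also have "\<dots> \<le> (real d + p) / sphere_area d * (\<delta> powr (- (real d + p - \<beta>)) * (A powr (real d + p) * \<rho>' powr (- \<beta>)))"
  proof (intro mult_mono)
    have "\<rho> powr (- \<beta>) \<le> A powr \<beta> * \<rho>' powr (- \<beta>)"
      using assms by (intro powr_neg_scale_le) auto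
    also have "\<dots> \<le> A powr (real d + p) * \<rho>' powr (- \<beta>)"
      using assms by (intro mult_right_mono powr_mono) auto
    finally show "\<rho> powr (- \<beta>) \<le> A powr (real d + p) * \<rho>' powr (- \<beta>)" .
  qed (use assms sa in \<open>auto intro: divide_right_mono\<close>)
  also have "\<dots> = (real d + p) / sphere_area d * A powr (real d + p) * (\<delta> powr (- (real d + p - \<beta>)) * \<rho>' powr (- \<beta>))"
    by (simp only: mult_ac)
  also have "\<dots> \<le> (real d + p) / sphere_area d * A powr (real d + p) * (A powr (real d + p - 2) * T_kernel d p \<beta> \<delta> \<rho>')"
  proof (intro mult_left_mono powr_le_T_kernel)
    show "\<rho>' \<le> A * \<delta>" using assms(2,4) True mult_left_mono[of \<rho> \<delta> A] by linarith
  qed (use assms sa in auto)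
  finally show ?thesis by (simp only: mult.assoc)
qed

text \<open>The transfer for pairs of which one point stays in the collar: only the other point is
  averaged, so a bound for the mass in \<open>x\<close> alone takes the place of the kernel
  bound.\<close>

lemma nn_integral_transfer_one:
  fixes Q H :: "'a::euclidean_space \<Rightarrow> 'a \<Rightarrow> ennreal"
  assumes Q: "(\<lambda>w. Q (fst w) (snd w)) \<in> borel_measurable (borel \<Otimes>\<^sub>M borel)"
    and H: "(\<lambda>w. H (fst w) (snd w)) \<in> borel_measurable (borel \<Otimes>\<^sub>M borel)"
    and G: "\<And>x y. G x y \<le> (\<integral>\<^sup>+a. Q x a * H a y)"
    and K: "\<And>a. (\<integral>\<^sup>+x. Q x a) \<le> K"
  shows "(\<integral>\<^sup>+x. \<integral>\<^sup>+y. G x y) \<le> K * (\<integral>\<^sup>+a. \<integral>\<^sup>+y. H a y)"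
proof -
  have [measurable]: "(\<lambda>w. Q (f w) (g w)) \<in> borel_measurable M" if "f \<in> M \<rightarrow>\<^sub>M borel" "g \<in> M \<rightarrow>\<^sub>M borel" for f g and M :: "'c measure"
    using measurable_compose[of "\<lambda>w. (f w, g w)", OF _ Q] that by simp
  have [measurable]: "(\<lambda>w. H (f w) (g w)) \<in> borel_measurable M" if "f \<in> M \<rightarrow>\<^sub>M borel" "g \<in> M \<rightarrow>\<^sub>M borel" for f g and M :: "'c measure"
    using measurable_compose[of "\<lambda>w. (f w, g w)", OF _ H] that by simp
  have "(\<integral>\<^sup>+x. \<integral>\<^sup>+y. G x y) \<le> (\<integral>\<^sup>+x. \<integral>\<^sup>+y. \<integral>\<^sup>+a. Q x a * H a y)"
    by (intro nn_integral_mono G)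
  also have "\<dots> = (\<integral>\<^sup>+x. \<integral>\<^sup>+a. \<integral>\<^sup>+y. Q x a * H a y)"
  proof (rule nn_integral_cong)
    fix x
    show "(\<integral>\<^sup>+y. \<integral>\<^sup>+a. Q x a * H a y) = (\<integral>\<^sup>+a. \<integral>\<^sup>+y. Q x a * H a y)"
      by (rule lborel_pair.Fubini') measurable
  qed
  also have "\<dots> = (\<integral>\<^sup>+x. \<integral>\<^sup>+a. Q x a * (\<integral>\<^sup>+y. H a y))"
    by (intro nn_integral_cong nn_integral_cmult) measurable
  also have "\<dots> = (\<integral>\<^sup>+a. \<integral>\<^sup>+x. Q x a * (\<integral>\<^sup>+y. H a y))"
    by (rule lborel_pair.Fubini') measurable
  also have "\<dots> = (\<integral>\<^sup>+a. (\<integral>\<^sup>+x. Q x a) * (\<integral>\<^sup>+y. H a y))"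
    by (intro nn_integral_cong nn_integral_multc) measurable
  also have "\<dots> \<le> (\<integral>\<^sup>+a. K * (\<integral>\<^sup>+y. H a y))"
    by (intro nn_integral_mono mult_right_mono K) simp
  also have "\<dots> = K * (\<integral>\<^sup>+a. \<integral>\<^sup>+y. H a y)"
    by (rule nn_integral_cmult) measurable
  finally show ?thesis .
qed

section \<open>Energy of the extension\<close>

context cone_domain
begin

lemma mass_compare:
  assumes "0 < \<delta>" "depth x / 2 \<le> depth y"
  shows "mass \<delta> x \<le> 2 ^ (DIM('a) + 1) * mass \<delta> y"
proof -
  have "(min (depth x) \<delta> / 2)\<^sup>2 * (depth x / 2) ^ (DIM('a) - 1) \<le> mass \<delta> y"
    unfolding mass_def using assms depth_nonneg[of x] depth_nonneg[of y] by (intro mult_mono power_mono) auto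
  moreover have "(min (depth x) \<delta> / 2)\<^sup>2 * (depth x / 2) ^ (DIM('a) - 1) * 2 ^ (DIM('a) + 1) = mass \<delta> x"
  proof -
    have "DIM('a) + 1 = 2 + (DIM('a) - 1)" using DIM_positive[where 'a='a] by linarith
    then have "(2::real) ^ (DIM('a) + 1) = 2\<^sup>2 * 2 ^ (DIM('a) - 1)" by (simp only: power_add)
    then show ?thesis unfolding mass_def power_divide by simp
  qed
  ultimately show ?thesis by (smt (verit) mult.commute mult_right_mono zero_le_power)
qed

text \<open>The tent factor of \<open>ext_ker\<close> makes the kernel Lipschitz in
  \<open>x\<close>: the depth changes by at most dist x y, so 12 * depth x - dist x a changes by at
  most 13 * dist x y. Dividing by the integral of the kernel, which is at least of order depth x *
  mass, leaves the relative change dist x y / depth x. Both bounds have the form demanded by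
  \<open>wavg_diff_lipschitz_powr_le\<close>.\<close>

lemma ext_ker_nearby:
  "\<exists>B>0. \<forall>\<delta> x y a. 0 < \<delta> \<longrightarrow> \<delta> < r / 16 \<longrightarrow> x \<in> \<Omega> \<longrightarrow> y \<in> \<Omega> \<longrightarrow> dist x y < depth x / 2 \<longrightarrow>
     \<bar>ext_ker \<delta> x a - ext_ker \<delta> y a\<bar> \<le> integral\<^sup>L lborel (ext_ker \<delta> x) * (dist x y / depth x) * (B * envelope \<delta> x a) \<and>
     ext_ker \<delta> y a \<le> integral\<^sup>L lborel (ext_ker \<delta> y) * (B * envelope \<delta> x a)"
proof -
  obtain c where c: "c > 0" and lower: "\<And>\<delta> x. 0 < \<delta> \<Longrightarrow> \<delta> < r / 16 \<Longrightarrow> x \<in> \<Omega> \<Longrightarrow> c * (depth x * mass \<delta> x) \<le> integral\<^sup>L lborel (ext_ker \<delta> x)"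
    using ext_ker_integral_lower by blast
  define B where "B = 13 * 2 ^ (DIM('a) + 1) / c"
  have B: "B > 0" using c by (simp add: B_def)
  have "\<bar>ext_ker \<delta> x a - ext_ker \<delta> y a\<bar> \<le> integral\<^sup>L lborel (ext_ker \<delta> x) * (dist x y / depth x) * (B * envelope \<delta> x a) \<and>
     ext_ker \<delta> y a \<le> integral\<^sup>L lborel (ext_ker \<delta> y) * (B * envelope \<delta> x a)"
    if \<delta>: "0 < \<delta>" "\<delta> < r / 16" and x: "x \<in> \<Omega>" and y: "y \<in> \<Omega>" and xy: "dist x y < depth x / 2" for \<delta> x y a
  proof (cases "a \<in> rim \<delta> \<and> (dist x a < 12 * depth x \<or> dist y a < 12 * depth y)")
    case False
    then have "ext_ker \<delta> x a = 0" "ext_ker \<delta> y a = 0" by (auto simp: ext_ker_def)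
    then show ?thesis
      using integral_nonneg_AE[of "ext_ker \<delta> x" lborel] integral_nonneg_AE[of "ext_ker \<delta> y" lborel] B depth_nonneg[of x] envelope_nonneg[of \<delta> x a]
      by (simp add: ext_ker_nonneg)
  next
    case True
    have tx: "depth x > 0" "mass \<delta> x > 0" using depth_pos[OF x] mass_pos[OF \<delta>(1) x] by auto
    have ty: "depth y > 0" using depth_pos[OF y] .
    have dl: "\<bar>depth x - depth y\<bar> \<le> dist x y"
      using depth_lipschitz[of x y] depth_lipschitz[of y x] by (simp add: dist_commute)
    \<comment> \<open>The depth of \<open>y\<close> is below 3 / 2 of that of \<open>x\<close>, so a
      point in reach of \<open>y\<close> is within 18 * depth x + dist x y of
      \<open>x\<close>.\<close>
    have dxa: "dist x a < 24 * depth x"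
      using True xy dl dist_triangle[of x a y] by linarith
    have env: "envelope \<delta> x a = height a / mass \<delta> x" using True dxa x by (simp add: envelope_def)
    have h: "height a \<ge> 0" by (rule height_nonneg)
    have "\<bar>ext_ker \<delta> x a - ext_ker \<delta> y a\<bar> = \<bar>max 0 (12 * depth x - dist x a) - max 0 (12 * depth y - dist y a)\<bar> * height a"
      using True h by (simp add: ext_ker_def left_diff_distrib[symmetric] abs_mult)
    also have "\<dots> \<le> 13 * dist x y * height a"
      using dl h dist_triangle[of x a y] dist_triangle[of y a x]
      by (intro mult_right_mono) (auto simp: dist_commute max_def)
    also have "\<dots> = c * (depth x * mass \<delta> x) * (dist x y / depth x) * (13 / c * envelope \<delta> x a)"
      using tx c by (simp add: env)
    also have "\<dots> \<le> integral\<^sup>L lborel (ext_ker \<delta> x) * (dist x y / depth x) * (B * envelope \<delta> x a)"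
    proof (intro mult_mono lower[OF \<delta> x])
      show "13 / c \<le> B" using c one_le_power[of "2::real" "DIM('a) + 1"] by (simp add: B_def divide_right_mono)
    qed (use tx c B envelope_nonneg ext_ker_nonneg in \<open>auto intro!: mult_nonneg_nonneg integral_nonneg_AE\<close>)
    finally have 1: "\<bar>ext_ker \<delta> x a - ext_ker \<delta> y a\<bar> \<le> integral\<^sup>L lborel (ext_ker \<delta> x) * (dist x y / depth x) * (B * envelope \<delta> x a)" .
    have "ext_ker \<delta> y a \<le> 13 * depth y * height a"
      using ty h True order_trans[of "- dist y a" 0 "depth y"] by (auto simp: ext_ker_def intro!: mult_right_mono)
    also have "\<dots> = 13 * depth y * (mass \<delta> x * envelope \<delta> x a)"
      using tx by (simp add: env)
    also have "\<dots> \<le> 13 * depth y * ((2 ^ (DIM('a) + 1) * mass \<delta> y) * envelope \<delta> x a)"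
      using ty xy dl by (intro mult_left_mono mult_right_mono mass_compare \<delta> envelope_nonneg) auto
    also have "\<dots> = c * (depth y * mass \<delta> y) * (B * envelope \<delta> x a)"
      using c by (simp add: B_def)
    also have "\<dots> \<le> integral\<^sup>L lborel (ext_ker \<delta> y) * (B * envelope \<delta> x a)"
      using B by (intro mult_right_mono lower[OF \<delta> y]) (simp add: envelope_nonneg)
    finally show ?thesis using 1 by simp
  qed
  then show ?thesis using B by blast
qed

definition extend :: "real \<Rightarrow> ('a \<Rightarrow> real) \<Rightarrow> 'a \<Rightarrow> real" where
  "extend \<delta> u x = (if x \<in> \<Omega> then wavg (ext_ker \<delta> x) u else u x)"

lemma ext_ker_measurable2[measurable (raw)]:
  assumes [measurable]: "f \<in> M \<rightarrow>\<^sub>M borel" "g \<in> M \<rightarrow>\<^sub>M borel"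
  shows "(\<lambda>w. ext_ker \<delta> (f w) (g w)) \<in> borel_measurable M"
  unfolding ext_ker_def by measurable

lemma extend_measurable[measurable]:
  assumes [measurable]: "u \<in> borel_measurable borel"
  shows "extend \<delta> u \<in> borel_measurable borel"
  unfolding extend_def[abs_def] wavg_def by measurable

lemma extend_Lp_le:
  assumes p: "p > 1"
  shows "\<exists>C>0. \<forall>\<delta> u. 0 < \<delta> \<longrightarrow> \<delta> < r / 16 \<longrightarrow> u \<in> borel_measurable borel \<longrightarrow>
     rim_integrable \<delta> u \<longrightarrow>
     Lp_energy p (nbhd \<delta>) (extend \<delta> u) \<le> ennreal (C / \<delta>) * Lp_energy p (rim \<delta>) u"
proof -
  obtain A where A: "A > 0" and ker: "\<And>\<delta> x a. 0 < \<delta> \<Longrightarrow> \<delta> < r / 16 \<Longrightarrow> x \<in> \<Omega> \<Longrightarrow>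
    ext_ker \<delta> x a / integral\<^sup>L lborel (ext_ker \<delta> x) \<le> A * envelope \<delta> x a"
    using ext_ker_div_le by blast
  obtain C0 where C0: "C0 > 0" and em: "\<And>\<delta> a. 0 < \<delta> \<Longrightarrow> \<delta> < r / 16 \<Longrightarrow> (\<integral>\<^sup>+x. ennreal (envelope \<delta> x a)) \<le> ennreal (C0 / \<delta>)"
    using envelope_mass by blast
  have "Lp_energy p (nbhd \<delta>) (extend \<delta> u) \<le> ennreal ((A * C0 + r) / \<delta>) * Lp_energy p (rim \<delta>) u"
    if \<delta>: "0 < \<delta>" "\<delta> < r / 16" and u[measurable]: "u \<in> borel_measurable borel" and i: "rim_integrable \<delta> u" for \<delta> u
  proof -
    define H where "H a = ennreal (\<bar>u a\<bar> powr p) * indicator (rim \<delta>) a" for a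
    have [measurable]: "H \<in> borel_measurable borel" unfolding H_def[abs_def] by measurable
    have Hi: "integral\<^sup>N lborel H = Lp_energy p (rim \<delta>) u" by (simp add: H_def[abs_def] Lp_energy_def)
    have "Lp_energy p (nbhd \<delta>) (extend \<delta> u) \<le> (\<integral>\<^sup>+x. (\<integral>\<^sup>+a. ennreal (A * envelope \<delta> x a) * H a) + H x)"
      unfolding Lp_energy_def
    proof (rule nn_integral_mono)
      fix x
      show "ennreal (\<bar>extend \<delta> u x\<bar> powr p) * indicator (nbhd \<delta>) x \<le> (\<integral>\<^sup>+a. ennreal (A * envelope \<delta> x a) * H a) + H x"
      proof (cases "x \<in> \<Omega>")
        case True
        have "ennreal (\<bar>extend \<delta> u x\<bar> powr p) \<le> (\<integral>\<^sup>+a. ennreal (ext_ker \<delta> x a / integral\<^sup>L lborel (ext_ker \<delta> x)) * ennreal (\<bar>u a - 0\<bar> powr p))"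
          using wavg_minus_powr_le[OF averaging_ext_ker[OF \<delta> True u i] p, of 0] True by (simp add: extend_def)
        also have "\<dots> \<le> (\<integral>\<^sup>+a. ennreal (A * envelope \<delta> x a) * H a)"
        proof (rule nn_integral_mono)
          fix a
          show "ennreal (ext_ker \<delta> x a / integral\<^sup>L lborel (ext_ker \<delta> x)) * ennreal (\<bar>u a - 0\<bar> powr p) \<le> ennreal (A * envelope \<delta> x a) * H a"
            using mult_right_mono[OF ennreal_leI[OF ker[OF \<delta> True, of a]], of "ennreal (\<bar>u a\<bar> powr p)"]
            by (cases "a \<in> rim \<delta>") (auto simp: H_def ext_ker_def)
        qed
        finally show ?thesis using True by (simp add: add_increasing2)
      qed (auto simp: H_def extend_def indicator_def add_increasing)
    qed
    also have "\<dots> = (\<integral>\<^sup>+x. \<integral>\<^sup>+a. ennreal (A * envelope \<delta> x a) * H a) + integral\<^sup>N lborel H"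
      by (rule nn_integral_add) measurable
    also have "(\<integral>\<^sup>+x. \<integral>\<^sup>+a. ennreal (A * envelope \<delta> x a) * H a) = (\<integral>\<^sup>+a. \<integral>\<^sup>+x. ennreal (A * envelope \<delta> x a) * H a)"
      by (rule lborel_pair.Fubini') measurable
    also have "\<dots> = (\<integral>\<^sup>+a. ennreal A * (\<integral>\<^sup>+x. ennreal (envelope \<delta> x a)) * H a)"
      using A by (simp add: nn_integral_multc nn_integral_cmult ennreal_mult envelope_nonneg)
    also have "\<dots> \<le> (\<integral>\<^sup>+a. ennreal A * ennreal (C0 / \<delta>) * H a)"
      by (intro nn_integral_mono mult_right_mono mult_left_mono em \<delta>) auto
    also have "\<dots> = ennreal A * ennreal (C0 / \<delta>) * integral\<^sup>N lborel H"
      by (rule nn_integral_cmult) measurable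
    also have "\<dots> + integral\<^sup>N lborel H = (ennreal A * ennreal (C0 / \<delta>) + 1) * integral\<^sup>N lborel H"
      by (simp add: distrib_right)
    also have "\<dots> \<le> ennreal ((A * C0 + r) / \<delta>) * integral\<^sup>N lborel H"
    proof (rule mult_right_mono)
      \<comment> \<open>The summand 1 comes from the collar itself, where the extension is
        \<open>u\<close>; it is absorbed since \<delta> < r.\<close>
      have "ennreal A * ennreal (C0 / \<delta>) + 1 = ennreal (A * (C0 / \<delta>) + 1)"
        using A C0 \<delta> by (simp add: ennreal_mult[symmetric] ennreal_plus)
      also have "\<dots> \<le> ennreal ((A * C0 + r) / \<delta>)"
        using \<delta> r_pos by (intro ennreal_leI) (simp add: field_simps)
      finally show "ennreal A * ennreal (C0 / \<delta>) + 1 \<le> ennreal ((A * C0 + r) / \<delta>)" .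
    qed simp
    finally show ?thesis by (simp add: Hi add_right_mono)
  qed
  moreover have "A * C0 + r > 0" using A C0 r_pos by (simp add: add_pos_pos)
  ultimately show ?thesis by blast
qed

end

lemma transfer_to_kenergy:
  fixes P :: "'a::euclidean_space \<Rightarrow> 'a \<Rightarrow> 'a \<Rightarrow> 'a \<Rightarrow> ennreal"
  assumes P: "(\<lambda>w. P (fst (fst w)) (snd (fst w)) (fst (snd w)) (snd (snd w))) \<in> borel_measurable ((borel \<Otimes>\<^sub>M borel) \<Otimes>\<^sub>M (borel \<Otimes>\<^sub>M borel))"
    and u[measurable]: "u \<in> borel_measurable borel" and U[measurable]: "U \<in> sets borel" and \<kappa>[measurable]: "\<kappa> \<in> borel_measurable borel" and C: "C \<ge> 0"
    and \<kappa>0: "\<And>\<rho>. 0 \<le> \<kappa> \<rho>"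
    and G: "\<And>x y. G x y \<le> (\<integral>\<^sup>+a. \<integral>\<^sup>+b. P x y a b * (ennreal (\<bar>u b - u a\<bar> powr p) * indicator U a * indicator U b))"
    and K: "\<And>a b. a \<noteq> b \<Longrightarrow> (\<integral>\<^sup>+x. \<integral>\<^sup>+y. P x y a b) \<le> ennreal (C * \<kappa> (dist a b))"
  shows "(\<integral>\<^sup>+x. \<integral>\<^sup>+y. G x y) \<le> ennreal C * kenergy \<kappa> p U u"
proof -
  \<comment> \<open>On the diagonal no bound is assumed; \<open>H\<close> vanishes there, and
    \<infinity> * 0 is 0 in \<open>ennreal\<close>.\<close>
  define K where "K a b = (if a = b then \<infinity> else ennreal (C * \<kappa> (dist a b)))" for a b :: 'a
  define H where "H a b = ennreal (\<bar>u b - u a\<bar> powr p) * indicator U a * indicator U b" for a b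
  have "(\<integral>\<^sup>+x. \<integral>\<^sup>+y. G x y) \<le> (\<integral>\<^sup>+a. \<integral>\<^sup>+b. K a b * H a b)"
  proof (rule nn_integral_transfer[OF P])
    show "(\<lambda>w. H (fst w) (snd w)) \<in> borel_measurable (borel \<Otimes>\<^sub>M borel)" unfolding H_def by measurable
    show "G x y \<le> (\<integral>\<^sup>+a. \<integral>\<^sup>+b. P x y a b * H a b)" for x y unfolding H_def by (rule G)
    show "(\<integral>\<^sup>+x. \<integral>\<^sup>+y. P x y a b) \<le> K a b" for a b unfolding K_def using assms(8) by simp
  qed
  also have "\<dots> = (\<integral>\<^sup>+a. \<integral>\<^sup>+b. ennreal (C * \<kappa> (dist a b) * \<bar>u b - u a\<bar> powr p) * indicator U a * indicator U b)"
    by (intro nn_integral_cong) (auto simp: K_def H_def ennreal_mult C \<kappa>0 mult.assoc)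
  also have "\<dots> = kenergy (\<lambda>\<rho>. C * \<kappa> \<rho>) p U u" by (simp add: kenergy_def)
  also have "\<dots> = ennreal C * kenergy \<kappa> p U u" by (rule kenergy_cmult[OF u U \<kappa> C])
  finally show ?thesis .
qed

context cone_domain
begin

text \<open>Pairs that are far apart relative to the depth gain nothing from smoothness, but both
  depths are at most 3 * dist x y < 3 * \<delta>, so both envelopes have bounded mass. The averaged
  points satisfy dist a b \<le> (48 + 1 + 72) * dist x y, hence 121.\<close>

lemma extend_far_le:
  assumes p: "p > 1"
  shows "\<exists>C>0. \<forall>\<delta> \<beta> u. 0 < \<delta> \<longrightarrow> \<delta> < r / 16 \<longrightarrow> 0 \<le> \<beta> \<longrightarrow> \<beta> < real DIM('a) + p \<longrightarrow> u \<in> borel_measurable borel \<longrightarrow>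
     rim_integrable \<delta> u \<longrightarrow>
     (\<integral>\<^sup>+x. \<integral>\<^sup>+y. nl_jump p \<beta> \<delta> (extend \<delta> u) x y *
        indicator {w. depth (fst w) / 2 \<le> dist (fst w) (snd w)} (x, y) * indicator \<Omega> x * indicator \<Omega> y)
     \<le> ennreal C * T_energy p \<beta> \<delta> u"
proof -
  let ?D = "real DIM('a)"
  have D1: "?D \<ge> 1" using DIM_ge_Suc0[where 'a='a] by simp
  have Dp: "2 \<le> ?D + p" using D1 p by linarith
  obtain A where A: "A > 0" and ker: "\<And>\<delta> x a. 0 < \<delta> \<Longrightarrow> \<delta> < r / 16 \<Longrightarrow> x \<in> \<Omega> \<Longrightarrow>
    ext_ker \<delta> x a / integral\<^sup>L lborel (ext_ker \<delta> x) \<le> A * envelope \<delta> x a"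
    using ext_ker_div_le by blast
  obtain C1 where C1: "C1 > 0" and near: "\<And>\<delta> a. 0 < \<delta> \<Longrightarrow>
     (\<integral>\<^sup>+x. ennreal (envelope \<delta> x a) * indicator {x. depth x \<le> 3 * \<delta>} x) \<le> ennreal C1"
    using envelope_near_mass by blast
  define c where "c = (?D + p) / sphere_area DIM('a) * 121 powr (?D + p) * 121 powr (?D + p - 2)"
  have c: "c > 0" using sphere_area_pos[of "DIM('a)"] D1 p by (simp add: c_def)
  have "(\<integral>\<^sup>+x. \<integral>\<^sup>+y. nl_jump p \<beta> \<delta> (extend \<delta> u) x y *
        indicator {w. depth (fst w) / 2 \<le> dist (fst w) (snd w)} (x, y) * indicator \<Omega> x * indicator \<Omega> y)
     \<le> ennreal (c * A\<^sup>2 * C1\<^sup>2) * T_energy p \<beta> \<delta> u"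
    if \<delta>: "0 < \<delta>" "\<delta> < r / 16" and \<beta>: "0 \<le> \<beta>" "\<beta> < ?D + p" and u[measurable]: "u \<in> borel_measurable borel" and i: "rim_integrable \<delta> u" for \<delta> \<beta> u
  proof (rule transfer_to_kenergy[where P = "\<lambda>x y a b. ennreal (c * A\<^sup>2 * T_kernel DIM('a) p \<beta> \<delta> (dist a b)) *
      ((ennreal (envelope \<delta> x a) * indicator {x. depth x \<le> 3 * \<delta>} x) * (ennreal (envelope \<delta> y b) * indicator {x. depth x \<le> 3 * \<delta>} y))"])
    show "(\<lambda>w. ennreal (c * A\<^sup>2 * T_kernel DIM('a) p \<beta> \<delta> (dist (fst (snd w)) (snd (snd w)))) *
      ((ennreal (envelope \<delta> (fst (fst w)) (fst (snd w))) * indicator {x. depth x \<le> 3 * \<delta>} (fst (fst w))) *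
       (ennreal (envelope \<delta> (snd (fst w)) (snd (snd w))) * indicator {x. depth x \<le> 3 * \<delta>} (snd (fst w)))))
      \<in> borel_measurable ((borel \<Otimes>\<^sub>M borel) \<Otimes>\<^sub>M (borel \<Otimes>\<^sub>M borel))"
      by measurable
    show "(\<integral>\<^sup>+x. \<integral>\<^sup>+y. ennreal (c * A\<^sup>2 * T_kernel DIM('a) p \<beta> \<delta> (dist a b)) *
      ((ennreal (envelope \<delta> x a) * indicator {x. depth x \<le> 3 * \<delta>} x) * (ennreal (envelope \<delta> y b) * indicator {x. depth x \<le> 3 * \<delta>} y)))
      \<le> ennreal (c * A\<^sup>2 * C1\<^sup>2 * T_kernel DIM('a) p \<beta> \<delta> (dist a b))" for a b
    proof -
      have "(\<integral>\<^sup>+x. \<integral>\<^sup>+y. ennreal (c * A\<^sup>2 * T_kernel DIM('a) p \<beta> \<delta> (dist a b)) *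
        ((ennreal (envelope \<delta> x a) * indicator {x. depth x \<le> 3 * \<delta>} x) * (ennreal (envelope \<delta> y b) * indicator {x. depth x \<le> 3 * \<delta>} y)))
        = ennreal (c * A\<^sup>2 * T_kernel DIM('a) p \<beta> \<delta> (dist a b)) * ((\<integral>\<^sup>+x. ennreal (envelope \<delta> x a) * indicator {x. depth x \<le> 3 * \<delta>} x) *
          (\<integral>\<^sup>+y. ennreal (envelope \<delta> y b) * indicator {x. depth x \<le> 3 * \<delta>} y))"
        by (simp add: nn_integral_cmult nn_integral_multc)
      also have "\<dots> \<le> ennreal (c * A\<^sup>2 * T_kernel DIM('a) p \<beta> \<delta> (dist a b)) * (ennreal C1 * ennreal C1)"
        by (intro mult_left_mono mult_mono near \<delta>) auto
      also have "\<dots> = ennreal (c * A\<^sup>2 * C1\<^sup>2 * T_kernel DIM('a) p \<beta> \<delta> (dist a b))"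
        using c A C1 by (simp add: ennreal_mult[symmetric] T_kernel_nonneg power2_eq_square mult_ac)
      finally show ?thesis .
    qed
    fix x y :: 'a
    let ?l = "nl_jump p \<beta> \<delta> (extend \<delta> u) x y *
        indicator {w. depth (fst w) / 2 \<le> dist (fst w) (snd w)} (x, y) * indicator \<Omega> x * indicator \<Omega> y"
    let ?r = "\<integral>\<^sup>+a. \<integral>\<^sup>+b. ennreal (c * A\<^sup>2 * T_kernel DIM('a) p \<beta> \<delta> (dist a b)) *
      ((ennreal (envelope \<delta> x a) * indicator {x. depth x \<le> 3 * \<delta>} x) * (ennreal (envelope \<delta> y b) * indicator {x. depth x \<le> 3 * \<delta>} y)) *
      (ennreal (\<bar>u b - u a\<bar> powr p) * indicator (rim \<delta>) a * indicator (rim \<delta>) b)"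
    show "?l \<le> ?r"
    proof (cases "x \<in> \<Omega> \<and> y \<in> \<Omega> \<and> depth x / 2 \<le> dist x y \<and> dist x y < \<delta>")
      case False
      then have z: "?l = 0" by (auto simp: nl_kernel_def)
      show ?thesis unfolding z by (rule zero_le)
    next
      case True
      then have x: "x \<in> \<Omega>" and y: "y \<in> \<Omega>" and far: "depth x \<le> 2 * dist x y" and lt: "dist x y < \<delta>" by auto
      have \<rho>: "dist x y > 0" using far depth_pos[OF x] by linarith
      have ty: "depth y \<le> 3 * dist x y" using far depth_lipschitz[of y x] by (simp add: dist_commute)
      note avx = averaging_ext_ker[OF \<delta> x u i] and avy = averaging_ext_ker[OF \<delta> y u i]
      let ?n = "nl_kernel DIM('a) p \<beta> \<delta> (dist x y)"
      let ?kx = "\<lambda>a. ext_ker \<delta> x a / integral\<^sup>L lborel (ext_ker \<delta> x)" and ?ky = "\<lambda>a. ext_ker \<delta> y a / integral\<^sup>L lborel (ext_ker \<delta> y)"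
      have n0: "0 \<le> ?n" using \<beta> by (intro nl_kernel_nonneg) simp
      have "?l = ennreal ?n * ennreal (\<bar>wavg (ext_ker \<delta> x) u - wavg (ext_ker \<delta> y) u\<bar> powr p)"
        using True n0 by (simp add: extend_def ennreal_mult abs_minus_commute)
      also have "\<dots> \<le> ennreal ?n * (\<integral>\<^sup>+a. (\<integral>\<^sup>+b. ennreal (?kx a) * ennreal (?ky b) * ennreal (\<bar>u a - u b\<bar> powr p)))"
        by (intro mult_left_mono wavg_diff_powr_le avx avy p) simp
      also have "\<dots> = (\<integral>\<^sup>+a. (\<integral>\<^sup>+b. ennreal ?n * (ennreal (?kx a) * ennreal (?ky b) * ennreal (\<bar>u a - u b\<bar> powr p))))"
        by (simp add: nn_integral_cmult)
      also have "\<dots> \<le> ?r"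
      proof (intro nn_integral_mono)
        fix a b
        show "ennreal ?n * (ennreal (?kx a) * ennreal (?ky b) * ennreal (\<bar>u a - u b\<bar> powr p)) \<le>
          ennreal (c * A\<^sup>2 * T_kernel DIM('a) p \<beta> \<delta> (dist a b)) *
            ((ennreal (envelope \<delta> x a) * indicator {x. depth x \<le> 3 * \<delta>} x) * (ennreal (envelope \<delta> y b) * indicator {x. depth x \<le> 3 * \<delta>} y)) *
            (ennreal (\<bar>u b - u a\<bar> powr p) * indicator (rim \<delta>) a * indicator (rim \<delta>) b)"
        proof (cases "envelope \<delta> x a = 0 \<or> envelope \<delta> y b = 0 \<or> a = b")
          case True
          moreover have "?kx a \<le> 0" if "envelope \<delta> x a = 0" using ker[OF \<delta> x, of a] that by simp
          moreover have "?ky b \<le> 0" if "envelope \<delta> y b = 0" using ker[OF \<delta> y, of b] that by simp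
          ultimately have "ennreal (?kx a) = 0 \<or> ennreal (?ky b) = 0 \<or> a = b" by (auto simp: ennreal_eq_0_iff)
          then show ?thesis by auto
        next
          case nz: False
          then have nz: "envelope \<delta> x a \<noteq> 0" "envelope \<delta> y b \<noteq> 0" "a \<noteq> b" by auto
          note s = envelope_support[OF nz(1)] envelope_support[OF nz(2)]
          have "dist a b \<le> dist x a + dist x y + dist y b"
            using dist_triangle[of a b x] dist_triangle[of x b y] by (simp add: dist_commute)
          then have ab: "dist a b \<le> 121 * dist x y" using s(3,7) far ty by linarith
          have nT: "?n \<le> c * T_kernel DIM('a) p \<beta> \<delta> (dist a b)"
            unfolding c_def using nz ab \<rho> \<delta> \<beta> Dp p by (intro nl_kernel_le_T_kernel) auto
          have "ennreal ?n * (ennreal (?kx a) * ennreal (?ky b) * ennreal (\<bar>u a - u b\<bar> powr p))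
            \<le> ennreal (c * T_kernel DIM('a) p \<beta> \<delta> (dist a b)) * (ennreal (A * envelope \<delta> x a) * ennreal (A * envelope \<delta> y b) * ennreal (\<bar>u a - u b\<bar> powr p))"
            by (intro mult_mono ennreal_leI nT ker \<delta> x y) auto
          also have "\<dots> = ennreal (c * A\<^sup>2 * T_kernel DIM('a) p \<beta> \<delta> (dist a b)) * ((ennreal (envelope \<delta> x a)) * (ennreal (envelope \<delta> y b))) * (ennreal (\<bar>u a - u b\<bar> powr p))"
            using c A by (simp add: ennreal_mult[symmetric] T_kernel_nonneg envelope_nonneg power2_eq_square mult_ac)
          finally show ?thesis
            using s(2,6) abs_minus_commute[of "u b" "u a"] order_trans[OF far, of "3 * \<delta>"] order_trans[OF ty, of "3 * \<delta>"] \<delta> lt by simp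
        qed
      qed
      finally show ?thesis .
    qed
  qed (use c A C1 in \<open>auto simp: T_kernel_nonneg\<close>)
  moreover have "c * A\<^sup>2 * C1\<^sup>2 > 0" using c A C1 by simp
  ultimately show ?thesis by blast
qed

text \<open>With \<open>y\<close> outside \<Omega> one has depth x \<le> dist x y, so such pairs
  behave like far ones. Only \<open>x\<close> is averaged, and dist a y \<le> (24 + 1) * dist x
  y.\<close>

lemma extend_cross_le:
  assumes p: "p > 1"
  shows "\<exists>C>0. \<forall>\<delta> \<beta> u. 0 < \<delta> \<longrightarrow> \<delta> < r / 16 \<longrightarrow> 0 \<le> \<beta> \<longrightarrow> \<beta> < real DIM('a) + p \<longrightarrow> u \<in> borel_measurable borel \<longrightarrow>
     rim_integrable \<delta> u \<longrightarrow>
     (\<integral>\<^sup>+x. \<integral>\<^sup>+y. nl_jump p \<beta> \<delta> (extend \<delta> u) x y *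
        indicator \<Omega> x * indicator (rim \<delta>) y)
     \<le> ennreal C * T_energy p \<beta> \<delta> u"
proof -
  let ?D = "real DIM('a)"
  have D1: "?D \<ge> 1" using DIM_ge_Suc0[where 'a='a] by simp
  have Dp: "2 \<le> ?D + p" using D1 p by linarith
  obtain A where A: "A > 0" and ker: "\<And>\<delta> x a. 0 < \<delta> \<Longrightarrow> \<delta> < r / 16 \<Longrightarrow> x \<in> \<Omega> \<Longrightarrow>
    ext_ker \<delta> x a / integral\<^sup>L lborel (ext_ker \<delta> x) \<le> A * envelope \<delta> x a"
    using ext_ker_div_le by blast
  obtain C1 where C1: "C1 > 0" and near: "\<And>\<delta> a. 0 < \<delta> \<Longrightarrow>
     (\<integral>\<^sup>+x. ennreal (envelope \<delta> x a) * indicator {x. depth x \<le> 3 * \<delta>} x) \<le> ennreal C1"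
    using envelope_near_mass by blast
  define c where "c = (?D + p) / sphere_area DIM('a) * 25 powr (?D + p) * 25 powr (?D + p - 2)"
  have c: "c > 0" using sphere_area_pos[of "DIM('a)"] D1 p by (simp add: c_def)
  have "(\<integral>\<^sup>+x. \<integral>\<^sup>+y. nl_jump p \<beta> \<delta> (extend \<delta> u) x y *
        indicator \<Omega> x * indicator (rim \<delta>) y)
     \<le> ennreal (C1 * (c * A)) * T_energy p \<beta> \<delta> u"
    if \<delta>: "0 < \<delta>" "\<delta> < r / 16" and \<beta>: "0 \<le> \<beta>" "\<beta> < ?D + p" and u[measurable]: "u \<in> borel_measurable borel" and i: "rim_integrable \<delta> u" for \<delta> \<beta> u
  proof -
    let ?H = "\<lambda>a y. ennreal (c * A * T_kernel DIM('a) p \<beta> \<delta> (dist a y) * \<bar>u y - u a\<bar> powr p) * indicator (rim \<delta>) a * indicator (rim \<delta>) y"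
    have "(\<integral>\<^sup>+x. \<integral>\<^sup>+y. nl_jump p \<beta> \<delta> (extend \<delta> u) x y *
        indicator \<Omega> x * indicator (rim \<delta>) y) \<le> ennreal C1 * (\<integral>\<^sup>+a. \<integral>\<^sup>+y. ?H a y)"
    proof (rule nn_integral_transfer_one[where Q = "\<lambda>x a. ennreal (envelope \<delta> x a) * indicator {x. depth x \<le> 3 * \<delta>} x"])
      show "(\<lambda>w. ennreal (envelope \<delta> (fst w) (snd w)) * indicator {x. depth x \<le> 3 * \<delta>} (fst w)) \<in> borel_measurable (borel \<Otimes>\<^sub>M borel)"
        by measurable
      show "(\<lambda>w. ?H (fst w) (snd w)) \<in> borel_measurable (borel \<Otimes>\<^sub>M borel)" by measurable
      show "(\<integral>\<^sup>+x. ennreal (envelope \<delta> x a) * indicator {x. depth x \<le> 3 * \<delta>} x) \<le> ennreal C1" for a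
        by (rule near[OF \<delta>(1)])
      fix x y :: 'a
      let ?n = "nl_kernel DIM('a) p \<beta> \<delta> (dist x y)"
      let ?l = "ennreal (?n * \<bar>extend \<delta> u y - extend \<delta> u x\<bar> powr p) * indicator \<Omega> x * indicator (rim \<delta>) y"
      let ?r = "\<integral>\<^sup>+a. ennreal (envelope \<delta> x a) * indicator {x. depth x \<le> 3 * \<delta>} x * ?H a y"
      show "?l \<le> ?r"
      proof (cases "x \<in> \<Omega> \<and> y \<in> rim \<delta> \<and> dist x y < \<delta>")
        case False
        then have z: "?l = 0" by (auto simp: nl_kernel_def)
        show ?thesis unfolding z by (rule zero_le)
      next
        case True
        then have x: "x \<in> \<Omega>" and y: "y \<in> rim \<delta>" "y \<notin> \<Omega>" and lt: "dist x y < \<delta>" by (auto simp: collar_def)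
        have tx: "depth x \<le> dist x y" by (rule depth_le[OF y(2)])
        have \<rho>: "dist x y > 0" using tx depth_pos[OF x] by linarith
        note avx = averaging_ext_ker[OF \<delta> x u i]
        let ?kx = "\<lambda>a. ext_ker \<delta> x a / integral\<^sup>L lborel (ext_ker \<delta> x)"
        have n0: "0 \<le> ?n" using \<beta> by (intro nl_kernel_nonneg) simp
        have "?l = ennreal ?n * ennreal (\<bar>wavg (ext_ker \<delta> x) u - u y\<bar> powr p)"
          using x y n0 by (simp add: extend_def ennreal_mult abs_minus_commute)
        also have "\<dots> \<le> ennreal ?n * (\<integral>\<^sup>+a. ennreal (?kx a) * ennreal (\<bar>u a - u y\<bar> powr p))"
          by (intro mult_left_mono wavg_minus_powr_le avx p) simp
        also have "\<dots> = (\<integral>\<^sup>+a. ennreal ?n * (ennreal (?kx a) * ennreal (\<bar>u a - u y\<bar> powr p)))"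
          by (simp add: nn_integral_cmult)
        also have "\<dots> \<le> ?r"
        proof (intro nn_integral_mono)
          fix a
          show "ennreal ?n * (ennreal (?kx a) * ennreal (\<bar>u a - u y\<bar> powr p)) \<le> ennreal (envelope \<delta> x a) * indicator {x. depth x \<le> 3 * \<delta>} x * ?H a y"
          proof (cases "envelope \<delta> x a = 0 \<or> a = y")
            case True
            moreover have "?kx a \<le> 0" if "envelope \<delta> x a = 0" using ker[OF \<delta> x, of a] that by simp
            ultimately have "ennreal (?kx a) = 0 \<or> a = y" by (auto simp: ennreal_eq_0_iff)
            then show ?thesis by auto
          next
            case nz: False
            then have nz: "envelope \<delta> x a \<noteq> 0" "a \<noteq> y" by auto
            note s = envelope_support[OF nz(1)]
            have "dist a y \<le> dist x a + dist x y" using dist_triangle[of a y x] by (simp add: dist_commute)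
            then have ay: "dist a y \<le> 25 * dist x y" using s(3) tx by linarith
            have nT: "?n \<le> c * T_kernel DIM('a) p \<beta> \<delta> (dist a y)"
              unfolding c_def using nz ay \<rho> \<delta> \<beta> Dp p by (intro nl_kernel_le_T_kernel) auto
            have "ennreal ?n * (ennreal (?kx a) * ennreal (\<bar>u a - u y\<bar> powr p))
              \<le> ennreal (c * T_kernel DIM('a) p \<beta> \<delta> (dist a y)) * (ennreal (A * envelope \<delta> x a) * ennreal (\<bar>u a - u y\<bar> powr p))"
              by (intro mult_mono ennreal_leI nT ker \<delta> x) auto
            also have "\<dots> = ennreal (envelope \<delta> x a) * ennreal (c * A * T_kernel DIM('a) p \<beta> \<delta> (dist a y) * \<bar>u a - u y\<bar> powr p)"
              using c A by (simp add: ennreal_mult[symmetric] T_kernel_nonneg envelope_nonneg mult_ac)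
            finally show ?thesis
              using s(2) abs_minus_commute[of "u y" "u a"] order_trans[OF tx, of "3 * \<delta>"] \<delta> lt y by simp
          qed
        qed
        finally show ?thesis .
      qed
    qed
    also have "(\<integral>\<^sup>+a. \<integral>\<^sup>+y. ?H a y) = kenergy (\<lambda>\<rho>. c * A * T_kernel DIM('a) p \<beta> \<delta> \<rho>) p (rim \<delta>) u"
      by (simp add: kenergy_def)
    also have "\<dots> = ennreal (c * A) * T_energy p \<beta> \<delta> u"
      using c A by (intro kenergy_cmult) auto
    finally show ?thesis using C1 c A by (simp add: ennreal_mult mult.assoc)
  qed
  moreover have "C1 * (c * A) > 0" using c A C1 by simp
  ultimately show ?thesis by blast
qed

text \<open>Smoothness of the average contributes (dist x y / depth x)^p, which makes the kernel
  integrable at the diagonal for every \<beta> < d + p. The integral is of order 1 / (d + p -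
  \<beta>) and is cancelled by the same factor in \<open>nl_kernel\<close>, so the constant is
  uniform in \<beta>.\<close>

lemma extend_near_le:
  assumes p: "p > 1"
  shows "\<exists>C>0. \<forall>\<delta> \<beta> u. 0 < \<delta> \<longrightarrow> \<delta> < r * \<eta> / 16 \<longrightarrow> 0 \<le> \<beta> \<longrightarrow> \<beta> < real DIM('a) + p \<longrightarrow> u \<in> borel_measurable borel \<longrightarrow>
     rim_integrable \<delta> u \<longrightarrow>
     (\<integral>\<^sup>+x. \<integral>\<^sup>+y. nl_jump p \<beta> \<delta> (extend \<delta> u) x y *
        indicator {w. dist (fst w) (snd w) < depth (fst w) / 2} (x, y) * indicator \<Omega> x * indicator \<Omega> y)
     \<le> ennreal C * T_energy p \<beta> \<delta> u"
proof -
  let ?D = "real DIM('a)" and ?v = "unit_ball_vol (real DIM('a))"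
  have D1: "?D \<ge> 1" using DIM_ge_Suc0[where 'a='a] by simp
  have sa: "sphere_area DIM('a) > 0" by (rule sphere_area_pos) simp
  obtain B where B: "B > 0" and ker: "\<And>\<delta> x y a. 0 < \<delta> \<Longrightarrow> \<delta> < r / 16 \<Longrightarrow> x \<in> \<Omega> \<Longrightarrow> y \<in> \<Omega> \<Longrightarrow> dist x y < depth x / 2 \<Longrightarrow>
     \<bar>ext_ker \<delta> x a - ext_ker \<delta> y a\<bar> \<le> integral\<^sup>L lborel (ext_ker \<delta> x) * (dist x y / depth x) * (B * envelope \<delta> x a) \<and>
     ext_ker \<delta> y a \<le> integral\<^sup>L lborel (ext_ker \<delta> y) * (B * envelope \<delta> x a)"
    using ext_ker_nearby by blast
  obtain C2 where C2: "C2 > 0" and dual: "\<And>\<delta> x. 0 < \<delta> \<Longrightarrow> \<delta> < r * \<eta> / 16 \<Longrightarrow>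
     (\<integral>\<^sup>+a. ennreal (envelope \<delta> x a)) \<le> ennreal C2"
    using envelope_dual_mass by blast
  obtain C3 where C3: "C3 > 0" and pair: "\<And>\<delta> \<beta> a b. 0 < \<delta> \<Longrightarrow> 0 \<le> \<beta> \<Longrightarrow> \<beta> < real DIM('a) + p \<Longrightarrow> a \<noteq> b \<Longrightarrow>
     (\<integral>\<^sup>+x. ennreal ((min (depth x) \<delta> / \<delta>) powr (real DIM('a) + p - \<beta>) * depth x powr (- p)) *
        (ennreal (envelope \<delta> x a) * ennreal (envelope \<delta> x b)))
     \<le> ennreal (C3 * T_kernel DIM('a) p \<beta> \<delta> (dist a b))"
    using envelope_pair_mass[OF p] by blast
  define G where "G = B * C2"
  define N where "N = G powr (p - 1) * B\<^sup>2 / sphere_area DIM('a)"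
  define N' where "N' = N * 2 powr (?D + p + 1) * ?v * 2 powr (?D + p)"
  have pos: "G > 0" "N > 0" "N' > 0" using B C2 sa by (simp_all add: G_def N_def N'_def)
  have "(\<integral>\<^sup>+x. \<integral>\<^sup>+y. nl_jump p \<beta> \<delta> (extend \<delta> u) x y *
        indicator {w. dist (fst w) (snd w) < depth (fst w) / 2} (x, y) * indicator \<Omega> x * indicator \<Omega> y)
     \<le> ennreal (N' * C3) * T_energy p \<beta> \<delta> u"
    if \<delta>: "0 < \<delta>" "\<delta> < r * \<eta> / 16" and \<beta>: "0 \<le> \<beta>" "\<beta> < ?D + p" and u[measurable]: "u \<in> borel_measurable borel" and i: "rim_integrable \<delta> u" for \<delta> \<beta> u
  proof -
    have \<delta>r: "\<delta> < r / 16" using \<delta> r_pos \<eta>_le_1 mult_left_mono[of \<eta> 1 r] by linarith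
    define \<alpha> where "\<alpha> = ?D + p - \<beta>"
    have \<alpha>: "\<alpha> > 0" using \<beta> by (simp add: \<alpha>_def)
    \<comment> \<open>Collects the constants of \<open>nl_kernel\<close>, of Jensen's inequality and
      of the two envelopes; its factor \<alpha> is the one that cancels the 1 / \<alpha> from the
      integral of \<open>q\<close>.\<close>
    define n where "n = N * \<alpha> * \<delta> powr (- \<alpha>)"
    have n: "n > 0" using pos \<alpha> \<delta> by (simp add: n_def)
    define q where "q x y = ennreal (dist x y powr (\<alpha> - ?D)) * indicator UNIV y * indicator {0<..min (depth x) \<delta>} (dist x y)" for x y :: 'a
    have qm: "(\<lambda>w. q (fst w) (snd w)) \<in> borel_measurable (borel \<Otimes>\<^sub>M borel)"
    proof -
      have "q x y = ennreal (dist x y powr (\<alpha> - ?D)) * (if 0 < dist x y \<and> dist x y \<le> min (depth x) \<delta> then 1 else 0)" for x y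
        by (simp add: q_def indicator_def)
      then show ?thesis by (simp only:) measurable
    qed
    have [measurable]: "(\<lambda>w. q (f w) (g w)) \<in> borel_measurable M" if "f \<in> M \<rightarrow>\<^sub>M borel" "g \<in> M \<rightarrow>\<^sub>M borel" for f g and M :: "'c measure"
      using measurable_compose[of "\<lambda>w. (f w, g w)", OF _ qm] that by simp
    show ?thesis
    proof (rule transfer_to_kenergy[where P = "\<lambda>x y a b. ennreal (n * depth x powr (- p)) * q x y * (ennreal (envelope \<delta> x a) * ennreal (envelope \<delta> x b))"])
      show "(\<lambda>w. ennreal (n * depth (fst (fst w)) powr (- p)) * q (fst (fst w)) (snd (fst w)) *
          (ennreal (envelope \<delta> (fst (fst w)) (fst (snd w))) * ennreal (envelope \<delta> (fst (fst w)) (snd (snd w)))))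
        \<in> borel_measurable ((borel \<Otimes>\<^sub>M borel) \<Otimes>\<^sub>M (borel \<Otimes>\<^sub>M borel))"
        by measurable
    next
      fix a b :: 'a assume ab: "a \<noteq> b"
      have "(\<integral>\<^sup>+x. \<integral>\<^sup>+y. ennreal (n * depth x powr (- p)) * q x y * (ennreal (envelope \<delta> x a) * ennreal (envelope \<delta> x b)))
        \<le> (\<integral>\<^sup>+x. ennreal N' * (ennreal ((min (depth x) \<delta> / \<delta>) powr (?D + p - \<beta>) * depth x powr (- p)) *
          (ennreal (envelope \<delta> x a) * ennreal (envelope \<delta> x b))))"
      proof (rule nn_integral_mono)
        fix x
        let ?e = "ennreal (envelope \<delta> x a) * ennreal (envelope \<delta> x b)"
        show "(\<integral>\<^sup>+y. ennreal (n * depth x powr (- p)) * q x y * ?e)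
          \<le> ennreal N' * (ennreal ((min (depth x) \<delta> / \<delta>) powr (?D + p - \<beta>) * depth x powr (- p)) * ?e)"
        proof (cases "x \<in> \<Omega>")
          case False
          then show ?thesis by (simp add: envelope_def)
        next
          case True
          \<comment> \<open>Radius of integration in \<open>y\<close>: the kernel stops at \<delta>,
            and nearby pairs are closer than half the depth.\<close>
          define R where "R = min (depth x) \<delta>"
          have R: "R > 0" using depth_pos[OF True] \<delta> by (simp add: R_def)
          have q: "(\<integral>\<^sup>+y. q x y) \<le> ennreal (2 powr (?D + p + 1) * ?v * 2 powr (?D + p) * (R powr \<alpha> / \<alpha>))"
          proof -
            have "(\<integral>\<^sup>+y. q x y) \<le> ennreal (2 powr (\<bar>\<alpha> - ?D\<bar> + 1) * ?v * ((2 * R) powr \<alpha> / \<alpha>))"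
              unfolding q_def R_def[symmetric]
              by (intro nn_integral_dist_powr_ball_le[OF _ \<alpha> R] emeasure_cball_powr) auto
            also have "\<dots> \<le> ennreal (2 powr (?D + p + 1) * ?v * (2 powr (?D + p) * R powr \<alpha> / \<alpha>))"
            proof (intro ennreal_leI mult_mono)
              show "2 powr (\<bar>\<alpha> - ?D\<bar> + 1) \<le> 2 powr (?D + p + 1)"
                using \<beta> p D1 by (intro powr_mono) (auto simp: \<alpha>_def)
              have "(2 * R) powr \<alpha> = 2 powr \<alpha> * R powr \<alpha>" using R by (simp add: powr_mult)
              also have "\<dots> \<le> 2 powr (?D + p) * R powr \<alpha>" using \<beta> by (intro mult_right_mono powr_mono) (auto simp: \<alpha>_def)
              finally show "(2 * R) powr \<alpha> / \<alpha> \<le> 2 powr (?D + p) * R powr \<alpha> / \<alpha>" using \<alpha> by (simp add: divide_right_mono)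
            qed (use \<alpha> in auto)
            finally show ?thesis by (simp add: mult.assoc)
          qed
          have "(\<integral>\<^sup>+y. ennreal (n * depth x powr (- p)) * q x y * ?e) = ennreal (n * depth x powr (- p)) * (\<integral>\<^sup>+y. q x y) * ?e"
            by (subst nn_integral_multc, measurable, subst nn_integral_cmult, measurable)
          also have "\<dots> \<le> ennreal (n * depth x powr (- p)) * ennreal (2 powr (?D + p + 1) * ?v * 2 powr (?D + p) * (R powr \<alpha> / \<alpha>)) * ?e"
            by (intro mult_right_mono mult_left_mono q) auto
          also have "\<dots> = ennreal (n * depth x powr (- p) * (2 powr (?D + p + 1) * ?v * 2 powr (?D + p) * (R powr \<alpha> / \<alpha>))) * ?e"
            using n \<alpha> by (subst ennreal_mult[symmetric]) auto
          also have "n * depth x powr (- p) * (2 powr (?D + p + 1) * ?v * 2 powr (?D + p) * (R powr \<alpha> / \<alpha>)) = N' * ((R / \<delta>) powr \<alpha> * depth x powr (- p))"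
          proof -
            have "(R / \<delta>) powr \<alpha> = R powr \<alpha> * \<delta> powr (- \<alpha>)"
              using powr_divide[of R \<delta> \<alpha>] R \<delta> unfolding powr_minus by (simp only: divide_inverse less_imp_le)
            then show ?thesis using \<alpha> by (simp add: n_def N'_def)
          qed
          also have "ennreal (N' * ((R / \<delta>) powr \<alpha> * depth x powr (- p))) = ennreal N' * ennreal ((R / \<delta>) powr \<alpha> * depth x powr (- p))"
            using pos by (intro ennreal_mult) auto
          finally show ?thesis by (simp only: R_def \<alpha>_def mult.assoc order_refl)
        qed
      qed
      also have "\<dots> = ennreal N' * (\<integral>\<^sup>+x. ennreal ((min (depth x) \<delta> / \<delta>) powr (?D + p - \<beta>) * depth x powr (- p)) *
          (ennreal (envelope \<delta> x a) * ennreal (envelope \<delta> x b)))"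
        by (rule nn_integral_cmult) measurable
      also have "\<dots> \<le> ennreal N' * ennreal (C3 * T_kernel DIM('a) p \<beta> \<delta> (dist a b))"
        by (intro mult_left_mono pair \<delta> \<beta> ab) simp
      also have "\<dots> = ennreal (N' * C3 * T_kernel DIM('a) p \<beta> \<delta> (dist a b))"
        using pos C3 by (simp add: ennreal_mult[symmetric] T_kernel_nonneg mult.assoc)
      finally show "(\<integral>\<^sup>+x. \<integral>\<^sup>+y. ennreal (n * depth x powr (- p)) * q x y * (ennreal (envelope \<delta> x a) * ennreal (envelope \<delta> x b)))
        \<le> ennreal (N' * C3 * T_kernel DIM('a) p \<beta> \<delta> (dist a b))" .
    next
      fix x y :: 'a
      let ?l = "nl_jump p \<beta> \<delta> (extend \<delta> u) x y *
        indicator {w. dist (fst w) (snd w) < depth (fst w) / 2} (x, y) * indicator \<Omega> x * indicator \<Omega> y"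
      let ?r = "\<integral>\<^sup>+a. \<integral>\<^sup>+b. ennreal (n * depth x powr (- p)) * q x y * (ennreal (envelope \<delta> x a) * ennreal (envelope \<delta> x b)) *
        (ennreal (\<bar>u b - u a\<bar> powr p) * indicator (rim \<delta>) a * indicator (rim \<delta>) b)"
      show "?l \<le> ?r"
      proof (cases "x \<in> \<Omega> \<and> y \<in> \<Omega> \<and> dist x y < depth x / 2 \<and> dist x y < \<delta> \<and> x \<noteq> y")
        case False
        then have z: "?l = 0" by (auto simp: nl_kernel_def)
        show ?thesis unfolding z by (rule zero_le)
      next
        case True
        then have x: "x \<in> \<Omega>" and y: "y \<in> \<Omega>" and nearby: "dist x y < depth x / 2" and lt: "dist x y < \<delta>" and \<rho>: "0 < dist x y" by auto
        have t: "depth x > 0" by (rule depth_pos[OF x])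
        let ?n = "nl_kernel DIM('a) p \<beta> \<delta> (dist x y)"
        let ?F = "\<lambda>a b. ennreal (B * envelope \<delta> x a) * ennreal (B * envelope \<delta> x b) * ennreal (\<bar>u a - u b\<bar> powr p)"
        have n0: "0 \<le> ?n" using \<beta> by (intro nl_kernel_nonneg) simp
        have G: "(\<integral>\<^sup>+a. ennreal (B * envelope \<delta> x a)) \<le> ennreal G"
          using B C2 dual[OF \<delta>, of x] by (simp add: ennreal_mult nn_integral_cmult envelope_nonneg G_def mult_left_mono)
        have w: "ennreal (\<bar>wavg (ext_ker \<delta> x) u - wavg (ext_ker \<delta> y) u\<bar> powr p) \<le> ennreal ((dist x y / depth x) powr p * G powr (p - 1)) * (\<integral>\<^sup>+a. \<integral>\<^sup>+b. ?F a b)"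
          using ker[OF \<delta>(1) \<delta>r x y nearby] t B
          by (intro wavg_diff_lipschitz_powr_le averaging_ext_ker[OF \<delta>(1) \<delta>r x u i] averaging_ext_ker[OF \<delta>(1) \<delta>r y u i] p G pos) (auto simp: envelope_nonneg)
        have "?l = ennreal ?n * ennreal (\<bar>wavg (ext_ker \<delta> x) u - wavg (ext_ker \<delta> y) u\<bar> powr p)"
          using True n0 by (simp add: extend_def ennreal_mult abs_minus_commute)
        also have "\<dots> \<le> ennreal ?n * (ennreal ((dist x y / depth x) powr p * G powr (p - 1)) * (\<integral>\<^sup>+a. \<integral>\<^sup>+b. ?F a b))"
          by (intro mult_left_mono w) simp
        also have "\<dots> = (\<integral>\<^sup>+a. \<integral>\<^sup>+b. ennreal (?n * ((dist x y / depth x) powr p * G powr (p - 1))) * ?F a b)"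
          using n0 by (simp add: nn_integral_cmult ennreal_mult mult.assoc)
        also have "\<dots> = ?r"
        proof (intro nn_integral_cong)
          fix a b
          have q1: "q x y = ennreal (dist x y powr (\<alpha> - ?D))" using \<rho> lt nearby t by (simp add: q_def)
          have c: "?n * ((dist x y / depth x) powr p * G powr (p - 1)) * B\<^sup>2 = n * depth x powr (- p) * dist x y powr (\<alpha> - ?D)"
          proof -
            have 1: "?n = \<alpha> / sphere_area DIM('a) * \<delta> powr (- \<alpha>) * dist x y powr (- \<beta>)"
              using lt unfolding nl_kernel_def powr_minus divide_inverse \<alpha>_def by simp
            have 2: "(dist x y / depth x) powr p = dist x y powr p * depth x powr (- p)"
              using powr_divide[of "dist x y" "depth x" p] \<rho> t unfolding powr_minus by (simp only: divide_inverse less_imp_le)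
            have 3: "dist x y powr (\<alpha> - ?D) = dist x y powr p * dist x y powr (- \<beta>)"
              unfolding powr_add[symmetric] by (simp add: \<alpha>_def)
            show ?thesis unfolding 1 2 3 n_def N_def by simp
          qed
          show "ennreal (?n * ((dist x y / depth x) powr p * G powr (p - 1))) * ?F a b = ennreal (n * depth x powr (- p)) * q x y * (ennreal (envelope \<delta> x a) * ennreal (envelope \<delta> x b)) *
            (ennreal (\<bar>u b - u a\<bar> powr p) * indicator (rim \<delta>) a * indicator (rim \<delta>) b)"
          proof (cases "envelope \<delta> x a = 0 \<or> envelope \<delta> x b = 0")
            case True
            then show ?thesis by auto
          next
            case False
            then have s: "a \<in> rim \<delta>" "b \<in> rim \<delta>" using envelope_support by auto
            have "ennreal (?n * ((dist x y / depth x) powr p * G powr (p - 1))) * ?F a b =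
              ennreal (?n * ((dist x y / depth x) powr p * G powr (p - 1)) * B\<^sup>2) * (ennreal (envelope \<delta> x a) * ennreal (envelope \<delta> x b)) * ennreal (\<bar>u a - u b\<bar> powr p)"
              using n0 B by (simp add: ennreal_mult envelope_nonneg power2_eq_square mult_ac)
            also have "\<dots> = ennreal (n * depth x powr (- p)) * q x y * (ennreal (envelope \<delta> x a) * ennreal (envelope \<delta> x b)) * ennreal (\<bar>u a - u b\<bar> powr p)"
              unfolding c q1 using n by (simp add: ennreal_mult)
            finally show ?thesis using s abs_minus_commute[of "u b" "u a"] by simp
          qed
        qed
        finally show ?thesis by simp
      qed
    qed (use pos C3 in \<open>auto simp: T_kernel_nonneg\<close>)
  qed
  moreover have "N' * C3 > 0" using pos C3 by simp
  ultimately show ?thesis by blast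
qed

end

section \<open>Assembly of the two halves of the theorem\<close>

lemma S_pow_eq:
  fixes U :: "'a::euclidean_space set"
  assumes "U \<in> sets borel" "AE x in lborel. x \<in> U \<longrightarrow> u x = v x"
  shows "S_pow p \<beta> \<delta> U u = Lp_energy p U v + kenergy (nl_kernel DIM('a) p \<beta> \<delta>) p U v"
  using assms unfolding S_pow_def
  by (simp add: Lp_pow_eq S_semi_pow_eq Lp_energy_cong_AE[OF assms(2)] kenergy_cong_AE[OF assms(2)])

lemma T_pow_eq:
  fixes U :: "'a::euclidean_space set"
  assumes "U \<in> sets borel" "AE x in lborel. x \<in> U \<longrightarrow> u x = v x" "v \<in> borel_measurable borel"
  shows "T_pow p \<beta> \<delta> U u = ennreal (1 / \<delta>) * Lp_energy p U v + kenergy (T_kernel DIM('a) p \<beta> \<delta>) p U v"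
  using assms unfolding T_pow_def
  by (simp add: Lp_pow_eq T_semi_pow_cong_AE[OF assms(1,2)] T_semi_pow_eq Lp_energy_cong_AE[OF assms(2)])

lemma enn2real_powr_le:
  assumes "X \<le> ennreal C * Y" "Y < \<infinity>" "0 \<le> C" "0 < p"
  shows "enn2real X powr (1 / p) \<le> C powr (1 / p) * enn2real Y powr (1 / p)"
proof -
  have "enn2real X \<le> enn2real (ennreal C * Y)"
    using assms by (intro enn2real_mono) (auto simp: ennreal_mult_less_top)
  also have "\<dots> = C * enn2real Y" using assms by (simp add: enn2real_mult)
  finally have "enn2real X powr (1 / p) \<le> (C * enn2real Y) powr (1 / p)"
    using assms by (intro powr_mono2) auto
  then show ?thesis using assms by (simp add: powr_mult)
qed

context cone_domain
begin

lemma extend_energy_le: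
  assumes p: "p > 1"
  shows "\<exists>C>0. \<forall>\<delta> \<beta> u. 0 < \<delta> \<longrightarrow> \<delta> < r * \<eta> / 16 \<longrightarrow> 0 \<le> \<beta> \<longrightarrow> \<beta> < real DIM('a) + p \<longrightarrow> u \<in> borel_measurable borel \<longrightarrow>
     rim_integrable \<delta> u \<longrightarrow>
     Lp_energy p (nbhd \<delta>) (extend \<delta> u) + S_energy p \<beta> \<delta> (extend \<delta> u) \<le>
     ennreal C * (ennreal (1 / \<delta>) * Lp_energy p (rim \<delta>) u + T_energy p \<beta> \<delta> u)"
proof -
  let ?D = "real DIM('a)"
  have D1: "?D \<ge> 1" using DIM_ge_Suc0[where 'a='a] by simp
  have Dp: "2 \<le> ?D + p" using D1 p by linarith
  obtain C0 where C0: "C0 > 0" and L: "\<And>\<delta> u. 0 < \<delta> \<Longrightarrow> \<delta> < r / 16 \<Longrightarrow> u \<in> borel_measurable borel \<Longrightarrow>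
     rim_integrable \<delta> u \<Longrightarrow>
     Lp_energy p (nbhd \<delta>) (extend \<delta> u) \<le> ennreal (C0 / \<delta>) * Lp_energy p (rim \<delta>) u"
    using extend_Lp_le[OF p] by blast
  define F where "F \<delta> \<beta> u x y = nl_jump p \<beta> \<delta> (extend \<delta> u) x y" for \<delta> \<beta> u and x y :: 'a
  obtain C1 where C1: "C1 > 0" and near: "\<And>\<delta> \<beta> u. 0 < \<delta> \<Longrightarrow> \<delta> < r * \<eta> / 16 \<Longrightarrow> 0 \<le> \<beta> \<Longrightarrow> \<beta> < ?D + p \<Longrightarrow> u \<in> borel_measurable borel \<Longrightarrow>
     rim_integrable \<delta> u \<Longrightarrow>
     (\<integral>\<^sup>+x. \<integral>\<^sup>+y. F \<delta> \<beta> u x y * indicator {w. dist (fst w) (snd w) < depth (fst w) / 2} (x, y) * indicator \<Omega> x * indicator \<Omega> y)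
     \<le> ennreal C1 * T_energy p \<beta> \<delta> u"
    using extend_near_le[OF p] unfolding F_def by blast
  obtain C2 where C2: "C2 > 0" and far: "\<And>\<delta> \<beta> u. 0 < \<delta> \<Longrightarrow> \<delta> < r / 16 \<Longrightarrow> 0 \<le> \<beta> \<Longrightarrow> \<beta> < ?D + p \<Longrightarrow> u \<in> borel_measurable borel \<Longrightarrow>
     rim_integrable \<delta> u \<Longrightarrow>
     (\<integral>\<^sup>+x. \<integral>\<^sup>+y. F \<delta> \<beta> u x y * indicator {w. depth (fst w) / 2 \<le> dist (fst w) (snd w)} (x, y) * indicator \<Omega> x * indicator \<Omega> y)
     \<le> ennreal C2 * T_energy p \<beta> \<delta> u"
    using extend_far_le[OF p] unfolding F_def by blast
  obtain C3 where C3: "C3 > 0" and cross: "\<And>\<delta> \<beta> u. 0 < \<delta> \<Longrightarrow> \<delta> < r / 16 \<Longrightarrow> 0 \<le> \<beta> \<Longrightarrow> \<beta> < ?D + p \<Longrightarrow> u \<in> borel_measurable borel \<Longrightarrow>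
     rim_integrable \<delta> u \<Longrightarrow>
     (\<integral>\<^sup>+x. \<integral>\<^sup>+y. F \<delta> \<beta> u x y * indicator \<Omega> x * indicator (rim \<delta>) y)
     \<le> ennreal C3 * T_energy p \<beta> \<delta> u"
    using extend_cross_le[OF p] unfolding F_def by blast
  define C4 where "C4 = (?D + p) / sphere_area DIM('a)"
  have C4: "C4 > 0" using sphere_area_pos[of "DIM('a)"] D1 p by (simp add: C4_def)
  define C where "C = C0 + (C1 + C2 + 2 * C3 + C4)"
  have C: "C > 0" using C0 C1 C2 C3 C4 by (simp add: C_def)
  have "Lp_energy p (nbhd \<delta>) (extend \<delta> u) + S_energy p \<beta> \<delta> (extend \<delta> u) \<le>
     ennreal C * (ennreal (1 / \<delta>) * Lp_energy p (rim \<delta>) u + T_energy p \<beta> \<delta> u)"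
    if \<delta>: "0 < \<delta>" "\<delta> < r * \<eta> / 16" and \<beta>: "0 \<le> \<beta>" "\<beta> < ?D + p" and u[measurable]: "u \<in> borel_measurable borel" and i: "rim_integrable \<delta> u" for \<delta> \<beta> u
  proof -
    have \<delta>r: "\<delta> < r / 16" using \<delta> r_pos \<eta>_le_1 mult_left_mono[of \<eta> 1 r] by linarith
    let ?V = "rim \<delta>" and ?F = "F \<delta> \<beta> u"
    let ?T = "kenergy (T_kernel DIM('a) p \<beta> \<delta>) p ?V u"
    \<comment> \<open>Near pairs, far pairs, pairs across the boundary and pairs in the collar. The
      third kind occurs in either order, and the symmetry of the integrand merges the two.\<close>
    define F1 where "F1 x y = ?F x y * indicator {w. dist (fst w) (snd w) < depth (fst w) / 2} (x, y) * indicator \<Omega> x * indicator \<Omega> y" for x y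
    define F2 where "F2 x y = ?F x y * indicator {w. depth (fst w) / 2 \<le> dist (fst w) (snd w)} (x, y) * indicator \<Omega> x * indicator \<Omega> y" for x y
    define F3 where "F3 x y = ?F x y * indicator \<Omega> x * indicator ?V y" for x y
    define F4 where "F4 x y = ?F x y * indicator ?V x * indicator ?V y" for x y
    have Fm[measurable]: "(\<lambda>w. ?F (fst w) (snd w)) \<in> borel_measurable (borel \<Otimes>\<^sub>M borel)"
      unfolding F_def by measurable
    have m: "(\<lambda>w. F1 (fst w) (snd w)) \<in> borel_measurable (borel \<Otimes>\<^sub>M borel)" "(\<lambda>w. F2 (fst w) (snd w)) \<in> borel_measurable (borel \<Otimes>\<^sub>M borel)"
      "(\<lambda>w. F3 (fst w) (snd w)) \<in> borel_measurable (borel \<Otimes>\<^sub>M borel)" "(\<lambda>w. F4 (fst w) (snd w)) \<in> borel_measurable (borel \<Otimes>\<^sub>M borel)"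
      unfolding F1_def F2_def F3_def F4_def prod.collapse by measurable
    have [measurable]: "(\<lambda>w. F1 (f w) (g w)) \<in> borel_measurable M" "(\<lambda>w. F2 (f w) (g w)) \<in> borel_measurable M"
      "(\<lambda>w. F3 (f w) (g w)) \<in> borel_measurable M" "(\<lambda>w. F4 (f w) (g w)) \<in> borel_measurable M"
      if "f \<in> M \<rightarrow>\<^sub>M borel" "g \<in> M \<rightarrow>\<^sub>M borel" for f g and M :: "'c measure"
      using that m[THEN measurable_compose[rotated], of "\<lambda>w. (f w, g w)"] by auto
    have sym: "?F y x = ?F x y" for x y by (simp add: F_def dist_commute abs_minus_commute)
    have "S_energy p \<beta> \<delta> (extend \<delta> u) = (\<integral>\<^sup>+x. \<integral>\<^sup>+y. F1 x y + (F2 x y + (F3 x y + (F3 y x + F4 x y))))"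
      unfolding kenergy_def
    proof (intro nn_integral_cong)
      fix x y
      show "nl_jump p \<beta> \<delta> (extend \<delta> u) x y * indicator (nbhd \<delta>) x * indicator (nbhd \<delta>) y
        = F1 x y + (F2 x y + (F3 x y + (F3 y x + F4 x y)))"
        unfolding F_def[symmetric, where u=u] F1_def F2_def F3_def F4_def sym[of y x]
        by (cases "x \<in> \<Omega>"; cases "y \<in> \<Omega>"; cases "x \<in> ?V"; cases "y \<in> ?V"; cases "dist x y < depth x / 2") (simp_all add: collar_def)
    qed
    also have "\<dots> = (\<integral>\<^sup>+x. \<integral>\<^sup>+y. F1 x y) + ((\<integral>\<^sup>+x. \<integral>\<^sup>+y. F2 x y) +
      ((\<integral>\<^sup>+x. \<integral>\<^sup>+y. F3 x y) + ((\<integral>\<^sup>+x. \<integral>\<^sup>+y. F3 y x) + (\<integral>\<^sup>+x. \<integral>\<^sup>+y. F4 x y))))"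
      by (simp add: nn_integral_add)
    also have "(\<integral>\<^sup>+x. \<integral>\<^sup>+y. F3 y x) = (\<integral>\<^sup>+x. \<integral>\<^sup>+y. F3 x y)"
      by (rule lborel_pair.Fubini') measurable
    also have "(\<integral>\<^sup>+x. \<integral>\<^sup>+y. F4 x y) \<le> ennreal C4 * ?T"
    proof -
      have "(\<integral>\<^sup>+x. \<integral>\<^sup>+y. F4 x y) = kenergy (nl_kernel DIM('a) p \<beta> \<delta>) p ?V (extend \<delta> u)"
        by (simp add: kenergy_def F4_def F_def)
      \<comment> \<open>On the collar the extension is \<open>u\<close> itself, so this part is a
        comparison of the two kernels at the same distance.\<close>
      also have "\<dots> = kenergy (nl_kernel DIM('a) p \<beta> \<delta>) p ?V u"
        by (rule kenergy_cong_AE) (auto simp: extend_def collar_def)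
      also have "\<dots> \<le> kenergy (\<lambda>\<rho>. C4 * T_kernel DIM('a) p \<beta> \<delta> \<rho>) p ?V u"
      proof (rule kenergy_mono)
        fix \<rho> :: real assume "\<rho> > 0"
        then show "nl_kernel DIM('a) p \<beta> \<delta> \<rho> \<le> C4 * T_kernel DIM('a) p \<beta> \<delta> \<rho>"
          using nl_kernel_le_T_kernel[of \<rho> 1 \<rho> \<delta> \<beta> "DIM('a)" p] \<delta> \<beta> Dp p by (simp add: C4_def)
      qed
      also have "\<dots> = ennreal C4 * ?T" using C4 by (intro kenergy_cmult) auto
      finally show ?thesis .
    qed
    also have "(\<integral>\<^sup>+x. \<integral>\<^sup>+y. F1 x y) \<le> ennreal C1 * ?T" unfolding F1_def by (rule near[OF \<delta> \<beta> u i])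
    also have "(\<integral>\<^sup>+x. \<integral>\<^sup>+y. F2 x y) \<le> ennreal C2 * ?T" unfolding F2_def by (rule far[OF \<delta>(1) \<delta>r \<beta> u i])
    also have "(\<integral>\<^sup>+x. \<integral>\<^sup>+y. F3 x y) \<le> ennreal C3 * ?T" unfolding F3_def by (rule cross[OF \<delta>(1) \<delta>r \<beta> u i])
    finally have "S_energy p \<beta> \<delta> (extend \<delta> u)
      \<le> ennreal C1 * ?T + (ennreal C2 * ?T + (ennreal C3 * ?T + (ennreal C3 * ?T + ennreal C4 * ?T)))"
      by (simp add: add_left_mono add_mono)
    also have "\<dots> = ennreal (C1 + C2 + 2 * C3 + C4) * ?T"
    proof -
      have e: "C1 + C2 + 2 * C3 + C4 = C1 + (C2 + (C3 + (C3 + C4)))" by simp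
      have "ennreal (C1 + C2 + 2 * C3 + C4) = ennreal C1 + (ennreal C2 + (ennreal C3 + (ennreal C3 + ennreal C4)))"
        unfolding e using C1 C2 C3 C4 by (simp only: ennreal_plus add_nonneg_nonneg less_imp_le)
      then show ?thesis by (simp only: distrib_right)
    qed
    also have "\<dots> \<le> ennreal C * ?T"
      using C0 by (intro mult_right_mono ennreal_leI) (auto simp: C_def)
    finally have K: "S_energy p \<beta> \<delta> (extend \<delta> u) \<le> ennreal C * ?T" .
    have "Lp_energy p (nbhd \<delta>) (extend \<delta> u) \<le> ennreal (C0 / \<delta>) * Lp_energy p ?V u" by (rule L[OF \<delta>(1) \<delta>r u i])
    also have "\<dots> \<le> ennreal (C / \<delta>) * Lp_energy p ?V u"
      using C1 C2 C3 C4 \<delta> by (intro mult_right_mono ennreal_leI divide_right_mono) (auto simp: C_def)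
    also have "ennreal (C / \<delta>) = ennreal C * ennreal (1 / \<delta>)"
      using C \<delta> by (simp add: ennreal_mult[symmetric])
    finally have "Lp_energy p (nbhd \<delta>) (extend \<delta> u) \<le> ennreal C * (ennreal (1 / \<delta>) * Lp_energy p ?V u)"
      by (simp only: mult.assoc)
    then show ?thesis using K by (simp only: distrib_left add_mono)
  qed
  then show ?thesis using C by blast
qed

text \<open>Membership in \<open>T_space\<close> follows from the finiteness of the bound. It
  belongs to the claim because \<open>enn2real\<close> sends \<infinity> to 0, so the inequality
  between real norms alone would say nothing about a function of infinite norm.\<close>

lemma trace_theorem:
  assumes p: "p > 1"
  shows "\<exists>C>0. \<forall>\<delta> \<beta>. 0 < \<delta> \<and> \<delta> < r * \<eta> / 16 \<and> 0 \<le> \<beta> \<and> \<beta> < real DIM('a) + p \<longrightarrow>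
    (\<forall>u \<in> S_space p \<beta> \<delta> (nbhd \<delta>). u \<in> T_space p \<beta> \<delta> (rim \<delta>) \<and>
       T_norm p \<beta> \<delta> (rim \<delta>) u \<le> C * \<bar>real DIM('a) + p - \<beta>\<bar> powr (- 1 / p) * S_norm p \<beta> \<delta> (nbhd \<delta>) u)"
proof -
  let ?D = "real DIM('a)"
  obtain C where C: "C > 0" and trace: "\<And>\<delta> \<beta> u. 0 < \<delta> \<Longrightarrow> \<delta> < r * \<eta> / 16 \<Longrightarrow> 0 \<le> \<beta> \<Longrightarrow> \<beta> < ?D + p \<Longrightarrow> u \<in> borel_measurable borel \<Longrightarrow>
    ennreal (1 / \<delta>) * Lp_energy p (rim \<delta>) u + T_energy p \<beta> \<delta> u \<le>
      ennreal (C / (?D + p - \<beta>)) * (Lp_energy p (nbhd \<delta>) u + S_energy p \<beta> \<delta> u)"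
    using trace_energy_le[OF p] by blast
  have "u \<in> T_space p \<beta> \<delta> (rim \<delta>) \<and>
       T_norm p \<beta> \<delta> (rim \<delta>) u \<le> C powr (1 / p) * \<bar>?D + p - \<beta>\<bar> powr (- 1 / p) * S_norm p \<beta> \<delta> (nbhd \<delta>) u"
    if \<delta>: "0 < \<delta>" "\<delta> < r * \<eta> / 16" and \<beta>: "0 \<le> \<beta>" "\<beta> < ?D + p" and u: "u \<in> S_space p \<beta> \<delta> (nbhd \<delta>)" for \<delta> \<beta> u
  proof -
    have um: "u \<in> borel_measurable (lebesgue_on (nbhd \<delta>))" and fin: "S_pow p \<beta> \<delta> (nbhd \<delta>) u < \<infinity>"
      using u by (auto simp: S_space_def)
    obtain v where v: "v \<in> borel_measurable borel" and uv: "AE x in lborel. x \<in> nbhd \<delta> \<longrightarrow> u x = v x"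
      using borel_version[OF um nbhd_borel(3)] by blast
    have uv': "AE x in lborel. x \<in> rim \<delta> \<longrightarrow> u x = v x" using uv by eventually_elim auto
    have le: "T_pow p \<beta> \<delta> (rim \<delta>) u \<le> ennreal (C / (?D + p - \<beta>)) * S_pow p \<beta> \<delta> (nbhd \<delta>) u"
      using trace[OF \<delta> \<beta> v] unfolding T_pow_eq[OF nbhd_borel(2) uv' v] S_pow_eq[OF nbhd_borel(3) uv] .
    also have "\<dots> < \<infinity>" using fin by (simp add: ennreal_mult_less_top)
    finally have Tfin: "T_pow p \<beta> \<delta> (rim \<delta>) u < \<infinity>" .
    have "ennreal (1 / \<delta>) * Lp_pow p (rim \<delta>) u < \<infinity>"
      using Tfin by (simp add: T_pow_def)
    then have "Lp_pow p (rim \<delta>) u < \<infinity>"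
      using \<delta> by (auto simp: ennreal_mult_less_top)
    moreover have "u \<in> borel_measurable (lebesgue_on (rim \<delta>))"
      by (rule measurable_restrict_mono[OF um]) auto
    ultimately have mem: "u \<in> T_space p \<beta> \<delta> (rim \<delta>)"
      using Tfin by (simp add: T_space_def Lp_space_def)
    have "T_norm p \<beta> \<delta> (rim \<delta>) u \<le> (C / (?D + p - \<beta>)) powr (1 / p) * S_norm p \<beta> \<delta> (nbhd \<delta>) u"
      unfolding T_norm_def S_norm_def using C \<beta> p by (intro enn2real_powr_le le fin) auto
    also have "(C / (?D + p - \<beta>)) powr (1 / p) = C powr (1 / p) * \<bar>?D + p - \<beta>\<bar> powr (- 1 / p)"
      using C \<beta> by (simp add: powr_divide powr_minus_divide)
    finally show ?thesis using mem by simp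
  qed
  then show ?thesis using C by (intro exI[of _ "C powr (1 / p)"]) auto
qed

lemma extension_theorem:
  assumes p: "p > 1"
  shows "\<exists>C>0. \<forall>\<delta> \<beta>. 0 < \<delta> \<and> \<delta> < r * \<eta> / 16 \<and> 0 \<le> \<beta> \<and> \<beta> < real DIM('a) + p \<and> \<beta> \<noteq> real DIM('a) \<longrightarrow>
    (\<exists>E. extension_operator (rim \<delta>) (nbhd \<delta>) (T_space p \<beta> \<delta> (rim \<delta>)) (S_space p \<beta> \<delta> (nbhd \<delta>)) E \<and>
       (\<forall>u \<in> T_space p \<beta> \<delta> (rim \<delta>). S_norm p \<beta> \<delta> (nbhd \<delta>) (E u) \<le>
          C * \<bar>real DIM('a) - \<beta>\<bar> powr (- 1 / p) *
          (T_norm p \<beta> \<delta> (rim \<delta>) u + \<bar>real DIM('a) + p - \<beta>\<bar> powr (- 1 / p) * Lp_norm p (rim \<delta>) u)))"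
proof -
  let ?D = "real DIM('a)"
  obtain C where C: "C > 0" and ext: "\<And>\<delta> \<beta> u. 0 < \<delta> \<Longrightarrow> \<delta> < r * \<eta> / 16 \<Longrightarrow> 0 \<le> \<beta> \<Longrightarrow> \<beta> < ?D + p \<Longrightarrow> u \<in> borel_measurable borel \<Longrightarrow>
     rim_integrable \<delta> u \<Longrightarrow>
     Lp_energy p (nbhd \<delta>) (extend \<delta> u) + S_energy p \<beta> \<delta> (extend \<delta> u) \<le>
     ennreal C * (ennreal (1 / \<delta>) * Lp_energy p (rim \<delta>) u + T_energy p \<beta> \<delta> u)"
    using extend_energy_le[OF p] by blast
  \<comment> \<open>The factor \<open>(?D + p) powr (1 / p)\<close> pays for inserting \<bar>d -
    \<beta>\<bar> powr (- 1 / p), which is at least (d + p) powr (- 1 / p).\<close>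
  define C2 where "C2 = C powr (1 / p) * (?D + p) powr (1 / p)"
  have C2: "C2 > 0" using C p by (simp add: C2_def add_nonneg_pos)
  have "\<exists>E. extension_operator (rim \<delta>) (nbhd \<delta>) (T_space p \<beta> \<delta> (rim \<delta>)) (S_space p \<beta> \<delta> (nbhd \<delta>)) E \<and>
       (\<forall>u \<in> T_space p \<beta> \<delta> (rim \<delta>). S_norm p \<beta> \<delta> (nbhd \<delta>) (E u) \<le> C2 * \<bar>?D - \<beta>\<bar> powr (- 1 / p) *
          (T_norm p \<beta> \<delta> (rim \<delta>) u + \<bar>?D + p - \<beta>\<bar> powr (- 1 / p) * Lp_norm p (rim \<delta>) u))"
    if \<delta>: "0 < \<delta>" "\<delta> < r * \<eta> / 16" and \<beta>: "0 \<le> \<beta>" "\<beta> < ?D + p" "\<beta> \<noteq> ?D" for \<delta> \<beta>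
  proof -
    let ?V = "rim \<delta>" and ?U = "nbhd \<delta>"
    let ?X = "T_space p \<beta> \<delta> ?V"
    have \<delta>r: "\<delta> < r / 2" using \<delta> r_pos \<eta>_le_1 mult_left_mono[of \<eta> 1 r] by linarith
    interpret fat_set ?U r "unit_ball_vol DIM('a) * (\<eta> / 4) ^ DIM('a)" by (rule fat_nbhd[OF \<delta>(1) \<delta>r])
    \<comment> \<open>Borel representatives are chosen arbitrarily, so \<open>R\<close> need not be
      linear. In \<Omega> the extension is an integral over the collar and does not see the choice;
      on the collar linearity holds almost everywhere, as required.\<close>
    define R where "R u = (SOME v. v \<in> borel_measurable borel \<and> (AE x in lborel. x \<in> ?V \<longrightarrow> u x = v x))" for u :: "'a \<Rightarrow> real"
    define E where "E u = extend \<delta> (R u)" for u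
    have R: "R u \<in> borel_measurable borel" "AE x in lborel. x \<in> ?V \<longrightarrow> u x = R u x"
      if "u \<in> borel_measurable (lebesgue_on ?V)" for u
    proof -
      have "\<exists>v. v \<in> borel_measurable borel \<and> (AE x in lborel. x \<in> ?V \<longrightarrow> u x = v x)"
        using borel_version[OF that nbhd_borel(2)] by blast
      then have "R u \<in> borel_measurable borel \<and> (AE x in lborel. x \<in> ?V \<longrightarrow> u x = R u x)"
        unfolding R_def by (rule someI_ex)
      then show "R u \<in> borel_measurable borel" "AE x in lborel. x \<in> ?V \<longrightarrow> u x = R u x" by auto
    qed
    have Xm: "u \<in> borel_measurable (lebesgue_on ?V)" "T_pow p \<beta> \<delta> ?V u < \<infinity>" "Lp_pow p ?V u < \<infinity>" if "u \<in> ?X" for u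
      using that by (auto simp: T_space_def Lp_space_def)
    have int: "integrable lborel (\<lambda>a. R u a * indicator ?V a)" if "u \<in> ?X" for u
    proof (rule integrable_of_Lp[OF R(1)[OF Xm(1)[OF that]] nbhd_borel(2) bounded_collar p])
      show "Lp_energy p ?V (R u) < \<infinity>"
        using Xm(3)[OF that] Lp_energy_cong_AE[OF R(2)[OF Xm(1)[OF that]], of p] by (simp add: Lp_pow_eq)
    qed
    have E_eq: "E u x = E v x" if "x \<in> \<Omega>" "R u \<in> borel_measurable borel" "v \<in> ?X" "AE x in lborel. x \<in> ?V \<longrightarrow> R u x = R v x" for u v x
    proof -
      note [measurable] = that(2) R(1)[OF Xm(1)[OF that(3)]]
      have "(\<integral>a. R u a * ext_ker \<delta> x a \<partial>lborel) = (\<integral>a. R v a * ext_ker \<delta> x a \<partial>lborel)"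
        by (rule integral_cong_AE, measurable, use that(4) in eventually_elim) (auto simp: ext_ker_def)
      then show ?thesis using that(1) by (simp add: E_def extend_def wavg_def)
    qed
    have pow: "S_pow p \<beta> \<delta> ?U (E u) \<le> ennreal C * T_pow p \<beta> \<delta> ?V u" if "u \<in> ?X" for u
      using ext[OF \<delta> \<beta>(1,2) R(1)[OF Xm(1)[OF that]] int[OF that]]
      unfolding T_pow_eq[OF nbhd_borel(2) R(2,1)[OF Xm(1)[OF that]]] E_def by (simp add: S_pow_eq[of _ _ "extend \<delta> (R u)"])
    have mem: "E u \<in> S_space p \<beta> \<delta> ?U" if "u \<in> ?X" for u
    proof (rule S_space_memI[OF _ p \<beta>(1,2) \<delta>(1)])
      show "E u \<in> borel_measurable (lebesgue_on ?U)"
        unfolding E_def by (intro borel_imp_lebesgue_on extend_measurable R(1)[OF Xm(1)[OF that]])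
      show "S_pow p \<beta> \<delta> ?U (E u) < \<infinity>"
        using Xm(2)[OF that] by (intro le_less_trans[OF pow[OF that]]) (simp add: ennreal_mult_less_top)
    qed
    have "extension_operator ?V ?U ?X (S_space p \<beta> \<delta> ?U) E"
      unfolding extension_operator_def
    proof (intro conjI ballI impI allI mem)
      fix u v assume u: "u \<in> ?X" and v: "v \<in> ?X" and "AE x in lebesgue_on ?V. u x = v x"
      then have "AE x in lborel. x \<in> ?V \<longrightarrow> u x = v x" by (simp add: AE_lebesgue_on_iff)
      then have ae: "AE x in lborel. x \<in> ?V \<longrightarrow> R u x = R v x"
        using R(2)[OF Xm(1)[OF u]] R(2)[OF Xm(1)[OF v]] by eventually_elim auto
      then have "AE x in lborel. x \<in> ?U \<longrightarrow> E u x = E v x"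
      proof eventually_elim
        case (elim x)
        then show ?case
          using E_eq[OF _ R(1)[OF Xm(1)[OF u]] v ae, of x] by (cases "x \<in> \<Omega>") (auto simp: E_def extend_def)
      qed
      then show "AE x in lebesgue_on ?U. E u x = E v x" by (simp add: AE_lebesgue_on_iff)
    next
      fix u v and a b :: real assume u: "u \<in> ?X" and v: "v \<in> ?X"
      let ?w = "\<lambda>y. a * u y + b * v y"
      note [measurable] = R(1)[OF Xm(1)[OF u]] R(1)[OF Xm(1)[OF v]] Xm(1)[OF u] Xm(1)[OF v]
      have wm: "?w \<in> borel_measurable (lebesgue_on ?V)" by measurable
      note [measurable] = R(1)[OF wm]
      have ae: "AE x in lborel. x \<in> ?V \<longrightarrow> R ?w x = a * R u x + b * R v x"
        using R(2)[OF Xm(1)[OF u]] R(2)[OF Xm(1)[OF v]] R(2)[OF wm] by eventually_elim auto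
      then have "AE x in lborel. x \<in> ?U \<longrightarrow> E ?w x = a * E u x + b * E v x"
      proof eventually_elim
        case (elim x)
        show ?case
        proof (cases "x \<in> \<Omega>")
          case True
          have "(\<integral>y. R ?w y * ext_ker \<delta> x y \<partial>lborel) = (\<integral>y. a * (R u y * ext_ker \<delta> x y) + b * (R v y * ext_ker \<delta> x y) \<partial>lborel)"
            by (rule integral_cong_AE, measurable, use ae in eventually_elim) (auto simp: ext_ker_def distrib_right)
          also have "\<dots> = a * (\<integral>y. R u y * ext_ker \<delta> x y \<partial>lborel) + b * (\<integral>y. R v y * ext_ker \<delta> x y \<partial>lborel)"
            using integrable_ext_ker_mult[OF \<delta>(1) int[OF u]] integrable_ext_ker_mult[OF \<delta>(1) int[OF v]] by simp
          finally show ?thesis using True by (simp add: E_def extend_def wavg_def add_divide_distrib)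
        qed (use elim in \<open>auto simp: E_def extend_def\<close>)
      qed
      then show "AE x in lebesgue_on ?U. E ?w x = a * E u x + b * E v x" by (simp add: AE_lebesgue_on_iff)
    next
      fix u assume u: "u \<in> ?X"
      have "AE x in lborel. x \<in> ?V \<longrightarrow> E u x = u x"
        using R(2)[OF Xm(1)[OF u]] by eventually_elim (auto simp: E_def extend_def collar_def)
      then show "AE x in lebesgue_on ?V. E u x = u x" by (simp add: AE_lebesgue_on_iff)
    qed
    moreover have "S_norm p \<beta> \<delta> ?U (E u) \<le> C2 * \<bar>?D - \<beta>\<bar> powr (- 1 / p) * (T_norm p \<beta> \<delta> ?V u + \<bar>?D + p - \<beta>\<bar> powr (- 1 / p) * Lp_norm p ?V u)" if "u \<in> ?X" for u
    proof -
      have "S_norm p \<beta> \<delta> ?U (E u) \<le> C powr (1 / p) * T_norm p \<beta> \<delta> ?V u"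
        unfolding S_norm_def T_norm_def using C p by (intro enn2real_powr_le pow Xm that) auto
      also have "\<dots> = C2 * (?D + p) powr (- (1 / p)) * T_norm p \<beta> \<delta> ?V u"
        using p by (simp add: C2_def powr_minus)
      \<comment> \<open>As \<bar>d - \<beta>\<bar> \<le> d + p and the exponent is negative, the
        power only grows, and the L^p term added is nonnegative. Here \<beta> \<noteq> d matters:
        \<open>0 powr (- (1 / p))\<close> is 0.\<close>
      also have "\<dots> \<le> C2 * \<bar>?D - \<beta>\<bar> powr (- (1 / p)) * (T_norm p \<beta> \<delta> ?V u + \<bar>?D + p - \<beta>\<bar> powr (- 1 / p) * Lp_norm p ?V u)"
        using C2 \<beta> p by (intro mult_mono mult_left_mono powr_mono2') (auto simp: T_norm_def Lp_norm_def)
      finally show ?thesis by simp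
    qed
    ultimately show ?thesis by blast
  qed
  then show ?thesis using C2 by blast
qed

end

theorem theorem1p3:
  fixes \<Omega> :: "'a::euclidean_space set"
  assumes "bounded \<Omega>" and "simply_connected \<Omega>" and "lipschitz_domain \<Omega>"
  shows "\<exists>\<epsilon>>0. \<forall>p>1. \<exists>C\<^sub>1>0. \<exists>C\<^sub>2>0.
     (\<forall>\<delta> \<beta>. 0 < \<delta> \<and> \<delta> < \<epsilon> \<and> 0 \<le> \<beta> \<and> \<beta> < real DIM('a) + p \<longrightarrow>
        (\<forall>u \<in> S_space p \<beta> \<delta> (\<Omega> \<union> collar \<delta> \<Omega>).
           u \<in> T_space p \<beta> \<delta> (collar \<delta> \<Omega>) \<and>
           T_norm p \<beta> \<delta> (collar \<delta> \<Omega>) u \<le>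
             C\<^sub>1 * \<bar>real DIM('a) + p - \<beta>\<bar> powr (- 1 / p) * S_norm p \<beta> \<delta> (\<Omega> \<union> collar \<delta> \<Omega>) u)) \<and>
     (\<forall>\<delta> \<beta>. 0 < \<delta> \<and> \<delta> < \<epsilon> \<and> 0 \<le> \<beta> \<and> \<beta> < real DIM('a) + p \<and> \<beta> \<noteq> real DIM('a) \<longrightarrow>
        (\<exists>E. extension_operator (collar \<delta> \<Omega>) (\<Omega> \<union> collar \<delta> \<Omega>)
               (T_space p \<beta> \<delta> (collar \<delta> \<Omega>)) (S_space p \<beta> \<delta> (\<Omega> \<union> collar \<delta> \<Omega>)) E \<and>
             (\<forall>u \<in> T_space p \<beta> \<delta> (collar \<delta> \<Omega>).
                S_norm p \<beta> \<delta> (\<Omega> \<union> collar \<delta> \<Omega>) (E u) \<le>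
                  C\<^sub>2 * \<bar>real DIM('a) - \<beta>\<bar> powr (- 1 / p) *
                  (T_norm p \<beta> \<delta> (collar \<delta> \<Omega>) u +
                   \<bar>real DIM('a) + p - \<beta>\<bar> powr (- 1 / p) * Lp_norm p (collar \<delta> \<Omega>) u))))"
proof -
  obtain r \<eta> where r: "r > 0" and \<eta>: "\<eta> > 0" "\<eta> \<le> 1" and cone: "\<forall>z\<in>closure \<Omega>. \<exists>e. cone_at \<Omega> r \<eta> z e"
    using uniform_cone[OF assms(1,3)] by blast
  interpret cone_domain \<Omega> r \<eta>
    using assms(1,3) r \<eta> cone by unfold_locales (auto simp: lipschitz_domain_def)
  show ?thesis
  \<comment> \<open>The threshold comes from the cone condition alone and is therefore fixed before
    \<open>p\<close>.\<close>
  proof (rule exI[of _ "r * \<eta> / 16"], intro conjI allI impI, goal_cases)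
    case 1
    show ?case using r \<eta> by simp
  next
    case p: (2 p)
    show ?case
      using trace_theorem[OF p] extension_theorem[OF p] by blast
  qed
qed

end
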